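(* If $\hat w$ is a weak minimum of problem (P), then $$\max_{\lambda\in G(\mathrm{co}\,\Lambda^{\#})}\Omega_{\mathcal P_2}[\lambda](\bar\xi,\bar u,\bar y,\bar h)\ \ge\ 0\qquad\text{for all }(\bar\xi,\bar u,\bar y,\bar h)\in\mathcal P_2 .$$
   Context: **Problem.** Notation: $h_t$ is the value of $h$ at time $t$; $\mathbb R^{k,*}$ denotes row vectors. Let $T>0$ and let $f_i:\mathbb R^{n+l}\to\mathbb R^n$ ($i=0,\dots,m$), $\varphi_i:\mathbb R^{2n}\to\mathbb R$ ($i=0,\dots,d_\varphi$), $\eta_j:\mathbb R^{2n}\to\mathbb R$ ($j=1,\dots,d_\eta$) have Lipschitz-continuous second derivatives. Put $F(x,u,v):=f_0(x,u)+\sum_{i=1}^m v_if_i(x,u)$, $\mathcal X:=W^{1,\infty}(0,T;\mathbb R^n)$, $\mathcal U:=L^\infty(0,T;\mathbb R^l)$, $\mathcal V:=L^\infty(0,T;\mathbb R^m)$, $\mathcal W:=\mathcal X\times\mathcal U\times\mathcal V$. Problem (P): minimize $J(w)=\varphi_0(x_0,x_T)$ over $w=(x,u,v)\in\mathcal W$ subject to $\dot x_t=F(x_t,u_t,v_t)$ a.e. on $[0,T]$, $\eta_j(x_0,x_T)=0$ ($j=1,\dots,d_\eta$), $\varphi_i(x_0,x_T)\le0$ ($i=1,\dots,d_\varphi$). A feasible trajectory is a $w\in\mathcal W$ satisfying all these constraints. A feasible trajectory $\hat w$ is a weak minimum if for some $\varepsilon>0$ it minimizes $J$ among feasible trajectories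 $w$ with $\|x-\hat x\|_\infty,\|u-\hat u\|_\infty,\|v-\hat v\|_\infty<\varepsilon$. **Nominal trajectory.** $\hat w=(\hat x,\hat u,\hat v)$ is a fixed feasible trajectory with $\varphi_i(\hat x_0,\hat x_T)=0$ for $i=1,\dots,d_\varphi$, and $\hat u,\hat v$ are smooth. Omitted arguments mean evaluation along $\hat w$; $F_x,F_u,F_v$ are the derivatives of $F$ along $\hat w$ (the $i$th column of $F_v$ is $f_i(\hat x_t,\hat u_t)$). **Multipliers.** For $\lambda=(\alpha,\beta,p)\in\mathbb R^{d_\varphi+1,*}\times\mathbb R^{d_\eta,*}\times W^{1,\infty}(0,T;\mathbb R^{n,*})$ let $H[\lambda](x,u,v,t):=p_tF(x,u,v)$ and $\ell[\lambda](q):=\sum_{i=0}^{d_\varphi}\alpha_i\varphi_i(q)+\sum_{j=1}^{d_\eta}\beta_j\eta_j(q)$. $\Lambda$ is the set of $\lambda$ with $|\alpha|+|\beta|=1$, $\alpha\ge0$, $-\dot p_t=H_x[\lambda](\hat w_t,t)$, $p_0=-D_{x_0}\ell[\lambda](\hat x_0,\hat x_T)$, $p_T=D_{x_T}\ell[\lambda](\hat x_0,\hat x_T)$, and $H_u[\lambda](\hat w_t,t)=0$, $H_v[\lambda](\hat w_t,t)=0$ a.e. Let $\mathcal X_2:=W^{1,2}(0,T;\mathbb R^n)$, $\mathcal U_2:=L^2(0,T;\mathbb R^l)$, $\mathcal V_2:=L^2(0,T;\mathbb R^m)$, $\mathcal W_2:=\mathcal X_2\times\mathcal U_2\times\mathcal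 V_2$, and $\mathcal H_2:=\{(\bar x,\bar u,\bar v)\in\mathcal W_2:\dot{\bar x}=F_x\bar x+F_u\bar u+F_v\bar v\text{ a.e.}\}$. On $\mathcal H_2$ put $\Omega[\lambda](\bar x,\bar u,\bar v):=\tfrac12D^2\ell[\lambda](\hat x_0,\hat x_T)(\bar x_0,\bar x_T)^2+\int_0^T[\tfrac12\bar x^\top H_{xx}\bar x+\bar u^\top H_{ux}\bar x+\bar v^\top H_{vx}\bar x+\tfrac12\bar u^\top H_{uu}\bar u+\bar v^\top H_{vu}\bar u]\,dt$ (all with $[\lambda]$), where $H_{ux}$ is $l\times n$, $H_{vx}$ is $m\times n$, $H_{vu}$ is $m\times l$. $\Lambda^{\#}:=\{\lambda\in\Lambda:\Omega[\lambda]\text{ is weakly lower semicontinuous on }\mathcal H_2\}$, and $\mathrm{co}\,\Lambda^\#$ is its convex hull. **Transformed objects** (all depending on $\lambda$ through $H,\ell$, along $\hat w$): $B:=F_xF_v-\frac{d}{dt}F_v$, $M:=F_v^\top H_{xx}-\dot H_{vx}-H_{vx}F_x$, $E:=F_v^\top H_{ux}^\top-H_{vx}F_u$, $S:=\tfrac12(H_{vx}F_v+(H_{vx}F_v)^\top)$, $V:=\tfrac12(H_{vx}F_v-(H_{vx}F_v)^\top)$, $R:=F_v^\top H_{xx}F_v-(H_{vx}B+(H_{vx}B)^\top)-\dot S$ (dots are total time derivatives along $\hat w$), and $g[\lambda](\zeta_0,\zeta_T,h):=\tfrac12D^2\ell[\lambda](\hat x_0,\hat x_T)(\zeta_0,\zeta_T+F_{v,T}h)^2+h^\top(H_{vx,T}\zeta_T+\tfrac12S_Th)$.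 $G(\mathrm{co}\,\Lambda^\#):=\{\lambda\in\mathrm{co}\,\Lambda^\#:V[\lambda]\equiv0\text{ on }[0,T]\}$. $\Omega_{\mathcal P_2}[\lambda](\bar\xi,\bar u,\bar y,\bar h):=g[\lambda](\bar\xi_0,\bar\xi_T,\bar h)+\int_0^T\big(\tfrac12\bar\xi^\top H_{xx}\bar\xi+\bar u^\top H_{ux}\bar\xi+\bar y^\top M\bar\xi+\tfrac12\bar u^\top H_{uu}\bar u+\bar y^\top E\bar u+\tfrac12\bar y^\top R\bar y\big)dt.$ $\mathcal P_2$ is the set of $(\bar\xi,\bar u,\bar y,\bar h)\in\mathcal X_2\times\mathcal U_2\times\mathcal V_2\times\mathbb R^m$ with $\dot{\bar\xi}=F_x\bar\xi+F_u\bar u+B\bar y$ a.e., $D\eta_j(\hat x_0,\hat x_T)(\bar\xi_0,\bar\xi_T+F_{v,T}\bar h)=0$ for $j=1,\dots,d_\eta$, and $D\varphi_i(\hat x_0,\hat x_T)(\bar\xi_0,\bar\xi_T+F_{v,T}\bar h)\le0$ for $i=0,\dots,d_\varphi$. A maximum over the empty set is $-\infty$. *)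

theory Defs
  imports
    "HOL-Analysis.Analysis"
    "HOL-Probability.Essential_Supremum"
    "HOL-Library.Function_Algebras"
begin

section \<open>Pointwise real vector space structure on functions\<close>

text \<open>Only needed so that the library's convex hull applies to sets of multipliers
  \<open>(\<alpha>, \<beta>, p)\<close>.\<close>

instantiation "fun" :: (type, real_vector) real_vector
begin

definition scaleR_fun_def: "c *\<^sub>R f = (\<lambda>x. c *\<^sub>R f x)"

instance
  by standard (simp_all add: scaleR_fun_def fun_eq_iff scaleR_add_right scaleR_add_left)

end


section \<open>Differential calculus\<close>

definition lipschitz_second_deriv ::
    "('a::real_normed_vector \<Rightarrow> 'b::real_normed_vector) \<Rightarrow> bool" where
  "lipschitz_second_deriv f \<longleftrightarrow>
     (\<exists>(f' :: 'a \<Rightarrow> 'a \<Rightarrow>\<^sub>L 'b) (f'' :: 'a \<Rightarrow> 'a \<Rightarrow>\<^sub>L 'a \<Rightarrow>\<^sub>L 'b) L.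
        (\<forall>x. (f has_derivative blinfun_apply (f' x)) (at x)) \<and>
        (\<forall>x. (f' has_derivative blinfun_apply (f'' x)) (at x)) \<and>
        L-lipschitz_on UNIV f'')"

definition grad :: "(real^'k \<Rightarrow> real) \<Rightarrow> real^'k \<Rightarrow> real^'k" where
  "grad f x = (\<chi> i. frechet_derivative f (at x) (axis i 1))"

definition deriv2 ::
    "('a::real_normed_vector \<Rightarrow> real) \<Rightarrow> 'a \<Rightarrow> 'a \<Rightarrow> 'a \<Rightarrow> real" where
  "deriv2 f q a b = frechet_derivative (\<lambda>y. frechet_derivative f (at y) a) (at q) b"

text \<open>Time derivative on \<open>[0,T]\<close>, one-sided at the end points.\<close>

definition tderiv :: "real \<Rightarrow> (real \<Rightarrow> 'a::real_normed_vector) \<Rightarrow> real \<Rightarrow> 'a" where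
  "tderiv T f t = vector_derivative f (at t within {0..T})"

definition smooth_upto :: "real \<Rightarrow> (real \<Rightarrow> 'a::real_normed_vector) \<Rightarrow> bool" where
  "smooth_upto T f \<longleftrightarrow>
     (\<exists>D :: nat \<Rightarrow> real \<Rightarrow> 'a.
        (\<forall>t\<in>{0..T}. D 0 t = f t) \<and>
        (\<forall>k. \<forall>t\<in>{0..T}. (D k has_vector_derivative D (Suc k) t) (at t within {0..T})))"


section \<open>Function spaces on \<open>[0,T]\<close>\<close>

text \<open>Elements of the spaces are represented by functions on the real line; their values outside
  \<open>[0,T]\<close> (and, for the Lebesgue spaces, on null sets) are irrelevant.\<close>

definition Linf_norm :: "real \<Rightarrow> (real \<Rightarrow> 'a::euclidean_space) \<Rightarrow> ereal" where
  "Linf_norm T u = esssup (lebesgue_on {0..T}) (\<lambda>t. ereal (norm (u t)))"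

definition Linf :: "real \<Rightarrow> (real \<Rightarrow> 'a::euclidean_space) set" where
  "Linf T = {u. u \<in> borel_measurable (lebesgue_on {0..T}) \<and> Linf_norm T u < \<infinity>}"

definition L2 :: "real \<Rightarrow> (real \<Rightarrow> 'a::euclidean_space) set" where
  "L2 T = {u. u \<in> borel_measurable (lebesgue_on {0..T}) \<and>
              integrable (lebesgue_on {0..T}) (\<lambda>t. (norm (u t))\<^sup>2)}"

text \<open>\<open>x\<close> is (the continuous representative of) a Sobolev function and \<open>x'\<close> is a representative of
  its weak derivative. As the weak derivative is a class of functions modulo null sets,
  \<^term>\<open>has_wderiv T x g\<close> is the differential equation \<open>dx/dt = g\<close> a.e. on \<open>[0,T]\<close> for an absolutely
  continuous \<open>x\<close>.\<close>

definition has_wderiv ::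
    "real \<Rightarrow> (real \<Rightarrow> 'a::euclidean_space) \<Rightarrow> (real \<Rightarrow> 'a) \<Rightarrow> bool" where
  "has_wderiv T x x' \<longleftrightarrow> integrable (lebesgue_on {0..T}) x' \<and>
     (\<forall>t\<in>{0..T}. x t = x 0 + (\<integral>s. x' s \<partial>lebesgue_on {0..t}))"

text \<open>The chosen representative is immaterial: \<open>wderiv\<close> only occurs under integrals.\<close>

definition wderiv :: "real \<Rightarrow> (real \<Rightarrow> 'a::euclidean_space) \<Rightarrow> real \<Rightarrow> 'a" where
  "wderiv T x = (SOME x'. has_wderiv T x x')"

definition W1inf :: "real \<Rightarrow> (real \<Rightarrow> 'a::euclidean_space) set" where
  "W1inf T = {x. \<exists>x'\<in>Linf T. has_wderiv T x x'}"

definition W12 :: "real \<Rightarrow> (real \<Rightarrow> 'a::euclidean_space) set" where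
  "W12 T = {x. \<exists>x'\<in>L2 T. has_wderiv T x x'}"

type_synonym ('n, 'l, 'm) traj =
  "(real \<Rightarrow> real^'n) \<times> (real \<Rightarrow> real^'l) \<times> (real \<Rightarrow> real^'m)"

definition W_inf :: "real \<Rightarrow> ('n::finite, 'l::finite, 'm::finite) traj set" where
  "W_inf T = W1inf T \<times> Linf T \<times> Linf T"

definition W_2 :: "real \<Rightarrow> ('n::finite, 'l::finite, 'm::finite) traj set" where
  "W_2 T = W12 T \<times> L2 T \<times> L2 T"

fun inner_W2 ::
    "real \<Rightarrow> ('n::finite, 'l::finite, 'm::finite) traj \<Rightarrow> ('n, 'l, 'm) traj \<Rightarrow> real" where
  "inner_W2 T (x, u, v) (x', u', v') =
     (\<integral>t. x t \<bullet> x' t + wderiv T x t \<bullet> wderiv T x' t + u t \<bullet> u' t + v t \<bullet> v' t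
        \<partial>lebesgue_on {0..T})"

text \<open>Weak convergence in the Hilbert space \<open>W_2\<close>.\<close>

definition weakly_conv_W2 ::
    "real \<Rightarrow> (nat \<Rightarrow> ('n::finite, 'l::finite, 'm::finite) traj) \<Rightarrow> ('n, 'l, 'm) traj \<Rightarrow> bool" where
  "weakly_conv_W2 T w w0 \<longleftrightarrow>
     (\<forall>z\<in>W_2 T. (\<lambda>k. inner_W2 T (w k) z) \<longlonglongrightarrow> inner_W2 T w0 z)"

text \<open>Weak lower semicontinuity is understood sequentially, as usual in the calculus of
  variations. (For quadratic forms on an infinite-dimensional space, lower semicontinuity for the
  weak topology would be strictly more restrictive.)\<close>

definition weakly_lsc_on ::
    "real \<Rightarrow> ('n::finite, 'l::finite, 'm::finite) traj set \<Rightarrow> (('n, 'l, 'm) traj \<Rightarrow> real) \<Rightarrow> bool"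
  where
  "weakly_lsc_on T A Q \<longleftrightarrow>
     (\<forall>w w0. (\<forall>k. w k \<in> A) \<and> w0 \<in> A \<and> weakly_conv_W2 T w w0 \<longrightarrow>
        ereal (Q w0) \<le> liminf (\<lambda>k. ereal (Q (w k))))"


section \<open>The optimal control problem\<close>

text \<open>The inequality constraints are indexed by \<open>{1..dphi}\<close>, \<open>phi 0\<close> is the cost and the equality
  constraints are indexed by \<open>{1..deta}\<close>; values at other indices are never used.\<close>

record ('n, 'l, 'm) ocp =
  horizon :: real
  f0 :: "(real^'n) \<times> (real^'l) \<Rightarrow> real^'n"
  fs :: "'m \<Rightarrow> (real^'n) \<times> (real^'l) \<Rightarrow> real^'n"
  dphi :: nat
  phi :: "nat \<Rightarrow> (real^'n) \<times> (real^'n) \<Rightarrow> real"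
  deta :: nat
  eta :: "nat \<Rightarrow> (real^'n) \<times> (real^'n) \<Rightarrow> real"

definition ocp_data :: "('n::finite, 'l::finite, 'm::finite) ocp \<Rightarrow> bool" where
  "ocp_data P \<longleftrightarrow> 0 < horizon P \<and>
     lipschitz_second_deriv (f0 P) \<and> (\<forall>i. lipschitz_second_deriv (fs P i)) \<and>
     (\<forall>i\<in>{0..dphi P}. lipschitz_second_deriv (phi P i)) \<and>
     (\<forall>j\<in>{1..deta P}. lipschitz_second_deriv (eta P j))"

definition dyn ::
    "('n::finite, 'l::finite, 'm::finite) ocp \<Rightarrow> real^'n \<Rightarrow> real^'l \<Rightarrow> real^'m \<Rightarrow> real^'n" where
  "dyn P x u v = f0 P (x, u) + (\<Sum>i\<in>UNIV. (v $ i) *\<^sub>R fs P i (x, u))"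

fun cost :: "('n::finite, 'l::finite, 'm::finite) ocp \<Rightarrow> ('n, 'l, 'm) traj \<Rightarrow> real" where
  "cost P (x, u, v) = phi P 0 (x 0, x (horizon P))"

definition feasible :: "('n::finite, 'l::finite, 'm::finite) ocp \<Rightarrow> ('n, 'l, 'm) traj set" where
  "feasible P = {(x, u, v) \<in> W_inf (horizon P).
     has_wderiv (horizon P) x (\<lambda>t. dyn P (x t) (u t) (v t)) \<and>
     (\<forall>j\<in>{1..deta P}. eta P j (x 0, x (horizon P)) = 0) \<and>
     (\<forall>i\<in>{1..dphi P}. phi P i (x 0, x (horizon P)) \<le> 0)}"

fun near ::
    "real \<Rightarrow> real \<Rightarrow> ('n::finite, 'l::finite, 'm::finite) traj \<Rightarrow> ('n, 'l, 'm) traj \<Rightarrow> bool" where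
  "near T \<epsilon> (x, u, v) (xh, uh, vh) \<longleftrightarrow>
     Linf_norm T (\<lambda>t. x t - xh t) < ereal \<epsilon> \<and>
     Linf_norm T (\<lambda>t. u t - uh t) < ereal \<epsilon> \<and>
     Linf_norm T (\<lambda>t. v t - vh t) < ereal \<epsilon>"

definition weak_minimum ::
    "('n::finite, 'l::finite, 'm::finite) ocp \<Rightarrow> ('n, 'l, 'm) traj \<Rightarrow> bool" where
  "weak_minimum P wh \<longleftrightarrow> wh \<in> feasible P \<and>
     (\<exists>\<epsilon>>0. \<forall>w\<in>feasible P. near (horizon P) \<epsilon> w wh \<longrightarrow> cost P wh \<le> cost P w)"

fun nominal :: "('n::finite, 'l::finite, 'm::finite) ocp \<Rightarrow> ('n, 'l, 'm) traj \<Rightarrow> bool" where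
  "nominal P (xh, uh, vh) \<longleftrightarrow> (xh, uh, vh) \<in> feasible P \<and>
     (\<forall>i\<in>{1..dphi P}. phi P i (xh 0, xh (horizon P)) = 0) \<and>
     smooth_upto (horizon P) uh \<and> smooth_upto (horizon P) vh"


section \<open>Derivatives along the nominal trajectory\<close>

fun Fx :: "('n::finite, 'l::finite, 'm::finite) ocp \<Rightarrow> ('n, 'l, 'm) traj \<Rightarrow> real \<Rightarrow> real^'n^'n" where
  "Fx P (xh, uh, vh) t = jacobian (\<lambda>x. dyn P x (uh t) (vh t)) (at (xh t))"

fun Fu :: "('n::finite, 'l::finite, 'm::finite) ocp \<Rightarrow> ('n, 'l, 'm) traj \<Rightarrow> real \<Rightarrow> real^'l^'n" where
  "Fu P (xh, uh, vh) t = jacobian (\<lambda>u. dyn P (xh t) u (vh t)) (at (uh t))"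

fun Fv :: "('n::finite, 'l::finite, 'm::finite) ocp \<Rightarrow> ('n, 'l, 'm) traj \<Rightarrow> real \<Rightarrow> real^'m^'n" where
  "Fv P (xh, uh, vh) t = jacobian (\<lambda>v. dyn P (xh t) (uh t) v) (at (vh t))"

text \<open>A multiplier \<open>(\<alpha>, \<beta>, p)\<close>: only the entries \<open>\<alpha> 0, \<dots>, \<alpha> (dphi P)\<close> and
  \<open>\<beta> 1, \<dots>, \<beta> (deta P)\<close>, and \<open>p\<close> on \<open>[0,T]\<close>, matter. Row vectors are identified with
  column vectors.\<close>

type_synonym 'n mult = "(nat \<Rightarrow> real) \<times> (nat \<Rightarrow> real) \<times> (real \<Rightarrow> real^'n)"

fun ham ::
    "('n::finite, 'l::finite, 'm::finite) ocp \<Rightarrow> 'n mult \<Rightarrow>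
       real^'n \<Rightarrow> real^'l \<Rightarrow> real^'m \<Rightarrow> real \<Rightarrow> real" where
  "ham P (\<alpha>, \<beta>, p) x u v t = p t \<bullet> dyn P x u v"

fun ell ::
    "('n::finite, 'l::finite, 'm::finite) ocp \<Rightarrow> 'n mult \<Rightarrow> (real^'n) \<times> (real^'n) \<Rightarrow> real" where
  "ell P (\<alpha>, \<beta>, p) q = (\<Sum>i=0..dphi P. \<alpha> i * phi P i q) + (\<Sum>j=1..deta P. \<beta> j * eta P j q)"

text \<open>\<open>Hux\<close> is the matrix with rows indexed by \<open>u\<close> and columns by \<open>x\<close>; similarly for \<open>Hvx\<close>
  and \<open>Hvu\<close>.\<close>

fun Hx :: "('n::finite, 'l::finite, 'm::finite) ocp \<Rightarrow> ('n, 'l, 'm) traj \<Rightarrow> 'n mult \<Rightarrow>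
    real \<Rightarrow> real^'n" where
  "Hx P (xh, uh, vh) \<mu> t = grad (\<lambda>x. ham P \<mu> x (uh t) (vh t) t) (xh t)"

fun Hu :: "('n::finite, 'l::finite, 'm::finite) ocp \<Rightarrow> ('n, 'l, 'm) traj \<Rightarrow> 'n mult \<Rightarrow>
    real \<Rightarrow> real^'l" where
  "Hu P (xh, uh, vh) \<mu> t = grad (\<lambda>u. ham P \<mu> (xh t) u (vh t) t) (uh t)"

fun Hv :: "('n::finite, 'l::finite, 'm::finite) ocp \<Rightarrow> ('n, 'l, 'm) traj \<Rightarrow> 'n mult \<Rightarrow>
    real \<Rightarrow> real^'m" where
  "Hv P (xh, uh, vh) \<mu> t = grad (\<lambda>v. ham P \<mu> (xh t) (uh t) v t) (vh t)"

fun Hxx :: "('n::finite, 'l::finite, 'm::finite) ocp \<Rightarrow> ('n, 'l, 'm) traj \<Rightarrow> 'n mult \<Rightarrow>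
    real \<Rightarrow> real^'n^'n" where
  "Hxx P (xh, uh, vh) \<mu> t =
     jacobian (\<lambda>x. grad (\<lambda>x'. ham P \<mu> x' (uh t) (vh t) t) x) (at (xh t))"

fun Hux :: "('n::finite, 'l::finite, 'm::finite) ocp \<Rightarrow> ('n, 'l, 'm) traj \<Rightarrow> 'n mult \<Rightarrow>
    real \<Rightarrow> real^'n^'l" where
  "Hux P (xh, uh, vh) \<mu> t =
     jacobian (\<lambda>x. grad (\<lambda>u. ham P \<mu> x u (vh t) t) (uh t)) (at (xh t))"

fun Hvx :: "('n::finite, 'l::finite, 'm::finite) ocp \<Rightarrow> ('n, 'l, 'm) traj \<Rightarrow> 'n mult \<Rightarrow>
    real \<Rightarrow> real^'n^'m" where
  "Hvx P (xh, uh, vh) \<mu> t =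
     jacobian (\<lambda>x. grad (\<lambda>v. ham P \<mu> x (uh t) v t) (vh t)) (at (xh t))"

fun Huu :: "('n::finite, 'l::finite, 'm::finite) ocp \<Rightarrow> ('n, 'l, 'm) traj \<Rightarrow> 'n mult \<Rightarrow>
    real \<Rightarrow> real^'l^'l" where
  "Huu P (xh, uh, vh) \<mu> t =
     jacobian (\<lambda>u. grad (\<lambda>u'. ham P \<mu> (xh t) u' (vh t) t) u) (at (uh t))"

fun Hvu :: "('n::finite, 'l::finite, 'm::finite) ocp \<Rightarrow> ('n, 'l, 'm) traj \<Rightarrow> 'n mult \<Rightarrow>
    real \<Rightarrow> real^'l^'m" where
  "Hvu P (xh, uh, vh) \<mu> t =
     jacobian (\<lambda>u. grad (\<lambda>v. ham P \<mu> (xh t) u v t) (vh t)) (at (uh t))"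


section \<open>Multipliers and the second variation\<close>

fun is_multiplier ::
    "('n::finite, 'l::finite, 'm::finite) ocp \<Rightarrow> ('n, 'l, 'm) traj \<Rightarrow> 'n mult \<Rightarrow> bool" where
  "is_multiplier P (xh, uh, vh) (\<alpha>, \<beta>, p) \<longleftrightarrow>
     (let T = horizon P; wh = (xh, uh, vh); \<mu> = (\<alpha>, \<beta>, p) in
        L2_set \<alpha> {0..dphi P} + L2_set \<beta> {1..deta P} = 1 \<and>
        (\<forall>i\<in>{0..dphi P}. 0 \<le> \<alpha> i) \<and>
        p \<in> W1inf T \<and>
        has_wderiv T p (\<lambda>t. - Hx P wh \<mu> t) \<and>
        p 0 = - grad (\<lambda>q. ell P \<mu> (q, xh T)) (xh 0) \<and>
        p T = grad (\<lambda>q. ell P \<mu> (xh 0, q)) (xh T) \<and>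
        (AE t in lebesgue_on {0..T}. Hu P wh \<mu> t = 0) \<and>
        (AE t in lebesgue_on {0..T}. Hv P wh \<mu> t = 0))"

definition Lambda ::
    "('n::finite, 'l::finite, 'm::finite) ocp \<Rightarrow> ('n, 'l, 'm) traj \<Rightarrow> 'n mult set" where
  "Lambda P wh = {\<mu>. is_multiplier P wh \<mu>}"

definition H_2 ::
    "('n::finite, 'l::finite, 'm::finite) ocp \<Rightarrow> ('n, 'l, 'm) traj \<Rightarrow> ('n, 'l, 'm) traj set" where
  "H_2 P wh = {(x, u, v) \<in> W_2 (horizon P).
     has_wderiv (horizon P) x (\<lambda>t. Fx P wh t *v x t + Fu P wh t *v u t + Fv P wh t *v v t)}"

fun D2ell ::
    "('n::finite, 'l::finite, 'm::finite) ocp \<Rightarrow> ('n, 'l, 'm) traj \<Rightarrow> 'n mult \<Rightarrow>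
       (real^'n) \<times> (real^'n) \<Rightarrow> real" where
  "D2ell P (xh, uh, vh) \<mu> a = deriv2 (ell P \<mu>) (xh 0, xh (horizon P)) a a"

fun Omega ::
    "('n::finite, 'l::finite, 'm::finite) ocp \<Rightarrow> ('n, 'l, 'm) traj \<Rightarrow> 'n mult \<Rightarrow>
       ('n, 'l, 'm) traj \<Rightarrow> real" where
  "Omega P wh \<mu> (x, u, v) =
     1/2 * D2ell P wh \<mu> (x 0, x (horizon P)) +
     (\<integral>t. 1/2 * (x t \<bullet> (Hxx P wh \<mu> t *v x t)) + u t \<bullet> (Hux P wh \<mu> t *v x t)
        + v t \<bullet> (Hvx P wh \<mu> t *v x t) + 1/2 * (u t \<bullet> (Huu P wh \<mu> t *v u t))
        + v t \<bullet> (Hvu P wh \<mu> t *v u t) \<partial>lebesgue_on {0..horizon P})"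

definition Lambda_sharp ::
    "('n::finite, 'l::finite, 'm::finite) ocp \<Rightarrow> ('n, 'l, 'm) traj \<Rightarrow> 'n mult set" where
  "Lambda_sharp P wh =
     {\<mu> \<in> Lambda P wh. weakly_lsc_on (horizon P) (H_2 P wh) (Omega P wh \<mu>)}"


section \<open>Transformed objects\<close>

definition Bmat ::
    "('n::finite, 'l::finite, 'm::finite) ocp \<Rightarrow> ('n, 'l, 'm) traj \<Rightarrow> real \<Rightarrow> real^'m^'n" where
  "Bmat P wh t = Fx P wh t ** Fv P wh t - tderiv (horizon P) (Fv P wh) t"

definition Mmat ::
    "('n::finite, 'l::finite, 'm::finite) ocp \<Rightarrow> ('n, 'l, 'm) traj \<Rightarrow> 'n mult \<Rightarrow>
       real \<Rightarrow> real^'n^'m" where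
  "Mmat P wh \<mu> t = transpose (Fv P wh t) ** Hxx P wh \<mu> t
     - tderiv (horizon P) (Hvx P wh \<mu>) t - Hvx P wh \<mu> t ** Fx P wh t"

definition Emat ::
    "('n::finite, 'l::finite, 'm::finite) ocp \<Rightarrow> ('n, 'l, 'm) traj \<Rightarrow> 'n mult \<Rightarrow>
       real \<Rightarrow> real^'l^'m" where
  "Emat P wh \<mu> t =
     transpose (Fv P wh t) ** transpose (Hux P wh \<mu> t) - Hvx P wh \<mu> t ** Fu P wh t"

definition Smat ::
    "('n::finite, 'l::finite, 'm::finite) ocp \<Rightarrow> ('n, 'l, 'm) traj \<Rightarrow> 'n mult \<Rightarrow>
       real \<Rightarrow> real^'m^'m" where
  "Smat P wh \<mu> t =
     (1/2) *\<^sub>R (Hvx P wh \<mu> t ** Fv P wh t + transpose (Hvx P wh \<mu> t ** Fv P wh t))"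

definition Vmat ::
    "('n::finite, 'l::finite, 'm::finite) ocp \<Rightarrow> ('n, 'l, 'm) traj \<Rightarrow> 'n mult \<Rightarrow>
       real \<Rightarrow> real^'m^'m" where
  "Vmat P wh \<mu> t =
     (1/2) *\<^sub>R (Hvx P wh \<mu> t ** Fv P wh t - transpose (Hvx P wh \<mu> t ** Fv P wh t))"

definition Rmat ::
    "('n::finite, 'l::finite, 'm::finite) ocp \<Rightarrow> ('n, 'l, 'm) traj \<Rightarrow> 'n mult \<Rightarrow>
       real \<Rightarrow> real^'m^'m" where
  "Rmat P wh \<mu> t = transpose (Fv P wh t) ** Hxx P wh \<mu> t ** Fv P wh t
     - (Hvx P wh \<mu> t ** Bmat P wh t + transpose (Hvx P wh \<mu> t ** Bmat P wh t))
     - tderiv (horizon P) (Smat P wh \<mu>) t"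

definition gfun ::
    "('n::finite, 'l::finite, 'm::finite) ocp \<Rightarrow> ('n, 'l, 'm) traj \<Rightarrow> 'n mult \<Rightarrow>
       real^'n \<Rightarrow> real^'n \<Rightarrow> real^'m \<Rightarrow> real" where
  "gfun P wh \<mu> \<zeta>0 \<zeta>T h = (let T = horizon P in
     1/2 * D2ell P wh \<mu> (\<zeta>0, \<zeta>T + Fv P wh T *v h)
     + h \<bullet> (Hvx P wh \<mu> T *v \<zeta>T + (1/2) *\<^sub>R (Smat P wh \<mu> T *v h)))"

definition Gset ::
    "('n::finite, 'l::finite, 'm::finite) ocp \<Rightarrow> ('n, 'l, 'm) traj \<Rightarrow> 'n mult set \<Rightarrow> 'n mult set" where
  "Gset P wh A = {\<mu> \<in> A. \<forall>t\<in>{0..horizon P}. Vmat P wh \<mu> t = 0}"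

type_synonym ('n, 'l, 'm) tdir =
  "(real \<Rightarrow> real^'n) \<times> (real \<Rightarrow> real^'l) \<times> (real \<Rightarrow> real^'m) \<times> (real^'m)"

fun Omega_P2 ::
    "('n::finite, 'l::finite, 'm::finite) ocp \<Rightarrow> ('n, 'l, 'm) traj \<Rightarrow> 'n mult \<Rightarrow>
       ('n, 'l, 'm) tdir \<Rightarrow> real" where
  "Omega_P2 P wh \<mu> (\<xi>, u, y, h) =
     gfun P wh \<mu> (\<xi> 0) (\<xi> (horizon P)) h +
     (\<integral>t. 1/2 * (\<xi> t \<bullet> (Hxx P wh \<mu> t *v \<xi> t)) + u t \<bullet> (Hux P wh \<mu> t *v \<xi> t)
        + y t \<bullet> (Mmat P wh \<mu> t *v \<xi> t) + 1/2 * (u t \<bullet> (Huu P wh \<mu> t *v u t))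
        + y t \<bullet> (Emat P wh \<mu> t *v u t) + 1/2 * (y t \<bullet> (Rmat P wh \<mu> t *v y t))
        \<partial>lebesgue_on {0..horizon P})"

fun in_P2 ::
    "('n::finite, 'l::finite, 'm::finite) ocp \<Rightarrow> ('n, 'l, 'm) traj \<Rightarrow> ('n, 'l, 'm) tdir \<Rightarrow> bool" where
  "in_P2 P (xh, uh, vh) (\<xi>, u, y, h) \<longleftrightarrow>
     (let T = horizon P; wh = (xh, uh, vh);
          q = (xh 0, xh T); \<zeta> = (\<xi> 0, \<xi> T + Fv P wh T *v h) in
        \<xi> \<in> W12 T \<and> u \<in> L2 T \<and> y \<in> L2 T \<and>
        has_wderiv T \<xi> (\<lambda>t. Fx P wh t *v \<xi> t + Fu P wh t *v u t + Bmat P wh t *v y t) \<and>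
        (\<forall>j\<in>{1..deta P}. frechet_derivative (eta P j) (at q) \<zeta> = 0) \<and>
        (\<forall>i\<in>{0..dphi P}. frechet_derivative (phi P i) (at q) \<zeta> \<le> 0))"

definition P_2 ::
    "('n::finite, 'l::finite, 'm::finite) ocp \<Rightarrow> ('n, 'l, 'm) traj \<Rightarrow> ('n, 'l, 'm) tdir set" where
  "P_2 P wh = {z. in_P2 P wh z}"

end

theory Submission
 imports Defs
begin

text \<open>Let \<open>\<chi>\<^sub>k\<close> be the cost and the constraints as functions of the initial value and the controls. Along
 continuous controls each has a first variation \<open>L\<^sub>k\<close> and a second variation \<open>B\<^sub>k\<close>, expressed through
 costates, with a third-order remainder. If no multiplier \<open>\<nu>\<close> annihilates \<open>L\<close>, is nonnegative on the limits
 of \<open>B/2\<close> along rapidly oscillating controls and satisfies \<open>\<nu> B(g,g) \<ge> 0\<close> for a given critical \<open>g\<close>, then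
 by compactness finitely many perturbations of \<open>g\<close> suffice to decrease every \<open>\<nu>\<close>, and a degree argument on a
 cube yields a feasible trajectory of smaller cost. Concentrated impulses in \<open>u\<close> and \<open>v\<close> force \<open>H\<^sub>u\<^sub>u \<ge> 0\<close> and
 \<open>H\<^sub>v\<^sub>u = 0\<close>, which is weak lower semicontinuity of \<open>\<Omega>\<close>; loops in \<open>y\<close> force \<open>V = 0\<close>, and then Goh's
 transformation turns \<open>\<nu> B/2\<close> into \<open>\<Omega>\<^sub>P\<^sub>2\<close>. Density of smooth directions and compactness of the normalized
 multipliers give all of \<open>P\<^sub>2\<close>. The multipliers form a convex cone, so that \<open>co \<Lambda>\<^sup>#\<close> only adds multipliers of
 norm at most 1 and the maximum is attained on \<open>\<Lambda>\<^sup>#\<close>.\<close>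

text \<open>The adjoint equation and its terminal condition determine p linearly from the
  \<open>N\<close> coefficients of a multiplier. So the first and second variations, V, H_uu, H_vu
  and both quadratic forms are linear in the coefficient vector, and compactness is used in finite
  dimension only. Perturbations are continuous controls with the sup norm, where the end-point map
  has a second-order expansion with cubic remainder. Directions of \<open>P_2\<close> are merely
  square integrable, with h unrelated to y, and are reached afterwards by approximation. The
  obstacle is that a single multiplier must serve both the given direction and all oscillations.
  Oscillations can be corrected to have zero first variation and superposed almost without
  interaction, so each of them adds its own inequality on the multiplier. The critical direction and
  the oscillations have size epsilon, the first-order corrections size epsilon squared; all of them
  then compete at order epsilon squared. An element of the hull may have only zero coefficients and
  hence value 0, so that nonnegativity of the largest value on normalized multipliers is what makes
  it the maximum over the hull.\<close>

abbreviation intg :: "real \<Rightarrow> (real \<Rightarrow> 'a::real_normed_vector) \<Rightarrow> 'a" where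
 "intg T \<equiv> integral {0..T}"

abbreviation cont_on :: "real \<Rightarrow> (real \<Rightarrow> 'a::topological_space) \<Rightarrow> bool" where
 "cont_on T \<equiv> continuous_on {0..T}"

abbreviation vd :: "real \<Rightarrow> (real \<Rightarrow> 'a::real_normed_vector) \<Rightarrow> 'a \<Rightarrow> real \<Rightarrow> bool" where
 "vd T x D t \<equiv> (x has_vector_derivative D) (at t within {0..T})"

abbreviation leb :: "real \<Rightarrow> real measure" where "leb T \<equiv> lebesgue_on {0..T}"

section \<open>Robust feasibility\<close>

text \<open>Pinning the coordinates from \<open>n\<close> on to 0 makes the cube a compact subset of
  \<open>nat \<Rightarrow> real\<close> in the product topology.\<close>

definition unit_cube :: "nat \<Rightarrow> (nat \<Rightarrow> real) set" where
 "unit_cube n = {r. (\<forall>i<n. 0 \<le> r i \<and> r i \<le> 1) \<and> (\<forall>i\<ge>n. r i = 0)}"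

lemma compact_PiE_UNIV:
 fixes S :: "'i \<Rightarrow> 'b::topological_space set"
 assumes "\<And>i. compact (S i)" shows "compact (PiE UNIV S)"
proof -
 have "compactin (product_topology (\<lambda>i. euclidean) UNIV) (PiE UNIV S)" using assms by (auto simp: compactin_PiE)
 then show ?thesis by (simp add: euclidean_product_topology)
qed

lemma compact_convergent_subsequence:
 fixes X :: "nat \<Rightarrow> 'a::first_countable_topology"
 assumes "compact S" "\<And>k. X k \<in> S"
 obtains l \<sigma> where "l \<in> S" "strict_mono (\<sigma> :: nat \<Rightarrow> nat)" "(X \<circ> \<sigma>) \<longlonglongrightarrow> l"
 using seq_compactE[OF compact_imp_seq_compact[OF assms(1)], of X] assms(2) by blast

lemma compact_unit_cube: "compact (unit_cube n)"
proof -
 have "unit_cube n = PiE UNIV (\<lambda>i. if i < n then {0..1} else {0})"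
  by (auto simp: unit_cube_def PiE_UNIV_domain Pi_iff split: if_splits)
 then show ?thesis by (auto intro!: compact_PiE_UNIV)
qed

lemma tendsto_fun_iff:
 fixes X :: "nat \<Rightarrow> 'i::countable \<Rightarrow> real"
 shows "X \<longlonglongrightarrow> l \<longleftrightarrow> (\<forall>i. (\<lambda>k. X k i) \<longlonglongrightarrow> l i)"
proof -
 have "X \<longlonglongrightarrow> l \<longleftrightarrow> limitin (product_topology (\<lambda>i. euclidean) UNIV) X l sequentially"
  by (simp add: euclidean_product_topology)
 also have "\<dots> \<longleftrightarrow> (\<forall>i. (\<lambda>k. X k i) \<longlonglongrightarrow> l i)"
  by (subst limitin_componentwise) auto
 finally show ?thesis .
qed

text \<open>The dimension is a number rather than a type, hence Kuhn's combinatorial lemma instead of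
 Brouwer's theorem for Euclidean types.\<close>

lemma poincare_miranda:
 fixes f :: "(nat \<Rightarrow> real) \<Rightarrow> nat \<Rightarrow> real"
 assumes cont: "\<And>i. i < n \<Longrightarrow> continuous_on (unit_cube n) (\<lambda>r. f r i)"
  and f0: "\<And>r i. r \<in> unit_cube n \<Longrightarrow> i < n \<Longrightarrow> r i = 0 \<Longrightarrow> f r i \<le> 0"
  and f1: "\<And>r i. r \<in> unit_cube n \<Longrightarrow> i < n \<Longrightarrow> r i = 1 \<Longrightarrow> 0 \<le> f r i"
 obtains r where "r \<in> unit_cube n" "\<And>i. i < n \<Longrightarrow> f r i = 0"
proof -
 define X :: "nat \<Rightarrow> (nat \<Rightarrow> nat) \<Rightarrow> nat \<Rightarrow> real" where
  "X p x = (\<lambda>i. if i < n then real (x i) / real p else 0)" for p x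
 have Xcube: "X p x \<in> unit_cube n" if "p > 0" "\<forall>i<n. x i \<le> p" for p x using that by (auto simp: X_def unit_cube_def)
 \<comment> \<open>Component \<open>i\<close> takes both signs within one mesh width of the grid
   point given by \<open>q\<close>; Kuhn's lemma yields such a \<open>q\<close> for every
   mesh.\<close>
 define straddles where "straddles p q i \<longleftrightarrow> (\<exists>r s. r \<in> unit_cube n \<and> s \<in> unit_cube n \<and>
  (\<forall>j<n. \<bar>r j - X p q j\<bar> \<le> 1 / real p \<and> \<bar>s j - X p q j\<bar> \<le> 1 / real p) \<and> f r i \<le> 0 \<and> 0 \<le> f s i)" for p q i
 have "\<exists>q. (\<forall>i<n. q i \<le> p) \<and> (\<forall>i<n. straddles p q i)" if p: "p > 0" for p
 proof -
  \<comment> \<open>On the faces the label is forced, as Kuhn's lemma demands; the hypotheses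
    \<open>f0\<close> and \<open>f1\<close> make the forced label agree with the sign of
    \<open>f\<close> there.\<close>
  define lab :: "(nat \<Rightarrow> nat) \<Rightarrow> nat \<Rightarrow> nat" where
   "lab x i = (if x i = 0 then 0 else if x i = p then 1 else if f (X p x) i \<le> 0 then 0 else 1)" for x i
  obtain q where q: "\<forall>i<n. q i < p"
   and qi: "\<forall>i<n. \<exists>r s. (\<forall>j<n. q j \<le> r j \<and> r j \<le> q j + 1) \<and> (\<forall>j<n. q j \<le> s j \<and> s j \<le> q j + 1)
       \<and> lab r i \<noteq> lab s i" by (rule kuhn_lemma[of p n lab]) (use p in \<open>auto simp: lab_def\<close>)
  have lab0: "f (X p x) i \<le> 0" if "lab x i = 0" "\<forall>j<n. x j \<le> p" "i < n" for x i
   using that f0[OF Xcube[OF p that(2)] that(3)] by (auto simp: lab_def X_def p split: if_splits)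
  have lab1: "0 \<le> f (X p x) i" if "lab x i \<noteq> 0" "\<forall>j<n. x j \<le> p" "i < n" for x i
   using that f1[OF Xcube[OF p that(2)] that(3)] p by (auto simp: lab_def X_def split: if_splits)
  have near: "\<bar>X p r j - X p q j\<bar> \<le> 1 / real p" if "\<forall>j<n. q j \<le> r j \<and> r j \<le> q j + 1" "j < n" for r j
  proof -
   have "real (r j) - real (q j) \<le> 1" "0 \<le> real (r j) - real (q j)" using that by (auto simp: le_diff_conv)
   then show ?thesis using that p by (auto simp: X_def diff_divide_distrib[symmetric] divide_right_mono)
  qed
  have "straddles p q i" if i: "i < n" for i
  proof -
   obtain r s where r: "\<forall>j<n. q j \<le> r j \<and> r j \<le> q j + 1" and s: "\<forall>j<n. q j \<le> s j \<and> s j \<le> q j + 1"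
    and ne: "lab r i \<noteq> lab s i" using qi[THEN spec, THEN mp, OF i] by (elim exE conjE)
   have le: "\<forall>j<n. r j \<le> p" "\<forall>j<n. s j \<le> p"
   proof -
    have "x j \<le> p" if "\<forall>j<n. q j \<le> x j \<and> x j \<le> q j + 1" "j < n" for x j
     using that q[rule_format, of j] by (force dest: spec[of _ j])
    then show "\<forall>j<n. r j \<le> p" "\<forall>j<n. s j \<le> p" using r s by blast+
   qed
   show ?thesis
   proof (cases "lab r i = 0")
    case True
    then show ?thesis unfolding straddles_def using ne lab0[of r i] lab1[of s i] le near[OF r] near[OF s] Xcube[OF p] that
     by (intro exI[of _ "X p r"] exI[of _ "X p s"]) auto
   next
    case False
    then have "lab s i = 0" using ne by (auto simp: lab_def split: if_splits)
    then show ?thesis unfolding straddles_def using False lab0[of s i] lab1[of r i] le near[OF r] near[OF s] Xcube[OF p] that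
     by (intro exI[of _ "X p s"] exI[of _ "X p r"]) auto
   qed
  qed
  then show ?thesis using q less_imp_le by blast
 qed
 then have "\<forall>p. \<exists>q. (\<forall>i<n. q i \<le> Suc p) \<and> (\<forall>i<n. straddles (Suc p) q i)" by blast
 then obtain Q where Q: "\<forall>p. (\<forall>i<n. Q p i \<le> Suc p) \<and> (\<forall>i<n. straddles (Suc p) (Q p) i)" by metis
 define a where "a p = X (Suc p) (Q p)" for p
 have acube: "a p \<in> unit_cube n" for p unfolding a_def using Q by (intro Xcube) auto
 then obtain l \<sigma> where l: "l \<in> unit_cube n" and \<sigma>: "strict_mono \<sigma>" and lim: "(a \<circ> \<sigma>) \<longlonglongrightarrow> l"
  using compact_convergent_subsequence[OF compact_unit_cube[of n]] by blast
 \<comment> \<open>The witnesses for the two signs are within one mesh width of \<open>a p\<close>,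
   so both sequences tend to \<open>l\<close> along the subsequence and continuity squeezes
   \<open>f l i\<close> to 0.\<close>
 have "f l i = 0" if i: "i < n" for i
 proof -
  have "\<forall>p. \<exists>r s. r \<in> unit_cube n \<and> s \<in> unit_cube n \<and>
    (\<forall>j<n. \<bar>r j - a p j\<bar> \<le> 1 / real (Suc p) \<and> \<bar>s j - a p j\<bar> \<le> 1 / real (Suc p))
    \<and> f r i \<le> 0 \<and> 0 \<le> f s i" unfolding a_def using Q i unfolding straddles_def by blast
  then obtain r s where rs: "\<And>p. r p \<in> unit_cube n" "\<And>p. s p \<in> unit_cube n"
   "\<And>p j. j < n \<Longrightarrow> \<bar>r p j - a p j\<bar> \<le> 1 / real (Suc p)"
   "\<And>p j. j < n \<Longrightarrow> \<bar>s p j - a p j\<bar> \<le> 1 / real (Suc p)" "\<And>p. f (r p) i \<le> 0" "\<And>p. 0 \<le> f (s p) i"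
   by metis
  have conv: "(r' \<circ> \<sigma>) \<longlonglongrightarrow> l" if r': "\<And>p. r' p \<in> unit_cube n"
    "\<And>p j. j < n \<Longrightarrow> \<bar>r' p j - a p j\<bar> \<le> 1 / real (Suc p)" for r' :: "nat \<Rightarrow> nat \<Rightarrow> real"
   unfolding tendsto_fun_iff
  proof
   fix j
   show "(\<lambda>k. (r' \<circ> \<sigma>) k j) \<longlonglongrightarrow> l j"
   proof (cases "j < n")
    case False
    then show ?thesis using r'(1) l by (auto simp: unit_cube_def)
   next
    case True
    have "(\<lambda>k. 1 / real (Suc (\<sigma> k))) \<longlonglongrightarrow> 0"
     using LIMSEQ_subseq_LIMSEQ[OF LIMSEQ_inverse_real_of_nat \<sigma>] by (simp add: o_def inverse_eq_divide)
    moreover have "\<forall>k. norm (r' (\<sigma> k) j - a (\<sigma> k) j) \<le> 1 / real (Suc (\<sigma> k))" using r'(2)[OF True] by simp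
    ultimately have "(\<lambda>k. r' (\<sigma> k) j - a (\<sigma> k) j) \<longlonglongrightarrow> 0"
     by (auto intro: tendsto_0_le[where K = 1] Lim_null_comparison)
    moreover have "(\<lambda>k. a (\<sigma> k) j) \<longlonglongrightarrow> l j" using lim by (auto simp: tendsto_fun_iff)
    ultimately have "(\<lambda>k. (r' (\<sigma> k) j - a (\<sigma> k) j) + a (\<sigma> k) j) \<longlonglongrightarrow> 0 + l j"
     by (rule tendsto_add)
    then show ?thesis by simp
   qed
  qed
  have "(\<lambda>k. f ((r \<circ> \<sigma>) k) i) \<longlonglongrightarrow> f l i"
   by (rule continuous_on_tendsto_compose[OF cont[OF i] conv l]) (use rs in \<open>auto intro!: always_eventually\<close>)
  then have "f l i \<le> 0" by (rule LIMSEQ_le_const2) (use rs in auto)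
  moreover have "(\<lambda>k. f ((s \<circ> \<sigma>) k) i) \<longlonglongrightarrow> f l i"
   by (rule continuous_on_tendsto_compose[OF cont[OF i] conv l]) (use rs in \<open>auto intro!: always_eventually\<close>)
  then have "0 \<le> f l i" by (rule LIMSEQ_le_const) (use rs in auto)
  ultimately show ?thesis by simp
 qed
 with l that show ?thesis by blast
qed

text \<open>A zero of \<open>r i - cl (r i - g r i)\<close> is a fixed point of the projected step r
  - g r, hence a solution. Clamping to [0,1] provides the signs on opposite faces that
  Poincare-Miranda requires.\<close>

lemma variational_inequality_cube:
 fixes g :: "(nat \<Rightarrow> real) \<Rightarrow> nat \<Rightarrow> real"
 assumes cont: "\<And>i. i < n \<Longrightarrow> continuous_on (unit_cube n) (\<lambda>r. g r i)"
 shows "\<exists>r\<in>unit_cube n. \<forall>s\<in>unit_cube n. 0 \<le> (\<Sum>i<n. g r i * (s i - r i))"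
proof -
 define cl :: "real \<Rightarrow> real" where "cl x = max 0 (min 1 x)" for x
 obtain r where r: "r \<in> unit_cube n" and eq: "\<And>i. i < n \<Longrightarrow> r i - cl (r i - g r i) = 0"
 proof (rule poincare_miranda[of n "\<lambda>r i. r i - cl (r i - g r i)"])
  show "continuous_on (unit_cube n) (\<lambda>r. r i - cl (r i - g r i))" if "i < n" for i unfolding cl_def
   by (intro continuous_intros cont that continuous_on_subset[OF continuous_on_product_coordinates])
    simp_all
 qed (auto simp: cl_def)
 have "0 \<le> g r i * (s i - r i)" if "s \<in> unit_cube n" "i < n" for s i
 proof -
  have s: "0 \<le> s i" "s i \<le> 1" using that by (auto simp: unit_cube_def)
  have e: "r i = max 0 (min 1 (r i - g r i))" using eq[OF that(2)] by (simp add: cl_def)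
  \<comment> \<open>At a fixed point, a nonzero \<open>g r i\<close> is possible only if
    \<open>r i\<close> sits at the end of [0,1] towards which the step \<open>- g r i\<close>
    points.\<close>
  consider "g r i = 0" | "g r i > 0" "r i = 0" | "g r i < 0" "r i = 1"
   using e by (cases "g r i" "0::real" rule: linorder_cases) (auto simp: max_def min_def split: if_splits)
  then show ?thesis using s by cases (auto simp: mult_nonpos_nonpos)
 qed
 then have "0 \<le> (\<Sum>i<n. g r i * (s i - r i))" if "s \<in> unit_cube n" for s using that by (intro sum_nonneg) auto
 with r show ?thesis by blast
qed

text \<open>A closed subset of a compact box. The sign condition on the first \<open>d\<close>
  coordinates is the one for the multipliers of cost and inequality constraints.\<close>

lemma compact_multiplier_sphere:
 "compact {\<nu>::nat \<Rightarrow> real. (\<forall>i<d. 0 \<le> \<nu> i) \<and> (\<Sum>i<n. \<bar>\<nu> i\<bar>) = 1 \<and> (\<forall>i\<ge>n. \<nu> i = 0)}"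
  (is "compact ?S")
proof -
 define C :: "(nat \<Rightarrow> real) set" where "C = PiE UNIV (\<lambda>i. if i < n then {-1..1} else {0})"
 have coord: "continuous_on UNIV (\<lambda>\<nu>::nat \<Rightarrow> real. \<nu> i)" for i by simp
 have "\<bar>\<nu> i\<bar> \<le> 1" if "(\<Sum>i<n. \<bar>\<nu> i\<bar>) = 1" "i < n" for \<nu> :: "nat \<Rightarrow> real" and i
  using member_le_sum[of i "{..<n}" "\<lambda>i. \<bar>\<nu> i\<bar>"] that by auto
 then have sub: "?S \<subseteq> C" by (auto simp: C_def PiE_UNIV_domain Pi_iff abs_le_iff minus_le_iff)
 have C: "compact C" unfolding C_def by (intro compact_PiE_UNIV) auto
 have cl: "closed ?S"
  by (intro closed_Collect_conj closed_Collect_all closed_Collect_imp closed_Collect_le closed_Collect_eq continuous_intros coord) auto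
 from compact_Int_closed[OF C cl] show ?thesis by (simp only: Int_absorb1[OF sub])
qed

text \<open>At the solution \<open>r\<close> of the variational inequality the multiplier \<open>l r\<close> made of the constraint
 violations cannot be decreased along any \<open>c k\<close>, so it vanishes by assumption.\<close>

lemma robust_feasibility:
 fixes b :: "nat \<Rightarrow> real" and c :: "nat \<Rightarrow> nat \<Rightarrow> real"
 assumes \<gamma>: "\<gamma> > 0" and desc: "\<And>\<nu>. (\<forall>i<d. 0 \<le> \<nu> i) \<Longrightarrow> \<exists>i<n. \<nu> i \<noteq> 0 \<Longrightarrow>
   \<exists>k<K. (\<Sum>i<n. \<nu> i * (b i + c k i)) \<le> - \<gamma> * (\<Sum>i<n. \<bar>\<nu> i\<bar>)"
 obtains \<kappa> where "\<kappa> > 0"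
  "\<And>q. (\<And>i. i < n \<Longrightarrow> continuous_on (unit_cube K) (\<lambda>r. q r i)) \<Longrightarrow>
   (\<And>r i. r \<in> unit_cube K \<Longrightarrow> i < n \<Longrightarrow> \<bar>q r i - (b i + (\<Sum>k<K. r k * c k i))\<bar> \<le> \<kappa>) \<Longrightarrow>
   \<exists>r\<in>unit_cube K. (\<forall>i<n. if i < d then q r i < 0 else q r i = (0::real))"
proof -
 \<comment> \<open>An error of \<kappa> in every component leaves the tested value at least -2
   \<kappa> = -\<gamma>/2 times the sum of the weights, which contradicts the upper bound with
   factor -\<gamma>.\<close>
 define \<kappa> where "\<kappa> = \<gamma> / 4"
 show ?thesis
 proof
  show "\<kappa> > 0" using \<gamma> by (simp add: \<kappa>_def)
  fix q :: "(nat \<Rightarrow> real) \<Rightarrow> nat \<Rightarrow> real"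
  assume cont: "\<And>i. i < n \<Longrightarrow> continuous_on (unit_cube K) (\<lambda>r. q r i)"
   and close: "\<And>r i. r \<in> unit_cube K \<Longrightarrow> i < n \<Longrightarrow> \<bar>q r i - (b i + (\<Sum>k<K. r k * c k i))\<bar> \<le> \<kappa>"
  \<comment> \<open>The shift by \<kappa> has the effect that \<open>l r i = 0\<close> with
    \<open>i < d\<close> means \<open>q r i \<le> - \<kappa>\<close>, a strict inequality.\<close>
  define l where "l r i = (if i < d then max (q r i + \<kappa>) 0 else q r i)" for r i
  define g where "g r k = (\<Sum>i<n. l r i * c k i)" for r k
  have contl: "continuous_on (unit_cube K) (\<lambda>r. l r i)" if "i < n" for i
   using cont[OF that] by (cases "i < d") (auto simp: l_def intro!: continuous_intros)
  obtain r where r: "r \<in> unit_cube K" and vi: "\<And>s. s \<in> unit_cube K \<Longrightarrow> 0 \<le> (\<Sum>k<K. g r k * (s k - r k))"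
  proof -
   assume *: "\<And>r. r \<in> unit_cube K \<Longrightarrow>
    (\<And>s. s \<in> unit_cube K \<Longrightarrow> 0 \<le> (\<Sum>k<K. g r k * (s k - r k))) \<Longrightarrow> thesis"
   have "continuous_on (unit_cube K) (\<lambda>r. g r k)" for k unfolding g_def by (intro continuous_intros contl) auto
   then show thesis using * variational_inequality_cube[of K g] by blast
  qed
  have "\<forall>i<n. l r i = 0"
  proof (rule ccontr)
   assume "\<not> (\<forall>i<n. l r i = 0)"
   then have nz: "\<exists>i<n. l r i \<noteq> 0" by blast
   define s where "s = (\<Sum>i<n. \<bar>l r i\<bar>)"
   have s: "s > 0" unfolding s_def using nz
    by (metis (no_types, lifting) abs_ge_zero finite_lessThan lessThan_iff sum_pos2 zero_less_abs_iff)
   obtain k where k: "k < K" "(\<Sum>i<n. l r i * (b i + c k i)) \<le> - \<gamma> * s"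
    using desc[OF _ nz] unfolding s_def by (auto simp: l_def)
   \<comment> \<open>Testing the variational inequality with the k-th unit vector: the solution
     \<open>r\<close> lowers the weighted sum at least as much as the single correction
     \<open>c k\<close> does.\<close>
   have "(\<lambda>j. if j = k then 1 else 0) \<in> unit_cube K" using k by (auto simp: unit_cube_def)
   from vi[OF this] have "0 \<le> (\<Sum>j<K. g r j * (if j = k then 1 else 0)) - (\<Sum>j<K. g r j * r j)"
    by (simp add: right_diff_distrib sum_subtractf)
   also have "(\<Sum>j<K. g r j * (if j = k then 1 else 0)) = g r k" using k by (simp add: if_distrib cong: if_cong)
   finally have "(\<Sum>j<K. g r j * r j) \<le> g r k" by simp
   moreover have "(\<Sum>j<K. g r j * r j) = (\<Sum>i<n. l r i * (\<Sum>j<K. r j * c j i))"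
    unfolding g_def sum_distrib_left sum_distrib_right by (subst sum.swap) (simp add: mult_ac)
   ultimately have "(\<Sum>i<n. l r i * (b i + (\<Sum>j<K. r j * c j i))) \<le> (\<Sum>i<n. l r i * (b i + c k i))"
    by (simp add: g_def distrib_left sum.distrib)
   also note k(2)
   finally have up: "(\<Sum>i<n. l r i * (b i + (\<Sum>j<K. r j * c j i))) \<le> - \<gamma> * s" .
   have "l r i * (b i + (\<Sum>j<K. r j * c j i)) \<ge> - 2 * \<kappa> * \<bar>l r i\<bar>" if i: "i < n" for i
   proof -
    have "\<bar>l r i * (q r i - (b i + (\<Sum>k<K. r k * c k i)))\<bar> \<le> \<bar>l r i\<bar> * \<kappa>"
     unfolding abs_mult by (intro mult_left_mono close[OF r i]) auto
    moreover have "l r i * q r i \<ge> - \<kappa> * \<bar>l r i\<bar>"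
    proof (cases "i < d")
     case True
     show ?thesis
     proof (cases "q r i + \<kappa> > 0")
      case True
      then have "l r i = q r i + \<kappa>" using \<open>i < d\<close> by (simp add: l_def)
      moreover have "(q r i + \<kappa>) * (q r i + \<kappa>) \<ge> 0" by simp
      ultimately show ?thesis using True by (simp add: algebra_simps)
     qed (use True in \<open>auto simp: l_def\<close>)
    next
     case False
     then have "l r i * q r i \<ge> 0" by (simp add: l_def)
     moreover have "\<kappa> * \<bar>l r i\<bar> \<ge> 0" using \<open>\<kappa> > 0\<close> by simp
     ultimately show ?thesis by linarith
    qed
    ultimately show ?thesis by (simp add: algebra_simps abs_le_iff)
   qed
   then have "(\<Sum>i<n. - 2 * \<kappa> * \<bar>l r i\<bar>) \<le> (\<Sum>i<n. l r i * (b i + (\<Sum>j<K. r j * c j i)))"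
    by (intro sum_mono) auto
   then have "- 2 * \<kappa> * s \<le> - \<gamma> * s" using up unfolding s_def sum_distrib_left[symmetric] by linarith
   then show False using s \<gamma> by (simp add: \<kappa>_def)
  qed
  then have "if i < d then q r i < 0 else q r i = 0" if "i < n" for i
   using that \<open>\<kappa> > 0\<close> by (auto simp: l_def max_def split: if_splits)
  then show "\<exists>r\<in>unit_cube K. \<forall>i<n. if i < d then q r i < 0 else q r i = (0::real)" using r by blast
 qed
qed

section \<open>Second-order multipliers\<close>

text \<open>Moves any vector into the common kernel by a fixed finite family whose coefficients are
  the values \<open>L i g\<close> themselves, also if the functionals are linearly dependent. Small
  values therefore need small corrections only.\<close>

lemma linear_functionals_projection:
 fixes L :: "nat \<Rightarrow> 'x::real_vector \<Rightarrow> real"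
 assumes lin: "\<And>i. linear (L i)"
 obtains e where "\<And>g k. k < n \<Longrightarrow> L k (g - (\<Sum>i<n. L i g *\<^sub>R e i)) = 0"
proof -
 have "\<exists>e. \<forall>g. \<forall>k<n. L k (g - (\<Sum>i<n. L i g *\<^sub>R e i)) = 0"
 proof (induction n)
  case 0
  then show ?case by simp
 next
  case (Suc n)
  then obtain e where e: "\<And>g k. k < n \<Longrightarrow> L k (g - (\<Sum>i<n. L i g *\<^sub>R e i)) = 0" by blast
  define \<pi> where "\<pi> g = g - (\<Sum>i<n. L i g *\<^sub>R e i)" for g
  show ?case
  proof (cases "\<forall>g. L n (\<pi> g) = 0")
   case True
   then show ?thesis using e by (intro exI[of _ "\<lambda>i. if i < n then e i else 0"]) (auto simp: \<pi>_def less_Suc_eq)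
  next
   case False
   then obtain g0 where g0: "L n (\<pi> g0) \<noteq> 0" by blast
   define f where "f = (1 / L n (\<pi> g0)) *\<^sub>R \<pi> g0"
   have f: "L n f = 1" "\<And>k. k < n \<Longrightarrow> L k f = 0" using g0 e by (auto simp: f_def linear_scale[OF lin] \<pi>_def)
   \<comment> \<open>The old correctors are cleaned of their \<open>L n\<close> part along
     \<open>f\<close>. As \<open>f\<close> lies in the kernels of the earlier functionals, what was
     achieved for these is kept.\<close>
   define e' where "e' i = (if i < n then e i - L n (e i) *\<^sub>R f else f)" for i
   have eq: "g - (\<Sum>i<Suc n. L i g *\<^sub>R e' i) = \<pi> g - L n (\<pi> g) *\<^sub>R f" for g
    by (simp add: e'_def \<pi>_def linear_diff[OF lin] linear_sum[OF lin] linear_scale[OF lin]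
      scaleR_diff_right scaleR_diff_left sum_subtractf scaleR_sum_left)
   have "L k (\<pi> g - L n (\<pi> g) *\<^sub>R f) = 0" if "k < Suc n" for g k
   proof (cases "k = n")
    case True
    then show ?thesis by (simp add: linear_diff[OF lin] linear_scale[OF lin] f(1))
   next
    case False
    then have "k < n" using that by simp
    then show ?thesis using e[of k g] unfolding \<pi>_def[symmetric] by (simp add: linear_diff[OF lin] linear_scale[OF lin] f(2))
   qed
   then show ?thesis by (intro exI[of _ e']) (simp add: eq del: sum.lessThan_Suc)
  qed
 qed
 then show ?thesis using that by blast
qed

text \<open>The sequence disappears at first order and against every fixed direction while its own
  quadratic values converge. Its norms may be unbounded, as for concentrated impulses: only finitely
  many terms are ever used, and these are scaled by a small factor.\<close>

definition oscillation_vector ::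
  "nat \<Rightarrow> (nat \<Rightarrow> 'x::real_normed_vector \<Rightarrow> real) \<Rightarrow> (nat \<Rightarrow> 'x \<Rightarrow> 'x \<Rightarrow> real) \<Rightarrow> (nat \<Rightarrow> real) \<Rightarrow> bool" where
 "oscillation_vector n L B c \<longleftrightarrow> (\<exists>w :: nat \<Rightarrow> 'x. \<forall>i<n.
   (\<forall>g. (\<lambda>k. B i g (w k)) \<longlonglongrightarrow> 0) \<and> (\<lambda>k. L i (w k)) \<longlonglongrightarrow> 0 \<and> (\<lambda>k. B i (w k) (w k) / 2) \<longlonglongrightarrow> c i)"

locale quadratic_model =
 fixes n :: nat and L :: "nat \<Rightarrow> 'x::real_normed_vector \<Rightarrow> real" and B :: "nat \<Rightarrow> 'x \<Rightarrow> 'x \<Rightarrow> real"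
 assumes L: "\<And>i. bounded_linear (L i)" and B: "\<And>i. bounded_bilinear (B i)" and B_sym: "\<And>i x y. B i x y = B i y x"
begin

lemmas B_lin =
 bounded_bilinear.add_left[OF B] bounded_bilinear.add_right[OF B]
 bounded_bilinear.diff_left[OF B] bounded_bilinear.diff_right[OF B]
 bounded_bilinear.scaleR_left[OF B] bounded_bilinear.scaleR_right[OF B]
 bounded_bilinear.sum_left[OF B] bounded_bilinear.sum_right[OF B]
 bounded_bilinear.zero_left[OF B] bounded_bilinear.zero_right[OF B]

lemmas L_lin =
 linear_add[OF bounded_linear.linear[OF L]] linear_diff[OF bounded_linear.linear[OF L]]
 linear_scale[OF bounded_linear.linear[OF L]] linear_sum[OF bounded_linear.linear[OF L]]
 linear_0[OF bounded_linear.linear[OF L]]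

lemma oscillation_vector_zero: "oscillation_vector n L B (\<lambda>i. 0)"
 unfolding oscillation_vector_def by (intro exI[of _ "\<lambda>k. 0"]) (auto simp: B_lin L_lin)

lemma oscillation_vector_scale:
 assumes "oscillation_vector n L B c" "0 \<le> s" shows "oscillation_vector n L B (\<lambda>i. s * c i)"
proof -
 obtain w where w: "\<And>i g. i < n \<Longrightarrow> (\<lambda>k. B i g (w k)) \<longlonglongrightarrow> 0" "\<And>i. i < n \<Longrightarrow> (\<lambda>k. L i (w k)) \<longlonglongrightarrow> 0"
   "\<And>i. i < n \<Longrightarrow> (\<lambda>k. B i (w k) (w k) / 2) \<longlonglongrightarrow> c i"
  using assms(1) unfolding oscillation_vector_def by blast
 have "(\<lambda>k. B i (sqrt s *\<^sub>R w k) (sqrt s *\<^sub>R w k) / 2) \<longlonglongrightarrow> s * c i" if "i < n" for i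
  using tendsto_mult_left[OF w(3)[OF that], of s] assms(2) by (simp add: B_lin mult.assoc[symmetric] flip: power2_eq_square)
 moreover have "(\<lambda>k. B i g (sqrt s *\<^sub>R w k)) \<longlonglongrightarrow> 0" if "i < n" for i g
  using tendsto_mult_left[OF w(1)[OF that, of g], of "sqrt s"] by (simp add: B_lin)
 moreover have "(\<lambda>k. L i (sqrt s *\<^sub>R w k)) \<longlonglongrightarrow> 0" if "i < n" for i
  using tendsto_mult_left[OF w(2)[OF that], of "sqrt s"] by (simp add: L_lin)
 ultimately show ?thesis unfolding oscillation_vector_def by (intro exI[of _ "\<lambda>k. sqrt s *\<^sub>R w k"]) auto
qed

text \<open>The correction has coefficients \<open>L i (w k)\<close>, which tend to 0. Its cross
  terms with \<open>w k\<close> are these coefficients times values \<open>B i (e j) (w k)\<close>,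
  which tend to 0 as well, so the limits \<open>c\<close> survive.\<close>

lemma oscillation_vector_in_kernel:
 assumes "oscillation_vector n L B c"
 obtains w where "\<And>i g. i < n \<Longrightarrow> (\<lambda>k. B i g (w k)) \<longlonglongrightarrow> 0"
  "\<And>i. i < n \<Longrightarrow> (\<lambda>k. B i (w k) (w k) / 2) \<longlonglongrightarrow> c i" "\<And>i k. i < n \<Longrightarrow> L i (w k) = 0"
proof -
 obtain w where w: "\<And>i g. i < n \<Longrightarrow> (\<lambda>k. B i g (w k)) \<longlonglongrightarrow> 0" "\<And>i. i < n \<Longrightarrow> (\<lambda>k. L i (w k)) \<longlonglongrightarrow> 0"
   "\<And>i. i < n \<Longrightarrow> (\<lambda>k. B i (w k) (w k) / 2) \<longlonglongrightarrow> c i"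
  using assms(1) unfolding oscillation_vector_def by blast
 obtain e where e: "\<And>g k. k < n \<Longrightarrow> L k (g - (\<Sum>i<n. L i g *\<^sub>R e i)) = 0"
  using linear_functionals_projection[of L n] L bounded_linear.linear by blast
 define s where "s k = (\<Sum>i<n. L i (w k) *\<^sub>R e i)" for k
 have Bs: "(\<lambda>k. B i g (s k)) \<longlonglongrightarrow> 0" for i g
  unfolding s_def B_lin by (rule tendsto_null_sum) (use tendsto_mult_left_zero w(2) in auto)
 have Bws: "(\<lambda>k. B i (s k) (w k)) \<longlonglongrightarrow> 0" if "i < n" for i unfolding s_def B_lin
  by (rule tendsto_null_sum) (use tendsto_mult_zero[OF w(2) w(1)] that in auto)
 have Bss: "(\<lambda>k. B i (s k) (s k)) \<longlonglongrightarrow> 0" for i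
 proof -
  have "(\<lambda>k. \<Sum>j<n. L j (w k) *\<^sub>R B i (e j) (s k)) \<longlonglongrightarrow> 0"
   by (rule tendsto_null_sum) (use tendsto_mult_zero[OF w(2) Bs] in auto)
  then show ?thesis by (subst (1) s_def) (simp add: B_lin)
 qed
 show ?thesis
 proof
  fix i assume i: "i < n"
  show "(\<lambda>k. B i g (w k - s k)) \<longlonglongrightarrow> 0" for g
   using tendsto_diff[OF w(1)[OF i, of g] Bs[of i g]] by (simp add: B_lin)
  have "(\<lambda>k. B i (w k) (w k) / 2 - B i (s k) (w k) + B i (s k) (s k) / 2) \<longlonglongrightarrow> c i - 0 + 0 / 2"
   by (intro tendsto_intros w(3) Bws Bss i) simp
  then show "(\<lambda>k. B i (w k - s k) (w k - s k) / 2) \<longlonglongrightarrow> c i"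
   by (simp add: B_lin B_sym[of i "w _" "s _"] field_simps)
  show "L i (w k - s k) = 0" for k unfolding s_def by (rule e[OF i])
 qed
qed

text \<open>Oscillations are chosen one after another, each one almost orthogonal to all previous
 directions, so that their contributions add up.\<close>

lemma oscillation_superposition:
 fixes g0 :: 'x
 assumes osc: "\<And>k. k < K \<Longrightarrow> oscillation_vector n L B (c k)" and "\<epsilon> > 0"
 shows "\<exists>w. (\<forall>k<K. \<forall>i<n. L i (w k) = 0) \<and> (\<forall>r\<in>unit_cube K. \<forall>i<n.
  \<bar>B i (g0 + (\<Sum>k<K. sqrt (r k) *\<^sub>R w k)) (g0 + (\<Sum>k<K. sqrt (r k) *\<^sub>R w k)) / 2
    - B i g0 g0 / 2 - (\<Sum>k<K. r k * c k i)\<bar> \<le> \<epsilon>)" using assms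
proof (induction K arbitrary: \<epsilon>)
 case 0
 then show ?case by simp
next
 case (Suc K)
 \<comment> \<open>Amplitudes \<open>sqrt (r k)\<close> turn the quadratic values into contributions
   that are linear in \<open>r\<close>.\<close>
 define G where "G w r = g0 + (\<Sum>k<K. sqrt (r k) *\<^sub>R w k)" for w :: "nat \<Rightarrow> 'x" and r :: "nat \<Rightarrow> real"
 obtain w where wL: "\<And>k i. k < K \<Longrightarrow> i < n \<Longrightarrow> L i (w k) = 0"
  and wB: "\<And>r i. r \<in> unit_cube K \<Longrightarrow> i < n \<Longrightarrow>
    \<bar>B i (G w r) (G w r) / 2 - B i g0 g0 / 2 - (\<Sum>k<K. r k * c k i)\<bar> \<le> \<epsilon> / 2"
  unfolding G_def using Suc.IH[of "\<epsilon> / 2", OF Suc.prems(1) half_gt_zero[OF Suc.prems(2)], OF less_SucI] by blast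
 obtain v where v: "\<And>i g. i < n \<Longrightarrow> (\<lambda>k. B i g (v k)) \<longlonglongrightarrow> 0"
  "\<And>i. i < n \<Longrightarrow> (\<lambda>k. B i (v k) (v k) / 2) \<longlonglongrightarrow> c K i" "\<And>i k. i < n \<Longrightarrow> L i (v k) = 0"
  using oscillation_vector_in_kernel[OF Suc.prems(1)[of K]] by blast
 \<comment> \<open>There are \<open>K + 2\<close> errors of size \<eta>: the products of
   \<open>v m\<close> with \<open>g0\<close> and with the \<open>K\<close> earlier vectors, and the
   defect of its own quadratic value. The other half of \<epsilon> pays for the induction
   hypothesis.\<close>
 define \<eta> where "\<eta> = \<epsilon> / 2 / (real K + 2)"
 have \<eta>: "\<eta> > 0" using Suc.prems by (simp add: \<eta>_def)
 have "\<forall>\<^sub>F k in sequentially. \<forall>i\<in>{..<n}. \<bar>B i g0 (v k)\<bar> < \<eta>"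
  by (rule eventually_ball_finite) (use v(1) \<eta> in \<open>auto simp: tendsto_iff\<close>)
 moreover have "\<forall>\<^sub>F k in sequentially. \<forall>i\<in>{..<n}. \<forall>j\<in>{..<K}. \<bar>B i (w j) (v k)\<bar> < \<eta>"
  by (intro eventually_ball_finite ballI) (use v(1) \<eta> in \<open>auto simp: tendsto_iff\<close>)
 moreover have "\<forall>\<^sub>F k in sequentially. \<forall>i\<in>{..<n}. \<bar>B i (v k) (v k) / 2 - c K i\<bar> < \<eta>"
  by (rule eventually_ball_finite) (use v(2) \<eta> in \<open>auto simp: tendsto_iff dist_real_def\<close>)
 ultimately have "\<forall>\<^sub>F k in sequentially. (\<forall>i\<in>{..<n}. \<bar>B i g0 (v k)\<bar> < \<eta>) \<and>
   (\<forall>i\<in>{..<n}. \<forall>j\<in>{..<K}. \<bar>B i (w j) (v k)\<bar> < \<eta>) \<and>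
   (\<forall>i\<in>{..<n}. \<bar>B i (v k) (v k) / 2 - c K i\<bar> < \<eta>)" by eventually_elim simp
 then obtain m where m: "\<And>i. i < n \<Longrightarrow> \<bar>B i g0 (v m)\<bar> < \<eta>"
   "\<And>i j. i < n \<Longrightarrow> j < K \<Longrightarrow> \<bar>B i (w j) (v m)\<bar> < \<eta>"
   "\<And>i. i < n \<Longrightarrow> \<bar>B i (v m) (v m) / 2 - c K i\<bar> < \<eta>"
  using eventually_happens'[OF sequentially_bot] by fastforce
 define w' where "w' = (\<lambda>k. if k < K then w k else v m)"
 have eqG: "g0 + (\<Sum>k<Suc K. sqrt (r k) *\<^sub>R w' k) = G w r + sqrt (r K) *\<^sub>R v m" for r by (simp add: G_def w'_def)
 have "\<bar>B i (G w r + sqrt (r K) *\<^sub>R v m) (G w r + sqrt (r K) *\<^sub>R v m) / 2 - B i g0 g0 / 2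
   - (\<Sum>k<Suc K. r k * c k i)\<bar> \<le> \<epsilon>" if r: "r \<in> unit_cube (Suc K)" and i: "i < n" for r i
 proof -
  have r01: "0 \<le> r k" "r k \<le> 1" for k using r by (cases "k < Suc K"; auto simp: unit_cube_def)+
  then have sq: "0 \<le> sqrt (r k)" "sqrt (r k) \<le> 1" for k by auto
  define r' where "r' k = (if k < K then r k else 0)" for k
  have r': "r' \<in> unit_cube K" using r by (auto simp: unit_cube_def r'_def)
  have Gr: "G w r' = G w r" and sr: "(\<Sum>k<K. r' k * c k i) = (\<Sum>k<K. r k * c k i)" by (auto simp: G_def r'_def)
  have 1: "\<bar>B i (G w r) (G w r) / 2 - B i g0 g0 / 2 - (\<Sum>k<K. r k * c k i)\<bar> \<le> \<epsilon> / 2"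
   using wB[OF r' i] unfolding Gr sr .
  have "\<bar>B i (G w r) (v m)\<bar> \<le> \<bar>B i g0 (v m)\<bar> + (\<Sum>k<K. \<bar>sqrt (r k) * B i (w k) (v m)\<bar>)"
   unfolding G_def B_lin real_scaleR_def by (intro order_trans[OF abs_triangle_ineq] add_left_mono sum_abs)
  also have "\<dots> \<le> \<eta> + (\<Sum>k<K. \<eta>)"
  proof (intro add_mono sum_mono)
   show "\<bar>B i g0 (v m)\<bar> \<le> \<eta>" using m(1)[OF i] by simp
   fix k assume "k \<in> {..<K}"
   then have "\<bar>B i (w k) (v m)\<bar> \<le> \<eta>" using m(2)[OF i, of k] by simp
   then have "sqrt (r k) * \<bar>B i (w k) (v m)\<bar> \<le> 1 * \<eta>" using sq[of k] by (intro mult_mono) auto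
   then show "\<bar>sqrt (r k) * B i (w k) (v m)\<bar> \<le> \<eta>" using sq[of k] by (simp add: abs_mult)
  qed
  finally have "\<bar>B i (G w r) (v m)\<bar> \<le> (real K + 1) * \<eta>" by (simp add: algebra_simps)
  then have 2: "\<bar>sqrt (r K) * B i (G w r) (v m)\<bar> \<le> (real K + 1) * \<eta>" unfolding abs_mult using sq[of K]
   by (metis abs_ge_zero abs_of_nonneg dual_order.trans mult_left_le_one_le)
  have "\<bar>r K * (B i (v m) (v m) / 2 - c K i)\<bar> \<le> 1 * \<eta>"
   unfolding abs_mult using r01[of K] m(3)[OF i] by (intro mult_mono) auto
  then have 3: "\<bar>r K * (B i (v m) (v m) / 2) - r K * c K i\<bar> \<le> \<eta>" by (simp add: right_diff_distrib)
  have "B i (G w r + sqrt (r K) *\<^sub>R v m) (G w r + sqrt (r K) *\<^sub>R v m) / 2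
    = B i (G w r) (G w r) / 2 + sqrt (r K) * B i (G w r) (v m) + (sqrt (r K) * sqrt (r K)) * (B i (v m) (v m) / 2)"
   unfolding B_lin real_scaleR_def B_sym[of i "v m" "G w r"] by algebra
  also have "sqrt (r K) * sqrt (r K) = r K" using r01 by simp
  finally have "B i (G w r + sqrt (r K) *\<^sub>R v m) (G w r + sqrt (r K) *\<^sub>R v m) / 2 - B i g0 g0 / 2
   - (\<Sum>k<Suc K. r k * c k i) = (B i (G w r) (G w r) / 2 - B i g0 g0 / 2 - (\<Sum>k<K. r k * c k i))
    + sqrt (r K) * B i (G w r) (v m) + (r K * (B i (v m) (v m) / 2) - r K * c K i)" by simp
  then have "\<bar>B i (G w r + sqrt (r K) *\<^sub>R v m) (G w r + sqrt (r K) *\<^sub>R v m) / 2 - B i g0 g0 / 2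
   - (\<Sum>k<Suc K. r k * c k i)\<bar> \<le> \<epsilon> / 2 + (real K + 1) * \<eta> + \<eta>" using 1 2 3 by linarith
  also have "\<dots> = \<epsilon> / 2 + (real K + 2) * \<eta>" by (simp add: algebra_simps)
  also have "(real K + 2) * \<eta> = \<epsilon> / 2"
   unfolding \<eta>_def by (rule nonzero_mult_div_cancel_left[of "real K + 2", unfolded times_divide_eq_right[symmetric]]) linarith
  also have "\<epsilon> / 2 + \<epsilon> / 2 = \<epsilon>" by simp
  finally show ?thesis .
 qed
 moreover have "\<forall>k<Suc K. \<forall>i<n. L i (w' k) = 0" using wL v(3) by (simp add: w'_def)
 ultimately show ?case unfolding eqG[symmetric] by (intro exI[of _ w']) blast
qed

text \<open>A triple of a first-order direction, an oscillation vector and a margin defines an open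
  set of multipliers that it decreases. If no multiplier were suitable, these sets would cover the
  compact sphere; the finite subcover feeds \<open>robust_feasibility\<close> and contradicts
  \<open>infeasible\<close>.\<close>

theorem second_order_multiplier:
 fixes \<Phi> :: "nat \<Rightarrow> 'x \<Rightarrow> real"
 assumes "\<rho> > 0" and cont: "\<And>i. i < n \<Longrightarrow> continuous_on (cball 0 \<rho>) (\<Phi> i)"
  and taylor: "\<And>i g. i < n \<Longrightarrow> norm g \<le> \<rho> \<Longrightarrow> \<bar>\<Phi> i g - L i g - B i g g / 2\<bar> \<le> C * norm g ^ 3"
  and infeasible: "\<And>g. norm g \<le> \<rho> \<Longrightarrow> \<not> (\<forall>i<n. if i < d then \<Phi> i g < 0 else \<Phi> i g = 0)"
  and g0: "\<And>i. i < n \<Longrightarrow> if i < d then L i g0 \<le> 0 else L i g0 = 0"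
 shows "\<exists>\<nu>. (\<forall>i<d. 0 \<le> \<nu> i) \<and> (\<Sum>i<n. \<bar>\<nu> i\<bar>) = 1 \<and> (\<forall>i\<ge>n. \<nu> i = 0) \<and>
  (\<forall>g. (\<Sum>i<n. \<nu> i * L i g) = 0) \<and>
  (\<forall>c. oscillation_vector n L B c \<longrightarrow> 0 \<le> (\<Sum>i<n. \<nu> i * c i)) \<and>
  0 \<le> (\<Sum>i<n. \<nu> i * B i g0 g0)"
proof (rule ccontr)
 assume contr: "\<not> ?thesis"
 let ?S = "{\<nu>::nat \<Rightarrow> real. (\<forall>i<d. 0 \<le> \<nu> i) \<and> (\<Sum>i<n. \<bar>\<nu> i\<bar>) = 1 \<and> (\<forall>i\<ge>n. \<nu> i = 0)}"
 define b where "b i = B i g0 g0 / 2" for i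
 define D where "D = (UNIV :: 'x set) \<times> {c. oscillation_vector n L B c} \<times> {0::real<..}"
 define U where "U = (\<lambda>(g, c, \<gamma>). {\<nu>. (\<Sum>i<n. \<nu> i * (b i + (L i g + c i))) < - \<gamma>})"
 have cover: "\<exists>p\<in>D. \<nu> \<in> U p" if "\<nu> \<in> ?S" for \<nu>
 proof -
  have D: "\<exists>p\<in>D. \<nu> \<in> U p" if "(\<Sum>i<n. \<nu> i * (b i + (L i g + c i))) < 0" "oscillation_vector n L B c" for g c
   by (rule bexI[of _ "(g, c, - (\<Sum>i<n. \<nu> i * (b i + (L i g + c i))) / 2)"]) (use that in \<open>simp_all add: U_def D_def\<close>)
  have scaled: "\<exists>p\<in>D. \<nu> \<in> U p"
   if neg: "(\<Sum>i<n. \<nu> i * (L i g + c i)) < 0" and c: "oscillation_vector n L B c" for g c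
  proof -
   define \<beta> where "\<beta> = (\<Sum>i<n. \<nu> i * b i)"
   define \<alpha> where "\<alpha> = (\<Sum>i<n. \<nu> i * (L i g + c i))"
   \<comment> \<open>With this factor \<beta> + t \<alpha> = \<beta> - \<bar>\<beta>\<bar> - 1 < 0:
     a strictly decreasing direction, taken large enough, outweighs whatever \<open>g0\<close>
     contributes.\<close>
   define t where "t = (\<bar>\<beta>\<bar> + 1) / (- \<alpha>)"
   have t: "0 \<le> t" using neg by (simp add: t_def \<alpha>_def divide_nonneg_neg)
   have "\<beta> + t * \<alpha> < 0" using neg by (simp add: t_def \<alpha>_def[symmetric])
   moreover have "(\<Sum>i<n. \<nu> i * (b i + (L i (t *\<^sub>R g) + t * c i))) = \<beta> + t * \<alpha>"
    by (simp add: \<beta>_def \<alpha>_def L_lin sum_distrib_left sum.distrib algebra_simps)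
   ultimately show ?thesis using oscillation_vector_scale[OF c t] by (intro D[of "t *\<^sub>R g" "\<lambda>i. t * c i"]) simp_all
  qed
  have "\<not> ((\<forall>g. (\<Sum>i<n. \<nu> i * L i g) = 0) \<and>
    (\<forall>c. oscillation_vector n L B c \<longrightarrow> 0 \<le> (\<Sum>i<n. \<nu> i * c i)) \<and> 0 \<le> (\<Sum>i<n. \<nu> i * B i g0 g0))" (is "\<not> ?Q")
  proof
   assume *: ?Q
   show False by (rule contr[THEN notE], rule exI[of _ \<nu>]) (use that * in simp)
  qed
  then consider g where "(\<Sum>i<n. \<nu> i * L i g) \<noteq> 0"
   | c where "oscillation_vector n L B c" "(\<Sum>i<n. \<nu> i * c i) < 0"
   | "(\<Sum>i<n. \<nu> i * B i g0 g0) < 0" unfolding not_le[symmetric] by blast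
  then show ?thesis
  proof cases
   case 1
   then have "(\<Sum>i<n. \<nu> i * L i g) < 0 \<or> (\<Sum>i<n. \<nu> i * L i (- g)) < 0"
    using L_lin(3)[of _ "-1" g] by (auto simp: sum_negf)
   then show ?thesis using scaled[of g "\<lambda>i. 0"] scaled[of "- g" "\<lambda>i. 0"] oscillation_vector_zero by auto
  next
   case 2
   then show ?thesis using scaled[of 0 c] by (simp add: L_lin)
  next
   case 3
   then show ?thesis by (intro D[of 0 "\<lambda>i. 0"] oscillation_vector_zero) (simp add: b_def L_lin sum_divide_distrib[symmetric])
  qed
 qed
 have "open (U p)" for p unfolding U_def by (cases p) (auto intro!: open_Collect_less continuous_intros)
 then obtain D' where D': "D' \<subseteq> D" "finite D'" "?S \<subseteq> (\<Union>p\<in>D'. U p)"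
 proof -
  assume *: "\<And>D'. D' \<subseteq> D \<Longrightarrow> finite D' \<Longrightarrow> ?S \<subseteq> (\<Union>p\<in>D'. U p) \<Longrightarrow> thesis"
  have "?S \<subseteq> (\<Union>p\<in>D. U p)" using cover by (intro subsetI UN_iff[THEN iffD2])
  then show thesis by (rule compactE_image[OF compact_multiplier_sphere[of d n] \<open>\<And>p. open (U p)\<close>]) (rule *)
 qed
 obtain h where h: "bij_betw h {0..<card D'} D'" using ex_bij_betw_nat_finite[OF D'(2)] by blast
 define K where "K = card D'"
 define a where "a k = fst (h k)" for k
 define c where "c k = fst (snd (h k))" for k
 \<comment> \<open>The smallest of the finitely many margins; the inserted 1 keeps the minimum
   meaningful for an empty \<open>D'\<close>.\<close>
 define \<gamma> where "\<gamma> = Min (insert 1 ((\<lambda>p. snd (snd p)) ` D'))"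
 have \<gamma>: "\<gamma> > 0" using D' by (auto simp: \<gamma>_def D_def)
 have hD: "h k \<in> D" if "k < K" for k using that D'(1) bij_betwE[OF h] by (auto simp: K_def)
 have osc: "oscillation_vector n L B (c k)" if "k < K" for k using hD[OF that] by (auto simp: D_def c_def)
 have desc: "\<exists>k<K. (\<Sum>i<n. \<nu> i * (b i + (L i (a k) + c k i))) \<le> - \<gamma> * (\<Sum>i<n. \<bar>\<nu> i\<bar>)"
  if nn: "\<forall>i<d. 0 \<le> \<nu> i" and nz: "\<exists>i<n. \<nu> i \<noteq> 0" for \<nu> :: "nat \<Rightarrow> real"
 proof -
  define s where "s = (\<Sum>i<n. \<bar>\<nu> i\<bar>)"
  have s: "s > 0" unfolding s_def using nz
   by (metis (no_types, lifting) abs_ge_zero finite_lessThan lessThan_iff sum_pos2 zero_less_abs_iff)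
  define \<mu> where "\<mu> i = (if i < n then \<nu> i / s else 0)" for i
  have "\<mu> \<in> ?S" using nn s by (auto simp: \<mu>_def s_def sum_divide_distrib[symmetric] abs_divide)
  then obtain p where p: "p \<in> D'" "\<mu> \<in> U p" using D'(3) by blast
  then obtain k where k: "k < K" "h k = p" using bij_betw_imp_surj_on[OF h] by (force simp: K_def)
  have "\<gamma> \<le> snd (snd p)" unfolding \<gamma>_def using D'(2) p(1) by (intro Min_le) auto
  then have "(\<Sum>i<n. \<mu> i * (b i + (L i (a k) + c k i))) \<le> - \<gamma>"
   using p(2) k(2) by (auto simp: U_def a_def c_def split: prod.splits)
  also have "(\<Sum>i<n. \<mu> i * (b i + (L i (a k) + c k i))) = (\<Sum>i<n. \<nu> i * (b i + (L i (a k) + c k i))) / s"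
   by (simp add: \<mu>_def sum_divide_distrib)
  finally show ?thesis using k(1) s unfolding s_def[symmetric] by (auto simp: divide_le_eq)
 qed
 obtain \<kappa> where \<kappa>: "\<kappa> > 0"
  and robust: "\<And>q. (\<And>i. i < n \<Longrightarrow> continuous_on (unit_cube K) (\<lambda>r. q r i)) \<Longrightarrow>
   (\<And>r i. r \<in> unit_cube K \<Longrightarrow> i < n \<Longrightarrow> \<bar>q r i - (b i + (\<Sum>k<K. r k * (L i (a k) + c k i)))\<bar> \<le> \<kappa>) \<Longrightarrow>
   \<exists>r\<in>unit_cube K. (\<forall>i<n. if i < d then q r i < 0 else q r i = (0::real))"
  using robust_feasibility[of \<gamma> d n K b "\<lambda>k i. L i (a k) + c k i", OF \<gamma> desc] by blast
 obtain w where wL: "\<And>k i. k < K \<Longrightarrow> i < n \<Longrightarrow> L i (w k) = 0"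
  and wB: "\<And>r i. r \<in> unit_cube K \<Longrightarrow> i < n \<Longrightarrow>
   \<bar>B i (g0 + (\<Sum>k<K. sqrt (r k) *\<^sub>R w k)) (g0 + (\<Sum>k<K. sqrt (r k) *\<^sub>R w k)) / 2
    - B i g0 g0 / 2 - (\<Sum>k<K. r k * c k i)\<bar> \<le> \<kappa> / 2"
  using oscillation_superposition[of K c "\<kappa> / 2" g0, OF osc half_gt_zero[OF \<kappa>]] by blast
 define G where "G r = g0 + (\<Sum>k<K. sqrt (r k) *\<^sub>R w k)" for r :: "nat \<Rightarrow> real"
 define A where "A r = (\<Sum>k<K. r k *\<^sub>R a k)" for r :: "nat \<Rightarrow> real"
 have r01: "0 \<le> r k" "r k \<le> 1" if "r \<in> unit_cube K" for r k using that by (cases "k < K"; auto simp: unit_cube_def)+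
 define M where "M = norm g0 + (\<Sum>k<K. norm (w k)) + (\<Sum>k<K. norm (a k)) + 1"
 have M1: "M \<ge> 1" by (simp add: M_def sum_nonneg)
 have nA: "norm (A r) \<le> M" and nG: "norm (G r) \<le> M" if r: "r \<in> unit_cube K" for r
 proof -
  have "norm (A r) \<le> (\<Sum>k<K. norm (r k *\<^sub>R a k))" unfolding A_def by (rule norm_sum)
  also have "\<dots> \<le> (\<Sum>k<K. norm (a k))" using r01[OF r] by (intro sum_mono) (auto intro!: mult_left_le_one_le)
  finally show "norm (A r) \<le> M" using sum_nonneg[of "{..<K}" "\<lambda>k. norm (w k)", OF norm_ge_zero] norm_ge_zero[of g0]
   unfolding M_def by linarith
  have "norm (G r) \<le> norm g0 + (\<Sum>k<K. norm (sqrt (r k) *\<^sub>R w k))"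
   unfolding G_def by (intro order_trans[OF norm_triangle_ineq] add_left_mono norm_sum)
  also have "\<dots> \<le> norm g0 + (\<Sum>k<K. norm (w k))"
   using r01[OF r] by (intro add_left_mono sum_mono) (auto intro!: mult_left_le_one_le)
  finally show "norm (G r) \<le> M" using sum_nonneg[of "{..<K}" "\<lambda>k. norm (a k)", OF norm_ge_zero] unfolding M_def by simp
 qed
 obtain \<beta> where \<beta>: "\<beta> > 0" "\<And>i x y. i < n \<Longrightarrow> \<bar>B i x y\<bar> \<le> \<beta> * (norm x * norm y)"
 proof -
  have "\<exists>K>0. \<forall>x y. \<bar>B i x y\<bar> \<le> norm x * norm y * K" for i
   using bounded_bilinear.pos_bounded[OF B[of i]] by (simp add: real_norm_def)
  then obtain k where k: "\<And>i. k i > 0" "\<And>i x y. \<bar>B i x y\<bar> \<le> norm x * norm y * k i" by metis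
  have "\<bar>B i x y\<bar> \<le> ((\<Sum>i<n. k i) + 1) * (norm x * norm y)" if "i < n" for i x y
  proof -
   have "k i \<le> (\<Sum>i<n. k i) + 1" using member_le_sum[of i "{..<n}" k] that k(1) by (force simp: less_imp_le)
   from order_trans[OF k(2) mult_left_mono[OF this]] show ?thesis by (simp add: mult.commute)
  qed
  moreover have "(\<Sum>i<n. k i) + 1 > 0" using k(1) by (simp add: add_nonneg_pos less_imp_le sum_nonneg)
  ultimately show ?thesis using that by blast
 qed
 define C' where "C' = \<bar>C\<bar> * (2 * M) ^ 3 + 2 * \<beta> * M\<^sup>2 + 1"
 have C'1: "C' \<ge> 1" using \<beta>(1) M1 unfolding C'_def by (simp add: add_nonneg_nonneg)
 \<comment> \<open>The bounds keep \<open>X r\<close> in the ball of radius \<rho> and all errors of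
   the expansion below \<kappa>/2; the remaining \<kappa>/2 is the error of the
   superposition.\<close>
 define \<epsilon> where "\<epsilon> = min 1 (min (\<rho> / (2 * M)) (\<kappa> / (2 * C')))"
 have \<epsilon>: "0 < \<epsilon>" "\<epsilon> \<le> 1" "\<epsilon> * (2 * M) \<le> \<rho>" "\<epsilon> * C' \<le> \<kappa> / 2"
 proof -
  show "0 < \<epsilon>" "\<epsilon> \<le> 1" using \<open>\<rho> > 0\<close> \<kappa> M1 C'1 by (auto simp: \<epsilon>_def)
  have "\<epsilon> \<le> \<rho> / (2 * M)" "\<epsilon> \<le> \<kappa> / (2 * C')" by (auto simp: \<epsilon>_def)
  then show "\<epsilon> * (2 * M) \<le> \<rho>" "\<epsilon> * C' \<le> \<kappa> / 2" using M1 C'1 by (auto simp: field_simps)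
 qed
 \<comment> \<open>\<open>G r\<close> enters the quadratic part at order \<epsilon> squared and
   \<open>A r\<close> the linear part at the same order, while mixed and higher terms are at least
   cubic in \<epsilon>.\<close>
 define X where "X r = \<epsilon> *\<^sub>R G r + \<epsilon>\<^sup>2 *\<^sub>R A r" for r
 have nX: "norm (X r) \<le> \<epsilon> * (2 * M)" if r: "r \<in> unit_cube K" for r
 proof -
  have "norm (X r) \<le> \<epsilon> * norm (G r) + \<epsilon>\<^sup>2 * norm (A r)"
   unfolding X_def using \<epsilon>(1) by (intro order_trans[OF norm_triangle_ineq]) simp
  also have "\<dots> \<le> \<epsilon> * M + \<epsilon> * M"
   using \<epsilon> nA[OF r] nG[OF r] M1 by (intro add_mono mult_mono) (auto simp: power2_eq_square mult_left_le_one_le)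
  finally show ?thesis by (simp add: algebra_simps)
 qed
 \<comment> \<open>The first-order term \<epsilon> \<open>L i g0\<close> is removed before
   rescaling. It is 0 for equalities and at most 0 for inequalities, so that adding it back at the
   end preserves the required signs.\<close>
 define q where "q r i = (\<Phi> i (X r) - \<epsilon> * L i g0) / \<epsilon>\<^sup>2" for r i
 have "\<exists>r\<in>unit_cube K. \<forall>i<n. if i < d then q r i < 0 else q r i = 0"
 proof (rule robust)
  fix i assume i: "i < n"
  have "continuous_on (unit_cube K) X" unfolding X_def G_def A_def
   by (intro continuous_intros continuous_on_subset[OF continuous_on_product_coordinates]) simp_all
  moreover have "X ` unit_cube K \<subseteq> cball 0 \<rho>" using order_trans[OF nX \<epsilon>(3)] by auto
  ultimately have "continuous_on (unit_cube K) (\<lambda>r. \<Phi> i (X r))" using continuous_on_compose2[OF cont[OF i]] by blast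
  then show "continuous_on (unit_cube K) (\<lambda>r. q r i)" unfolding q_def by (intro continuous_intros) (use \<epsilon> in auto)
 next
  fix r i assume r: "r \<in> unit_cube K" and i: "i < n"
  have LG: "L i (G r) = L i g0" using wL[OF _ i] by (simp add: G_def L_lin)
  have LX: "L i (X r) = \<epsilon> * L i g0 + \<epsilon>\<^sup>2 * (\<Sum>k<K. r k * L i (a k))" by (simp add: X_def L_lin LG A_def)
  have BX: "B i (X r) (X r) / 2 = \<epsilon>\<^sup>2 * (B i (G r) (G r) / 2) + \<epsilon>\<^sup>2 * (\<epsilon> * B i (G r) (A r) + \<epsilon>\<^sup>2 * B i (A r) (A r) / 2)"
   by (simp add: X_def B_lin B_sym[of i "A r" "G r"] power2_eq_square field_simps)
  have "\<bar>\<Phi> i (X r) - L i (X r) - B i (X r) (X r) / 2\<bar> \<le> C * norm (X r) ^ 3"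
   by (intro taylor i order_trans[OF nX[OF r] \<epsilon>(3)])
  also have "\<dots> \<le> \<bar>C\<bar> * (\<epsilon> * (2 * M)) ^ 3" using nX[OF r] by (intro mult_mono power_mono) auto
  also have "\<dots> = \<epsilon>\<^sup>2 * (\<epsilon> * (\<bar>C\<bar> * (2 * M) ^ 3))"
   by (simp add: power2_eq_square power3_eq_cube mult_ac)
  finally have 1: "\<bar>\<Phi> i (X r) - L i (X r) - B i (X r) (X r) / 2\<bar> \<le> \<epsilon>\<^sup>2 * (\<epsilon> * (\<bar>C\<bar> * (2 * M) ^ 3))" .
  have Bb: "\<bar>B i (G r) (A r)\<bar> \<le> \<beta> * (M * M)" "\<bar>B i (A r) (A r)\<bar> \<le> \<beta> * (M * M)"
   using \<beta>(1) nA[OF r] nG[OF r] M1 by (auto intro!: order_trans[OF \<beta>(2)[OF i]] mult_left_mono mult_mono)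
  have "\<bar>\<epsilon> * B i (G r) (A r)\<bar> \<le> \<epsilon> * (\<beta> * (M * M))"
   using Bb(1) \<epsilon>(1) by (simp add: abs_mult mult_left_mono)
  moreover have "\<bar>\<epsilon>\<^sup>2 * B i (A r) (A r) / 2\<bar> \<le> \<epsilon> * (\<beta> * (M * M))"
  proof -
   have "\<bar>\<epsilon>\<^sup>2 * B i (A r) (A r) / 2\<bar> \<le> \<epsilon>\<^sup>2 * (\<beta> * (M * M))"
    using Bb(2) \<epsilon>(1) by (simp add: abs_mult)
   also have "\<dots> \<le> \<epsilon> * (\<beta> * (M * M))"
    using \<epsilon> \<beta>(1) M1 by (intro mult_right_mono) (auto simp: power2_eq_square mult_left_le_one_le)
   finally show ?thesis .
  qed
  ultimately have 2: "\<bar>\<epsilon> * B i (G r) (A r) + \<epsilon>\<^sup>2 * B i (A r) (A r) / 2\<bar> \<le> \<epsilon> * (2 * \<beta> * M\<^sup>2)"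
   by (simp add: power2_eq_square algebra_simps abs_le_iff)
  define z where "z = \<Phi> i (X r) - L i (X r) - B i (X r) (X r) / 2"
  have eq: "q r i - (b i + (\<Sum>k<K. r k * (L i (a k) + c k i)))
    = z / \<epsilon>\<^sup>2 + (\<epsilon> * B i (G r) (A r) + \<epsilon>\<^sup>2 * B i (A r) (A r) / 2)
     + (B i (G r) (G r) / 2 - b i - (\<Sum>k<K. r k * c k i))"
  proof -
   have "\<Phi> i (X r) - \<epsilon> * L i g0 = z + \<epsilon>\<^sup>2 * ((\<Sum>k<K. r k * L i (a k)) + B i (G r) (G r) / 2
     + (\<epsilon> * B i (G r) (A r) + \<epsilon>\<^sup>2 * B i (A r) (A r) / 2))" using LX BX by (simp add: z_def algebra_simps)
   then have "q r i = z / \<epsilon>\<^sup>2 + ((\<Sum>k<K. r k * L i (a k)) + B i (G r) (G r) / 2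
     + (\<epsilon> * B i (G r) (A r) + \<epsilon>\<^sup>2 * B i (A r) (A r) / 2))"
    using \<epsilon>(1) by (simp add: q_def add_divide_distrib)
   then show ?thesis by (simp add: distrib_left sum.distrib)
  qed
  have "\<bar>z / \<epsilon>\<^sup>2\<bar> \<le> \<epsilon> * (\<bar>C\<bar> * (2 * M) ^ 3)"
   using 1 \<epsilon>(1) unfolding z_def[symmetric] by (simp add: divide_le_eq mult_ac)
  moreover have "\<bar>B i (G r) (G r) / 2 - b i - (\<Sum>k<K. r k * c k i)\<bar> \<le> \<kappa> / 2"
   using wB[OF r i] unfolding G_def b_def .
  ultimately have "\<bar>q r i - (b i + (\<Sum>k<K. r k * (L i (a k) + c k i)))\<bar>
    \<le> \<epsilon> * (\<bar>C\<bar> * (2 * M) ^ 3) + \<epsilon> * (2 * \<beta> * M\<^sup>2) + \<kappa> / 2"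
   unfolding eq using 2 by linarith
  also have "\<dots> \<le> \<epsilon> * C' + \<kappa> / 2" using \<epsilon>(1) by (simp add: C'_def distrib_left)
  also have "\<dots> \<le> \<kappa>" using \<epsilon>(4) by simp
  finally show "\<bar>q r i - (b i + (\<Sum>k<K. r k * (L i (a k) + c k i)))\<bar> \<le> \<kappa>" .
 qed
 then obtain r where r: "r \<in> unit_cube K" and qr: "\<And>i. i < n \<Longrightarrow> if i < d then q r i < 0 else q r i = 0" by blast
 have "if i < d then \<Phi> i (X r) < 0 else \<Phi> i (X r) = 0" if i: "i < n" for i
 proof -
  have e: "\<Phi> i (X r) = \<epsilon>\<^sup>2 * q r i + \<epsilon> * L i g0" using \<epsilon>(1) by (simp add: q_def)
  show ?thesis
  proof (cases "i < d")
   case True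
   then have "\<epsilon>\<^sup>2 * q r i < 0" "\<epsilon> * L i g0 \<le> 0"
    using qr[OF i] g0[OF i] \<epsilon>(1) by (auto simp: mult_le_0_iff mult_less_0_iff)
   then show ?thesis using True by (simp add: e)
  next
   case False
   then show ?thesis using qr[OF i] g0[OF i] by (simp add: e)
  qed
 qed
 then show False using infeasible[of "X r"] nX[OF r] \<epsilon>(3) by auto
qed

end

section \<open>Differential equations\<close>

text \<open>The integral majorant, multiplied by \<open>exp (- K s)\<close>, has a nonpositive
  derivative.\<close>

lemma gronwall:
 fixes \<phi> :: "real \<Rightarrow> real"
 assumes cont: "cont_on T \<phi>" and "0 \<le> K"
  and le: "\<And>t. t \<in> {0..T} \<Longrightarrow> \<phi> t \<le> a + K * intg t \<phi>" and t: "t \<in> {0..T}"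
 shows "\<phi> t \<le> a * exp (K * t)"
proof -
 define \<psi> where "\<psi> s = a + K * intg s \<phi>" for s
 define h where "h s = exp (- (K * s)) * \<psi> s" for s
 have d\<psi>: "(\<psi> has_real_derivative K * \<phi> s) (at s within {0..T})" if "s \<in> {0..T}" for s unfolding \<psi>_def
  by (auto intro!: derivative_eq_intros integral_has_real_derivative[OF cont that])
 have dh: "(h has_real_derivative (exp (- (K * s)) * (K * (\<phi> s - \<psi> s)))) (at s within {0..T})"
  if "s \<in> {0..T}" for s unfolding h_def by (auto intro!: derivative_eq_intros d\<psi>[OF that] simp: algebra_simps)
 have "h t \<le> h 0"
 proof (rule DERIV_nonpos_imp_decreasing_open[where f = h and a = 0 and b = t])
  show "0 \<le> t" using t by simp
  show "cont_on t h" by (rule continuous_on_subset[OF DERIV_continuous_on[OF dh]]) (use t in auto)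
  fix s assume s: "0 < s" "s < t"
  have "(h has_real_derivative (exp (- (K * s)) * (K * (\<phi> s - \<psi> s)))) (at s)" using dh[of s] s t by (simp add: at_within_Icc_at)
  moreover have "exp (- (K * s)) * (K * (\<phi> s - \<psi> s)) \<le> 0" using le[of s] s t \<open>0 \<le> K\<close> unfolding \<psi>_def
   by (intro mult_nonneg_nonpos mult_nonneg_nonpos2) (auto simp: mult_nonneg_nonpos)
  ultimately show "\<exists>y. (h has_real_derivative y) (at s) \<and> y \<le> 0" by blast
 qed
 then have "\<psi> t \<le> a * exp (K * t)" by (simp add: h_def \<psi>_def exp_minus field_simps)
 with le[OF t] show ?thesis by (simp add: \<psi>_def)
qed

text \<open>Constant continuation beyond both end points turns a continuous function on [0,T] into
  an element of the complete normed type of bounded continuous functions on the line.\<close>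

definition clamp_ext :: "real \<Rightarrow> (real \<Rightarrow> 'b::metric_space) \<Rightarrow> real \<Rightarrow>\<^sub>C 'b" where
 "clamp_ext T h = Bcontfun (\<lambda>t. h (max 0 (min T t)))"

lemma apply_clamp_ext:
 assumes "0 \<le> T" "cont_on T h" shows "apply_bcontfun (clamp_ext T h) t = h (max 0 (min T t))"
proof -
 have "continuous_on UNIV (\<lambda>t. h (max 0 (min T t)))"
  by (rule continuous_on_compose2[OF assms(2)]) (use assms(1) in \<open>auto intro!: continuous_intros\<close>)
 moreover have "bounded (range (\<lambda>t. h (max 0 (min T t))))"
  by (rule bounded_subset[OF compact_imp_bounded[OF compact_continuous_image[OF assms(2)]]]) (use assms(1) in auto)
 ultimately show ?thesis unfolding clamp_ext_def by (subst Bcontfun_inverse) (auto simp: bcontfun_def)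
qed

lemma apply_clamp_ext_on:
 assumes "0 \<le> T" "cont_on T h" "t \<in> {0..T}" shows "apply_bcontfun (clamp_ext T h) t = h t"
proof -
 have "max 0 (min T t) = t" using assms(3) by auto
 then show ?thesis using assms by (simp add: apply_clamp_ext)
qed

text \<open>An exponentially weighted norm makes the Picard operator a contraction on the whole interval.\<close>

lemma picard_lindelof:
 fixes f :: "real \<Rightarrow> 'a::euclidean_space \<Rightarrow> 'a"
 assumes T: "0 \<le> T" and cont: "continuous_on ({0..T} \<times> UNIV) (\<lambda>(t, x). f t x)"
  and lip: "\<And>t x y. t \<in> {0..T} \<Longrightarrow> norm (f t x - f t y) \<le> K * norm (x - y)"
 obtains x where "x 0 = x0" "\<And>t. t \<in> {0..T} \<Longrightarrow> vd T x (f t (x t)) t"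
proof -
 define L where "L = \<bar>K\<bar> + 1"
 have L: "L > 0" by (simp add: L_def)
 have lipL: "norm (f t x - f t y) \<le> L * norm (x - y)" if "t \<in> {0..T}" for t x y
 proof -
  have "K * norm (x - y) \<le> L * norm (x - y)" by (intro mult_right_mono) (auto simp: L_def)
  then show ?thesis using lip[OF that, of x y] by linarith
 qed
 have contf: "cont_on T (\<lambda>s. f s (y s))" if "cont_on T y" for y
 proof -
  have "cont_on T (\<lambda>s. (s, y s))" "(\<lambda>s. (s, y s)) ` {0..T} \<subseteq> {0..T} \<times> UNIV"
   using that by (auto intro!: continuous_intros)
  from continuous_on_compose2[OF cont this] show ?thesis by simp
 qed
 \<comment> \<open>The unknown is \<open>z t = exp (- 2 L t) x t\<close>. In this variable the
   Picard operator contracts by 1/2, and the plain sup norm of \<open>z\<close> is the weighted norm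
   of \<open>x\<close>.\<close>
 define I where "I z t = exp (- (2 * L * t)) *\<^sub>R (x0 + intg t (\<lambda>s. f s (exp (2 * L * s) *\<^sub>R apply_bcontfun z s)))"
  for z :: "real \<Rightarrow>\<^sub>C 'a" and t
 have contz: "cont_on T (\<lambda>s. f s (exp (2 * L * s) *\<^sub>R apply_bcontfun z s))" for z :: "real \<Rightarrow>\<^sub>C 'a"
  by (intro contf continuous_intros continuous_on_apply_bcontfun)
 have contI: "cont_on T (I z)" for z unfolding I_def
  by (intro continuous_intros indefinite_integral_continuous_1 integrable_continuous_real contz)
 have contr: "dist (clamp_ext T (I z)) (clamp_ext T (I w)) \<le> 1 / 2 * dist z w" for z w
 proof (rule dist_bound)
  fix t0
  define t where "t = max 0 (min T t0)"
  have t: "t \<in> {0..T}" using T by (auto simp: t_def)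
  let ?d = "\<lambda>s. f s (exp (2 * L * s) *\<^sub>R apply_bcontfun z s) - f s (exp (2 * L * s) *\<^sub>R apply_bcontfun w s)"
  have sub: "{0..t} \<subseteq> {0..T}" using t by auto
  have int: "(\<lambda>s. f s (exp (2 * L * s) *\<^sub>R apply_bcontfun v s)) integrable_on {0..t}" for v :: "real \<Rightarrow>\<^sub>C 'a"
   by (rule integrable_continuous_real[OF continuous_on_subset[OF contz sub]])
  have "((\<lambda>s. L * exp (2 * L * s) * dist z w) has_integral (exp (2 * L * t) / 2 * dist z w - exp (2 * L * 0) / 2 * dist z w)) {0..t}"
   using t by (intro fundamental_theorem_of_calculus)
    (auto intro!: derivative_eq_intros simp: has_real_derivative_iff_has_vector_derivative[symmetric])
  then have hi: "((\<lambda>s. L * exp (2 * L * s) * dist z w) has_integral ((exp (2 * L * t) - 1) / 2 * dist z w)) {0..t}"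
   by (simp add: algebra_simps diff_divide_distrib)
  have "norm (intg t ?d) \<le> intg t (\<lambda>s. L * exp (2 * L * s) * dist z w)"
  proof (rule integral_norm_bound_integral)
   show "?d integrable_on {0..t}" by (intro integrable_diff int)
   show "(\<lambda>s. L * exp (2 * L * s) * dist z w) integrable_on {0..t}" using hi by blast
   fix s assume s: "s \<in> {0..t}"
   have "norm (?d s) \<le> L * norm (exp (2 * L * s) *\<^sub>R apply_bcontfun z s - exp (2 * L * s) *\<^sub>R apply_bcontfun w s)"
    by (rule lipL) (use s t in auto)
   also have "\<dots> = L * (exp (2 * L * s) * dist (apply_bcontfun z s) (apply_bcontfun w s))"
    by (simp add: scaleR_diff_right[symmetric] dist_norm)
   also have "\<dots> \<le> L * (exp (2 * L * s) * dist z w)" using L by (intro mult_left_mono dist_bounded) auto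
   finally show "norm (?d s) \<le> L * exp (2 * L * s) * dist z w" by (simp add: mult_ac)
  qed
  also have "\<dots> = (exp (2 * L * t) - 1) / 2 * dist z w" using hi by (rule integral_unique)
  finally have "exp (- (2 * L * t)) * norm (intg t ?d) \<le> exp (- (2 * L * t)) * ((exp (2 * L * t) - 1) / 2 * dist z w)"
   by (intro mult_left_mono) auto
  also have "\<dots> = (1 - exp (- (2 * L * t))) / 2 * dist z w" by (simp add: exp_minus field_simps)
  also have "\<dots> \<le> 1 / 2 * dist z w" by (intro mult_right_mono) auto
  finally have "exp (- (2 * L * t)) * norm (intg t ?d) \<le> 1 / 2 * dist z w" .
  moreover have "dist (I z t) (I w t) = exp (- (2 * L * t)) * norm (intg t ?d)" unfolding I_def dist_norm
   by (simp add: scaleR_diff_right[symmetric] integral_diff[OF int int])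
  ultimately show "dist (apply_bcontfun (clamp_ext T (I z)) t0) (apply_bcontfun (clamp_ext T (I w)) t0) \<le> 1 / 2 * dist z w"
   by (simp add: apply_clamp_ext[OF T contI] t_def)
 qed
 then have "\<exists>!z. clamp_ext T (I z) = z" by (intro banach_fix_type[of "1 / 2"]) auto
 then obtain z where z: "clamp_ext T (I z) = z" by blast
 define x where "x t = exp (2 * L * t) *\<^sub>R apply_bcontfun z t" for t
 have xI: "x t = x0 + intg t (\<lambda>s. f s (x s))" if "t \<in> {0..T}" for t
 proof -
  have "apply_bcontfun z t = I z t" using apply_clamp_ext_on[OF T contI[of z] that] z by simp
  then show ?thesis by (simp add: x_def I_def exp_minus)
 qed
 have contx: "cont_on T x" unfolding x_def by (intro continuous_intros continuous_on_apply_bcontfun)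
 show ?thesis
 proof
  show "x 0 = x0" using xI[of 0] T by simp
  fix t assume t: "t \<in> {0..T}"
  have "vd T (\<lambda>t. x0 + intg t (\<lambda>s. f s (x s))) (0 + f t (x t)) t"
   by (intro has_vector_derivative_add has_vector_derivative_const
     integral_has_vector_derivative[OF contf[OF contx] t])
  then have "vd T (\<lambda>t. x0 + intg t (\<lambda>s. f s (x s))) (f t (x t)) t" by simp
  then show "vd T x (f t (x t)) t" by (rule has_vector_derivative_transform[OF t xI, rotated -1]) simp
 qed
qed

lemma has_vector_derivative_continuous_on:
 assumes "\<And>t. t \<in> S \<Longrightarrow> (x has_vector_derivative g t) (at t within S)" shows "continuous_on S x"
 using assms by (auto simp: continuous_on_eq_continuous_within intro: has_vector_derivative_continuous)

lemma eq_integral_of_derivative: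
 fixes x :: "real \<Rightarrow> 'a::banach"
 assumes "\<And>t. t \<in> {0..T} \<Longrightarrow> vd T x (g t) t" "t \<in> {0..T}" shows "x t = x 0 + intg t g"
proof -
 have "(g has_integral (x t - x 0)) {0..t}" using assms(2) by (intro fundamental_theorem_of_calculus)
   (auto intro!: has_vector_derivative_within_subset[OF assms(1)])
 then show ?thesis by (simp add: integral_unique)
qed

lemma derivative_growth_bound:
 fixes x :: "real \<Rightarrow> 'a::euclidean_space"
 assumes der: "\<And>t. t \<in> {0..T} \<Longrightarrow> vd T x (g t) t" and contg: "cont_on T g" and contb: "cont_on T b"
  and b: "\<And>t. t \<in> {0..T} \<Longrightarrow> 0 \<le> b t" and K: "0 \<le> K"
  and bound: "\<And>t. t \<in> {0..T} \<Longrightarrow> norm (g t) \<le> K * norm (x t) + b t" and t: "t \<in> {0..T}"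
 shows "norm (x t) \<le> (norm (x 0) + intg T b) * exp (K * T)"
proof -
 have contx: "cont_on T x" by (rule has_vector_derivative_continuous_on[OF der])
 have int_nonneg: "0 \<le> intg T b" by (rule integral_nonneg[OF integrable_continuous_real[OF contb] b])
 have "norm (x t) \<le> (norm (x 0) + intg T b) * exp (K * t)"
 proof (rule gronwall[OF _ K _ t])
  show "cont_on T (\<lambda>t. norm (x t))" by (intro continuous_intros contx)
  fix s assume s: "s \<in> {0..T}"
  have sub: "{0..s} \<subseteq> {0..T}" using s by auto
  have i1: "(\<lambda>r. K * norm (x r)) integrable_on {0..s}" and i2: "b integrable_on {0..s}" and i3: "g integrable_on {0..s}"
   by (intro integrable_continuous_real continuous_intros continuous_on_subset[OF contx sub]
     continuous_on_subset[OF contb sub] continuous_on_subset[OF contg sub])+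
  have "norm (intg s g) \<le> intg s (\<lambda>r. K * norm (x r) + b r)"
   using bound sub by (intro integral_norm_bound_integral integrable_add i1 i2 i3) auto
  also have "\<dots> = K * intg s (\<lambda>r. norm (x r)) + intg s b" by (simp add: integral_add[OF i1 i2])
  also have "intg s b \<le> intg T b" using b by (intro integral_subset_le sub i2 integrable_continuous_real[OF contb]) auto
  finally have "norm (intg s g) \<le> K * intg s (\<lambda>r. norm (x r)) + intg T b" by simp
  then show "norm (x s) \<le> norm (x 0) + intg T b + K * intg s (\<lambda>t. norm (x t))"
   using eq_integral_of_derivative[OF der s] norm_triangle_ineq[of "x 0" "intg s g"] by simp
 qed
 also have "\<dots> \<le> (norm (x 0) + intg T b) * exp (K * T)"
  using t K int_nonneg by (intro mult_left_mono) (auto intro!: mult_left_mono)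
 finally show ?thesis .
qed

lemma norm_fst_le_norm: "norm (fst g) \<le> norm g" by (metis norm_fst_le prod.collapse)

lemma norm_snd_le_norm: "norm (snd g) \<le> norm g" by (metis norm_snd_le prod.collapse)

lemma linear_representer:
 fixes f :: "'a::euclidean_space \<Rightarrow> real"
 assumes "linear f" shows "(\<Sum>b\<in>Basis. f b *\<^sub>R b) \<bullet> x = f x"
proof -
 have "f x = f (\<Sum>b\<in>Basis. (x \<bullet> b) *\<^sub>R b)" by (simp add: euclidean_representation)
 also have "\<dots> = (\<Sum>b\<in>Basis. (x \<bullet> b) * f b)"
  using linear_sum[OF assms, of "\<lambda>b. (x \<bullet> b) *\<^sub>R b" Basis] linear_scale[OF assms] by simp
 finally show ?thesis unfolding inner_sum_left inner_scaleR_left by (simp add: inner_commute mult.commute)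
qed

lemma blinfun_representer:
 fixes x :: "'a::euclidean_space"
 assumes "linear g" shows "(\<Sum>b\<in>Basis. (q \<bullet> blinfun_apply B (g b)) *\<^sub>R b) \<bullet> x = q \<bullet> B (g x)"
 by (rule linear_representer, rule linearI)
  (simp_all add: linear_add[OF assms] linear_scale[OF assms] blinfun.add_right blinfun.scaleR_right inner_add_right)

lemma norm_quadratic_diff:
 fixes B :: "'x::real_normed_vector \<Rightarrow>\<^sub>L 'x \<Rightarrow>\<^sub>L 'y::real_normed_vector"
 shows "norm (B x x - B y y) \<le> norm B * (norm x + norm y) * norm (x - y)"
proof -
 have "B x x - B y y = B (x - y) x + B y (x - y)" by (simp add: blinfun.bilinear_simps)
 also have "norm \<dots> \<le> norm B * norm (x - y) * norm x + norm B * norm y * norm (x - y)"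
  by (intro order_trans[OF norm_triangle_ineq] add_mono) (auto intro!: order_trans[OF norm_blinfun] mult_right_mono norm_blinfun)
 finally show ?thesis by (simp add: algebra_simps)
qed

section \<open>The end-point map\<close>

text \<open>Dynamics in deviations from a reference trajectory, so that zero deviation is at rest.
  The estimates are asked for on the unit ball only, because control-affine dynamics need not have
  global bounds.\<close>

locale control_system =
 fixes T K :: real
  and F :: "real \<Rightarrow> 'a::euclidean_space \<times> 'c::euclidean_space \<Rightarrow> 'a"
  and F1 :: "real \<Rightarrow> ('a \<times> 'c) \<Rightarrow>\<^sub>L 'a"
  and F2 :: "real \<Rightarrow> ('a \<times> 'c) \<Rightarrow>\<^sub>L ('a \<times> 'c) \<Rightarrow>\<^sub>L 'a"
 assumes T: "0 < T" and K: "0 \<le> K" and F1_cont: "cont_on T F1" and F2_cont: "cont_on T F2"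
  and F_cont: "continuous_on ({0..T} \<times> UNIV) (\<lambda>(t, w). F t w)"
  and F_lip: "\<And>t w w'. t \<in> {0..T} \<Longrightarrow> norm w \<le> 1 \<Longrightarrow> norm w' \<le> 1 \<Longrightarrow>
   norm (F t w - F t w') \<le> K * norm (w - w')"
  and F_taylor: "\<And>t w. t \<in> {0..T} \<Longrightarrow> norm w \<le> 1 \<Longrightarrow>
   norm (F t w - F1 t w - (1/2) *\<^sub>R F2 t w w) \<le> K * norm w ^ 3" and F2_sym: "\<And>t v w. F2 t v w = F2 t w v"
  and F1_le: "\<And>t. t \<in> {0..T} \<Longrightarrow> norm (F1 t) \<le> K"
  and F2_le: "\<And>t. t \<in> {0..T} \<Longrightarrow> norm (F2 t) \<le> K"
begin

lemma F_zero: "t \<in> {0..T} \<Longrightarrow> F t 0 = 0" using F_taylor[of t 0] by (simp add: blinfun.bilinear_simps)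

lemma F1_bound: "t \<in> {0..T} \<Longrightarrow> norm (F1 t w) \<le> K * norm w"
 using order_trans[OF norm_blinfun mult_right_mono[OF F1_le]] by auto

lemma F2_bound:
 assumes "t \<in> {0..T}" shows "norm (F2 t v w) \<le> K * norm v * norm w"
proof -
 have "norm (F2 t v w) \<le> norm (F2 t v) * norm w" by (rule norm_blinfun)
 also have "\<dots> \<le> norm (F2 t) * norm v * norm w" by (intro mult_right_mono norm_blinfun) auto
 also have "\<dots> \<le> K * norm v * norm w" by (intro mult_right_mono F2_le assms) auto
 finally show ?thesis .
qed

lemma F1_Pair: "F1 t (x, c) = F1 t (x, 0) + F1 t (0, c)" by (simp add: blinfun.add_right[symmetric])

lemma cont_F1: "cont_on T w \<Longrightarrow> cont_on T (\<lambda>t. F1 t (w t))" by (intro blinfun.continuous_on F1_cont)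

lemma cont_F2: "cont_on T v \<Longrightarrow> cont_on T w \<Longrightarrow> cont_on T (\<lambda>t. F2 t (v t) (w t))"
 by (intro blinfun.continuous_on F2_cont)

lemma cont_F:
 assumes "cont_on T w" shows "cont_on T (\<lambda>t. F t (w t))"
proof -
 have "cont_on T (\<lambda>t. (t, w t))" "(\<lambda>t. (t, w t)) ` {0..T} \<subseteq> {0..T} \<times> UNIV"
  using assms by (auto intro!: continuous_intros)
 from continuous_on_compose2[OF F_cont this] show ?thesis by simp
qed

text \<open>The argument pairs the initial state with a bounded continuous control, which makes the
  perturbations a normed space. The solution is determined on [0,T] only, whence the restriction on
  \<open>t\<close> in its linearity lemmas.\<close>

definition xlin :: "'a \<times> (real \<Rightarrow>\<^sub>C 'c) \<Rightarrow> real \<Rightarrow> 'a" where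
 "xlin g = (SOME x. x 0 = fst g \<and> (\<forall>t\<in>{0..T}. vd T x (F1 t (x t, snd g t)) t))"

lemma xlin:
 shows xlin_0: "xlin g 0 = fst g" and xlin_deriv: "\<And>t. t \<in> {0..T} \<Longrightarrow> vd T (xlin g) (F1 t (xlin g t, snd g t)) t"
proof -
 have cont: "continuous_on ({0..T} \<times> UNIV) (\<lambda>(t, x). F1 t (x, snd g t))" unfolding case_prod_unfold
  by (intro blinfun.continuous_on continuous_on_compose2[OF F1_cont] continuous_intros
    continuous_on_compose2[OF continuous_on_apply_bcontfun[of UNIV]]) auto
 have lip: "norm (F1 t (x, snd g t) - F1 t (y, snd g t)) \<le> K * norm (x - y)" if "t \<in> {0..T}" for t x y
  using F1_bound[OF that, of "(x - y, 0)"] by (simp add: blinfun.diff_right[symmetric] norm_Pair)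
 obtain x where "x 0 = fst g"
  "\<And>t. t \<in> {0..T} \<Longrightarrow> vd T x (F1 t (x t, snd g t)) t"
  using picard_lindelof[OF less_imp_le[OF T] cont lip, of "fst g"] by blast
 then have "\<exists>x. x 0 = fst g \<and> (\<forall>t\<in>{0..T}. vd T x (F1 t (x t, snd g t)) t)" by blast
 from someI_ex[OF this] show "xlin g 0 = fst g"
  "\<And>t. t \<in> {0..T} \<Longrightarrow> vd T (xlin g) (F1 t (xlin g t, snd g t)) t" unfolding xlin_def by blast+
qed

lemma xlin_cont: "cont_on T (xlin g)" by (rule has_vector_derivative_continuous_on[OF xlin_deriv])

lemma linear_solution_bound:
 assumes "\<And>t. t \<in> {0..T} \<Longrightarrow> vd T x (F1 t (x t, 0) + b t) t"
  and "cont_on T b" "t \<in> {0..T}" shows "norm (x t) \<le> (norm (x 0) + intg T (\<lambda>s. norm (b s))) * exp (K * T)"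
proof (rule derivative_growth_bound[OF assms(1) _ _ _ K _ assms(3)])
 have "cont_on T x" by (rule has_vector_derivative_continuous_on[OF assms(1)])
 then show "cont_on T (\<lambda>t. F1 t (x t, 0) + b t)" by (intro continuous_intros cont_F1 assms(2))
 show "cont_on T (\<lambda>s. norm (b s))" by (intro continuous_intros assms(2))
 fix t assume t: "t \<in> {0..T}"
 have "norm (F1 t (x t, 0)) \<le> K * norm (x t)" using F1_bound[OF t, of "(x t, 0)"] by (simp add: norm_Pair)
 then show "norm (F1 t (x t, 0) + b t) \<le> K * norm (x t) + norm (b t)" using norm_triangle_ineq[of "F1 t (x t, 0)" "b t"] by linarith
qed auto

lemma linear_solution_unique:
 assumes "\<And>t. t \<in> {0..T} \<Longrightarrow> vd T x (F1 t (x t, b t)) t"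
  and "\<And>t. t \<in> {0..T} \<Longrightarrow> vd T y (F1 t (y t, b t)) t"
  and "x 0 = y 0" "t \<in> {0..T}" shows "x t = y t"
proof -
 have "norm (x t - y t) \<le> (norm (x 0 - y 0) + intg T (\<lambda>s. norm (0 :: 'a))) * exp (K * T)"
  by (rule linear_solution_bound[where b = "\<lambda>t. 0"])
   (use assms(4) in \<open>auto intro!: derivative_eq_intros assms(1,2) simp: blinfun.diff_right[symmetric]\<close>)
 then show ?thesis using assms(3) by simp
qed

lemma xlin_unique:
 fixes g :: "'a \<times> (real \<Rightarrow>\<^sub>C 'c)"
 assumes "\<And>t. t \<in> {0..T} \<Longrightarrow> vd T x (F1 t (x t, snd g t)) t"
  and "x 0 = fst g" "t \<in> {0..T}" shows "xlin g t = x t"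
 by (rule linear_solution_unique[OF xlin_deriv assms(1)]) (use assms in \<open>auto simp: xlin_0\<close>)

lemma xlin_add: "t \<in> {0..T} \<Longrightarrow> xlin (g + h) t = xlin g t + xlin h t" by (rule xlin_unique)
  (auto intro!: derivative_eq_intros xlin_deriv simp: xlin_0 blinfun.add_right[symmetric])

lemma xlin_scale: "t \<in> {0..T} \<Longrightarrow> xlin (r *\<^sub>R g) t = r *\<^sub>R xlin g t" by (rule xlin_unique)
  (auto intro!: derivative_eq_intros xlin_deriv simp: xlin_0 blinfun.scaleR_right[symmetric])

lemma xlin_L1_bound:
 assumes "t \<in> {0..T}" shows "norm (xlin g t) \<le> (norm (fst g) + K * intg T (\<lambda>s. norm (snd g s))) * exp (K * T)"
proof -
 have i: "(\<lambda>s. norm (apply_bcontfun (snd g) s)) integrable_on {0..T}"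
  by (intro integrable_continuous_real continuous_intros continuous_on_apply_bcontfun)
 have c: "cont_on T (\<lambda>t. F1 t (0, snd g t))" by (intro cont_F1 continuous_intros continuous_on_apply_bcontfun)
 have "norm (xlin g t) \<le> (norm (xlin g 0) + intg T (\<lambda>s. norm (F1 s (0, snd g s)))) * exp (K * T)"
  by (rule linear_solution_bound[OF _ c assms]) (use xlin_deriv in \<open>simp add: F1_Pair[symmetric]\<close>)
 also have "intg T (\<lambda>s. norm (F1 s (0, snd g s))) \<le> intg T (\<lambda>s. K * norm (snd g s))"
 proof (rule integral_le)
  show "norm (F1 s (0, snd g s)) \<le> K * norm (snd g s)" if "s \<in> {0..T}" for s
   using F1_bound[OF that, of "(0, snd g s)"] by (simp add: norm_Pair)
 qed (intro integrable_continuous_real continuous_intros c continuous_on_apply_bcontfun)+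
 finally show ?thesis using i by (simp add: xlin_0)
qed

text \<open>The Gronwall constant by which linearized and nonlinear states are bounded in terms of
  the norm of \<open>g\<close>.\<close>

definition gain :: real where "gain = (1 + K * T) * exp (K * T)"

lemma gain_ge_1: "1 \<le> gain"
proof -
 have "1 * 1 \<le> (1 + K * T) * exp (K * T)" using K T by (intro mult_mono) auto
 then show ?thesis by (simp add: gain_def)
qed

lemma growth_le_gain:
 assumes "norm \<xi> \<le> r" "norm c \<le> r" shows "(norm \<xi> + T * (K * norm c)) * exp (K * T) \<le> gain * r"
proof -
 have "norm \<xi> + T * (K * norm c) \<le> r + T * (K * r)" using assms K T by (intro add_mono mult_left_mono) auto
 then have "(norm \<xi> + T * (K * norm c)) * exp (K * T) \<le> (r + T * (K * r)) * exp (K * T)" by (intro mult_right_mono) auto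
 then show ?thesis by (simp add: gain_def algebra_simps)
qed

lemma xlin_bound:
 assumes t: "t \<in> {0..T}" shows "norm (xlin g t) \<le> gain * norm g"
proof -
 have "intg T (\<lambda>s. norm (snd g s)) \<le> intg T (\<lambda>s. norm (snd g))"
  by (intro integral_le integrable_continuous_real continuous_intros continuous_on_apply_bcontfun norm_bounded)
 then have "intg T (\<lambda>s. norm (snd g s)) \<le> T * norm (snd g)" using T by simp
 then have "norm (fst g) + K * intg T (\<lambda>s. norm (snd g s)) \<le> norm (fst g) + T * (K * norm (snd g))"
  using mult_left_mono[OF _ K] by (simp add: mult.left_commute)
 then have "norm (xlin g t) \<le> (norm (fst g) + T * (K * norm (snd g))) * exp (K * T)"
  using xlin_L1_bound[OF t, of g] by (meson exp_ge_zero mult_right_mono order_trans)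
 also have "\<dots> \<le> gain * norm g" by (rule growth_le_gain) (rule norm_fst_le_norm norm_snd_le_norm)+
 finally show ?thesis .
qed

text \<open>Up to this norm the state and the control each stay below 1/2, hence jointly in the unit
  ball where the estimates of the locale hold.\<close>

definition radius :: real where "radius = 1 / (2 * gain)"

lemma radius: "0 < radius" "radius \<le> 1 / 2" "gain * radius = 1 / 2" using gain_ge_1 by (auto simp: radius_def field_simps)

definition xnl :: "'a \<times> (real \<Rightarrow>\<^sub>C 'c) \<Rightarrow> real \<Rightarrow> 'a" where
 "xnl g = (SOME x. x 0 = fst g \<and> (\<forall>t\<in>{0..T}. vd T x (F t (x t, snd g t)) t \<and>
    norm (x t) \<le> gain * norm g))"

text \<open>The state is projected onto the ball of radius 1/2 before it enters \<open>F\<close>,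
  which makes the right-hand side globally Lipschitz. The solution of the modified equation never
  leaves this ball and therefore solves the original one.\<close>

lemma xnl:
 assumes g: "norm g \<le> radius" shows xnl_0: "xnl g 0 = fst g"
  and xnl_deriv: "\<And>t. t \<in> {0..T} \<Longrightarrow> vd T (xnl g) (F t (xnl g t, snd g t)) t"
  and xnl_bound: "\<And>t. t \<in> {0..T} \<Longrightarrow> norm (xnl g t) \<le> gain * norm g"
proof -
 define pr :: "'a \<Rightarrow> 'a" where "pr = closest_point (cball 0 (1/2))"
 have pr_lip: "norm (pr x - pr y) \<le> norm (x - y)" for x y unfolding pr_def dist_norm[symmetric] by (rule closest_point_lipschitz) auto
 have pr_in: "norm (pr x) \<le> 1/2" for x using closest_point_in_set[of "cball (0::'a) (1/2)" x] by (simp add: pr_def)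
 have pr_id: "pr x = x" if "norm x \<le> 1/2" for x unfolding pr_def by (rule closest_point_self) (use that in simp)
 have pr_le: "norm (pr x) \<le> norm x" for x using pr_lip[of x 0] pr_id[of 0] by simp
 have c: "norm (snd g t) \<le> norm g" "norm (snd g t) \<le> 1/2" for t
  using norm_bounded[of "snd g" t] norm_snd_le_norm[of g] g radius(2) by linarith+
 have w1: "norm (pr x, snd g t) \<le> 1" for x t using norm_Pair_le[of "pr x" "snd g t"] pr_in[of x] c(2)[of t] by linarith
 have "continuous_on ({0..T} \<times> UNIV) (\<lambda>(t, x). (t, pr x, snd g t))" unfolding case_prod_unfold pr_def
  by (intro continuous_intros continuous_on_compose2[OF continuous_on_apply_bcontfun[of UNIV]]
    continuous_on_compose2[OF continuous_on_closest_point[of _ UNIV]]) auto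
 from continuous_on_compose2[OF F_cont this]
 have contF: "continuous_on ({0..T} \<times> UNIV) (\<lambda>(t, x). F t (pr x, snd g t))" by (simp add: case_prod_unfold image_subset_iff)
 have lipF: "norm (F t (pr x, snd g t) - F t (pr y, snd g t)) \<le> K * norm (x - y)" if "t \<in> {0..T}" for t x y
 proof -
  have "norm (F t (pr x, snd g t) - F t (pr y, snd g t)) \<le> K * norm (pr x - pr y)"
   using F_lip[OF that w1[of x t] w1[of y t]] by (simp add: norm_Pair)
  also have "\<dots> \<le> K * norm (x - y)" by (intro mult_left_mono pr_lip K)
  finally show ?thesis .
 qed
 obtain x where x0: "x 0 = fst g" and dx: "\<And>t. t \<in> {0..T} \<Longrightarrow> vd T x (F t (pr (x t), snd g t)) t"
  using picard_lindelof[OF less_imp_le[OF T] contF lipF, of "fst g"] by blast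
 have contx: "cont_on T x" by (rule has_vector_derivative_continuous_on[OF dx])
 have bd: "norm (x t) \<le> gain * norm g" if t: "t \<in> {0..T}" for t
 proof -
  have "norm (x t) \<le> (norm (x 0) + intg T (\<lambda>s. K * norm (snd g))) * exp (K * T)"
  proof (rule derivative_growth_bound[OF dx _ _ _ K _ t])
   have "continuous_on UNIV pr" unfolding pr_def by (rule continuous_on_closest_point) auto
   from continuous_on_compose2[OF this contx]
   have "cont_on T (\<lambda>t. pr (x t))" by auto
   then show "cont_on T (\<lambda>t. F t (pr (x t), snd g t))" by (intro cont_F continuous_intros continuous_on_apply_bcontfun)
   fix s assume s: "s \<in> {0..T}"
   have "norm (F s (pr (x s), snd g s)) \<le> K * norm (pr (x s), snd g s)"
    using F_lip[OF s w1[of "x s" s], of 0] by (simp add: F_zero[OF s])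
   also have "\<dots> \<le> K * (norm (x s) + norm (snd g))"
    by (intro mult_left_mono K order_trans[OF norm_Pair_le] add_mono pr_le norm_bounded)
   finally show "norm (F s (pr (x s), snd g s)) \<le> K * norm (x s) + K * norm (snd g)" by (simp add: distrib_left)
  qed (use K in auto)
  also have "\<dots> = (norm (fst g) + T * (K * norm (snd g))) * exp (K * T)" using T by (simp add: x0)
  also have "\<dots> \<le> gain * norm g" by (rule growth_le_gain) (rule norm_fst_le_norm norm_snd_le_norm)+
  finally show ?thesis .
 qed
 have "norm (x t) \<le> 1/2" if "t \<in> {0..T}" for t
 proof -
  have "gain * norm g \<le> gain * radius" using g gain_ge_1 by (intro mult_left_mono) auto
  then show ?thesis using bd[OF that] radius(3) by linarith
 qed
 then have "vd T x (F t (x t, snd g t)) t" if "t \<in> {0..T}" for t using dx[OF that] pr_id that by simp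
 then have "\<exists>x. x 0 = fst g \<and> (\<forall>t\<in>{0..T}. vd T x (F t (x t, snd g t)) t \<and>
    norm (x t) \<le> gain * norm g)" using x0 bd by blast
 from someI_ex[OF this] show "xnl g 0 = fst g"
  "\<And>t. t \<in> {0..T} \<Longrightarrow> vd T (xnl g) (F t (xnl g t, snd g t)) t"
  "\<And>t. t \<in> {0..T} \<Longrightarrow> norm (xnl g t) \<le> gain * norm g" unfolding xnl_def by blast+
qed

lemma xnl_cont: "norm g \<le> radius \<Longrightarrow> cont_on T (xnl g)" by (rule has_vector_derivative_continuous_on[OF xnl_deriv])

lemma xnl_small:
 assumes "norm g \<le> radius" "t \<in> {0..T}"
 shows "norm (xnl g t, snd g s) \<le> 1" "norm (xnl g t) \<le> 1 / 2" "norm (snd g s) \<le> 1 / 2"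
proof -
 have "gain * norm g \<le> gain * radius" using assms gain_ge_1 by (intro mult_left_mono) auto
 then show x: "norm (xnl g t) \<le> 1 / 2" using xnl_bound[OF assms] radius(3) by linarith
 show c: "norm (snd g s) \<le> 1 / 2" using norm_bounded[of "snd g" s] norm_snd_le_norm[of g] assms radius(2) by linarith
 show "norm (xnl g t, snd g s) \<le> 1" using norm_Pair_le[of "xnl g t" "snd g s"] x c by linarith
qed

lemma xnl_lipschitz:
 assumes g: "norm g \<le> radius" and h: "norm h \<le> radius" and t: "t \<in> {0..T}"
 shows "norm (xnl g t - xnl h t) \<le> gain * norm (g - h)"
proof -
 have "norm (xnl g t - xnl h t) \<le> (norm (xnl g 0 - xnl h 0) + intg T (\<lambda>s. K * norm (snd g - snd h))) * exp (K * T)"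
 proof (rule derivative_growth_bound[OF _ _ _ _ K _ t])
  show "vd T (\<lambda>t. xnl g t - xnl h t) (F s (xnl g s, snd g s) - F s (xnl h s, snd h s)) s"
   if "s \<in> {0..T}" for s by (intro has_vector_derivative_diff xnl_deriv g h that)
  show "cont_on T (\<lambda>s. F s (xnl g s, snd g s) - F s (xnl h s, snd h s))"
   by (intro continuous_intros cont_F xnl_cont g h continuous_on_apply_bcontfun)
  fix s assume s: "s \<in> {0..T}"
  have "norm (F s (xnl g s, snd g s) - F s (xnl h s, snd h s)) \<le> K * norm ((xnl g s, snd g s) - (xnl h s, snd h s))"
   by (intro F_lip s xnl_small(1) g h)
  also have "\<dots> = K * norm (xnl g s - xnl h s, (snd g - snd h) s)" by simp
  also have "\<dots> \<le> K * (norm (xnl g s - xnl h s) + norm (snd g - snd h))"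
   by (intro mult_left_mono K order_trans[OF norm_Pair_le] add_mono norm_bounded order_refl)
  finally show "norm (F s (xnl g s, snd g s) - F s (xnl h s, snd h s))
    \<le> K * norm (xnl g s - xnl h s) + K * norm (snd g - snd h)" by (simp add: distrib_left)
 qed (use K in auto)
 also have "\<dots> = (norm (fst (g - h)) + T * (K * norm (snd (g - h)))) * exp (K * T)" using T by (simp add: xnl_0 g h)
 also have "\<dots> \<le> gain * norm (g - h)" by (rule growth_le_gain) (rule norm_fst_le_norm norm_snd_le_norm)+
 finally show ?thesis .
qed

lemma xnl_pair_bound:
 assumes "norm g \<le> radius" "t \<in> {0..T}" shows "norm (xnl g t, snd g s) \<le> 2 * gain * norm g"
proof -
 have "norm (snd g s) \<le> 1 * norm g" using norm_bounded[of "snd g" s] norm_snd_le_norm[of g] by linarith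
 also have "\<dots> \<le> gain * norm g" using gain_ge_1 by (intro mult_right_mono) auto
 finally show ?thesis using norm_Pair_le[of "xnl g t" "snd g s"] xnl_bound[OF assms] by linarith
qed

lemma xlin_pair_bound:
 assumes "t \<in> {0..T}" shows "norm (xlin g t, snd g s) \<le> 2 * gain * norm g"
proof -
 have "norm (snd g s) \<le> 1 * norm g" using norm_bounded[of "snd g" s] norm_snd_le_norm[of g] by linarith
 also have "\<dots> \<le> gain * norm g" using gain_ge_1 by (intro mult_right_mono) auto
 finally show ?thesis using norm_Pair_le[of "xlin g t" "snd g s"] xlin_bound[OF assms, of g] by linarith
qed

definition gain2 :: real where "gain2 = T * (2 * K * (2 * gain)\<^sup>2) * exp (K * T)"

text \<open>The difference solves the linearized equation with zero initial value and with source
  \<open>F - F1\<close> along the nonlinear trajectory, which is quadratically small by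
  \<open>F_taylor\<close>.\<close>

lemma xnl_xlin_bound:
 assumes g: "norm g \<le> radius" and t: "t \<in> {0..T}" shows "norm (xnl g t - xlin g t) \<le> gain2 * (norm g)\<^sup>2"
proof -
 define b where "b s = F s (xnl g s, snd g s) - F1 s (xnl g s, snd g s)" for s
 have contb: "cont_on T b" unfolding b_def by (intro continuous_intros cont_F cont_F1 xnl_cont g continuous_on_apply_bcontfun)
 have bb: "norm (b s) \<le> 2 * K * (2 * gain * norm g)\<^sup>2" if s: "s \<in> {0..T}" for s
 proof -
  let ?w = "(xnl g s, snd g s)"
  have w: "norm ?w \<le> 1" by (rule xnl_small(1)[OF g s])
  have "norm (b s) \<le> norm (F s ?w - F1 s ?w - (1/2) *\<^sub>R F2 s ?w ?w) + norm ((1/2) *\<^sub>R F2 s ?w ?w)"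
   unfolding b_def by (metis diff_add_cancel norm_triangle_ineq)
  also have "\<dots> \<le> K * norm ?w ^ 3 + K * norm ?w * norm ?w"
  proof (intro add_mono F_taylor s w)
   have "norm ((1/2) *\<^sub>R F2 s ?w ?w) \<le> norm (F2 s ?w ?w)" by simp
   also have "\<dots> \<le> K * norm ?w * norm ?w" by (rule F2_bound[OF s])
   finally show "norm ((1/2) *\<^sub>R F2 s ?w ?w) \<le> K * norm ?w * norm ?w" .
  qed
  also have "\<dots> \<le> K * (norm ?w)\<^sup>2 + K * (norm ?w)\<^sup>2"
   using w K by (intro add_mono mult_left_mono power_decreasing) (auto simp: power2_eq_square mult.assoc)
  also have "\<dots> \<le> 2 * K * (2 * gain * norm g)\<^sup>2"
   using mult_left_mono[OF power_mono[OF xnl_pair_bound[OF g s, of s] norm_ge_zero, of 2], of "2 * K"] K by simp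
  finally show ?thesis .
 qed
 have "norm (xnl g t - xlin g t) \<le> (norm (xnl g 0 - xlin g 0) + intg T (\<lambda>s. norm (b s))) * exp (K * T)"
 proof (rule linear_solution_bound[OF _ contb t])
  fix s assume s: "s \<in> {0..T}"
  have "F1 s (xnl g s - xlin g s, 0) + b s = F s (xnl g s, snd g s) - F1 s (xlin g s, snd g s)"
   using blinfun.diff_right[of "F1 s" "(xnl g s, 0)" "(xlin g s, 0)"]
   by (simp add: b_def F1_Pair[of s "xnl g s" "snd g s"] F1_Pair[of s "xlin g s" "snd g s"])
  then show "vd T (\<lambda>t. xnl g t - xlin g t) (F1 s (xnl g s - xlin g s, 0) + b s) s"
   using has_vector_derivative_diff[OF xnl_deriv[OF g s] xlin_deriv[OF s]] by simp
 qed
 also have "intg T (\<lambda>s. norm (b s)) \<le> intg T (\<lambda>s. 2 * K * (2 * gain * norm g)\<^sup>2)"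
  by (intro integral_le bb integrable_continuous_real continuous_intros contb)
 finally show ?thesis using T by (simp add: xnl_0 xlin_0 g gain2_def power_mult_distrib mult_ac)
qed

section \<open>Costates and the variations of an end-point function\<close>

definition costate :: "(real \<Rightarrow> 'a) \<Rightarrow> bool" where
 "costate p \<longleftrightarrow> (\<forall>t\<in>{0..T}. vd T p (- (\<Sum>b\<in>Basis. (p t \<bullet> F1 t (b, 0)) *\<^sub>R b)) t)"

text \<open>Identifies the coordinate sum in \<open>costate\<close> as the row vector p F_x, written
  as a column; \<open>costate\<close> is the adjoint equation -p' = p F_x.\<close>

lemma adjoint_inner: "(\<Sum>b\<in>Basis. (q \<bullet> F1 t (b, 0)) *\<^sub>R b) \<bullet> x = q \<bullet> F1 t (x, 0)"
 by (rule blinfun_representer) (simp add: linear_iff)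

lemma costate_cont: "costate p \<Longrightarrow> cont_on T p" unfolding costate_def by (rule has_vector_derivative_continuous_on) blast

text \<open>The adjoint equation is solved backwards from \<open>T\<close>: reversing time turns it
  into an initial value problem for Picard-Lindelof.\<close>

lemma costate_exists:
 obtains p where "costate p" "p T = \<pi>"
proof -
 define f where "f t q = (\<Sum>b\<in>Basis. (q \<bullet> F1 (T - t) (b, 0)) *\<^sub>R b)" for t and q :: 'a
 have f_inner: "f t q \<bullet> x = q \<bullet> F1 (T - t) (x, 0)" for t q x unfolding f_def by (rule adjoint_inner)
 have "continuous_on ({0..T} \<times> UNIV) (\<lambda>(t, q). f t q)" unfolding f_def case_prod_unfold
  by (intro continuous_intros blinfun.continuous_on continuous_on_compose2[OF F1_cont]) auto
 moreover have "norm (f t x - f t y) \<le> K * norm (x - y)" if t: "t \<in> {0..T}" for t x y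
 proof -
  let ?d = "f t x - f t y"
  have t': "T - t \<in> {0..T}" using t by auto
  \<comment> \<open>Testing the difference with itself transfers the bound on \<open>F1\<close> to
    its adjoint.\<close>
  have "?d \<bullet> ?d = (x - y) \<bullet> F1 (T - t) (?d, 0)"
   unfolding f_inner[symmetric] by (simp add: inner_diff_left f_inner inner_diff_right)
  also have "\<dots> \<le> norm (x - y) * norm (F1 (T - t) (?d, 0))" by (rule norm_cauchy_schwarz)
  also have "\<dots> \<le> norm (x - y) * (K * norm ?d)"
   using F1_bound[OF t', of "(?d, 0)"] by (intro mult_left_mono) (auto simp: norm_Pair)
  finally have "norm ?d * norm ?d \<le> (K * norm (x - y)) * norm ?d"
   by (simp add: power2_norm_eq_inner[symmetric] power2_eq_square mult_ac)
  then show ?thesis by (cases "norm ?d = 0") (use K in auto)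
 qed
 ultimately obtain z where z0: "z 0 = \<pi>" and dz: "\<And>t. t \<in> {0..T} \<Longrightarrow> vd T z (f t (z t)) t"
  using picard_lindelof[OF less_imp_le[OF T], of f K \<pi>] by blast
 define p where "p t = z (T - t)" for t
 have "vd T p (- (\<Sum>b\<in>Basis. (p t \<bullet> F1 t (b, 0)) *\<^sub>R b)) t"
  if t: "t \<in> {0..T}" for t
 proof -
  have im: "(\<lambda>t. T - t) ` {0..T} = {0..T}" by (auto simp: image_iff intro!: bexI[of _ "T - _"])
  have "vd T (\<lambda>t. T - t) (-1) t" by (auto intro!: derivative_eq_intros)
  moreover have "(z has_vector_derivative f (T - t) (z (T - t))) (at (T - t) within (\<lambda>t. T - t) ` {0..T})"
   unfolding im using t by (intro dz) auto
  ultimately have "vd T (z \<circ> (\<lambda>t. T - t)) ((-1) *\<^sub>R f (T - t) (z (T - t))) t" by (rule vector_diff_chain_within)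
  then show ?thesis by (simp add: p_def[abs_def] f_def o_def)
 qed
 then have "costate p" unfolding costate_def by blast
 moreover have "p T = \<pi>" by (simp add: p_def z0)
 ultimately show ?thesis using that by blast
qed

text \<open>Lagrange identity: in the derivative of p . x the homogeneous parts of both equations
  cancel and only the source remains.\<close>

lemma costate_integral:
 assumes p: "costate p" and dx: "\<And>t. t \<in> {0..T} \<Longrightarrow> vd T x (F1 t (x t, 0) + b t) t"
 shows "p T \<bullet> x T = p 0 \<bullet> x 0 + intg T (\<lambda>t. p t \<bullet> b t)"
proof -
 have "vd T (\<lambda>t. p t \<bullet> x t) (p t \<bullet> b t) t" if t: "t \<in> {0..T}" for t
 proof -
  have "vd T p (- (\<Sum>b\<in>Basis. (p t \<bullet> F1 t (b, 0)) *\<^sub>R b)) t" using p t by (auto simp: costate_def)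
  from bounded_bilinear.has_vector_derivative[OF bounded_bilinear_inner this dx[OF t]]
  show ?thesis by (simp add: adjoint_inner inner_add_right)
 qed
 from eq_integral_of_derivative[OF this, of T] T show ?thesis by simp
qed

text \<open>Uniqueness by duality: \<open>q\<close> itself is used as the source of the linearized
  equation with zero initial value, and the Lagrange identity makes the integral of q . q
  vanish.\<close>

lemma costate_zero_terminal:
 assumes q: "costate q" and qT: "q T = 0" and t: "t \<in> {0..T}" shows "q t = 0"
proof -
 have cq: "cont_on T q" by (rule costate_cont[OF q])
 have cont: "continuous_on ({0..T} \<times> UNIV) (\<lambda>(t, x). F1 t (x, 0) + q t)" unfolding case_prod_unfold
  by (intro continuous_intros blinfun.continuous_on continuous_on_compose2[OF F1_cont] continuous_on_compose2[OF cq]) auto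
 have lip: "norm ((F1 t (x, 0) + q t) - (F1 t (y, 0) + q t)) \<le> K * norm (x - y)" if "t \<in> {0..T}" for t x y
  using F1_bound[OF that, of "(x - y, 0)"] by (simp add: blinfun.diff_right[symmetric] norm_Pair)
 obtain x where "x 0 = 0" "\<And>t. t \<in> {0..T} \<Longrightarrow> vd T x (F1 t (x t, 0) + q t) t"
  using picard_lindelof[OF less_imp_le[OF T] cont lip, of 0] by blast
 with costate_integral[OF q this(2)] qT have "intg T (\<lambda>t. q t \<bullet> q t) = 0" by simp
 then have "\<forall>t\<in>{0..T}. q t \<bullet> q t = 0" by (subst (asm) integral_eq_0_iff[OF _ T]) (auto intro!: continuous_intros cq)
 then show ?thesis using t by simp
qed

text \<open>If \<open>p\<close> is a costate with terminal value D (0, .), this is D at the end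
  points of the linearized trajectory, with the final state eliminated through
  \<open>p\<close>.\<close>

definition first_variation :: "('a \<times> 'a) \<Rightarrow>\<^sub>L real \<Rightarrow> (real \<Rightarrow> 'a) \<Rightarrow> 'a \<times> (real \<Rightarrow>\<^sub>C 'c) \<Rightarrow> real" where
 "first_variation D p g = D (fst g, 0) + p 0 \<bullet> fst g + intg T (\<lambda>t. p t \<bullet> F1 t (0, snd g t))"

definition second_variation :: "('a \<times> 'a) \<Rightarrow>\<^sub>L ('a \<times> 'a) \<Rightarrow>\<^sub>L real \<Rightarrow> (real \<Rightarrow> 'a) \<Rightarrow>
  'a \<times> (real \<Rightarrow>\<^sub>C 'c) \<Rightarrow> 'a \<times> (real \<Rightarrow>\<^sub>C 'c) \<Rightarrow> real" where
 "second_variation D2 p g h = D2 (fst g, xlin g T) (fst h, xlin h T)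
   + intg T (\<lambda>t. p t \<bullet> F2 t (xlin g t, snd g t) (xlin h t, snd h t))"

lemma cont_first_integrand:
 "cont_on T p \<Longrightarrow> cont_on T (\<lambda>t. p t \<bullet> F1 t (0, apply_bcontfun c t))"
 by (intro continuous_intros cont_F1 continuous_on_apply_bcontfun)

lemma cont_second_integrand:
 "cont_on T p \<Longrightarrow>
  cont_on T (\<lambda>t. p t \<bullet> F2 t (xlin g t, apply_bcontfun c t) (xlin h t, apply_bcontfun c' t))"
 by (intro continuous_intros cont_F2 xlin_cont continuous_on_apply_bcontfun)

lemma integral_inner_bound:
 assumes "cont_on T p" "cont_on T b" "\<And>t. t \<in> {0..T} \<Longrightarrow> norm (p t) \<le> Pm"
  and "\<And>t. t \<in> {0..T} \<Longrightarrow> norm (b t) \<le> \<beta>" "0 \<le> Pm"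
 shows "\<bar>intg T (\<lambda>t. p t \<bullet> b t)\<bar> \<le> T * (Pm * \<beta>)"
proof -
 have "norm (intg T (\<lambda>t. p t \<bullet> b t)) \<le> intg T (\<lambda>t. Pm * \<beta>)"
 proof (rule integral_norm_bound_integral)
  fix t assume t: "t \<in> {0..T}"
  have "norm (p t \<bullet> b t) \<le> norm (p t) * norm (b t)" by (simp add: Cauchy_Schwarz_ineq2)
  also have "\<dots> \<le> Pm * \<beta>" using assms t by (intro mult_mono) auto
  finally show "norm (p t \<bullet> b t) \<le> Pm * \<beta>" .
 qed (intro integrable_continuous_real continuous_intros assms)+
 then show ?thesis using T by (simp add: mult_ac)
qed

lemma bounded_linear_first_variation:
 assumes p: "cont_on T p" shows "bounded_linear (first_variation D p)"
proof -
 obtain Pm where Pm: "0 \<le> Pm" "\<And>t. t \<in> {0..T} \<Longrightarrow> norm (p t) \<le> Pm"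
  using compact_imp_bounded[OF compact_continuous_image[OF p]] unfolding bounded_pos by (metis compact_Icc image_eqI less_imp_le)
 note i = integrable_continuous_real[OF cont_first_integrand[OF p]]
 show ?thesis
 proof (rule bounded_linear_intro)
  fix g h :: "'a \<times> (real \<Rightarrow>\<^sub>C 'c)" and r :: real
  have "F1 t (0, snd (g + h) t) = F1 t (0, snd g t) + F1 t (0, snd h t)" for t by (simp add: blinfun.add_right[symmetric])
  moreover have "D (fst (g + h), 0) = D (fst g, 0) + D (fst h, 0)" by (simp add: blinfun.add_right[symmetric])
  ultimately show "first_variation D p (g + h) = first_variation D p g + first_variation D p h"
   by (simp add: first_variation_def inner_add_right integral_add[OF i i])
  have "F1 t (0, snd (r *\<^sub>R g) t) = r *\<^sub>R F1 t (0, snd g t)" for t by (simp add: blinfun.scaleR_right[symmetric])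
  moreover have "D (fst (r *\<^sub>R g), 0) = r * D (fst g, 0)" using blinfun.scaleR_right[of D r "(fst g, 0)"] by simp
  ultimately show "first_variation D p (r *\<^sub>R g) = r *\<^sub>R first_variation D p g" by (simp add: first_variation_def distrib_left)
 next
  fix g :: "'a \<times> (real \<Rightarrow>\<^sub>C 'c)"
  have "\<bar>D (fst g, 0)\<bar> \<le> norm D * norm g"
   using norm_blinfun[of D "(fst g, 0)"] mult_left_mono[OF norm_fst_le_norm[of g] norm_ge_zero[of D]] by (simp add: norm_Pair)
  moreover have "\<bar>p 0 \<bullet> fst g\<bar> \<le> Pm * norm g"
   using T by (intro order_trans[OF Cauchy_Schwarz_ineq2] mult_mono Pm norm_fst_le_norm) auto
  moreover have "\<bar>intg T (\<lambda>t. p t \<bullet> F1 t (0, snd g t))\<bar> \<le> T * (Pm * (K * norm g))"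
  proof (rule integral_inner_bound[OF p _ Pm(2) _ Pm(1)])
   show "cont_on T (\<lambda>t. F1 t (0, snd g t))" by (intro cont_F1 continuous_intros continuous_on_apply_bcontfun)
   fix t assume t: "t \<in> {0..T}"
   have "norm (F1 t (0, snd g t)) \<le> K * norm (snd g t)" using F1_bound[OF t, of "(0, snd g t)"] by (simp add: norm_Pair)
   also have "\<dots> \<le> K * norm g" by (intro mult_left_mono K order_trans[OF norm_bounded norm_snd_le_norm])
   finally show "norm (F1 t (0, snd g t)) \<le> K * norm g" .
  qed
  ultimately show "norm (first_variation D p g) \<le> norm g * (norm D + Pm + T * (Pm * K))"
   unfolding first_variation_def by (simp add: algebra_simps abs_le_iff)
 qed
qed

lemma bounded_bilinear_second_variation:
 assumes p: "cont_on T p" shows "bounded_bilinear (second_variation D2 p)"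
proof -
 obtain Pm where Pm: "0 \<le> Pm" "\<And>t. t \<in> {0..T} \<Longrightarrow> norm (p t) \<le> Pm"
  using compact_imp_bounded[OF compact_continuous_image[OF p]] unfolding bounded_pos by (metis compact_Icc image_eqI less_imp_le)
 note i = integrable_continuous_real[OF cont_second_integrand[OF p]]
 have T': "T \<in> {0..T}" using T by simp
 have pair_add: "(xlin (g + h) t, snd (g + h) s) = (xlin g t, snd g s) + (xlin h t, snd h s)"
   "(fst (g + h), xlin (g + h) t) = (fst g, xlin g t) + (fst h, xlin h t)"
  and pair_scale: "(xlin (r *\<^sub>R g) t, snd (r *\<^sub>R g) s) = r *\<^sub>R (xlin g t, snd g s)"
   "(fst (r *\<^sub>R g), xlin (r *\<^sub>R g) t) = r *\<^sub>R (fst g, xlin g t)"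
  if "t \<in> {0..T}" for g h r t s using that by (simp_all add: xlin_add xlin_scale)
 have cong: "intg T f = intg T f'" if "\<And>t. t \<in> {0..T} \<Longrightarrow> f t = f' t" for f f' :: "real \<Rightarrow> real"
  by (rule integral_cong) (use that in auto)
 let ?j = "\<lambda>g h t. p t \<bullet> F2 t (xlin g t, snd g t) (xlin h t, snd h t)"
 let ?I = "\<lambda>g h. intg T (?j g h)"
 show ?thesis
 proof
  fix g g' h :: "'a \<times> (real \<Rightarrow>\<^sub>C 'c)" and r :: real
  have "?I (g + g') h = intg T (\<lambda>t. ?j g h t + ?j g' h t)"
   by (rule cong) (simp only: pair_add blinfun.add_right blinfun.add_left inner_add_right)
  then show "second_variation D2 p (g + g') h = second_variation D2 p g h + second_variation D2 p g' h"
   unfolding second_variation_def pair_add(2)[OF T'] blinfun.add_right blinfun.add_left by (simp only: integral_add[OF i i])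
  have "?I h (g + g') = intg T (\<lambda>t. ?j h g t + ?j h g' t)"
   by (rule cong) (simp only: pair_add blinfun.add_right blinfun.add_left inner_add_right)
  then show "second_variation D2 p h (g + g') = second_variation D2 p h g + second_variation D2 p h g'"
   unfolding second_variation_def pair_add(2)[OF T'] blinfun.add_right blinfun.add_left by (simp only: integral_add[OF i i])
  have "?I (r *\<^sub>R g) h = intg T (\<lambda>t. r * ?j g h t)"
   by (rule cong) (simp only: pair_scale blinfun.scaleR_right blinfun.scaleR_left inner_scaleR_right)
  then show "second_variation D2 p (r *\<^sub>R g) h = r *\<^sub>R second_variation D2 p g h"
   unfolding second_variation_def pair_scale(2)[OF T'] blinfun.scaleR_right blinfun.scaleR_left
   by (simp only: integral_mult_right real_scaleR_def distrib_left)
  have "?I h (r *\<^sub>R g) = intg T (\<lambda>t. r * ?j h g t)"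
   by (rule cong) (simp only: pair_scale blinfun.scaleR_right blinfun.scaleR_left inner_scaleR_right)
  then show "second_variation D2 p h (r *\<^sub>R g) = r *\<^sub>R second_variation D2 p h g"
   unfolding second_variation_def pair_scale(2)[OF T'] blinfun.scaleR_right blinfun.scaleR_left
   by (simp only: integral_mult_right real_scaleR_def distrib_left)
 next
  have D2b: "\<bar>D2 (fst g, xlin g T) (fst h, xlin h T)\<bar> \<le> norm D2 * (2 * gain * norm g) * (2 * gain * norm h)" for g h
  proof -
   have e: "norm (fst k, xlin k T) \<le> 2 * gain * norm k" for k
   proof -
    have "norm (fst k) \<le> gain * norm k" using norm_fst_le_norm[of k] mult_right_mono[OF gain_ge_1 norm_ge_zero[of k]] by linarith
    then show ?thesis using norm_Pair_le[of "fst k" "xlin k T"] xlin_bound[OF T', of k] by linarith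
   qed
   have "norm (D2 (fst g, xlin g T) (fst h, xlin h T)) \<le> norm D2 * norm (fst g, xlin g T) * norm (fst h, xlin h T)"
    by (intro order_trans[OF norm_blinfun] mult_right_mono norm_blinfun) auto
   also have "\<dots> \<le> norm D2 * (2 * gain * norm g) * (2 * gain * norm h)"
    using gain_ge_1 by (intro mult_mono e mult_nonneg_nonneg) auto
   finally show ?thesis by simp
  qed
  have Ib: "\<bar>?I g h\<bar>
    \<le> T * (Pm * (K * (2 * gain * norm g) * (2 * gain * norm h)))" for g h
  proof (rule integral_inner_bound[OF p _ Pm(2) _ Pm(1)])
   show "cont_on T (\<lambda>t. F2 t (xlin g t, snd g t) (xlin h t, snd h t))"
    by (intro cont_F2 continuous_intros xlin_cont continuous_on_apply_bcontfun)
   fix t assume t: "t \<in> {0..T}"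
   show "norm (F2 t (xlin g t, snd g t) (xlin h t, snd h t)) \<le> K * (2 * gain * norm g) * (2 * gain * norm h)" using K gain_ge_1
    by (intro order_trans[OF F2_bound[OF t]] mult_mono xlin_pair_bound[OF t] mult_nonneg_nonneg) auto
  qed
  show "\<exists>C. \<forall>g h. norm (second_variation D2 p g h) \<le> norm g * norm h * C"
  proof (intro exI allI)
   fix g h
   show "norm (second_variation D2 p g h) \<le> norm g * norm h *
     (norm D2 * (2 * gain) * (2 * gain) + T * (Pm * (K * (2 * gain) * (2 * gain))))"
    using D2b[of g h] Ib[of g h] unfolding second_variation_def by (simp add: algebra_simps abs_le_iff)
  qed
 qed
qed

lemma second_variation_sym:
 fixes D2 :: "('a \<times> 'a) \<Rightarrow>\<^sub>L ('a \<times> 'a) \<Rightarrow>\<^sub>L real"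
 assumes "\<And>u v. D2 u v = D2 v u" shows "second_variation D2 p g h = second_variation D2 p h g"
 unfolding second_variation_def by (subst assms, subst F2_sym) (rule refl)

text \<open>The costate removes the first-order effect of the dynamics; replacing the nonlinear by the
 linearized state in the quadratic terms costs only a third-order error.\<close>

theorem endpoint_expansion:
 fixes D :: "('a \<times> 'a) \<Rightarrow>\<^sub>L real" and D2 :: "('a \<times> 'a) \<Rightarrow>\<^sub>L ('a \<times> 'a) \<Rightarrow>\<^sub>L real"
 assumes p: "costate p" and pT: "\<And>a. p T \<bullet> a = D (0, a)"
  and \<phi>: "\<And>q. norm q \<le> 1 \<Longrightarrow> \<bar>\<phi> q - D q - D2 q q / 2\<bar> \<le> C0 * norm q ^ 3"
 obtains C where "\<And>g. norm g \<le> radius \<Longrightarrow>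
  \<bar>\<phi> (fst g, xnl g T) - first_variation D p g - second_variation D2 p g g / 2\<bar> \<le> C * norm g ^ 3"
proof -
 note cp = costate_cont[OF p]
 have T': "T \<in> {0..T}" using T by simp
 obtain Pm where Pm: "0 \<le> Pm" "\<And>t. t \<in> {0..T} \<Longrightarrow> norm (p t) \<le> Pm"
  using compact_imp_bounded[OF compact_continuous_image[OF cp]] unfolding bounded_pos by (metis compact_Icc image_eqI less_imp_le)
 define G where "G = 2 * gain"
 have G: "1 \<le> G" using gain_ge_1 by (simp add: G_def)
 define C1 where "C1 = \<bar>C0\<bar> * G ^ 3"
 define C2 where "C2 = norm D2 * (2 * G) * gain2"
 define C3 where "C3 = T * (Pm * (K * G ^ 3 + K * (2 * G) * gain2))"
 have "\<bar>\<phi> (fst g, xnl g T) - first_variation D p g - second_variation D2 p g g / 2\<bar> \<le> (C1 + C2 + C3) * norm g ^ 3"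
  if g: "norm g \<le> radius" for g
 proof -
  define q where "q = (fst g, xnl g T)"
  define ql where "ql = (fst g, xlin g T)"
  define w where "w t = (xnl g t, snd g t)" for t
  define wl where "wl t = (xlin g t, snd g t)" for t
  define b where "b t = F t (w t) - F1 t (xnl g t, 0)" for t
  \<comment> \<open>What is left of the dynamics after the linear terms and the quadratic term along
    the linearized trajectory; it is of third order in \<open>g\<close>.\<close>
  define r where "r t = b t - F1 t (0, snd g t) - (1/2) *\<^sub>R F2 t (wl t) (wl t)" for t
  have fstg: "norm (fst g) \<le> gain * norm g" using norm_fst_le_norm[of g] mult_right_mono[OF gain_ge_1 norm_ge_zero[of g]] by linarith
  have nq: "norm q \<le> G * norm g" using norm_Pair_le[of "fst g" "xnl g T"] xnl_bound[OF g T'] fstg unfolding q_def G_def by linarith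
  have nql: "norm ql \<le> G * norm g"
   using norm_Pair_le[of "fst g" "xlin g T"] xlin_bound[OF T', of g] fstg unfolding ql_def G_def by linarith
  have "norm (fst g) \<le> 1 / 2" using norm_fst_le_norm[of g] g radius(2) by linarith
  then have q1: "norm q \<le> 1" using norm_Pair_le[of "fst g" "xnl g T"] xnl_small(2)[OF g T'] unfolding q_def by linarith
  have qd: "norm (q - ql) \<le> gain2 * (norm g)\<^sup>2" using xnl_xlin_bound[OF g T'] by (simp add: q_def ql_def norm_Pair)
  have cb: "cont_on T b" unfolding b_def w_def by (intro continuous_intros cont_F cont_F1 xnl_cont g continuous_on_apply_bcontfun)
  have c2: "cont_on T (\<lambda>t. F2 t (wl t) (wl t))" unfolding wl_def
   by (intro cont_F2 continuous_intros xlin_cont continuous_on_apply_bcontfun)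
  have c1: "cont_on T (\<lambda>t. F1 t (0, snd g t))" by (intro cont_F1 continuous_intros continuous_on_apply_bcontfun)
  have cr: "cont_on T r" unfolding r_def by (intro continuous_intros cb c1 c2)
  have "p T \<bullet> xnl g T = p 0 \<bullet> xnl g 0 + intg T (\<lambda>t. p t \<bullet> b t)"
   by (rule costate_integral[OF p]) (use xnl_deriv[OF g] in \<open>simp add: b_def w_def\<close>)
  then have Dq: "D q = D (fst g, 0) + p 0 \<bullet> fst g + intg T (\<lambda>t. p t \<bullet> b t)"
   using blinfun.add_right[of D "(fst g, 0)" "(0, xnl g T)"] by (simp add: q_def pT xnl_0[OF g])
  have "intg T (\<lambda>t. p t \<bullet> b t)
    = intg T (\<lambda>t. p t \<bullet> F1 t (0, snd g t) + (p t \<bullet> F2 t (wl t) (wl t)) / 2 + p t \<bullet> r t)"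
   by (rule integral_cong) (simp add: r_def inner_diff_right)
  also have "\<dots> = intg T (\<lambda>t. p t \<bullet> F1 t (0, snd g t))
    + intg T (\<lambda>t. p t \<bullet> F2 t (wl t) (wl t)) / 2 + intg T (\<lambda>t. p t \<bullet> r t)"
   by (subst integral_add integral_divide | intro integrable_continuous_real continuous_intros cp c1 c2 cr | simp)+
  \<comment> \<open>Three separate errors: the Taylor remainder of \<phi>, the replacement of the
    end points by linearized ones in \<open>D2\<close>, and the remainder \<open>r\<close> of the
    dynamics weighted with \<open>p\<close>.\<close>
  finally have eq: "\<phi> q - first_variation D p g - second_variation D2 p g g / 2
    = (\<phi> q - D q - D2 q q / 2) + (D2 q q - D2 ql ql) / 2 + intg T (\<lambda>t. p t \<bullet> r t)"
   unfolding first_variation_def second_variation_def Dq ql_def[symmetric] wl_def[symmetric] by (simp add: field_simps)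
  have "\<bar>\<phi> q - D q - D2 q q / 2\<bar> \<le> C0 * norm q ^ 3" by (rule \<phi>[OF q1])
  also have "\<dots> \<le> \<bar>C0\<bar> * (G * norm g) ^ 3" by (intro mult_mono power_mono nq) auto
  finally have 1: "\<bar>\<phi> q - D q - D2 q q / 2\<bar> \<le> C1 * norm g ^ 3" by (simp add: C1_def power_mult_distrib mult_ac)
  have "\<bar>D2 q q - D2 ql ql\<bar> \<le> norm D2 * (norm q + norm ql) * norm (q - ql)" using norm_quadratic_diff[of D2 q ql] by simp
  also have "\<dots> \<le> norm D2 * (2 * (G * norm g)) * (gain2 * (norm g)\<^sup>2)"
   using nq nql G by (intro mult_mono qd mult_nonneg_nonneg) auto
  also have "\<dots> = C2 * norm g ^ 3" by (simp add: C2_def power2_eq_square power3_eq_cube mult_ac)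
  finally have 2: "\<bar>D2 q q - D2 ql ql\<bar> / 2 \<le> C2 * norm g ^ 3" by (rule order_trans[rotated]) simp
  have "\<bar>intg T (\<lambda>t. p t \<bullet> r t)\<bar> \<le> T * (Pm * ((K * G ^ 3 + K * (2 * G) * gain2) * norm g ^ 3))"
  proof (rule integral_inner_bound[OF cp cr Pm(2) _ Pm(1)])
   fix t assume t: "t \<in> {0..T}"
   have nw: "norm (w t) \<le> G * norm g" unfolding w_def G_def by (rule xnl_pair_bound[OF g t])
   have nwl: "norm (wl t) \<le> G * norm g" unfolding wl_def G_def by (rule xlin_pair_bound[OF t])
   have wd: "norm (w t - wl t) \<le> gain2 * (norm g)\<^sup>2" using xnl_xlin_bound[OF g t] by (simp add: w_def wl_def norm_Pair)
   have "r t = (F t (w t) - F1 t (w t) - (1/2) *\<^sub>R F2 t (w t) (w t))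
     + (1/2) *\<^sub>R (F2 t (w t) (w t) - F2 t (wl t) (wl t))"
    unfolding r_def b_def w_def using F1_Pair[of t "xnl g t" "snd g t"] by (simp add: algebra_simps)
   also have "norm \<dots> \<le> K * norm (w t) ^ 3 + norm (F2 t) * (norm (w t) + norm (wl t)) * norm (w t - wl t)"
   proof (rule order_trans[OF norm_triangle_ineq add_mono])
    show "norm (F t (w t) - F1 t (w t) - (1/2) *\<^sub>R F2 t (w t) (w t)) \<le> K * norm (w t) ^ 3"
     unfolding w_def by (rule F_taylor[OF t xnl_small(1)[OF g t]])
    have "norm ((1/2) *\<^sub>R (F2 t (w t) (w t) - F2 t (wl t) (wl t))) \<le> norm (F2 t (w t) (w t) - F2 t (wl t) (wl t))" by simp
    also note norm_quadratic_diff
    finally show "norm ((1/2) *\<^sub>R (F2 t (w t) (w t) - F2 t (wl t) (wl t)))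
     \<le> norm (F2 t) * (norm (w t) + norm (wl t)) * norm (w t - wl t)" .
   qed
   also have "\<dots> \<le> K * (G * norm g) ^ 3 + K * (2 * (G * norm g)) * (gain2 * (norm g)\<^sup>2)"
    using K G nw nwl F2_le[OF t] by (intro add_mono mult_mono power_mono wd mult_nonneg_nonneg) auto
   also have "\<dots> = (K * G ^ 3 + K * (2 * G) * gain2) * norm g ^ 3" by (simp add: power2_eq_square power3_eq_cube algebra_simps)
   finally show "norm (r t) \<le> (K * G ^ 3 + K * (2 * G) * gain2) * norm g ^ 3" .
  qed
  also have "\<dots> = C3 * norm g ^ 3" by (simp add: C3_def)
  finally have 3: "\<bar>intg T (\<lambda>t. p t \<bullet> r t)\<bar> \<le> C3 * norm g ^ 3" .
  show ?thesis
  proof -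
   have tri: "\<bar>a\<bar> \<le> x \<Longrightarrow> \<bar>b\<bar> / 2 \<le> y \<Longrightarrow> \<bar>c\<bar> \<le> z \<Longrightarrow> \<bar>a + b / 2 + c\<bar> \<le> x + y + z" for a b c x y z :: real
    by (simp add: abs_le_iff)
   show ?thesis unfolding q_def[symmetric] eq distrib_right by (rule tri[OF 1 2 3])
  qed
 qed
 then show ?thesis using that by blast
qed

lemma endpoint_continuous:
 fixes \<phi> :: "'a \<times> 'a \<Rightarrow> real"
 assumes "continuous_on UNIV \<phi>" shows "continuous_on (cball 0 radius) (\<lambda>g. \<phi> (fst g, xnl g T))"
proof -
 have "gain-lipschitz_on (cball 0 radius) (\<lambda>g. xnl g T)"
  using gain_ge_1 T by (intro lipschitz_onI) (auto simp: dist_norm intro!: xnl_lipschitz)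
 then have "continuous_on (cball 0 radius) (\<lambda>g. xnl g T)" by (rule lipschitz_on_continuous_on)
 then have "continuous_on (cball 0 radius) (\<lambda>g. (fst g, xnl g T))" by (intro continuous_intros)
 from continuous_on_compose2[OF assms this] show ?thesis by auto
qed

end

section \<open>Taylor expansions\<close>

text \<open>Both derivatives are packed into a pair so that \<open>D1\<close> and \<open>D2\<close>
  stem from one choice, which guarantees that \<open>D2 f\<close> differentiates
  \<open>D1 f\<close>.\<close>

definition has_lipschitz_second_deriv ::
  "('a::real_normed_vector \<Rightarrow> 'b::real_normed_vector) \<Rightarrow> ('a \<Rightarrow> 'a \<Rightarrow>\<^sub>L 'b) \<times> ('a \<Rightarrow> 'a \<Rightarrow>\<^sub>L 'a \<Rightarrow>\<^sub>L 'b) \<Rightarrow> bool" where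
 "has_lipschitz_second_deriv f = (\<lambda>(f', f''). (\<forall>x. (f has_derivative blinfun_apply (f' x)) (at x)) \<and>
   (\<forall>x. (f' has_derivative blinfun_apply (f'' x)) (at x)) \<and> (\<exists>L. L-lipschitz_on UNIV f''))"

definition D1 :: "('a::real_normed_vector \<Rightarrow> 'b::real_normed_vector) \<Rightarrow> 'a \<Rightarrow> 'a \<Rightarrow>\<^sub>L 'b" where
 "D1 f = fst (SOME d. has_lipschitz_second_deriv f d)"

definition D2 :: "('a::real_normed_vector \<Rightarrow> 'b::real_normed_vector) \<Rightarrow> 'a \<Rightarrow> 'a \<Rightarrow>\<^sub>L 'a \<Rightarrow>\<^sub>L 'b" where
 "D2 f = snd (SOME d. has_lipschitz_second_deriv f d)"

context
 fixes f :: "'a::real_normed_vector \<Rightarrow> 'b::real_normed_vector"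
 assumes f: "lipschitz_second_deriv f"
begin

lemma D1_D2_spec: "has_lipschitz_second_deriv f (D1 f, D2 f)"
proof -
 have "\<exists>d. has_lipschitz_second_deriv f d" using f unfolding lipschitz_second_deriv_def has_lipschitz_second_deriv_def by fast
 from someI_ex[OF this] show ?thesis by (simp add: D1_def D2_def)
qed

lemma has_derivative_D1: "(f has_derivative D1 f x) (at x)"
 and has_derivative_D2: "(D1 f has_derivative D2 f x) (at x)" using D1_D2_spec by (auto simp: has_lipschitz_second_deriv_def)

lemma D2_lipschitz: obtains L where "0 \<le> L" "\<And>x y. norm (D2 f x - D2 f y) \<le> L * norm (x - y)"
proof -
 obtain L where L: "L-lipschitz_on UNIV (D2 f)" using D1_D2_spec by (auto simp: has_lipschitz_second_deriv_def)
 show ?thesis by (rule that[of L]) (use lipschitz_on_nonneg[OF L] lipschitz_onD[OF L] in \<open>auto simp: dist_norm\<close>)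
qed

lemma continuous_D0: "continuous_on S f" by (rule has_derivative_continuous_on[OF has_derivative_at_withinI[OF has_derivative_D1]])

lemma continuous_D1: "continuous_on S (D1 f)" by (rule has_derivative_continuous_on[OF has_derivative_at_withinI[OF has_derivative_D2]])

lemma continuous_D2: "continuous_on S (D2 f)"
proof -
 obtain L where "0 \<le> L" "\<And>x y. norm (D2 f x - D2 f y) \<le> L * norm (x - y)" using D2_lipschitz by blast
 then have "L-lipschitz_on S (D2 f)" by (auto intro!: lipschitz_onI simp: dist_norm)
 then show ?thesis by (rule lipschitz_on_continuous_on)
qed

lemma D1_increment:
 assumes L: "\<And>x y. norm (D2 f x - D2 f y) \<le> L * norm (x - y)" "0 \<le> L" and r: "norm p \<le> r" "norm q \<le> r"
 shows "norm (D1 f (x + p) - D1 f (x + q) - D2 f x (p - q)) \<le> L * r * norm (p - q)"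
proof -
 have "norm ((D1 f (x + p) - D2 f x p) - (D1 f (x + q) - D2 f x q)) \<le> L * r * norm (p - q)"
 proof (rule differentiable_bound[of "cball 0 r" "\<lambda>k. D1 f (x + k) - D2 f x k" "\<lambda>k h. D2 f (x + k) h - D2 f x h"])
  fix k :: 'a assume k: "k \<in> cball 0 r"
  have "((\<lambda>k. D1 f (x + k)) has_derivative (\<lambda>h. D2 f (x + k) (0 + h))) (at k within cball 0 r)"
   by (rule has_derivative_compose[of "\<lambda>k. x + k" "\<lambda>h. 0 + h" k "cball 0 r" "D1 f"])
    (auto intro!: derivative_eq_intros has_derivative_D2)
  then show "((\<lambda>k. D1 f (x + k) - D2 f x k) has_derivative (\<lambda>h. D2 f (x + k) h - D2 f x h)) (at k within cball 0 r)"
   by (auto intro!: derivative_eq_intros)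
  have "(\<lambda>h. D2 f (x + k) h - D2 f x h) = (\<lambda>h. (D2 f (x + k) - D2 f x) h)" by (simp add: blinfun.diff_left)
  then have "onorm (\<lambda>h. D2 f (x + k) h - D2 f x h) = norm (D2 f (x + k) - D2 f x)" by (simp add: norm_blinfun.rep_eq)
  also have "\<dots> \<le> L * norm k" using L(1)[of "x + k" x] by simp
  also have "\<dots> \<le> L * r" using k L(2) by (intro mult_left_mono) auto
  finally show "onorm (\<lambda>h. D2 f (x + k) h - D2 f x h) \<le> L * r" .
 qed (use r in auto)
 then show ?thesis by (simp add: blinfun.diff_right algebra_simps)
qed

text \<open>Mean value inequality in the increment \<open>a\<close>; the derivative of the second
  difference minus its bilinear part is an increment of \<open>D1\<close>, controlled by
  \<open>D1_increment\<close> on the ball of radius \<open>norm a + norm b\<close>.\<close>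

lemma second_difference_bound:
 assumes L: "\<And>x y. norm (D2 f x - D2 f y) \<le> L * norm (x - y)" "0 \<le> L"
 shows "norm (f (x + b + a) - f (x + a) - f (x + b) + f x - D2 f x b a)
  \<le> L * (norm a + norm b) * norm b * norm a"
proof -
 have "norm ((f (x + b + a) - f (x + a) - D2 f x b a) - (f (x + b + 0) - f (x + 0) - D2 f x b 0))
   \<le> (L * (norm a + norm b) * norm b) * norm (a - 0)"
 proof (rule differentiable_bound[of "cball 0 (norm a)" "\<lambda>k. f (x + b + k) - f (x + k) - D2 f x b k"
    "\<lambda>k h. D1 f (x + b + k) h - D1 f (x + k) h - D2 f x b h"])
  fix k :: 'a assume k: "k \<in> cball 0 (norm a)"
  have "((\<lambda>k. f (y + k)) has_derivative (\<lambda>h. D1 f (y + k) (0 + h))) (at k within cball 0 (norm a))" for y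
   by (rule has_derivative_compose[of "\<lambda>k. y + k" "\<lambda>h. 0 + h" k _ f]) (auto intro!: derivative_eq_intros has_derivative_D1)
  from this[of "x + b"] this[of x]
  show "((\<lambda>k. f (x + b + k) - f (x + k) - D2 f x b k) has_derivative
    (\<lambda>h. D1 f (x + b + k) h - D1 f (x + k) h - D2 f x b h)) (at k within cball 0 (norm a))" by (auto intro!: derivative_eq_intros)
  have "(\<lambda>h. D1 f (x + b + k) h - D1 f (x + k) h - D2 f x b h)
    = (\<lambda>h. (D1 f (x + (b + k)) - D1 f (x + k) - D2 f x ((b + k) - k)) h)" by (simp add: blinfun.diff_left add.assoc)
  then have "onorm (\<lambda>h. D1 f (x + b + k) h - D1 f (x + k) h - D2 f x b h)
    = norm (D1 f (x + (b + k)) - D1 f (x + k) - D2 f x ((b + k) - k))" by (simp add: norm_blinfun.rep_eq)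
  also have "\<dots> \<le> L * (norm a + norm b) * norm ((b + k) - k)"
   using k norm_triangle_ineq[of b k] by (intro D1_increment L) (auto intro: order_trans)
  finally show "onorm (\<lambda>h. D1 f (x + b + k) h - D1 f (x + k) h - D2 f x b h) \<le> L * (norm a + norm b) * norm b" by simp
 qed auto
 then show ?thesis by (simp add: blinfun.zero_right algebra_simps)
qed

text \<open>The second difference is symmetric in the two increments. Scaled by \<open>s\<close>, it
  equals either mixed derivative times s^2 up to an error of order s^3, and \<open>s\<close> tends
  to 0.\<close>

lemma D2_sym: "D2 f x a b = D2 f x b a"
proof -
 obtain L where L: "0 \<le> L" "\<And>x y. norm (D2 f x - D2 f y) \<le> L * norm (x - y)" using D2_lipschitz by blast
 define C where "C = 2 * (L * (norm a + norm b) * norm b * norm a)"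
 have bound: "norm (D2 f x a b - D2 f x b a) \<le> s * C" if s: "0 < s" for s
 proof -
  let ?\<Delta> = "f (x + s *\<^sub>R b + s *\<^sub>R a) - f (x + s *\<^sub>R a) - f (x + s *\<^sub>R b) + f x"
  have 1: "norm (?\<Delta> - (s * s) *\<^sub>R D2 f x b a) \<le> (s * s) * (s * (C / 2))"
   using second_difference_bound[OF L(2,1), of x "s *\<^sub>R b" "s *\<^sub>R a"] s
   by (simp add: blinfun.bilinear_simps C_def algebra_simps)
  have "norm (f (x + s *\<^sub>R a + s *\<^sub>R b) - f (x + s *\<^sub>R b) - f (x + s *\<^sub>R a) + f x - (s * s) *\<^sub>R D2 f x a b)
    \<le> (s * s) * (s * (C / 2))" using second_difference_bound[OF L(2,1), of x "s *\<^sub>R a" "s *\<^sub>R b"] s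
   by (simp add: blinfun.bilinear_simps C_def algebra_simps)
  also have "f (x + s *\<^sub>R a + s *\<^sub>R b) - f (x + s *\<^sub>R b) - f (x + s *\<^sub>R a) + f x = ?\<Delta>"
   by (simp add: algebra_simps)
  finally have 2: "norm (?\<Delta> - (s * s) *\<^sub>R D2 f x a b) \<le> (s * s) * (s * (C / 2))" .
  have "(s * s) * norm (D2 f x a b - D2 f x b a)
    = norm ((?\<Delta> - (s * s) *\<^sub>R D2 f x b a) - (?\<Delta> - (s * s) *\<^sub>R D2 f x a b))"
   using s by (simp add: scaleR_diff_right[symmetric])
  also have "\<dots> \<le> (s * s) * (s * C)"
   using norm_triangle_ineq4[of "?\<Delta> - (s * s) *\<^sub>R D2 f x b a" "?\<Delta> - (s * s) *\<^sub>R D2 f x a b"] 1 2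
   by (simp add: algebra_simps)
  finally show ?thesis using s by simp
 qed
 have "norm (D2 f x a b - D2 f x b a) \<le> 0"
 proof (rule tendsto_lowerbound[of "\<lambda>s. s * C" 0 "at_right 0"])
  have "((\<lambda>s. s * C) \<longlongrightarrow> 0 * C) (at_right 0)" by (intro tendsto_intros)
  then show "((\<lambda>s. s * C) \<longlongrightarrow> 0) (at_right 0)" by simp
  show "\<forall>\<^sub>F s in at_right 0. norm (D2 f x a b - D2 f x b a) \<le> s * C" using bound by (auto simp: eventually_at_filter)
 qed simp
 then show ?thesis by simp
qed

text \<open>The derivative of the remainder in the increment is quadratically small by
  \<open>D1_increment\<close>; symmetry of \<open>D2\<close> is what gives the quadratic term the
  derivative \<open>D2 f x k\<close>.\<close>

lemma taylor_second_order:
 "\<exists>L\<ge>0. \<forall>x h. norm (f (x + h) - f x - D1 f x h - (1/2) *\<^sub>R D2 f x h h) \<le> L * norm h ^ 3"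
proof -
 obtain L where L: "0 \<le> L" "\<And>x y. norm (D2 f x - D2 f y) \<le> L * norm (x - y)" using D2_lipschitz by blast
 have "norm (f (x + h) - f x - D1 f x h - (1/2) *\<^sub>R D2 f x h h) \<le> L * norm h ^ 3" for x h
 proof -
  let ?R = "\<lambda>k. f (x + k) - D1 f x k - (1/2) *\<^sub>R D2 f x k k"
  have "norm (?R h - ?R 0) \<le> (L * norm h * norm h) * norm (h - 0)"
  proof (rule differentiable_bound[of "cball 0 (norm h)" ?R "\<lambda>k h. D1 f (x + k) h - D1 f x h - D2 f x k h"])
   fix k :: 'a assume k: "k \<in> cball 0 (norm h)"
   have "((\<lambda>k. f (x + k)) has_derivative (\<lambda>h. D1 f (x + k) (0 + h))) (at k within cball 0 (norm h))"
    by (rule has_derivative_compose[of "\<lambda>k. x + k" "\<lambda>h. 0 + h" k _ f]) (auto intro!: derivative_eq_intros has_derivative_D1)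
   moreover have "((\<lambda>k. D2 f x k k) has_derivative (\<lambda>h. D2 f x k h + D2 f x h k)) (at k within cball 0 (norm h))"
    by (rule blinfun.FDERIV) (auto intro!: derivative_eq_intros)
   ultimately have "(?R has_derivative (\<lambda>h. D1 f (x + k) (0 + h) - D1 f x h - (1/2) *\<^sub>R (D2 f x k h + D2 f x h k)))
     (at k within cball 0 (norm h))" by (auto intro!: derivative_eq_intros)
   moreover have "(1/2) *\<^sub>R (D2 f x k h + D2 f x h k) = D2 f x k h" for h using D2_sym[of x h k] by (simp add: scaleR_half_double)
   ultimately show "(?R has_derivative (\<lambda>h. D1 f (x + k) h - D1 f x h - D2 f x k h)) (at k within cball 0 (norm h))" by simp
   have "(\<lambda>h. D1 f (x + k) h - D1 f x h - D2 f x k h) = (\<lambda>h. (D1 f (x + k) - D1 f (x + 0) - D2 f x (k - 0)) h)"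
    by (simp add: blinfun.diff_left)
   then have "onorm (\<lambda>h. D1 f (x + k) h - D1 f x h - D2 f x k h) = norm (D1 f (x + k) - D1 f (x + 0) - D2 f x (k - 0))"
    by (simp add: norm_blinfun.rep_eq)
   also have "\<dots> \<le> L * norm h * norm (k - 0)" using k by (intro D1_increment L) auto
   also have "\<dots> \<le> L * norm h * norm h" using k L(1) by (intro mult_left_mono) auto
   finally show "onorm (\<lambda>h. D1 f (x + k) h - D1 f x h - D2 f x k h) \<le> L * norm h * norm h" .
  qed auto
  then show ?thesis by (simp add: blinfun.zero_right blinfun.zero_left power3_eq_cube algebra_simps)
 qed
 with L(1) show ?thesis by blast
qed

end

section \<open>The control-affine dynamics as one map of state and controls\<close>

type_synonym ('n, 'l, 'm) point = "(real^'n) \<times> (real^'l) \<times> (real^'m)"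

definition xu :: "('n::finite, 'l::finite, 'm::finite) point \<Rightarrow> (real^'n) \<times> (real^'l)" where
 "xu w = (fst w, fst (snd w))"

definition vv :: "('n::finite, 'l::finite, 'm::finite) point \<Rightarrow> real^'m" where
 "vv w = snd (snd w)"

lemma xu_lin [simp]: "xu (a + b) = xu a + xu b" "xu (r *\<^sub>R a) = r *\<^sub>R xu a" "xu 0 = 0" "xu (a - b) = xu a - xu b"
 and vv_lin [simp]: "vv (a + b) = vv a + vv b" "vv (r *\<^sub>R a) = r *\<^sub>R vv a" "vv 0 = 0" "vv (a - b) = vv a - vv b"
 and xu_vv_Pair [simp]: "xu (x, u, v) = (x, u)" "vv (x, u, v) = v" by (simp_all add: xu_def vv_def zero_prod_def)

lemma bounded_linear_xu: "bounded_linear xu" and bounded_linear_vv_nth: "bounded_linear (\<lambda>w. vv w $ i)"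
 by (auto simp: linear_conv_bounded_linear[symmetric] intro!: linearI)

lemma norm_xu_le: "norm (xu w) \<le> norm w" by (cases w) (auto simp: xu_def norm_Pair intro!: real_sqrt_le_mono)

lemma vv_nth_le: "\<bar>vv w $ i\<bar> \<le> norm w"
 unfolding vv_def using component_le_norm_cart[of "snd (snd w)" i] norm_snd_le_norm[of "snd w"] norm_snd_le_norm[of w] by linarith

definition dynw :: "('n::finite, 'l::finite, 'm::finite) ocp \<Rightarrow> ('n, 'l, 'm) point \<Rightarrow> real^'n" where
 "dynw P w = f0 P (xu w) + (\<Sum>i\<in>UNIV. vv w $ i *\<^sub>R fs P i (xu w))"

definition dyn1 :: "('n::finite, 'l::finite, 'm::finite) ocp \<Rightarrow> ('n, 'l, 'm) point \<Rightarrow>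
  ('n, 'l, 'm) point \<Rightarrow>\<^sub>L (real^'n)" where
 "dyn1 P w = Blinfun (\<lambda>h. D1 (f0 P) (xu w) (xu h) + (\<Sum>i\<in>UNIV. vv w $ i *\<^sub>R D1 (fs P i) (xu w) (xu h))
   + (\<Sum>i\<in>UNIV. vv h $ i *\<^sub>R fs P i (xu w)))"

text \<open>As the dynamics is affine in v, there is no v-v block, and the blocks that mix v with
  (x, u) contain only first derivatives of the \<open>fs P i\<close>.\<close>

definition dyn2 :: "('n::finite, 'l::finite, 'm::finite) ocp \<Rightarrow> ('n, 'l, 'm) point \<Rightarrow>
  ('n, 'l, 'm) point \<Rightarrow>\<^sub>L ('n, 'l, 'm) point \<Rightarrow>\<^sub>L (real^'n)" where
 "dyn2 P w = Blinfun (\<lambda>h. Blinfun (\<lambda>k. D2 (f0 P) (xu w) (xu h) (xu k)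
   + (\<Sum>i\<in>UNIV. vv w $ i *\<^sub>R D2 (fs P i) (xu w) (xu h) (xu k))
   + (\<Sum>i\<in>UNIV. vv h $ i *\<^sub>R D1 (fs P i) (xu w) (xu k))
   + (\<Sum>i\<in>UNIV. vv k $ i *\<^sub>R D1 (fs P i) (xu w) (xu h))))"

lemma dyn_eq_dynw: "dyn P x u v = dynw P (x, u, v)" by (simp add: dyn_def dynw_def)

lemma dyn1_apply: "dyn1 P w h = D1 (f0 P) (xu w) (xu h) + (\<Sum>i\<in>UNIV. vv w $ i *\<^sub>R D1 (fs P i) (xu w) (xu h))
   + (\<Sum>i\<in>UNIV. vv h $ i *\<^sub>R fs P i (xu w))" unfolding dyn1_def
 by (rule fun_cong[OF bounded_linear_Blinfun_apply], unfold linear_conv_bounded_linear[symmetric], rule linearI)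
  (simp_all add: blinfun.bilinear_simps algebra_simps sum.distrib scaleR_sum_right)

lemma dyn2_apply: "dyn2 P w h k = D2 (f0 P) (xu w) (xu h) (xu k)
   + (\<Sum>i\<in>UNIV. vv w $ i *\<^sub>R D2 (fs P i) (xu w) (xu h) (xu k))
   + (\<Sum>i\<in>UNIV. vv h $ i *\<^sub>R D1 (fs P i) (xu w) (xu k))
   + (\<Sum>i\<in>UNIV. vv k $ i *\<^sub>R D1 (fs P i) (xu w) (xu h))"
proof -
 define q where "q h k = D2 (f0 P) (xu w) (xu h) (xu k)
   + (\<Sum>i\<in>UNIV. vv w $ i *\<^sub>R D2 (fs P i) (xu w) (xu h) (xu k))
   + (\<Sum>i\<in>UNIV. vv h $ i *\<^sub>R D1 (fs P i) (xu w) (xu k))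
   + (\<Sum>i\<in>UNIV. vv k $ i *\<^sub>R D1 (fs P i) (xu w) (xu h))" for h k
 have lin: "bounded_linear (q h)" for h unfolding q_def linear_conv_bounded_linear[symmetric]
  by (rule linearI) (simp_all add: blinfun.bilinear_simps algebra_simps sum.distrib scaleR_sum_right)
 have lin': "bounded_linear (\<lambda>h. Blinfun (q h))"
 proof (subst linear_conv_bounded_linear[symmetric], rule linearI)
  show "Blinfun (q (h + h')) = Blinfun (q h) + Blinfun (q h')" for h h' by (rule blinfun_eqI)
    (simp add: bounded_linear_Blinfun_apply[OF lin] blinfun.bilinear_simps,
     simp add: q_def blinfun.bilinear_simps algebra_simps sum.distrib)
  show "Blinfun (q (r *\<^sub>R h)) = r *\<^sub>R Blinfun (q h)" for r h by (rule blinfun_eqI)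
    (simp add: bounded_linear_Blinfun_apply[OF lin] blinfun.bilinear_simps,
     simp add: q_def blinfun.bilinear_simps algebra_simps sum.distrib scaleR_sum_right)
 qed
 have "dyn2 P w = Blinfun (\<lambda>h. Blinfun (q h))" by (simp add: dyn2_def q_def[abs_def])
 then have "dyn2 P w h k = q h k" by (simp add: bounded_linear_Blinfun_apply[OF lin'] bounded_linear_Blinfun_apply[OF lin])
 then show ?thesis by (simp add: q_def)
qed

context
 fixes P :: "('n::finite, 'l::finite, 'm::finite) ocp"
 assumes data: "ocp_data P"
begin

lemma f0_smooth: "lipschitz_second_deriv (f0 P)" and fs_smooth: "lipschitz_second_deriv (fs P i)" using data by (auto simp: ocp_data_def)

lemma dyn2_sym: "dyn2 P w h k = dyn2 P w k h"
 by (simp add: dyn2_apply D2_sym[OF f0_smooth, of _ "xu h" "xu k"] D2_sym[OF fs_smooth, of _ _ "xu h" "xu k"])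

lemma has_derivative_comp_xu:
 assumes "\<And>q. (f has_derivative f' q) (at q)" shows "((\<lambda>w. f (xu w)) has_derivative (\<lambda>h. f' (xu w) (xu h))) (at w)"
 by (rule has_derivative_compose[OF bounded_linear_imp_has_derivative[OF bounded_linear_xu] assms])

lemma has_derivative_dynw: "(dynw P has_derivative dyn1 P w) (at w)" unfolding dynw_def[abs_def] dyn1_apply[abs_def]
 by (auto intro!: derivative_eq_intros has_derivative_comp_xu has_derivative_D1[OF f0_smooth]
   has_derivative_D1[OF fs_smooth] bounded_linear_imp_has_derivative[OF bounded_linear_vv_nth]
   simp: sum.distrib add_ac)

lemma has_derivative_dyn1: "((\<lambda>w. dyn1 P w k) has_derivative (\<lambda>h. dyn2 P w h k)) (at w)"
proof -
 have d: "((\<lambda>w. D1 f (xu w)) has_derivative (\<lambda>h. D2 f (xu w) (xu h))) (at w)"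
  if "lipschitz_second_deriv f" for f :: "(real^'n) \<times> (real^'l) \<Rightarrow> real^'n"
  by (rule has_derivative_comp_xu[OF has_derivative_D2[OF that]])
 show ?thesis unfolding dyn1_apply dyn2_apply by (auto intro!: derivative_eq_intros has_derivative_comp_xu d f0_smooth fs_smooth
    has_derivative_D1[OF fs_smooth] bounded_linear_imp_has_derivative[OF bounded_linear_vv_nth]
    simp: sum.distrib add_ac)
qed

lemma cont_comp_xu: "continuous_on UNIV f \<Longrightarrow> continuous_on S (\<lambda>w. f (xu w))"
 by (rule continuous_on_compose2[of UNIV f]) (auto intro!: linear_continuous_on bounded_linear_xu)

lemma cont_dyn1: "continuous_on S (dyn1 P)" by (rule continuous_on_blinfun_componentwise, unfold dyn1_apply)
  (intro continuous_intros cont_comp_xu continuous_D1 continuous_D0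
   f0_smooth fs_smooth linear_continuous_on bounded_linear_vv_nth)

lemma cont_dyn2: "continuous_on S (dyn2 P)" by (intro continuous_on_blinfun_componentwise, unfold dyn2_apply)
  (intro continuous_intros cont_comp_xu continuous_D1 continuous_D2
   f0_smooth fs_smooth linear_continuous_on bounded_linear_vv_nth)

lemma cont_dynw: "continuous_on S (dynw P)" by (rule has_derivative_continuous_on[OF has_derivative_at_withinI[OF has_derivative_dynw]])

lemma bounded_on_cball:
 fixes f :: "('n, 'l, 'm) point \<Rightarrow> 'b::real_normed_vector"
 assumes "continuous_on UNIV f" shows "\<exists>M\<ge>0. \<forall>w. norm w \<le> R \<longrightarrow> norm (f w) \<le> M"
proof -
 have "compact (f ` cball 0 R)" by (rule compact_continuous_image[OF continuous_on_subset[OF assms]]) auto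
 then obtain M where "M > 0" "\<forall>y\<in>f ` cball 0 R. norm y \<le> M" using compact_imp_bounded bounded_pos by metis
 then show ?thesis by (intro exI[of _ M]) auto
qed

lemma dynw_lipschitz:
 "\<exists>M\<ge>0. \<forall>w w'. norm w \<le> R \<longrightarrow> norm w' \<le> R \<longrightarrow> norm (dynw P w - dynw P w') \<le> M * norm (w - w')"
proof -
 obtain M where M: "0 \<le> M" "\<And>w. norm w \<le> R \<Longrightarrow> norm (dyn1 P w) \<le> M"
  using bounded_on_cball[OF cont_dyn1[of UNIV], of R] by blast
 have "norm (dynw P w - dynw P w') \<le> M * norm (w - w')" if "norm w \<le> R" "norm w' \<le> R" for w w'
 proof (rule differentiable_bound[of "cball 0 R"])
  show "(dynw P has_derivative dyn1 P x) (at x within cball 0 R)" for x by (rule has_derivative_at_withinI[OF has_derivative_dynw])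
  show "onorm (dyn1 P x) \<le> M" if "x \<in> cball 0 R" for x using M(2)[of x] that by (simp add: norm_blinfun.rep_eq)
 qed (use that in auto)
 with M(1) show ?thesis by blast
qed

text \<open>A quadratic remainder is the right order here, because it gets multiplied by the
  v-component of the increment, which supplies the third factor.\<close>

lemma fs_second_order:
 "\<exists>M\<ge>0. \<forall>(w :: ('n, 'l, 'm) point) (h :: ('n, 'l, 'm) point). norm w \<le> R \<longrightarrow> norm h \<le> 1 \<longrightarrow>
  norm (fs P i (xu w + xu h) - fs P i (xu w) - D1 (fs P i) (xu w) (xu h)) \<le> M * (norm h)\<^sup>2"
proof -
 let ?f = "fs P i"
 obtain L where L: "0 \<le> L" "\<And>x h. norm (?f (x + h) - ?f x - D1 ?f x h - (1/2) *\<^sub>R D2 ?f x h h) \<le> L * norm h ^ 3"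
  using taylor_second_order[OF fs_smooth[of i]] by blast
 have "continuous_on UNIV (\<lambda>w :: ('n, 'l, 'm) point. D2 ?f (xu w))" by (rule cont_comp_xu[OF continuous_D2[OF fs_smooth]])
 from bounded_on_cball[OF this, of R]
 obtain M where "0 \<le> M \<and> (\<forall>w :: ('n, 'l, 'm) point. norm w \<le> R \<longrightarrow> norm (D2 ?f (xu w)) \<le> M)" ..
 then have M: "0 \<le> M" "\<And>w :: ('n, 'l, 'm) point. norm w \<le> R \<Longrightarrow> norm (D2 ?f (xu w)) \<le> M" by blast+
 have "norm (?f (xu w + xu h) - ?f (xu w) - D1 ?f (xu w) (xu h)) \<le> (L + M) * (norm h)\<^sup>2"
  if w: "norm w \<le> R" and h: "norm h \<le> 1" for w h :: "('n, 'l, 'm) point"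
 proof -
  let ?k = "xu h"
  have k: "norm ?k \<le> norm h" by (rule norm_xu_le)
  have "?f (xu w + ?k) - ?f (xu w) - D1 ?f (xu w) ?k
    = (?f (xu w + ?k) - ?f (xu w) - D1 ?f (xu w) ?k - (1/2) *\<^sub>R D2 ?f (xu w) ?k ?k) + (1/2) *\<^sub>R D2 ?f (xu w) ?k ?k" by simp
  also have "norm \<dots> \<le> L * norm ?k ^ 3 + M * norm ?k * norm ?k"
  proof (rule order_trans[OF norm_triangle_ineq add_mono[OF L(2)]])
   have "norm ((1/2) *\<^sub>R D2 ?f (xu w) ?k ?k) \<le> norm (D2 ?f (xu w) ?k ?k)" by simp
   also have "\<dots> \<le> norm (D2 ?f (xu w)) * norm ?k * norm ?k"
    by (intro order_trans[OF norm_blinfun] mult_right_mono norm_blinfun) auto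
   also have "\<dots> \<le> M * norm ?k * norm ?k" by (intro mult_right_mono M w) auto
   finally show "norm ((1/2) *\<^sub>R D2 ?f (xu w) ?k ?k) \<le> M * norm ?k * norm ?k" .
  qed
  also have "\<dots> \<le> L * (norm h)\<^sup>2 + M * norm h * norm h"
  proof (intro add_mono mult_mono mult_left_mono)
   have "norm ?k ^ 3 \<le> norm h ^ 3" by (intro power_mono k) auto
   also have "\<dots> \<le> (norm h)\<^sup>2" using h by (intro power_decreasing) auto
   finally show "norm ?k ^ 3 \<le> (norm h)\<^sup>2" .
  qed (use L(1) M(1) k in auto)
  finally show ?thesis by (simp add: power2_eq_square algebra_simps)
 qed
 moreover have "0 \<le> L + M" using L(1) M(1) by simp
 ultimately show ?thesis by (intro exI[of _ "L + M"] conjI allI impI)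
qed

text \<open>The cubic remainder consists of that of \<open>f0\<close>, those of the
  \<open>fs P i\<close> weighted by the bounded components of v, and the increments of v times the
  quadratic remainders of the \<open>fs P i\<close>.\<close>

lemma dynw_taylor:
 "\<exists>M\<ge>0. \<forall>w h. norm w \<le> R \<longrightarrow> norm h \<le> 1 \<longrightarrow>
  norm (dynw P (w + h) - dynw P w - dyn1 P w h - (1/2) *\<^sub>R dyn2 P w h h) \<le> M * norm h ^ 3"
proof -
 obtain L0 where L0: "0 \<le> L0"
   "\<And>x h. norm (f0 P (x + h) - f0 P x - D1 (f0 P) x h - (1/2) *\<^sub>R D2 (f0 P) x h h) \<le> L0 * norm h ^ 3"
  using taylor_second_order[OF f0_smooth] by blast
 have "\<forall>i. \<exists>L\<ge>0. \<forall>x h. norm (fs P i (x + h) - fs P i x - D1 (fs P i) x h - (1/2) *\<^sub>R D2 (fs P i) x h h) \<le> L * norm h ^ 3"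
  using taylor_second_order[OF fs_smooth] by blast
 from choice[OF this] obtain L where L: "\<And>i. 0 \<le> L i"
   "\<And>i x h. norm (fs P i (x + h) - fs P i x - D1 (fs P i) x h - (1/2) *\<^sub>R D2 (fs P i) x h h) \<le> L i * norm h ^ 3" by blast
 have "\<forall>i. \<exists>M\<ge>0. \<forall>(w :: ('n, 'l, 'm) point) (h :: ('n, 'l, 'm) point). norm w \<le> R \<longrightarrow> norm h \<le> 1 \<longrightarrow>
  norm (fs P i (xu w + xu h) - fs P i (xu w) - D1 (fs P i) (xu w) (xu h)) \<le> M * (norm h)\<^sup>2" using fs_second_order[of R] by blast
 from choice[OF this] obtain M where M: "\<And>i. 0 \<le> M i" "\<And>i (w :: ('n, 'l, 'm) point) h :: ('n, 'l, 'm) point. norm w \<le> R \<Longrightarrow> norm h \<le> 1 \<Longrightarrow>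
  norm (fs P i (xu w + xu h) - fs P i (xu w) - D1 (fs P i) (xu w) (xu h)) \<le> M i * (norm h)\<^sup>2" by blast
 define C where "C = L0 + (\<Sum>i\<in>UNIV. \<bar>R\<bar> * L i) + (\<Sum>i\<in>UNIV. M i)"
 have "norm (dynw P (w + h) - dynw P w - dyn1 P w h - (1/2) *\<^sub>R dyn2 P w h h) \<le> C * norm h ^ 3"
  if w: "norm w \<le> R" and h: "norm h \<le> 1" for w h
 proof -
  let ?q = "xu w" and ?k = "xu h"
  have k3: "norm ?k ^ 3 \<le> norm h ^ 3" by (intro power_mono norm_xu_le) auto
  define r0 where "r0 = f0 P (?q + ?k) - f0 P ?q - D1 (f0 P) ?q ?k - (1/2) *\<^sub>R D2 (f0 P) ?q ?k ?k"
  define r where "r i = fs P i (?q + ?k) - fs P i ?q - D1 (fs P i) ?q ?k - (1/2) *\<^sub>R D2 (fs P i) ?q ?k ?k" for i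
  define s where "s i = fs P i (?q + ?k) - fs P i ?q - D1 (fs P i) ?q ?k" for i
  have "(1/2) *\<^sub>R (\<Sum>i\<in>UNIV. vv w $ i *\<^sub>R D2 (fs P i) ?q ?k ?k) = (\<Sum>i\<in>UNIV. vv w $ i *\<^sub>R ((1/2) *\<^sub>R D2 (fs P i) ?q ?k ?k))"
   by (simp add: scaleR_sum_right mult.commute)
  moreover have "(1/2) *\<^sub>R (A + X + S + S) = (1/2) *\<^sub>R A + (1/2) *\<^sub>R X + S" for A X S :: "real^'n"
   by (simp add: scaleR_add_right add.assoc scaleR_left_distrib[symmetric])
  ultimately have "(1/2) *\<^sub>R dyn2 P w h h = (1/2) *\<^sub>R D2 (f0 P) ?q ?k ?k + (\<Sum>i\<in>UNIV. vv w $ i *\<^sub>R ((1/2) *\<^sub>R D2 (fs P i) ?q ?k ?k))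
    + (\<Sum>i\<in>UNIV. vv h $ i *\<^sub>R D1 (fs P i) ?q ?k)" unfolding dyn2_apply by metis
  then have "dynw P (w + h) - dynw P w - dyn1 P w h - (1/2) *\<^sub>R dyn2 P w h h
    = r0 + (\<Sum>i\<in>UNIV. vv w $ i *\<^sub>R r i) + (\<Sum>i\<in>UNIV. vv h $ i *\<^sub>R s i)"
   by (simp add: dynw_def dyn1_apply r0_def r_def s_def scaleR_diff_right scaleR_add_left sum.distrib sum_subtractf)
  also have "norm \<dots> \<le> L0 * norm h ^ 3 + (\<Sum>i\<in>UNIV. (\<bar>R\<bar> * L i) * norm h ^ 3) + (\<Sum>i\<in>UNIV. M i * norm h ^ 3)"
  proof (intro order_trans[OF norm_triangle_ineq add_mono] order_trans[OF norm_sum sum_mono])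
   show "norm r0 \<le> L0 * norm h ^ 3" unfolding r0_def by (rule order_trans[OF L0(2) mult_left_mono[OF k3 L0(1)]])
   fix i
   have "norm (r i) \<le> L i * norm h ^ 3" unfolding r_def by (rule order_trans[OF L(2) mult_left_mono[OF k3 L(1)]])
   moreover have "\<bar>vv w $ i\<bar> \<le> \<bar>R\<bar>" using vv_nth_le[of w i] w by linarith
   ultimately have "\<bar>vv w $ i\<bar> * norm (r i) \<le> \<bar>R\<bar> * (L i * norm h ^ 3)" by (intro mult_mono) auto
   then show "norm (vv w $ i *\<^sub>R r i) \<le> (\<bar>R\<bar> * L i) * norm h ^ 3" by (simp add: mult.assoc)
   have "norm (s i) \<le> M i * (norm h)\<^sup>2" unfolding s_def by (rule M(2)[OF w h])
   then have "\<bar>vv h $ i\<bar> * norm (s i) \<le> norm h * (M i * (norm h)\<^sup>2)" by (intro mult_mono vv_nth_le) auto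
   then show "norm (vv h $ i *\<^sub>R s i) \<le> M i * norm h ^ 3" by (simp add: power2_eq_square power3_eq_cube mult_ac)
  qed
  also have "\<dots> = C * norm h ^ 3" by (simp add: C_def distrib_right sum_distrib_right)
  finally show ?thesis .
 qed
 moreover have "0 \<le> C" unfolding C_def using L0(1) L(1) M(1) by (intro add_nonneg_nonneg sum_nonneg) auto
 ultimately show ?thesis by (intro exI[of _ C] conjI allI impI)
qed

lemma control_system_along:
 assumes w: "cont_on T w" and T: "0 < T"
 shows "\<exists>K. control_system T K (\<lambda>t h. dynw P (w t + h) - dynw P (w t)) (\<lambda>t. dyn1 P (w t)) (\<lambda>t. dyn2 P (w t))"
proof -
 obtain R where R: "\<And>t. t \<in> {0..T} \<Longrightarrow> norm (w t) \<le> R"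
  using compact_imp_bounded[OF compact_continuous_image[OF w]] unfolding bounded_iff by blast
 obtain M1 where M1: "0 \<le> M1" "\<And>v. norm v \<le> R \<Longrightarrow> norm (dyn1 P v) \<le> M1"
  using bounded_on_cball[OF cont_dyn1[of UNIV], of R] by blast
 obtain M2 where M2: "0 \<le> M2" "\<And>v. norm v \<le> R \<Longrightarrow> norm (dyn2 P v) \<le> M2"
  using bounded_on_cball[OF cont_dyn2[of UNIV], of R] by blast
 obtain M3 where M3: "0 \<le> M3" "\<And>v h. norm v \<le> R \<Longrightarrow> norm h \<le> 1 \<Longrightarrow>
   norm (dynw P (v + h) - dynw P v - dyn1 P v h - (1/2) *\<^sub>R dyn2 P v h h) \<le> M3 * norm h ^ 3" using dynw_taylor[of R] by blast
 \<comment> \<open>Radius \<open>R + 1\<close>, since a deviation of norm at most 1 is added to the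
   reference point.\<close>
 obtain M4 where M4: "0 \<le> M4" "\<And>v v'. norm v \<le> R + 1 \<Longrightarrow> norm v' \<le> R + 1 \<Longrightarrow>
   norm (dynw P v - dynw P v') \<le> M4 * norm (v - v')" using dynw_lipschitz[of "R + 1"] by blast
 define K where "K = M1 + M2 + M3 + M4"
 have K: "0 \<le> K" "M1 \<le> K" "M2 \<le> K" "M3 \<le> K" "M4 \<le> K" using M1(1) M2(1) M3(1) M4(1) by (auto simp: K_def)
 have R1: "norm (w t + h) \<le> R + 1" if "t \<in> {0..T}" "norm h \<le> 1" for t h
  using norm_triangle_ineq[of "w t" h] R[OF that(1)] that(2) by linarith
 show ?thesis
 proof (intro exI[of _ K] control_system.intro T K(1))
  show "cont_on T (\<lambda>t. dyn1 P (w t))" "cont_on T (\<lambda>t. dyn2 P (w t))"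
   by (rule continuous_on_compose2[OF cont_dyn1[of UNIV] w] continuous_on_compose2[OF cont_dyn2[of UNIV] w]; simp)+
  have "continuous_on ({0..T} \<times> UNIV) (\<lambda>z. w (fst z))"
   by (rule continuous_on_compose2[OF w]) (auto intro!: continuous_intros)
  then show "continuous_on ({0..T} \<times> UNIV) (\<lambda>(t, h). dynw P (w t + h) - dynw P (w t))" unfolding case_prod_unfold
   by (intro continuous_intros continuous_on_compose2[OF cont_dynw[of UNIV]]) auto
  show "norm (dyn1 P (w t)) \<le> K" "norm (dyn2 P (w t)) \<le> K" if "t \<in> {0..T}" for t
   using M1(2)[OF R[OF that]] M2(2)[OF R[OF that]] K by linarith+
  show "norm (dynw P (w t + h) - dynw P (w t) - (dynw P (w t + h') - dynw P (w t))) \<le> K * norm (h - h')"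
   if t: "t \<in> {0..T}" and h: "norm h \<le> 1" "norm h' \<le> 1" for t h h'
   using order_trans[OF M4(2)[OF R1[OF t h(1)] R1[OF t h(2)]] mult_right_mono[OF K(5) norm_ge_zero]] by simp
  show "norm (dynw P (w t + h) - dynw P (w t) - dyn1 P (w t) h - (1/2) *\<^sub>R dyn2 P (w t) h h) \<le> K * norm h ^ 3"
   if t: "t \<in> {0..T}" and h: "norm h \<le> 1" for t h by (rule order_trans[OF M3(2)[OF R[OF t] h] mult_right_mono[OF K(4)]]) simp
  show "dyn2 P (w t) h k = dyn2 P (w t) k h" for t h k by (rule dyn2_sym)
 qed
qed

end

section \<open>The Lebesgue notions of the problem for continuous functions, Jacobians and
  gradients\<close>

lemma lebesgue_integral_continuous:
 fixes f :: "real \<Rightarrow> 'b::euclidean_space"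
 assumes "continuous_on {a..b} f" shows "integral\<^sup>L (lebesgue_on {a..b}) f = integral {a..b} f"
 by (rule lebesgue_integral_eq_integral) (auto intro: continuous_imp_integrable_real assms)

lemma has_wderivD:
 assumes "has_wderiv T x g" shows "integrable (leb T) g" using assms by (simp add: has_wderiv_def)

lemma has_wderiv_integrable:
 assumes "has_wderiv T x g" "t \<in> {0..T}" shows "integrable (leb t) g"
 by (rule integrable_subinterval[OF has_wderivD[OF assms(1)]]) (use assms(2) in auto)

lemma has_wderiv_eq:
 assumes "has_wderiv T x g" "t \<in> {0..T}" shows "x t = x 0 + intg t g"
proof -
 have "x t = x 0 + integral\<^sup>L (leb t) g" using assms unfolding has_wderiv_def by blast
 also have "integral\<^sup>L (leb t) g = intg t g" by (rule lebesgue_integral_eq_integral[OF has_wderiv_integrable[OF assms]]) simp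
 finally show ?thesis .
qed

lemma has_wderiv_continuous:
 fixes x :: "real \<Rightarrow> 'a::euclidean_space"
 assumes "has_wderiv T x g" shows "cont_on T x"
proof (rule continuous_on_eq)
 show "cont_on T (\<lambda>t. x 0 + intg t g)"
  by (intro continuous_intros indefinite_integral_continuous_1 integrable_on_lebesgue_on has_wderivD[OF assms]) simp
 show "x 0 + intg t g = x t" if "t \<in> {0..T}" for t by (rule has_wderiv_eq[OF assms that, symmetric])
qed

lemma has_wderiv_of_derivative:
 fixes x :: "real \<Rightarrow> 'a::euclidean_space"
 assumes "\<And>t. t \<in> {0..T} \<Longrightarrow> vd T x (g t) t"
  and "cont_on T g" shows "has_wderiv T x g" unfolding has_wderiv_def
proof (intro conjI ballI)
 show "integrable (leb T) g" by (rule continuous_imp_integrable_real[OF assms(2)])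
 fix t assume t: "t \<in> {0..T}"
 have "cont_on t g" by (rule continuous_on_subset[OF assms(2)]) (use t in auto)
 then show "x t = x 0 + integral\<^sup>L (leb t) g"
  using eq_integral_of_derivative[OF assms(1) t] by (simp add: lebesgue_integral_continuous)
qed

lemma has_wderiv_imp_derivative:
 fixes x :: "real \<Rightarrow> 'a::euclidean_space"
 assumes "has_wderiv T x g" "cont_on T g" and t: "t \<in> {0..T}" shows "vd T x (g t) t"
proof -
 have "vd T (\<lambda>t. x 0 + intg t g) (0 + g t) t"
  by (intro has_vector_derivative_add has_vector_derivative_const integral_has_vector_derivative[OF assms(2) t])
 then have "vd T (\<lambda>t. x 0 + intg t g) (g t) t" by simp
 then show ?thesis by (rule has_vector_derivative_transform[OF t has_wderiv_eq[OF assms(1)], rotated -1])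
qed

lemma continuous_measurable:
 fixes u :: "real \<Rightarrow> 'b::euclidean_space"
 assumes "cont_on T u" shows "u \<in> borel_measurable (leb T)" by (rule continuous_imp_measurable_on_sets_lebesgue[OF assms]) simp

lemma Linf_norm_le:
 fixes u :: "real \<Rightarrow> 'b::euclidean_space"
 assumes "cont_on T u" "\<And>t. t \<in> {0..T} \<Longrightarrow> norm (u t) \<le> M" shows "Linf_norm T u \<le> ereal M"
 unfolding Linf_norm_def by (rule esssup_I) (use assms(2) continuous_measurable[OF assms(1)] in auto)

lemma continuous_imp_Linf:
 fixes u :: "real \<Rightarrow> 'b::euclidean_space"
 assumes "cont_on T u" shows "u \<in> Linf T"
proof -
 obtain M where "\<And>t. t \<in> {0..T} \<Longrightarrow> norm (u t) \<le> M"
  using compact_imp_bounded[OF compact_continuous_image[OF assms]] unfolding bounded_iff by blast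
 then have "Linf_norm T u \<le> ereal M" by (rule Linf_norm_le[OF assms])
 then show ?thesis using continuous_measurable[OF assms] by (auto simp: Linf_def)
qed

lemma continuous_imp_L2:
 fixes u :: "real \<Rightarrow> 'b::euclidean_space"
 assumes "cont_on T u" shows "u \<in> L2 T" unfolding L2_def
 using continuous_measurable[OF assms] by (auto intro!: continuous_imp_integrable_real continuous_intros assms)

lemma jacobian_apply:
 fixes f :: "real^'a::finite \<Rightarrow> real^'b::finite"
 assumes "(f has_derivative f') (at x)" shows "jacobian f (at x) *v h = f' h"
proof -
 have "linear f'" using has_derivative_linear[OF assms] .
 then show ?thesis unfolding jacobian_def frechet_derivative_at[OF assms, symmetric] by (simp add: matrix_works)
qed

lemma grad_inner:
 fixes f :: "real^'k::finite \<Rightarrow> real"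
 assumes "(f has_derivative f') (at x)" shows "a \<bullet> grad f x = f' a"
proof -
 have lin: "linear f'" using has_derivative_linear[OF assms] .
 have "f' a = f' (\<Sum>i\<in>UNIV. (a $ i) *\<^sub>R axis i 1)" using basis_expansion[of a] by (simp add: scalar_mult_eq_scaleR)
 also have "\<dots> = (\<Sum>i\<in>UNIV. a $ i * f' (axis i 1))" by (simp add: linear_sum[OF lin] linear_scale[OF lin])
 also have "\<dots> = a \<bullet> grad f x" unfolding grad_def frechet_derivative_at[OF assms, symmetric] by (simp add: inner_vec_def)
 finally show ?thesis by simp
qed

text \<open>The Hessian blocks are Jacobians of gradients, and a gradient is accessible through its
  scalar products. Differentiability of the vector-valued map is assembled from these
  components.\<close>

lemma inner_jacobian_apply:
 fixes G :: "real^'a::finite \<Rightarrow> real^'b::finite"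
 assumes "\<And>k. ((\<lambda>y. k \<bullet> G y) has_derivative D k) (at y)" shows "k \<bullet> (jacobian G (at y) *v h) = D k h"
proof -
 define G' where "G' h = (\<Sum>b\<in>Basis. D b h *\<^sub>R b)" for h
 have "(G has_derivative G') (at y)" unfolding has_derivative_componentwise_within[of G]
 proof
  fix b :: "real^'b" assume b: "b \<in> Basis"
  have "G' h \<bullet> b = D b h" for h using b by (simp add: G'_def inner_sum_left inner_Basis if_distrib cong: if_cong)
  then show "((\<lambda>x. G x \<bullet> b) has_derivative (\<lambda>x. G' x \<bullet> b)) (at y)"
   using assms[of b] by (simp add: inner_commute)
 qed
 moreover from this have "((\<lambda>y. k \<bullet> G y) has_derivative (\<lambda>h. k \<bullet> G' h)) (at y)"
  by (auto intro!: derivative_eq_intros)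
 ultimately show ?thesis using has_derivative_unique[OF _ assms[of k]] by (auto simp: jacobian_apply dest: fun_cong)
qed

lemma matrix_vector_inner_eqI:
 fixes A B :: "real^'a::finite^'b::finite"
 assumes "\<And>b a. b \<bullet> (A *v a) = b \<bullet> (B *v a)" shows "A = B"
proof -
 have "A *v a = B *v a" for a using assms vector_eq_ldot by blast
 then show ?thesis by (simp add: matrix_eq)
qed

section \<open>The nominal trajectory\<close>

text \<open>One index range for cost and constraints: index \<open>dphi P + j\<close> is the j-th
  equality constraint, so that the sign conditions concern an initial segment of indices.\<close>

definition chi :: "('n::finite, 'l::finite, 'm::finite) ocp \<Rightarrow> nat \<Rightarrow> (real^'n) \<times> (real^'n) \<Rightarrow> real" where
 "chi P k = (if k \<le> dphi P then phi P k else eta P (k - dphi P))"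

definition nchi :: "('n::finite, 'l::finite, 'm::finite) ocp \<Rightarrow> nat" where
 "nchi P = Suc (dphi P + deta P)"

text \<open>Extracts the finitely many entries that matter and sets all others to 0, so that
  multipliers are compared through vectors of a compact set.\<close>

fun coeff :: "('n::finite, 'l::finite, 'm::finite) ocp \<Rightarrow> 'n mult \<Rightarrow> nat \<Rightarrow> real" where
 "coeff P (\<alpha>, \<beta>, p) k = (if k < nchi P then if k \<le> dphi P then \<alpha> k else \<beta> (k - dphi P) else 0)"

lemma sum_nchi:
 fixes f g :: "nat \<Rightarrow> 'b::comm_monoid_add"
 shows "(\<Sum>k<nchi P. if k \<le> dphi P then f k else g (k - dphi P)) = (\<Sum>i=0..dphi P. f i) + (\<Sum>j=1..deta P. g j)"
proof -
 have split: "{..<nchi P} = {0..dphi P} \<union> {Suc (dphi P)..dphi P + deta P}" by (auto simp: nchi_def)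
 have "(\<Sum>k<nchi P. if k \<le> dphi P then f k else g (k - dphi P))
   = (\<Sum>k\<in>{0..dphi P}. f k) + (\<Sum>k\<in>{Suc (dphi P)..dphi P + deta P}. g (k - dphi P))"
  unfolding split by (subst sum.union_disjoint) (auto intro!: arg_cong2[where f = "(+)"] sum.cong)
 also have "(\<Sum>k\<in>{Suc (dphi P)..dphi P + deta P}. g (k - dphi P)) = (\<Sum>j=1..deta P. g j)"
  by (rule sum.reindex_bij_witness[of _ "\<lambda>j. j + dphi P" "\<lambda>k. k - dphi P"]) auto
 finally show ?thesis .
qed

lemma ell_eq: "ell P \<mu> q = (\<Sum>k<nchi P. coeff P \<mu> k * chi P k q)"
proof (cases \<mu>)
 case (fields \<alpha> \<beta> p)
 have "(\<Sum>k<nchi P. coeff P \<mu> k * chi P k q)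
   = (\<Sum>k<nchi P. if k \<le> dphi P then \<alpha> k * phi P k q else \<beta> (k - dphi P) * eta P (k - dphi P) q)"
  by (rule sum.cong) (auto simp: fields chi_def)
 also have "\<dots> = (\<Sum>i=0..dphi P. \<alpha> i * phi P i q) + (\<Sum>j=1..deta P. \<beta> j * eta P j q)"
  by (rule sum_nchi[where f = "\<lambda>i. \<alpha> i * phi P i q" and g = "\<lambda>j. \<beta> j * eta P j q"])
 finally show ?thesis by (simp add: fields)
qed

lemmas [simp del] = Fx.simps Fu.simps Fv.simps Hx.simps Hu.simps Hv.simps Hxx.simps Hux.simps Hvx.simps
 Huu.simps Hvu.simps D2ell.simps Omega.simps Omega_P2.simps ell.simps ham.simps

locale nominal_ocp =
 fixes P :: "('n::finite, 'l::finite, 'm::finite) ocp"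
  and xh :: "real \<Rightarrow> real^'n" and uh :: "real \<Rightarrow> real^'l" and vh :: "real \<Rightarrow> real^'m"
 assumes data: "ocp_data P" and nom: "nominal P (xh, uh, vh)"
begin

abbreviation "T \<equiv> horizon P"
abbreviation "wh \<equiv> (xh, uh, vh)"
abbreviation "N \<equiv> nchi P"

definition W :: "real \<Rightarrow> ('n, 'l, 'm) point" where "W t = (xh t, uh t, vh t)"
definition qh :: "(real^'n) \<times> (real^'n)" where "qh = (xh 0, xh T)"

lemma T_pos: "0 < T" using data by (simp add: ocp_data_def)

lemma chi_smooth: "k < N \<Longrightarrow> lipschitz_second_deriv (chi P k)"
proof (cases "k \<le> dphi P")
 case False
 assume "k < N"
 then have "k - dphi P \<in> {1..deta P}" using False by (auto simp: nchi_def)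
 then show ?thesis using data False by (auto simp: chi_def ocp_data_def)
qed (use data in \<open>auto simp: chi_def ocp_data_def\<close>)

lemma smooth_upto_continuous:
 assumes "smooth_upto T f" obtains f' where "cont_on T f'"
  "\<And>t. t \<in> {0..T} \<Longrightarrow> vd T f (f' t) t"
proof -
 obtain D where D: "\<And>t. t \<in> {0..T} \<Longrightarrow> D 0 t = f t"
  "\<And>k t. t \<in> {0..T} \<Longrightarrow> vd T (D k) (D (Suc k) t) t" using assms unfolding smooth_upto_def by blast
 have "cont_on T (D 1)" by (rule has_vector_derivative_continuous_on[OF D(2)])
 moreover have "vd T f (D 1 t) t" if "t \<in> {0..T}" for t
  using has_vector_derivative_transform[OF that D(1)[symmetric] D(2)[OF that, of 0]] by simp
 ultimately show ?thesis using that by blast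
qed

lemma W_C1: "\<exists>W'. cont_on T W' \<and> (\<forall>t\<in>{0..T}. vd T W (W' t) t)"
proof -
 obtain u' where u': "cont_on T u'" "\<And>t. t \<in> {0..T} \<Longrightarrow> vd T uh (u' t) t"
  using smooth_upto_continuous[of uh] nom by auto
 obtain v' where v': "cont_on T v'" "\<And>t. t \<in> {0..T} \<Longrightarrow> vd T vh (v' t) t"
  using smooth_upto_continuous[of vh] nom by auto
 have wd: "has_wderiv T xh (\<lambda>t. dyn P (xh t) (uh t) (vh t))" using nom by (simp add: feasible_def)
 have "cont_on T W" unfolding W_def by (intro continuous_intros has_wderiv_continuous[OF wd] has_vector_derivative_continuous_on[OF u'(2)]
    has_vector_derivative_continuous_on[OF v'(2)])
 then have "cont_on T (\<lambda>t. dynw P (W t))" by (rule continuous_on_compose2[OF cont_dynw[OF data]]) auto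
 then have c: "cont_on T (\<lambda>t. dyn P (xh t) (uh t) (vh t))" by (simp add: dyn_eq_dynw W_def)
 show ?thesis
 proof (intro exI[of _ "\<lambda>t. (dyn P (xh t) (uh t) (vh t), u' t, v' t)"] conjI ballI)
  show "cont_on T (\<lambda>t. (dyn P (xh t) (uh t) (vh t), u' t, v' t))" by (intro continuous_intros c u' v')
  fix t assume t: "t \<in> {0..T}"
  show "vd T W (dyn P (xh t) (uh t) (vh t), u' t, v' t) t" unfolding W_def[abs_def]
   by (intro has_vector_derivative_Pair has_wderiv_imp_derivative[OF wd c t] u'(2)[OF t] v'(2)[OF t])
 qed
qed

definition W' :: "real \<Rightarrow> ('n, 'l, 'm) point" where
 "W' = (SOME W'. cont_on T W' \<and> (\<forall>t\<in>{0..T}. vd T W (W' t) t))"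

lemma W'_cont: "cont_on T W'"
 and W_deriv: "t \<in> {0..T} \<Longrightarrow> vd T W (W' t) t" using someI_ex[OF W_C1] unfolding W'_def by blast+

lemma W_cont: "cont_on T W" by (rule has_vector_derivative_continuous_on[OF W_deriv])

definition Kc :: real where
 "Kc = (SOME K. control_system T K (\<lambda>t h. dynw P (W t + h) - dynw P (W t)) (\<lambda>t. dyn1 P (W t)) (\<lambda>t. dyn2 P (W t)))"

text \<open>From here on \<open>xlin\<close>, \<open>xnl\<close>, \<open>costate\<close> and the
  variations refer to deviations from the nominal trajectory, with \<open>dyn1\<close> and
  \<open>dyn2\<close> along \<open>W\<close> as first and second derivative.\<close>

sublocale control_system T Kc "\<lambda>t h. dynw P (W t + h) - dynw P (W t)" "\<lambda>t. dyn1 P (W t)" "\<lambda>t. dyn2 P (W t)"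
 unfolding Kc_def by (rule someI_ex[OF control_system_along[OF data W_cont T_pos]])

lemma dyn_derivatives:
 shows "((\<lambda>x. dyn P x u v) has_derivative (\<lambda>a. dyn1 P (x, u, v) (a, 0, 0))) (at x)"
  and "((\<lambda>u. dyn P x u v) has_derivative (\<lambda>c. dyn1 P (x, u, v) (0, c, 0))) (at u)"
  and "((\<lambda>v. dyn P x u v) has_derivative (\<lambda>b. dyn1 P (x, u, v) (0, 0, b))) (at v)" unfolding dyn_eq_dynw
 by (rule has_derivative_compose[OF _ has_derivative_dynw[OF data]]; auto intro!: derivative_eq_intros simp: zero_prod_def)+

lemma dyn1_derivatives:
 shows "((\<lambda>x. q \<bullet> dyn1 P (x, u, v) k) has_derivative (\<lambda>a. q \<bullet> dyn2 P (x, u, v) (a, 0, 0) k)) (at x)"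
  and "((\<lambda>u. q \<bullet> dyn1 P (x, u, v) k) has_derivative (\<lambda>c. q \<bullet> dyn2 P (x, u, v) (0, c, 0) k)) (at u)"
 by (rule has_derivative_inner_right, rule has_derivative_compose[OF _ has_derivative_dyn1[OF data]];
   auto intro!: derivative_eq_intros simp: zero_prod_def)+

lemma Fx_apply: "Fx P wh t *v a = dyn1 P (W t) (a, 0, 0)"
 and Fu_apply: "Fu P wh t *v c = dyn1 P (W t) (0, c, 0)" and Fv_apply: "Fv P wh t *v b = dyn1 P (W t) (0, 0, b)"
 unfolding Fx.simps Fu.simps Fv.simps W_def
 by (rule jacobian_apply[OF dyn_derivatives(1)] jacobian_apply[OF dyn_derivatives(2)] jacobian_apply[OF dyn_derivatives(3)])+

lemma dyn1_split: "dyn1 P (W t) (a, c, b) = Fx P wh t *v a + Fu P wh t *v c + Fv P wh t *v b"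
 unfolding Fx_apply Fu_apply Fv_apply by (simp add: blinfun.add_right[symmetric])

lemma ham_eq: "ham P \<mu> x u v t = snd (snd \<mu>) t \<bullet> dyn P x u v" by (cases \<mu>) (simp add: ham.simps)

lemma grad_ham:
 shows "k \<bullet> grad (\<lambda>x. ham P \<mu> x u v t) x = snd (snd \<mu>) t \<bullet> dyn1 P (x, u, v) (k, 0, 0)"
  and "c \<bullet> grad (\<lambda>u. ham P \<mu> x u v t) u = snd (snd \<mu>) t \<bullet> dyn1 P (x, u, v) (0, c, 0)"
  and "b \<bullet> grad (\<lambda>v. ham P \<mu> x u v t) v = snd (snd \<mu>) t \<bullet> dyn1 P (x, u, v) (0, 0, b)" unfolding ham_eq
 by (rule grad_inner[OF has_derivative_inner_right] dyn_derivatives)+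

lemma Hx_inner: "k \<bullet> Hx P wh \<mu> t = snd (snd \<mu>) t \<bullet> dyn1 P (W t) (k, 0, 0)"
 and Hu_inner: "c \<bullet> Hu P wh \<mu> t = snd (snd \<mu>) t \<bullet> dyn1 P (W t) (0, c, 0)"
 and Hv_inner: "b \<bullet> Hv P wh \<mu> t = snd (snd \<mu>) t \<bullet> dyn1 P (W t) (0, 0, b)"
 unfolding Hx.simps Hu.simps Hv.simps W_def by (rule grad_ham)+

lemma Hxx_inner: "k \<bullet> (Hxx P wh \<mu> t *v h) = snd (snd \<mu>) t \<bullet> dyn2 P (W t) (h, 0, 0) (k, 0, 0)"
 and Hux_inner: "c \<bullet> (Hux P wh \<mu> t *v h) = snd (snd \<mu>) t \<bullet> dyn2 P (W t) (h, 0, 0) (0, c, 0)"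
 and Hvx_inner: "b \<bullet> (Hvx P wh \<mu> t *v h) = snd (snd \<mu>) t \<bullet> dyn2 P (W t) (h, 0, 0) (0, 0, b)"
 unfolding Hxx.simps Hux.simps Hvx.simps W_def by (rule inner_jacobian_apply, unfold grad_ham, rule dyn1_derivatives)+

lemma Huu_inner: "c \<bullet> (Huu P wh \<mu> t *v h) = snd (snd \<mu>) t \<bullet> dyn2 P (W t) (0, h, 0) (0, c, 0)"
 and Hvu_inner: "b \<bullet> (Hvu P wh \<mu> t *v h) = snd (snd \<mu>) t \<bullet> dyn2 P (W t) (0, h, 0) (0, 0, b)"
 unfolding Huu.simps Hvu.simps W_def by (rule inner_jacobian_apply, unfold grad_ham, rule dyn1_derivatives)+

lemma dyn2_vv: "dyn2 P w (0, 0, b) (0, 0, b') = 0" by (simp add: dyn2_apply zero_prod_def[symmetric] blinfun.zero_right)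

text \<open>All blocks of the Hessian of H are values of one symmetric bilinear form p .
  \<open>dyn2\<close>, whose v-v block vanishes; this links the integrand of \<open>Omega\<close> to
  the second variation.\<close>

lemma Omega_integrand:
 "1/2 * (x \<bullet> (Hxx P wh \<mu> t *v x)) + u \<bullet> (Hux P wh \<mu> t *v x) + v \<bullet> (Hvx P wh \<mu> t *v x)
   + 1/2 * (u \<bullet> (Huu P wh \<mu> t *v u)) + v \<bullet> (Hvu P wh \<mu> t *v u)
  = 1/2 * (snd (snd \<mu>) t \<bullet> dyn2 P (W t) (x, u, v) (x, u, v))"
proof -
 let ?B = "\<lambda>a b. snd (snd \<mu>) t \<bullet> dyn2 P (W t) a b"
 have split: "(x, u, v) = (x, 0, 0) + (0, u, 0) + (0, 0, v)" by simp
 have "?B (x, u, v) (x, u, v) = ?B (x, 0, 0) (x, 0, 0) + ?B (0, u, 0) (0, u, 0)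
   + 2 * ?B (x, 0, 0) (0, u, 0) + 2 * ?B (x, 0, 0) (0, 0, v) + 2 * ?B (0, u, 0) (0, 0, v)"
  unfolding split blinfun.add_right blinfun.add_left inner_add_right
  by (simp add: dyn2_vv dyn2_sym[OF data, of _ "(0, 0, v)"] dyn2_sym[OF data, of _ "(0, u, 0)" "(x, 0, 0)"])
 then show ?thesis by (simp add: Hxx_inner Hux_inner Hvx_inner Huu_inner Hvu_inner)
qed

lemma Omega_eq:
 "Omega P wh \<mu> (x, u, v) = 1/2 * D2ell P wh \<mu> (x 0, x T)
  + (\<integral>t. 1/2 * (snd (snd \<mu>) t \<bullet> dyn2 P (W t) (x t, u t, v t) (x t, u t, v t)) \<partial>leb T)"
 unfolding Omega.simps Omega_integrand ..

lemma frechet_chi: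
 assumes "k < N" shows "frechet_derivative (chi P k) (at q) = D1 (chi P k) q"
 by (rule frechet_derivative_at[OF has_derivative_D1[OF chi_smooth[OF assms]], symmetric])

lemma ell_has_derivative:
 "(ell P \<mu> has_derivative (\<lambda>a. \<Sum>k<N. coeff P \<mu> k * D1 (chi P k) q a)) (at q)" unfolding ell_eq[abs_def]
 by (auto intro!: derivative_eq_intros has_derivative_D1 chi_smooth)

lemma D2ell_eq: "D2ell P wh \<mu> a = (\<Sum>k<N. coeff P \<mu> k * D2 (chi P k) qh a a)"
proof -
 have "frechet_derivative (ell P \<mu>) (at y) = (\<lambda>a. \<Sum>k<N. coeff P \<mu> k * D1 (chi P k) y a)" for y
  by (rule frechet_derivative_at[OF ell_has_derivative, symmetric])
 then have e: "(\<lambda>y. frechet_derivative (ell P \<mu>) (at y) a) = (\<lambda>y. \<Sum>k<N. coeff P \<mu> k * D1 (chi P k) y a)"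
  by simp
 have "((\<lambda>y. \<Sum>k<N. coeff P \<mu> k * D1 (chi P k) y a) has_derivative (\<lambda>b. \<Sum>k<N. coeff P \<mu> k * D2 (chi P k) qh b a)) (at qh)"
  by (auto intro!: derivative_eq_intros has_derivative_D2 chi_smooth)
 from fun_cong[OF frechet_derivative_at[OF this], of a] show ?thesis unfolding D2ell.simps deriv2_def e qh_def by simp
qed

lemma grad_ell:
 shows "a \<bullet> grad (\<lambda>q. ell P \<mu> (q, xh T)) (xh 0) = (\<Sum>k<N. coeff P \<mu> k * D1 (chi P k) qh (a, 0))"
  and "a \<bullet> grad (\<lambda>q. ell P \<mu> (xh 0, q)) (xh T) = (\<Sum>k<N. coeff P \<mu> k * D1 (chi P k) qh (0, a))" unfolding qh_def
 by (rule grad_inner, rule has_derivative_compose[OF _ ell_has_derivative]; auto intro!: derivative_eq_intros simp: zero_prod_def)+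

end

section \<open>Matrix functions of time along the nominal trajectory\<close>

lemma bounded_bilinear_matrix_vector: "bounded_bilinear (\<lambda>(A :: real^'a::finite^'b::finite) x. A *v x)"
 unfolding bilinear_conv_bounded_bilinear[symmetric] bilinear_def
 by (auto intro!: linearI simp: matrix_vector_mult_add_rdistrib matrix_vector_right_distrib
   scaleR_matrix_vector_assoc matrix_vector_mult_scaleR)

lemma bounded_bilinear_matrix_matrix: "bounded_bilinear (\<lambda>(A :: real^'a::finite^'b::finite) (B :: real^'c::finite^'a). A ** B)"
 unfolding bilinear_conv_bounded_bilinear[symmetric] bilinear_def
 by (auto intro!: linearI simp: matrix_add_ldistrib matrix_matrix_mult_def vec_eq_iff
   sum.distrib distrib_right distrib_left sum_distrib_left mult_ac)

lemmas continuous_matrix_vector = bounded_bilinear.continuous_on[OF bounded_bilinear_matrix_vector]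

lemma inner_axis_matrix_axis:
 "axis i 1 \<bullet> ((A :: real^'a::finite^'b::finite) *v axis j 1) = A \<bullet> axis i (axis j 1)"
 by (simp add: inner_axis inner_axis' matrix_vector_mult_basis column_def)

lemma matrix_Basis:
 assumes "b \<in> (Basis :: (real^'a::finite^'b::finite) set)"
 obtains i j where "b = axis i (axis j 1)" using assms by (auto simp: Basis_vec_def)

lemma matrix_has_vector_derivativeI:
 fixes A :: "real \<Rightarrow> real^'a::finite^'b::finite"
 assumes "\<And>b a. ((\<lambda>t. b \<bullet> (A t *v a)) has_vector_derivative (b \<bullet> (D *v a))) (at t within S)"
 shows "(A has_vector_derivative D) (at t within S)" unfolding has_vector_derivative_def has_derivative_componentwise_within[of A]
proof
 fix b :: "real^'a^'b" assume "b \<in> Basis"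
 then obtain i j where b: "b = axis i (axis j 1)" by (rule matrix_Basis)
 show "((\<lambda>x. A x \<bullet> b) has_derivative (\<lambda>x. (x *\<^sub>R D) \<bullet> b)) (at t within S)"
  using assms[of "axis i 1" "axis j 1"] unfolding has_vector_derivative_def inner_axis_matrix_axis b by simp
qed

lemma matrix_continuous_onI:
 fixes A :: "real \<Rightarrow> real^'a::finite^'b::finite"
 assumes "\<And>b a. continuous_on S (\<lambda>t. b \<bullet> (A t *v a))" shows "continuous_on S A"
proof (subst continuous_on_componentwise, rule ballI)
 fix b :: "real^'a^'b" assume "b \<in> Basis"
 then obtain i j where b: "b = axis i (axis j 1)" by (rule matrix_Basis)
 show "continuous_on S (\<lambda>x. A x \<bullet> b)" using assms[of "axis i 1" "axis j 1"] unfolding inner_axis_matrix_axis b .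
qed

declare transpose_matrix_vector [simp del]

lemma inner_transpose: "x \<bullet> (transpose A *v y) = (A *v x) \<bullet> y"
 for A :: "real^'a::finite^'b::finite" by (metis dot_lmul_matrix inner_commute transpose_matrix_vector)

lemma tderiv_eq:
 assumes "0 < T" "t \<in> {0..T}" "vd T f D t" shows "tderiv T f t = D"
 unfolding tderiv_def using vector_derivative_within_cbox[of 0 T t f D] assms by simp

lemma matrix_of_apply:
 fixes f :: "real^'a::finite \<Rightarrow> real^'b::finite"
 assumes "linear f" shows "matrix f *v x = f x" using assms by (simp add: matrix_works)

context nominal_ocp
begin

lemma pair_zero: "(a, 0 :: (real^'l) \<times> (real^'m)) = (a, 0, 0)" "((0::real^'n), c) = (0, fst c, snd c)"
 by (simp_all add: zero_prod_def)

lemma dyn1_has_vd: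
 assumes t: "t \<in> {0..T}" shows "vd T (\<lambda>t. dyn1 P (W t) k) (dyn2 P (W t) (W' t) k) t"
proof -
 have "((\<lambda>w. dyn1 P w k) \<circ> W has_derivative (\<lambda>h. dyn2 P (W t) h k) \<circ> (\<lambda>h. h *\<^sub>R W' t)) (at t within {0..T})"
  by (rule diff_chain_within[OF W_deriv[OF t, unfolded has_vector_derivative_def]
    has_derivative_at_withinI[OF has_derivative_dyn1[OF data]]])
 then show ?thesis by (simp add: has_vector_derivative_def o_def blinfun.bilinear_simps)
qed

text \<open>The time derivative of the x-v block of \<open>dyn2\<close> along the nominal
  trajectory. The block involves only first derivatives of the \<open>fs P i\<close>, hence it is
  differentiable in time although second derivatives are merely Lipschitz.\<close>

definition Wxv :: "real \<Rightarrow> real^'n \<Rightarrow> real^'m \<Rightarrow> real^'n" where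
 "Wxv t a b = (\<Sum>i\<in>UNIV. b $ i *\<^sub>R D2 (fs P i) (xu (W t)) (xu (W' t)) (a, 0))"

lemma dyn2_xv: "dyn2 P w (a, 0, 0) (0, 0, b) = (\<Sum>i\<in>UNIV. b $ i *\<^sub>R D1 (fs P i) (xu w) (a, 0))"
 unfolding dyn2_apply xu_vv_Pair by (simp add: zero_prod_def[symmetric] blinfun.zero_right)

lemma dyn2_xv_has_vd:
 assumes t: "t \<in> {0..T}" shows "vd T (\<lambda>t. dyn2 P (W t) (a, 0, 0) (0, 0, b)) (Wxv t a b) t"
proof -
 have "((\<lambda>t. D1 (fs P i) (xu (W t)) (a, 0)) has_vector_derivative D2 (fs P i) (xu (W t)) (xu (W' t)) (a, 0))
   (at t within {0..T})" for i
 proof -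
  have "((\<lambda>w. D1 (fs P i) (xu w) (a, 0)) has_derivative (\<lambda>h. D2 (fs P i) (xu (W t)) (xu h) (a, 0))) (at (W t))"
   by (rule bounded_linear.has_derivative[OF blinfun.bounded_linear_left])
    (rule has_derivative_comp_xu[OF data has_derivative_D2[OF fs_smooth[OF data]]])
  from diff_chain_within[OF W_deriv[OF t, unfolded has_vector_derivative_def] has_derivative_at_withinI[OF this]]
  show ?thesis by (simp add: has_vector_derivative_def o_def blinfun.bilinear_simps)
 qed
 then show ?thesis unfolding dyn2_xv Wxv_def by (auto intro!: derivative_eq_intros)
qed

lemma Wxv_cont: "cont_on T a \<Longrightarrow> cont_on T (\<lambda>t. Wxv t (a t) b)" unfolding Wxv_def
 by (intro continuous_intros blinfun.continuous_on
   continuous_on_compose2[OF cont_comp_xu[OF data continuous_D2[OF fs_smooth[OF data]]] W_cont]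
   continuous_on_compose2[OF linear_continuous_on[OF bounded_linear_xu] W'_cont]) auto

lemma dyn1_cont: "cont_on T w \<Longrightarrow> cont_on T (\<lambda>t. dyn1 P (W t) (w t))" by (rule cont_F1)

lemma dyn2_cont: "cont_on T v \<Longrightarrow> cont_on T w \<Longrightarrow> cont_on T (\<lambda>t. dyn2 P (W t) (v t) (w t))"
 by (rule cont_F2)

lemma Fv_has_vd:
 assumes t: "t \<in> {0..T}" shows "vd T (Fv P wh) (matrix (\<lambda>b. dyn2 P (W t) (W' t) (0, 0, b))) t"
proof (rule matrix_has_vector_derivativeI)
 fix b a
 have "linear (\<lambda>b. dyn2 P (W t) (W' t) (0, 0, b))"
  by (rule linearI) (simp_all add: blinfun.add_right[symmetric] blinfun.scaleR_right[symmetric])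
 then have e: "matrix (\<lambda>b. dyn2 P (W t) (W' t) (0, 0, b)) *v a = dyn2 P (W t) (W' t) (0, 0, a)" by (rule matrix_of_apply)
 show "vd T (\<lambda>t. b \<bullet> (Fv P wh t *v a)) (b \<bullet> (matrix (\<lambda>b. dyn2 P (W t) (W' t) (0, 0, b)) *v a)) t"
  unfolding e Fv_apply by (rule bounded_linear.has_vector_derivative[OF bounded_linear_inner_right dyn1_has_vd[OF t]])
qed

definition Fv' :: "real \<Rightarrow> real^'m^'n" where "Fv' t = matrix (\<lambda>b. dyn2 P (W t) (W' t) (0, 0, b))"

lemma Fv'_apply: "Fv' t *v a = dyn2 P (W t) (W' t) (0, 0, a)" unfolding Fv'_def
 by (intro matrix_of_apply linearI) (simp_all add: blinfun.add_right[symmetric] blinfun.scaleR_right[symmetric])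

lemma Fv'_deriv: "t \<in> {0..T} \<Longrightarrow> vd T (Fv P wh) (Fv' t) t" unfolding Fv'_def by (rule Fv_has_vd)

lemma Fv'_cont: "cont_on T Fv'" by (intro matrix_continuous_onI, unfold Fv'_apply) (intro continuous_intros dyn2_cont W'_cont)

lemma Fv_cont: "cont_on T (Fv P wh)" by (rule has_vector_derivative_continuous_on[OF Fv'_deriv])

lemma Fx_cont: "cont_on T (Fx P wh)" by (intro matrix_continuous_onI, unfold Fx_apply) (intro continuous_intros dyn1_cont)

lemma Fu_cont: "cont_on T (Fu P wh)" by (intro matrix_continuous_onI, unfold Fu_apply) (intro continuous_intros dyn1_cont)

lemma Bmat_eq: "t \<in> {0..T} \<Longrightarrow> Bmat P wh t = Fx P wh t ** Fv P wh t - Fv' t"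
 unfolding Bmat_def by (simp add: tderiv_eq[OF T_pos _ Fv'_deriv])

lemma Bmat_cont: "cont_on T (Bmat P wh)"
proof -
 have "cont_on T (\<lambda>t. Fx P wh t ** Fv P wh t - Fv' t)"
  by (intro continuous_intros bounded_bilinear.continuous_on[OF bounded_bilinear_matrix_matrix] Fx_cont Fv_cont Fv'_cont)
 then show ?thesis by (rule continuous_on_eq) (simp add: Bmat_eq)
qed

end

section \<open>Matrices that depend on a costate, and the Goh transformation\<close>

locale nominal_costate = nominal_ocp P xh uh vh
 for P :: "('n::finite, 'l::finite, 'm::finite) ocp" and xh uh vh +
 fixes \<mu> :: "'n mult"
 assumes costate: "costate (snd (snd \<mu>))"
begin

abbreviation "p \<equiv> snd (snd \<mu>)"

lemma p_cont: "cont_on T p" by (rule costate_cont[OF costate])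

definition p' :: "real \<Rightarrow> real^'n" where "p' t = - (\<Sum>b\<in>Basis. (p t \<bullet> dyn1 P (W t) (b, 0)) *\<^sub>R b)"

lemma p_deriv: "t \<in> {0..T} \<Longrightarrow> vd T p (p' t) t" using costate unfolding costate_def p'_def by blast

lemma p'_inner: "p' t \<bullet> a = - (p t \<bullet> (Fx P wh t *v a))"
 unfolding p'_def Fx_apply inner_minus_left adjoint_inner by (simp add: pair_zero)

lemma p'_cont: "cont_on T p'" unfolding p'_def by (intro continuous_intros p_cont dyn1_cont)

text \<open>The total time derivative of H_vx by the product rule: \<open>p'\<close> comes from the
  adjoint equation and \<open>Wxv\<close> from the block itself. The entries are its values on axis
  vectors.\<close>

definition Hvx' :: "real \<Rightarrow> real^'n^'m" where
 "Hvx' t = (\<chi> i j. p t \<bullet> Wxv t (axis j 1) (axis i 1) + p' t \<bullet> dyn2 P (W t) (axis j 1, 0, 0) (0, 0, axis i 1))"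

lemma Hvx'_inner: "b \<bullet> (Hvx' t *v a) = p t \<bullet> Wxv t a b + p' t \<bullet> dyn2 P (W t) (a, 0, 0) (0, 0, b)"
proof -
 define f where "f a b = p t \<bullet> Wxv t a b + p' t \<bullet> dyn2 P (W t) (a, 0, 0) (0, 0, b)" for a b
 have l1: "linear (\<lambda>a. f a b)" for b
 proof (rule linearI)
  show "f (x + y) b = f x b + f y b" for x y
  proof -
   have "D2 (fs P i) (xu (W t)) (xu (W' t)) (x + y, 0)
     = D2 (fs P i) (xu (W t)) (xu (W' t)) (x, 0) + D2 (fs P i) (xu (W t)) (xu (W' t)) (y, 0)" for i
    by (simp add: blinfun.add_right[symmetric])
   then show ?thesis using blinfun.add_right[of "dyn2 P (W t)" "(x, 0, 0)" "(y, 0, 0)"]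
    by (simp add: f_def Wxv_def blinfun.add_left inner_add_right scaleR_add_right sum.distrib)
  qed
  show "f (r *\<^sub>R x) b = r *\<^sub>R f x b" for r x
  proof -
   have "D2 (fs P i) (xu (W t)) (xu (W' t)) (r *\<^sub>R x, 0) = r *\<^sub>R D2 (fs P i) (xu (W t)) (xu (W' t)) (x, 0)" for i
    by (simp add: blinfun.scaleR_right[symmetric])
   then show ?thesis using blinfun.scaleR_right[of "dyn2 P (W t)" r "(x, 0, 0)"]
    by (simp add: f_def Wxv_def blinfun.scaleR_left distrib_left inner_sum_right sum_distrib_left mult_ac)
  qed
 qed
 have l2: "linear (\<lambda>b. f a b)" for a
 proof (rule linearI)
  show "f a (x + y) = f a x + f a y" for x y using blinfun.add_right[of "dyn2 P (W t) (a, 0, 0)" "(0, 0, x)" "(0, 0, y)"]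
   by (simp add: f_def Wxv_def inner_add_right scaleR_add_left sum.distrib)
  show "f a (r *\<^sub>R x) = r *\<^sub>R f a x" for r x using blinfun.scaleR_right[of "dyn2 P (W t) (a, 0, 0)" r "(0, 0, x)"]
   by (simp add: f_def Wxv_def distrib_left inner_sum_right sum_distrib_left mult_ac)
 qed
 have "f a b = f (\<Sum>j\<in>UNIV. (a $ j) *\<^sub>R axis j 1) b" using basis_expansion[of a] by (simp add: scalar_mult_eq_scaleR)
 also have "\<dots> = (\<Sum>j\<in>UNIV. a $ j * f (axis j 1) b)" by (simp add: linear_sum[OF l1] linear_scale[OF l1])
 also have "\<dots> = (\<Sum>j\<in>UNIV. a $ j * f (axis j 1) (\<Sum>i\<in>UNIV. (b $ i) *\<^sub>R axis i 1))"
  using basis_expansion[of b] by (simp add: scalar_mult_eq_scaleR)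
 also have "\<dots> = (\<Sum>j\<in>UNIV. a $ j * (\<Sum>i\<in>UNIV. b $ i * f (axis j 1) (axis i 1)))"
  by (simp add: linear_sum[OF l2] linear_scale[OF l2])
 also have "\<dots> = (\<Sum>i\<in>UNIV. b $ i * (\<Sum>j\<in>UNIV. f (axis j 1) (axis i 1) * a $ j))"
  by (simp add: sum_distrib_left, subst sum.swap, simp add: mult_ac)
 also have "\<dots> = (\<Sum>i\<in>UNIV. b $ i * (\<Sum>j\<in>UNIV. Hvx' t $ i $ j * a $ j))" by (simp add: Hvx'_def f_def)
 also have "\<dots> = b \<bullet> (Hvx' t *v a)" by (simp add: inner_vec_def[of b] matrix_vector_mult_def)
 finally show ?thesis by (simp add: f_def)
qed

lemma Hvx'_deriv:
 assumes t: "t \<in> {0..T}" shows "vd T (Hvx P wh \<mu>) (Hvx' t) t"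
proof (rule matrix_has_vector_derivativeI)
 fix b a
 show "vd T (\<lambda>t. b \<bullet> (Hvx P wh \<mu> t *v a)) (b \<bullet> (Hvx' t *v a)) t" unfolding Hvx_inner Hvx'_inner
  by (rule bounded_bilinear.has_vector_derivative[OF bounded_bilinear_inner p_deriv[OF t] dyn2_xv_has_vd[OF t]])
qed

lemma Hvx'_cont: "cont_on T Hvx'" by (intro matrix_continuous_onI, unfold Hvx'_inner)
  (intro continuous_intros dyn2_cont p_cont p'_cont Wxv_cont)

lemma Hvx_cont: "cont_on T (Hvx P wh \<mu>)" by (rule has_vector_derivative_continuous_on[OF Hvx'_deriv])

lemma Hxx_cont: "cont_on T (Hxx P wh \<mu>)"
 and Hux_cont: "cont_on T (Hux P wh \<mu>)" and Huu_cont: "cont_on T (Huu P wh \<mu>)"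
 and Hvu_cont: "cont_on T (Hvu P wh \<mu>)" by (intro matrix_continuous_onI, unfold Hxx_inner Hux_inner Huu_inner Hvu_inner,
   intro continuous_intros dyn2_cont p_cont)+

lemma Hxx_sym: "a \<bullet> (Hxx P wh \<mu> t *v b) = b \<bullet> (Hxx P wh \<mu> t *v a)"
 by (simp add: Hxx_inner dyn2_sym[OF data, of _ "(a, 0, 0)"])

definition S' :: "real \<Rightarrow> real^'m^'m" where
 "S' t = (1/2) *\<^sub>R ((Hvx' t ** Fv P wh t + Hvx P wh \<mu> t ** Fv' t) + transpose (Hvx' t ** Fv P wh t + Hvx P wh \<mu> t ** Fv' t))"

lemma bounded_linear_transpose: "bounded_linear (transpose :: real^'a::finite^'b::finite \<Rightarrow> _)"
 by (auto simp: linear_conv_bounded_linear[symmetric] transpose_def vec_eq_iff intro!: linearI)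

lemma S'_deriv:
 assumes t: "t \<in> {0..T}" shows "vd T (Smat P wh \<mu>) (S' t) t"
proof -
 have d: "vd T (\<lambda>t. Hvx P wh \<mu> t ** Fv P wh t) (Hvx P wh \<mu> t ** Fv' t + Hvx' t ** Fv P wh t) t"
  by (rule bounded_bilinear.has_vector_derivative[OF bounded_bilinear_matrix_matrix Hvx'_deriv[OF t] Fv'_deriv[OF t]])
 have "((\<lambda>t. (1/2) *\<^sub>R (Hvx P wh \<mu> t ** Fv P wh t + transpose (Hvx P wh \<mu> t ** Fv P wh t))) has_vector_derivative
   (1/2) *\<^sub>R ((Hvx P wh \<mu> t ** Fv' t + Hvx' t ** Fv P wh t) + transpose (Hvx P wh \<mu> t ** Fv' t + Hvx' t ** Fv P wh t))) (at t within {0..T})"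
  by (intro bounded_linear.has_vector_derivative[OF bounded_linear_scaleR_right] has_vector_derivative_add d
    bounded_linear.has_vector_derivative[OF bounded_linear_transpose])
 then show ?thesis unfolding Smat_def[abs_def] S'_def by (simp add: add.commute)
qed

lemma S_cont: "cont_on T (Smat P wh \<mu>)" by (rule has_vector_derivative_continuous_on[OF S'_deriv])

lemma S'_cont: "cont_on T S'" unfolding S'_def by (intro continuous_intros bounded_linear.continuous_on[OF bounded_linear_transpose]
   bounded_bilinear.continuous_on[OF bounded_bilinear_matrix_matrix] Hvx'_cont Hvx_cont Fv_cont Fv'_cont)

lemma Mmat_eq: "t \<in> {0..T} \<Longrightarrow> Mmat P wh \<mu> t = transpose (Fv P wh t) ** Hxx P wh \<mu> t - Hvx' t - Hvx P wh \<mu> t ** Fx P wh t"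
 unfolding Mmat_def by (simp add: tderiv_eq[OF T_pos _ Hvx'_deriv])

lemma Rmat_eq: "t \<in> {0..T} \<Longrightarrow> Rmat P wh \<mu> t = transpose (Fv P wh t) ** Hxx P wh \<mu> t ** Fv P wh t
   - (Hvx P wh \<mu> t ** Bmat P wh t + transpose (Hvx P wh \<mu> t ** Bmat P wh t)) - S' t"
 unfolding Rmat_def by (simp add: tderiv_eq[OF T_pos _ S'_deriv])

lemmas matrix_continuous_intros =
 bounded_linear.continuous_on[OF bounded_linear_transpose] bounded_bilinear.continuous_on[OF bounded_bilinear_matrix_matrix]
 Hvx'_cont Hvx_cont Fv_cont Fv'_cont Fx_cont Fu_cont Bmat_cont S'_cont S_cont Hxx_cont Hux_cont Huu_cont Hvu_cont

lemma Mmat_cont: "cont_on T (Mmat P wh \<mu>)"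
 by (rule continuous_on_eq[of _ "\<lambda>t. transpose (Fv P wh t) ** Hxx P wh \<mu> t - Hvx' t - Hvx P wh \<mu> t ** Fx P wh t"])
  (auto intro!: continuous_intros matrix_continuous_intros simp: Mmat_eq)

lemma Rmat_cont: "cont_on T (Rmat P wh \<mu>)"
 by (rule continuous_on_eq[of _ "\<lambda>t. transpose (Fv P wh t) ** Hxx P wh \<mu> t ** Fv P wh t
   - (Hvx P wh \<mu> t ** Bmat P wh t + transpose (Hvx P wh \<mu> t ** Bmat P wh t)) - S' t"])
  (auto intro!: continuous_intros matrix_continuous_intros simp: Rmat_eq)

lemma Emat_cont: "cont_on T (Emat P wh \<mu>)" unfolding Emat_def[abs_def] by (intro continuous_intros matrix_continuous_intros)

lemma Vmat_cont: "cont_on T (Vmat P wh \<mu>)" unfolding Vmat_def[abs_def] by (intro continuous_intros matrix_continuous_intros)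

text \<open>The Goh transformation: with \<open>x = \<xi> + F\<^sub>v y\<close> and \<open>v = dy/dt\<close>, the two integrands differ by the
 total derivative of \<open>y H\<^sub>v\<^sub>x \<xi> + y S y / 2\<close>, up to the terms with \<open>V\<close> and \<open>H\<^sub>v\<^sub>u\<close>.\<close>

definition integrand_P2 :: "real \<Rightarrow> real^'n \<Rightarrow> real^'l \<Rightarrow> real^'m \<Rightarrow> real" where
 "integrand_P2 t \<xi> u y = 1/2 * (\<xi> \<bullet> (Hxx P wh \<mu> t *v \<xi>)) + u \<bullet> (Hux P wh \<mu> t *v \<xi>)
    + y \<bullet> (Mmat P wh \<mu> t *v \<xi>) + 1/2 * (u \<bullet> (Huu P wh \<mu> t *v u))
    + y \<bullet> (Emat P wh \<mu> t *v u) + 1/2 * (y \<bullet> (Rmat P wh \<mu> t *v y))"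

lemma goh_pointwise:
 assumes t: "t \<in> {0..T}" shows "1/2 * (p t \<bullet> dyn2 P (W t) (\<xi> + Fv P wh t *v y, u, v) (\<xi> + Fv P wh t *v y, u, v))
  = integrand_P2 t \<xi> u y
   + (v \<bullet> (Hvx P wh \<mu> t *v \<xi>) + y \<bullet> (Hvx' t *v \<xi>)
     + y \<bullet> (Hvx P wh \<mu> t *v (Fx P wh t *v \<xi> + Fu P wh t *v u + Bmat P wh t *v y))
     + v \<bullet> (Smat P wh \<mu> t *v y) + 1/2 * (y \<bullet> (S' t *v y)))
   + v \<bullet> (Vmat P wh \<mu> t *v y) + v \<bullet> (Hvu P wh \<mu> t *v u)"
proof -
 let ?F = "Fv P wh t" and ?Hxx = "Hxx P wh \<mu> t" and ?Hvx = "Hvx P wh \<mu> t" and ?B = "Bmat P wh t"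
 \<comment> \<open>S and V are the symmetric and antisymmetric parts of H_vx F_v. Only the symmetric
   one is absorbed by a total derivative.\<close>
 have SV: "v \<bullet> (Smat P wh \<mu> t *v y) + v \<bullet> (Vmat P wh \<mu> t *v y) = v \<bullet> (?Hvx *v (?F *v y))"
 proof -
  have "Smat P wh \<mu> t + Vmat P wh \<mu> t = ?Hvx ** ?F" unfolding Smat_def Vmat_def
   by (simp add: scaleR_add_right[symmetric] scaleR_half_double)
  moreover have "v \<bullet> (Smat P wh \<mu> t *v y) + v \<bullet> (Vmat P wh \<mu> t *v y) = v \<bullet> ((Smat P wh \<mu> t + Vmat P wh \<mu> t) *v y)"
   by (simp add: matrix_vector_mult_add_rdistrib inner_add_right)
  ultimately show ?thesis by (simp only: matrix_vector_mul_assoc)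
 qed
 have M: "y \<bullet> (Mmat P wh \<mu> t *v \<xi>) = (?F *v y) \<bullet> (?Hxx *v \<xi>) - y \<bullet> (Hvx' t *v \<xi>) - y \<bullet> (?Hvx *v (Fx P wh t *v \<xi>))"
  by (simp add: Mmat_eq[OF t] matrix_vector_mult_diff_rdistrib inner_diff_right matrix_vector_mul_assoc[symmetric] inner_transpose)
 have E: "y \<bullet> (Emat P wh \<mu> t *v u) = u \<bullet> (Hux P wh \<mu> t *v (?F *v y)) - y \<bullet> (?Hvx *v (Fu P wh t *v u))"
  by (simp add: Emat_def matrix_vector_mult_diff_rdistrib inner_diff_right matrix_vector_mul_assoc[symmetric] inner_transpose
    inner_commute[of "Hux P wh \<mu> t *v (?F *v y)" u])
 have R: "y \<bullet> (Rmat P wh \<mu> t *v y) = (?F *v y) \<bullet> (?Hxx *v (?F *v y)) - 2 * (y \<bullet> (?Hvx *v (?B *v y))) - y \<bullet> (S' t *v y)"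
  by (simp add: Rmat_eq[OF t] matrix_vector_mult_diff_rdistrib matrix_vector_mult_add_rdistrib inner_diff_right inner_add_right
    matrix_vector_mul_assoc[symmetric] inner_transpose inner_commute[of "?Hvx *v (?B *v y)" y])
 have H: "(?F *v y) \<bullet> (?Hxx *v \<xi>) = \<xi> \<bullet> (?Hxx *v (?F *v y))" by (rule Hxx_sym)
 show ?thesis unfolding integrand_P2_def M E R Omega_integrand[symmetric] using SV H
  by (simp add: matrix_vector_right_distrib inner_add_right inner_add_left algebra_simps)
qed

text \<open>The total derivative that appears in \<open>goh_pointwise\<close>. Symmetry of S merges
  the two terms with S that arise from differentiating both factors \<open>y\<close>.\<close>

lemma goh_boundary_deriv:
 assumes t: "t \<in> {0..T}" and \<xi>: "vd T \<xi> \<xi>' t" and y: "vd T y v t"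
 shows "((\<lambda>t. y t \<bullet> (Hvx P wh \<mu> t *v \<xi> t + (1/2) *\<^sub>R (Smat P wh \<mu> t *v y t))) has_vector_derivative
   v \<bullet> (Hvx P wh \<mu> t *v \<xi> t) + y t \<bullet> (Hvx' t *v \<xi> t) + y t \<bullet> (Hvx P wh \<mu> t *v \<xi>')
   + v \<bullet> (Smat P wh \<mu> t *v y t) + 1/2 * (y t \<bullet> (S' t *v y t))) (at t within {0..T})"
proof -
 have S_inner: "a \<bullet> (Smat P wh \<mu> t *v b)
   = 1/2 * (a \<bullet> ((Hvx P wh \<mu> t ** Fv P wh t) *v b) + b \<bullet> ((Hvx P wh \<mu> t ** Fv P wh t) *v a))" for a b
  unfolding Smat_def scaleR_matrix_vector_assoc[symmetric] matrix_vector_mult_add_rdistrib inner_scaleR_right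
   inner_add_right inner_transpose by (simp add: inner_commute[of _ b])
 have S_sym: "y t \<bullet> (Smat P wh \<mu> t *v v) = v \<bullet> (Smat P wh \<mu> t *v y t)" unfolding S_inner by simp
 have "((\<lambda>t. y t \<bullet> (Hvx P wh \<mu> t *v \<xi> t + (1/2) *\<^sub>R (Smat P wh \<mu> t *v y t))) has_vector_derivative
   y t \<bullet> ((Hvx P wh \<mu> t *v \<xi>' + Hvx' t *v \<xi> t) + (1/2) *\<^sub>R (Smat P wh \<mu> t *v v + S' t *v y t))
   + v \<bullet> (Hvx P wh \<mu> t *v \<xi> t + (1/2) *\<^sub>R (Smat P wh \<mu> t *v y t))) (at t within {0..T})"
  by (intro bounded_bilinear.has_vector_derivative[OF bounded_bilinear_inner] y has_vector_derivative_add
    bounded_linear.has_vector_derivative[OF bounded_linear_scaleR_right]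
    bounded_bilinear.has_vector_derivative[OF bounded_bilinear_matrix_vector] Hvx'_deriv[OF t] S'_deriv[OF t] \<xi>)
 then show ?thesis by (simp add: inner_add_right S_sym algebra_simps)
qed

end

section \<open>Square-integrable and Sobolev functions\<close>

lemma tendsto_0_abs_le:
 fixes f g :: "nat \<Rightarrow> real"
 assumes "\<And>n. \<bar>f n\<bar> \<le> g n" "g \<longlonglongrightarrow> 0" shows "f \<longlonglongrightarrow> 0"
 by (rule Lim_null_comparison[OF _ assms(2)]) (simp add: assms(1))

definition l2n :: "real \<Rightarrow> (real \<Rightarrow> 'a::euclidean_space) \<Rightarrow> real" where
 "l2n T u = sqrt (\<integral>t. (norm (u t))\<^sup>2 \<partial>leb T)"

lemma L2_measurable: "u \<in> L2 T \<Longrightarrow> u \<in> borel_measurable (leb T)"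
 and L2_integrable_sq: "u \<in> L2 T \<Longrightarrow> integrable (leb T) (\<lambda>t. (norm (u t))\<^sup>2)" by (auto simp: L2_def)

lemma l2n_nonneg: "0 \<le> l2n T u" by (simp add: l2n_def)

lemma l2n_sq: "(l2n T u)\<^sup>2 = (\<integral>t. (norm (u t))\<^sup>2 \<partial>leb T)" by (simp add: l2n_def)

lemma L2_norm_mult_integrable:
 assumes "u \<in> L2 T" "v \<in> L2 T" shows "integrable (leb T) (\<lambda>t. norm (u t) * norm (v t))"
proof (rule Bochner_Integration.integrable_bound)
 show "integrable (leb T) (\<lambda>t. (norm (u t))\<^sup>2 + (norm (v t))\<^sup>2)"
  using assms by (intro Bochner_Integration.integrable_add L2_integrable_sq)
 show "(\<lambda>t. norm (u t) * norm (v t)) \<in> borel_measurable (leb T)"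
  using L2_measurable[OF assms(1)] L2_measurable[OF assms(2)] by measurable
 have "norm a * norm b \<le> (norm a)\<^sup>2 + (norm b)\<^sup>2" for a :: 'a and b :: 'b
  using sum_squares_bound[of "norm a" "norm b"] mult_nonneg_nonneg[OF norm_ge_zero[of a] norm_ge_zero[of b]]
  unfolding mult.assoc by linarith
 then show "AE t in leb T. norm (norm (u t) * norm (v t)) \<le> norm ((norm (u t))\<^sup>2 + (norm (v t))\<^sup>2)" by (simp add: abs_mult)
qed

text \<open>Integrates 2 x y \<le> c x^2 + y^2 / c and takes c = b / a. If one of the norms is 0, c
  is sent to infinity or to 0 through the auxiliary \<open>e\<close>.\<close>

lemma L2_cauchy_schwarz:
 assumes "u \<in> L2 T" "v \<in> L2 T" shows "(\<integral>t. norm (u t) * norm (v t) \<partial>leb T) \<le> l2n T u * l2n T v"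
proof -
 let ?M = "leb T"
 define a where "a = l2n T u" define b where "b = l2n T v"
 have ab: "0 \<le> a" "0 \<le> b" by (simp_all add: a_def b_def l2n_nonneg)
 note i = L2_norm_mult_integrable[OF assms] L2_integrable_sq[OF assms(1)] L2_integrable_sq[OF assms(2)]
 have le: "2 * (\<integral>t. norm (u t) * norm (v t) \<partial>?M) \<le> c * a\<^sup>2 + b\<^sup>2 / c" if c: "c > 0" for c
 proof -
  have "2 * (x * y) \<le> c * x\<^sup>2 + y\<^sup>2 / c" for x y :: real
  proof -
   have "0 \<le> (sqrt c * x - y / sqrt c)\<^sup>2" by simp
   also have "\<dots> = c * x\<^sup>2 + y\<^sup>2 / c - 2 * (x * y)" using c by (simp add: power2_diff power_mult_distrib power_divide)
   finally show ?thesis by simp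
  qed
  then have "(\<integral>t. 2 * (norm (u t) * norm (v t)) \<partial>?M) \<le> (\<integral>t. c * (norm (u t))\<^sup>2 + (norm (v t))\<^sup>2 / c \<partial>?M)"
   by (intro integral_mono Bochner_Integration.integrable_add) (use i in auto)
  then show ?thesis using i by (simp add: a_def b_def l2n_sq)
 qed
 show ?thesis
 proof (cases "a = 0")
  case True
  have "(\<integral>t. norm (u t) * norm (v t) \<partial>?M) \<le> 0"
  proof (rule field_le_epsilon)
   fix e :: real assume e: "0 < e"
   have "2 * (\<integral>t. norm (u t) * norm (v t) \<partial>?M) \<le> b\<^sup>2 / ((b\<^sup>2 + 1) / e)"
    using le[of "(b\<^sup>2 + 1) / e"] e True by (simp add: add_nonneg_pos)
   also have "\<dots> \<le> e" using e by (simp add: divide_le_eq add_nonneg_pos mult_left_le_one_le)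
   finally show "(\<integral>t. norm (u t) * norm (v t) \<partial>?M) \<le> 0 + e" using e by simp
  qed
  then show ?thesis using True by (simp add: a_def)
 next
  case False
  show ?thesis
  proof (cases "b = 0")
   case True
   have "(\<integral>t. norm (u t) * norm (v t) \<partial>?M) \<le> 0"
   proof (rule field_le_epsilon)
    fix e :: real assume e: "0 < e"
    have "2 * (\<integral>t. norm (u t) * norm (v t) \<partial>?M) \<le> e / a\<^sup>2 * a\<^sup>2"
     using le[of "e / a\<^sup>2"] e True False by simp
    then show "(\<integral>t. norm (u t) * norm (v t) \<partial>?M) \<le> 0 + e" using e False by simp
   qed
   then show ?thesis using True by (simp add: b_def)
  next
   case b: False
   then have "2 * (\<integral>t. norm (u t) * norm (v t) \<partial>?M) \<le> b / a * a\<^sup>2 + b\<^sup>2 / (b / a)"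
    using le[of "b / a"] False ab by simp
   also have "\<dots> = 2 * (a * b)" using b False by (simp add: power2_eq_square)
   finally show ?thesis by (simp add: a_def b_def)
  qed
 qed
qed

lemma L2_diff: "u \<in> L2 T \<Longrightarrow> v \<in> L2 T \<Longrightarrow> (\<lambda>t. u t - v t) \<in> L2 T"
 and L2_add: "u \<in> L2 T \<Longrightarrow> v \<in> L2 T \<Longrightarrow> (\<lambda>t. u t + v t) \<in> L2 T"
proof -
 assume uv: "u \<in> L2 T" "v \<in> L2 T"
 have i: "integrable (leb T) (\<lambda>t. 2 * (norm (u t))\<^sup>2 + 2 * (norm (v t))\<^sup>2)"
  using uv by (intro Bochner_Integration.integrable_add) (auto intro: L2_integrable_sq)
 have sq: "(norm (a + b))\<^sup>2 \<le> 2 * (norm a)\<^sup>2 + 2 * (norm b)\<^sup>2" for a b :: 'a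
 proof -
  have "(norm (a + b))\<^sup>2 \<le> (norm a + norm b)\<^sup>2" by (intro power_mono norm_triangle_ineq) auto
  also have "\<dots> \<le> 2 * (norm a)\<^sup>2 + 2 * (norm b)\<^sup>2"
   using sum_squares_bound[of "norm a" "norm b"] by (simp add: power2_sum)
  finally show ?thesis .
 qed
 note m = L2_measurable[OF uv(1)] L2_measurable[OF uv(2)]
 have "integrable (leb T) (\<lambda>t. (norm (u t + v t))\<^sup>2)" by (rule Bochner_Integration.integrable_bound[OF i]) (use m sq in auto)
 moreover have "integrable (leb T) (\<lambda>t. (norm (u t - v t))\<^sup>2)"
  by (rule Bochner_Integration.integrable_bound[OF i]) (use m sq[of _ "- v _"] in auto)
 ultimately show "(\<lambda>t. u t - v t) \<in> L2 T" "(\<lambda>t. u t + v t) \<in> L2 T" using m by (auto simp: L2_def)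
qed

lemma L2_bounded_image:
 assumes u: "u \<in> L2 T" and m: "w \<in> borel_measurable (leb T)"
  and b: "\<And>t. t \<in> {0..T} \<Longrightarrow> norm (w t) \<le> C * norm (u t)"
 shows "w \<in> L2 T" and "l2n T w \<le> \<bar>C\<bar> * l2n T u"
proof -
 have b2: "(norm (w t))\<^sup>2 \<le> C\<^sup>2 * (norm (u t))\<^sup>2" if "t \<in> {0..T}" for t
  using power_mono[OF b[OF that] norm_ge_zero, of 2] by (simp add: power_mult_distrib)
 have i: "integrable (leb T) (\<lambda>t. C\<^sup>2 * (norm (u t))\<^sup>2)" using L2_integrable_sq[OF u] by simp
 have iw: "integrable (leb T) (\<lambda>t. (norm (w t))\<^sup>2)" by (rule Bochner_Integration.integrable_bound[OF i]) (use m b2 in auto)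
 then show "w \<in> L2 T" using m by (simp add: L2_def)
 have "(\<integral>t. (norm (w t))\<^sup>2 \<partial>leb T) \<le> (\<integral>t. C\<^sup>2 * (norm (u t))\<^sup>2 \<partial>leb T)"
  by (intro integral_mono iw i) (use b2 in auto)
 then have "l2n T w \<le> sqrt (C\<^sup>2 * (\<integral>t. (norm (u t))\<^sup>2 \<partial>leb T))"
  unfolding l2n_def by (intro real_sqrt_le_mono) simp
 then show "l2n T w \<le> \<bar>C\<bar> * l2n T u" by (simp add: l2n_def real_sqrt_mult)
qed

lemma L2_scale: "u \<in> L2 T \<Longrightarrow> (\<lambda>t. c *\<^sub>R u t) \<in> L2 T"
 by (rule L2_bounded_image(1)[of u T _ "\<bar>c\<bar>"]) (auto dest: L2_measurable)

lemma L2_triangle: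
 assumes "u \<in> L2 T" "v \<in> L2 T" shows "l2n T (\<lambda>t. u t + v t) \<le> l2n T u + l2n T v"
proof (rule power2_le_imp_le)
 note i = L2_norm_mult_integrable[OF assms] L2_integrable_sq[OF assms(1)] L2_integrable_sq[OF assms(2)]
 have "(l2n T (\<lambda>t. u t + v t))\<^sup>2 \<le> (\<integral>t. (norm (u t))\<^sup>2 + (norm (v t))\<^sup>2 + 2 * (norm (u t) * norm (v t)) \<partial>leb T)"
  unfolding l2n_sq
 proof (intro integral_mono Bochner_Integration.integrable_add)
  show "integrable (leb T) (\<lambda>t. (norm (u t + v t))\<^sup>2)" by (rule L2_integrable_sq[OF L2_add[OF assms]])
  fix t
  show "(norm (u t + v t))\<^sup>2 \<le> (norm (u t))\<^sup>2 + (norm (v t))\<^sup>2 + 2 * (norm (u t) * norm (v t))"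
   using power_mono[OF norm_triangle_ineq[of "u t" "v t"] norm_ge_zero, of 2] by (simp add: power2_sum)
 qed (use i in auto)
 also have "\<dots> = (l2n T u)\<^sup>2 + (l2n T v)\<^sup>2 + 2 * (\<integral>t. norm (u t) * norm (v t) \<partial>leb T)"
  using i by (simp add: l2n_sq)
 also have "\<dots> \<le> (l2n T u + l2n T v)\<^sup>2" using L2_cauchy_schwarz[OF assms] by (simp add: power2_sum)
 finally show "(l2n T (\<lambda>t. u t + v t))\<^sup>2 \<le> (l2n T u + l2n T v)\<^sup>2" .
qed (simp add: l2n_nonneg)

lemma matrix_vector_measurable:
 fixes A :: "real \<Rightarrow> real^'a::finite^'b::finite"
 assumes "cont_on T A" "u \<in> borel_measurable (leb T)" shows "(\<lambda>t. A t *v u t) \<in> borel_measurable (leb T)"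
 by (rule borel_measurable_bilinear[OF _ continuous_measurable[OF assms(1)] assms(2)])
  (auto simp: bilinear_conv_bounded_bilinear bounded_bilinear_matrix_vector)

lemma matrix_bound:
 fixes A :: "real \<Rightarrow> real^'a::finite^'b::finite"
 assumes "cont_on T A" shows "\<exists>C\<ge>0. \<forall>t\<in>{0..T}. \<forall>x. norm (A t *v x) \<le> C * norm x"
proof -
 obtain K where K: "K > 0" "\<And>(M :: real^'a^'b) x. norm (M *v x) \<le> norm M * norm x * K"
  using bounded_bilinear.pos_bounded[OF bounded_bilinear_matrix_vector] by auto
 obtain a where a: "\<And>t. t \<in> {0..T} \<Longrightarrow> norm (A t) \<le> a"
  using compact_imp_bounded[OF compact_continuous_image[OF assms]] unfolding bounded_iff by blast
 have "norm (A t *v x) \<le> (\<bar>a\<bar> * K) * norm x" if "t \<in> {0..T}" for t x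
 proof -
  have "norm (A t) * norm x * K \<le> \<bar>a\<bar> * norm x * K" using a[OF that] K(1) by (intro mult_right_mono) auto
  then show ?thesis using K(2)[of "A t" x] by (simp add: mult_ac)
 qed
 then show ?thesis using K(1) by (intro exI[of _ "\<bar>a\<bar> * K"]) auto
qed

lemma matrix_L2:
 fixes A :: "real \<Rightarrow> real^'a::finite^'b::finite"
 assumes "cont_on T A" "u \<in> L2 T" shows "(\<lambda>t. A t *v u t) \<in> L2 T"
proof -
 obtain C where "\<And>t x. t \<in> {0..T} \<Longrightarrow> norm (A t *v x) \<le> C * norm x" using matrix_bound[OF assms(1)] by blast
 then show ?thesis by (intro L2_bounded_image(1)[OF assms(2) matrix_vector_measurable[OF assms(1) L2_measurable[OF assms(2)]]])
qed

section \<open>Pairings, strong convergence and density in L2\<close>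

abbreviation ip :: "real \<Rightarrow> (real \<Rightarrow> 'a::euclidean_space) \<Rightarrow> (real \<Rightarrow> 'a) \<Rightarrow> real" where
 "ip T u v \<equiv> \<integral>t. u t \<bullet> v t \<partial>leb T"

abbreviation form :: "real \<Rightarrow> (real \<Rightarrow> real^'a::finite^'b::finite) \<Rightarrow> (real \<Rightarrow> real^'b) \<Rightarrow> (real \<Rightarrow> real^'a) \<Rightarrow> real" where
 "form T A u v \<equiv> ip T u (\<lambda>t. A t *v v t)"

lemma L2_inner_integrable:
 assumes "u \<in> L2 T" "v \<in> L2 T" shows "integrable (leb T) (\<lambda>t. u t \<bullet> v t)"
 by (rule Bochner_Integration.integrable_bound[OF L2_norm_mult_integrable[OF assms]])
  (use L2_measurable[OF assms(1)] L2_measurable[OF assms(2)] in \<open>auto simp: Cauchy_Schwarz_ineq2\<close>)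

lemma L2_inner_bound:
 assumes "u \<in> L2 T" "v \<in> L2 T" shows "\<bar>ip T u v\<bar> \<le> l2n T u * l2n T v"
proof -
 have "\<bar>ip T u v\<bar> \<le> (\<integral>t. norm (u t \<bullet> v t) \<partial>leb T)"
  using integral_norm_bound[of "leb T" "\<lambda>t. u t \<bullet> v t"] by simp
 also have "\<dots> \<le> (\<integral>t. norm (u t) * norm (v t) \<partial>leb T)"
  by (intro integral_mono integrable_norm L2_inner_integrable L2_norm_mult_integrable assms) (simp add: Cauchy_Schwarz_ineq2)
 finally show ?thesis using L2_cauchy_schwarz[OF assms] by linarith
qed

definition L2conv :: "real \<Rightarrow> (nat \<Rightarrow> real \<Rightarrow> 'a::euclidean_space) \<Rightarrow> (real \<Rightarrow> 'a) \<Rightarrow> bool" where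
 "L2conv T U u \<longleftrightarrow> (\<forall>n. U n \<in> L2 T) \<and> u \<in> L2 T \<and> (\<lambda>n. l2n T (\<lambda>t. U n t - u t)) \<longlonglongrightarrow> 0"

lemma L2conv_bounded:
 assumes "L2conv T U u" shows "\<exists>C\<ge>0. \<forall>n. l2n T (U n) \<le> C"
proof -
 have m: "\<And>n. U n \<in> L2 T" "u \<in> L2 T" and lim: "(\<lambda>n. l2n T (\<lambda>t. U n t - u t)) \<longlonglongrightarrow> 0"
  using assms unfolding L2conv_def by blast+
 obtain c where c: "\<And>n. \<bar>l2n T (\<lambda>t. U n t - u t)\<bar> \<le> c"
  using convergent_imp_Bseq[OF convergentI[OF lim]] by (auto simp: Bseq_def)
 have "l2n T (U n) \<le> c + l2n T u" for n using L2_triangle[OF L2_diff[OF m(1)[of n] m(2)] m(2)] c[of n] by simp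
 moreover have "0 \<le> c + l2n T u" using c[of 0] l2n_nonneg[of T u] by linarith
 ultimately show ?thesis by (intro exI[of _ "c + l2n T u"]) auto
qed

text \<open>Weak times strong convergence: the error of the strongly convergent factor is paired
  with a bounded sequence.\<close>

lemma L2_inner_convergence:
 fixes A :: "real \<Rightarrow> real^'a::finite^'b::finite"
 assumes A: "cont_on T A" and u: "\<And>n. U n \<in> L2 T" "\<And>n. l2n T (U n) \<le> C"
  and wk: "(\<lambda>n. form T A (U n) v) \<longlonglongrightarrow> form T A u v" and v: "L2conv T V v"
 shows "(\<lambda>n. form T A (U n) (V n)) \<longlonglongrightarrow> form T A u v"
proof -
 have vm: "\<And>n. V n \<in> L2 T" "v \<in> L2 T" and lim: "(\<lambda>n. l2n T (\<lambda>t. V n t - v t)) \<longlonglongrightarrow> 0"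
  using v unfolding L2conv_def by blast+
 obtain D where D: "0 \<le> D" "\<And>t x. t \<in> {0..T} \<Longrightarrow> norm (A t *v x) \<le> D * norm x"
  using matrix_bound[OF A] by blast
 have d: "(\<lambda>t. V n t - v t) \<in> L2 T" for n by (intro L2_diff vm)
 have bd: "\<bar>\<integral>t. U n t \<bullet> (A t *v (V n t - v t)) \<partial>leb T\<bar> \<le> C * (D * l2n T (\<lambda>t. V n t - v t))" for n
 proof -
  have "l2n T (\<lambda>t. A t *v (V n t - v t)) \<le> \<bar>D\<bar> * l2n T (\<lambda>t. V n t - v t)"
   using D(2) by (intro L2_bounded_image(2)[OF d] matrix_vector_measurable A L2_measurable d)
  then have "l2n T (U n) * l2n T (\<lambda>t. A t *v (V n t - v t)) \<le> C * (D * l2n T (\<lambda>t. V n t - v t))"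
   using D(1) u(2)[of n] l2n_nonneg order_trans[OF l2n_nonneg u(2)[of n]] by (intro mult_mono) auto
  then show ?thesis using L2_inner_bound[OF u(1)[of n] matrix_L2[OF A d[of n]]] by linarith
 qed
 have "(\<lambda>n. C * (D * l2n T (\<lambda>t. V n t - v t))) \<longlonglongrightarrow> C * (D * 0)" by (intro tendsto_intros lim)
 then have "(\<lambda>n. \<integral>t. U n t \<bullet> (A t *v (V n t - v t)) \<partial>leb T) \<longlonglongrightarrow> 0"
  by (intro tendsto_0_abs_le[OF bd]) simp
 from tendsto_add[OF this wk]
 have "(\<lambda>n. (\<integral>t. U n t \<bullet> (A t *v (V n t - v t)) \<partial>leb T) + form T A (U n) v)
   \<longlonglongrightarrow> form T A u v" by simp
 moreover have "(\<integral>t. U n t \<bullet> (A t *v (V n t - v t)) \<partial>leb T) + form T A (U n) v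
   = form T A (U n) (V n)" for n by (subst Bochner_Integration.integral_add[symmetric])
   (auto intro!: L2_inner_integrable u matrix_L2 A d vm simp: matrix_vector_mult_diff_distrib inner_diff_right)
 ultimately show ?thesis by simp
qed

lemma L2conv_weak:
 assumes "L2conv T U u" "w \<in> L2 T" shows "(\<lambda>n. ip T (U n) w) \<longlonglongrightarrow> ip T u w"
proof -
 have m: "\<And>n. U n \<in> L2 T" "u \<in> L2 T" and lim: "(\<lambda>n. l2n T (\<lambda>t. U n t - u t)) \<longlonglongrightarrow> 0"
  using assms unfolding L2conv_def by blast+
 have "\<bar>(ip T (U n) w) - ip T u w\<bar> \<le> l2n T (\<lambda>t. U n t - u t) * l2n T w" for n
 proof -
  have "ip T (U n) w - ip T u w = (\<integral>t. (U n t - u t) \<bullet> w t \<partial>leb T)"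
   by (subst Bochner_Integration.integral_diff[symmetric]) (auto intro!: L2_inner_integrable m assms simp: inner_diff_left)
  then show ?thesis using L2_inner_bound[OF L2_diff[OF m(1)[of n] m(2)] assms(2)] by simp
 qed
 moreover have "(\<lambda>n. l2n T (\<lambda>t. U n t - u t) * l2n T w) \<longlonglongrightarrow> 0"
  using tendsto_mult_left_zero[OF lim] by simp
 ultimately have "(\<lambda>n. (ip T (U n) w) - ip T u w) \<longlonglongrightarrow> 0" by (rule tendsto_0_abs_le)
 then show ?thesis by (simp add: LIM_zero_iff)
qed

lemma L2conv_quadratic:
 fixes A :: "real \<Rightarrow> real^'a::finite^'b::finite"
 assumes "cont_on T A" "L2conv T U u" "L2conv T V v" shows "(\<lambda>n. form T A (U n) (V n)) \<longlonglongrightarrow> form T A u v"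
proof -
 obtain C where C: "\<And>n. l2n T (U n) \<le> C" using L2conv_bounded[OF assms(2)] by blast
 have v: "v \<in> L2 T" and U: "\<And>n. U n \<in> L2 T" using assms unfolding L2conv_def by blast+
 show ?thesis by (rule L2_inner_convergence[OF assms(1) U C L2conv_weak[OF assms(2) matrix_L2[OF assms(1) v]] assms(3)])
qed

lemma L2conv_dominated:
 assumes U: "\<And>n. U n \<in> borel_measurable (leb T)" and u: "u \<in> L2 T"
  and b: "\<And>n t. t \<in> {0..T} \<Longrightarrow> norm (U n t) \<le> C * norm (w t)" and w: "w \<in> L2 T"
  and lim: "AE t in leb T. (\<lambda>n. U n t) \<longlonglongrightarrow> u t" shows "L2conv T U u"
proof -
 have U2: "U n \<in> L2 T" for n by (rule L2_bounded_image(1)[OF w U b])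
 have sq: "(norm (a - b))\<^sup>2 \<le> 2 * (norm a)\<^sup>2 + 2 * (norm b)\<^sup>2" for a b :: 'a
 proof -
  have "(norm (a - b))\<^sup>2 \<le> (norm a + norm b)\<^sup>2" by (intro power_mono norm_triangle_ineq4) auto
  also have "\<dots> \<le> 2 * (norm a)\<^sup>2 + 2 * (norm b)\<^sup>2"
   using sum_squares_bound[of "norm a" "norm b"] by (simp add: power2_sum)
  finally show ?thesis .
 qed
 have "(\<lambda>n. \<integral>t. (norm (U n t - u t))\<^sup>2 \<partial>leb T) \<longlonglongrightarrow> (\<integral>t. 0 \<partial>leb T)"
 proof (rule integral_dominated_convergence)
  show "integrable (leb T) (\<lambda>t. 2 * (C\<^sup>2 * (norm (w t))\<^sup>2) + 2 * (norm (u t))\<^sup>2)"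
   using L2_integrable_sq[OF u] L2_integrable_sq[OF w] by simp
  show "(\<lambda>t. (norm (U n t - u t))\<^sup>2) \<in> borel_measurable (leb T)" for n using U[of n] L2_measurable[OF u] by measurable
  show "AE t in leb T. (\<lambda>n. (norm (U n t - u t))\<^sup>2) \<longlonglongrightarrow> 0" using lim
  proof eventually_elim
   case (elim t)
   then have "(\<lambda>n. (norm (U n t - u t))\<^sup>2) \<longlonglongrightarrow> (norm (u t - u t))\<^sup>2" by (intro tendsto_intros)
   then show ?case by simp
  qed
  show "AE t in leb T. norm ((norm (U n t - u t))\<^sup>2) \<le> 2 * (C\<^sup>2 * (norm (w t))\<^sup>2) + 2 * (norm (u t))\<^sup>2" for n
  proof (rule AE_I2)
   fix t assume "t \<in> space (leb T)"
   then have "(norm (U n t))\<^sup>2 \<le> C\<^sup>2 * (norm (w t))\<^sup>2"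
    using power_mono[OF b norm_ge_zero, of t n 2] by (simp add: power_mult_distrib)
   then show "norm ((norm (U n t - u t))\<^sup>2) \<le> 2 * (C\<^sup>2 * (norm (w t))\<^sup>2) + 2 * (norm (u t))\<^sup>2"
    using sq[of "U n t" "u t"] by simp
  qed
 qed simp
 from tendsto_real_sqrt[OF this]
 have "(\<lambda>n. l2n T (\<lambda>t. U n t - u t)) \<longlonglongrightarrow> 0" by (simp add: l2n_def)
 then show ?thesis using U2 u by (simp add: L2conv_def)
qed

lemma l2n_cong: "(\<And>t. t \<in> {0..T} \<Longrightarrow> f t = g t) \<Longrightarrow> l2n T f = l2n T g"
 unfolding l2n_def by (auto intro!: Bochner_Integration.integral_cong)

lemma L2_const: "(\<lambda>t. c) \<in> L2 T" by (rule continuous_imp_L2) simp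

text \<open>Projection onto a large ball first replaces \<open>u\<close> by a bounded function;
  almost everywhere approximation by continuous functions then becomes approximation in L2 by
  dominated convergence.\<close>

lemma L2_dense_continuous:
 fixes u :: "real \<Rightarrow> 'a::euclidean_space"
 assumes u: "u \<in> L2 T" and "e > 0" shows "\<exists>g. continuous_on UNIV g \<and> l2n T (\<lambda>t. g t - u t) < e"
proof -
 define cl :: "real \<Rightarrow> 'a \<Rightarrow> 'a" where "cl R = closest_point (cball 0 R)" for R
 have cl_cont: "continuous_on S (cl R)" if "0 \<le> R" for R S unfolding cl_def by (rule continuous_on_closest_point) (use that in auto)
 have cl_le: "norm (cl R x) \<le> R" if "0 \<le> R" for R x using closest_point_in_set[of "cball (0::'a) R" x] that by (auto simp: cl_def)
 have cl_id: "cl R x = x" if "norm x \<le> R" for R x unfolding cl_def by (rule closest_point_self) (use that in simp)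
 have cl_norm: "norm (cl R x) \<le> norm x" if "0 \<le> R" for R x
  using closest_point_lipschitz[of "cball (0::'a) R" x 0] cl_id[of 0 R] that by (auto simp: cl_def dist_norm)
 have meas: "(\<lambda>t. cl R (u t)) \<in> borel_measurable (leb T)" if "0 \<le> R" for R
  by (rule measurable_compose[OF L2_measurable[OF u] borel_measurable_continuous_onI[OF cl_cont[OF that]]])
 have conv1: "L2conv T (\<lambda>n t. cl (real n) (u t)) u"
 proof (rule L2conv_dominated[OF meas u _ u])
  show "norm (cl (real n) (u t)) \<le> 1 * norm (u t)" for n t using cl_norm[of "real n" "u t"] by simp
  have "(\<lambda>n. cl (real n) (u t)) \<longlonglongrightarrow> u t" for t
  proof (rule tendsto_eventually)
   obtain m where "norm (u t) \<le> real m" using real_arch_simple by blast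
   then show "\<forall>\<^sub>F n in sequentially. cl (real n) (u t) = u t"
    unfolding eventually_sequentially by (intro exI[of _ m]) (auto intro!: cl_id)
  qed
  then show "AE t in leb T. (\<lambda>n. cl (real n) (u t)) \<longlonglongrightarrow> u t" by simp
 qed simp
 then have "\<forall>\<^sub>F n in sequentially. l2n T (\<lambda>t. cl (real n) (u t) - u t) < e / 2"
  unfolding L2conv_def using \<open>e > 0\<close> by (intro order_tendstoD) auto
 then obtain m where m: "l2n T (\<lambda>t. cl (real m) (u t) - u t) < e / 2" by (auto simp: eventually_sequentially)
 have "u measurable_on {0..T}" using L2_measurable[OF u] by (simp add: measurable_on_iff_borel_measurable)
 then obtain Z g where Z: "negligible Z" and g: "\<And>n. continuous_on UNIV (g n)"
  and lim: "\<And>x. x \<notin> Z \<Longrightarrow> (\<lambda>n. g n x) \<longlonglongrightarrow> (if x \<in> {0..T} then u x else 0)"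
  unfolding measurable_on_def by blast
 \<comment> \<open>The approximants are projected onto the same ball, which provides the dominating
   constant.\<close>
 define h where "h n = (\<lambda>t. cl (real m) (g n t))" for n
 have hc: "continuous_on UNIV (h n)" for n unfolding h_def by (rule continuous_on_compose2[OF cl_cont[of "real m" UNIV] g]) auto
 have u1: "(\<lambda>t. cl (real m) (u t)) \<in> L2 T" using conv1 unfolding L2conv_def
  by (intro L2_bounded_image(1)[OF u meas, of "real m" 1]) (use cl_norm[of "real m"] in auto)
 have "L2conv T h (\<lambda>t. cl (real m) (u t))"
 proof (rule L2conv_dominated[OF _ u1 _ L2_const[of "1::real"]])
  show "h n \<in> borel_measurable (leb T)" for n by (rule continuous_measurable[OF continuous_on_subset[OF hc]]) simp
  show "norm (h n t) \<le> real m * norm (1::real)" for n t using cl_le[of "real m"] by (simp add: h_def)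
  have "AE t in lebesgue. t \<notin> Z" using Z by (simp add: negligible_iff_null_sets AE_not_in)
  then have "AE t in leb T. t \<notin> Z" by (simp add: AE_restrict_space_iff) (auto elim: eventually_mono)
  then show "AE t in leb T. (\<lambda>n. h n t) \<longlonglongrightarrow> cl (real m) (u t)"
  proof (rule AE_mp, intro AE_I2 impI)
   fix t assume "t \<in> space (leb T)" "t \<notin> Z"
   then have "(\<lambda>n. g n t) \<longlonglongrightarrow> u t" using lim[of t] by auto
   then show "(\<lambda>n. h n t) \<longlonglongrightarrow> cl (real m) (u t)"
    unfolding h_def by (rule continuous_on_tendsto_compose[OF cl_cont[OF of_nat_0_le_iff, of UNIV]]) auto
  qed
 qed
 then have "\<forall>\<^sub>F n in sequentially. l2n T (\<lambda>t. h n t - cl (real m) (u t)) < e / 2" and hL: "\<And>n. h n \<in> L2 T"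
  unfolding L2conv_def using \<open>e > 0\<close> by (auto intro!: order_tendstoD)
 then obtain n where n: "l2n T (\<lambda>t. h n t - cl (real m) (u t)) < e / 2" by (auto simp: eventually_sequentially)
 have "l2n T (\<lambda>t. (h n t - cl (real m) (u t)) + (cl (real m) (u t) - u t)) < e"
  using L2_triangle[OF L2_diff[OF hL[of n] u1] L2_diff[OF u1 u]] m n by linarith
 then show ?thesis using hc by (intro exI[of _ "h n"]) auto
qed

text \<open>The boundary values of a polynomial are corrected by high powers of \<open>t/T\<close> and \<open>1 - t/T\<close>,
 which are small in \<open>L2\<close>.\<close>

lemma L2_dense_boundary_values:
 fixes y :: "real \<Rightarrow> 'a::euclidean_space"
 assumes y: "y \<in> L2 T" and T: "0 < T" and "e > 0"
 shows "\<exists>V. continuous_on UNIV V \<and> intg T V = h \<and> l2n T (\<lambda>t. intg t V - y t) < e"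
proof -
 obtain g where g: "continuous_on UNIV g" "l2n T (\<lambda>t. g t - y t) < e / 3"
  using L2_dense_continuous[OF y, of "e / 3"] \<open>e > 0\<close> by auto
 \<comment> \<open>A uniform error \<open>d\<close> amounts to an L2 error of at most
   \<open>d * sqrt T = e / 3\<close>.\<close>
 define d where "d = e / (3 * sqrt T)"
 have d: "d > 0" using T \<open>e > 0\<close> by (simp add: d_def)
 obtain q where q: "polynomial_function q" "\<And>t. t \<in> {0..T} \<Longrightarrow> norm (g t - q t) < d"
  using Stone_Weierstrass_polynomial_function[OF compact_Icc continuous_on_subset[OF g(1) subset_UNIV] d, of 0 T] by blast
 obtain q' where q': "polynomial_function q'" "\<And>t. (q has_vector_derivative q' t) (at t)"
  using has_vector_derivative_polynomial_function[OF q(1)] by blast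
 have gL: "g \<in> L2 T" by (rule continuous_imp_L2[OF continuous_on_subset[OF g(1)]]) simp
 have qL: "q \<in> L2 T" by (rule continuous_imp_L2[OF continuous_on_polymonial_function[OF q(1)]])
 have qg: "l2n T (\<lambda>t. q t - g t) \<le> e / 3"
 proof -
  have "l2n T (\<lambda>t. q t - g t) \<le> \<bar>d\<bar> * l2n T (\<lambda>t. 1::real)"
  proof (rule L2_bounded_image(2)[OF L2_const])
   show "(\<lambda>t. q t - g t) \<in> borel_measurable (leb T)" by (rule L2_measurable[OF L2_diff[OF qL gL]])
   show "norm (q t - g t) \<le> d * norm (1::real)" if "t \<in> {0..T}" for t using q(2)[OF that] by (simp add: norm_minus_commute)
  qed
  also have "l2n T (\<lambda>t. 1::real) = sqrt T" using T by (simp add: l2n_def measure_restrict_space)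
  finally show ?thesis using \<open>e > 0\<close> T by (simp add: d_def)
 qed
 \<comment> \<open>Takes the value \<open>- q 0\<close> at 0 and \<open>h - q T\<close> at
   \<open>T\<close>, so that the corrected polynomial runs from 0 to \<open>h\<close>.\<close>
 define c where "c n t = (t / T) ^ Suc n *\<^sub>R (h - q T) - (1 - t / T) ^ Suc n *\<^sub>R q 0" for n t
 have cL: "L2conv T c (\<lambda>t. 0)"
 proof (rule L2conv_dominated[OF _ L2_const _ L2_const[of "1::real"]])
  show "c n \<in> borel_measurable (leb T)" for n unfolding c_def by (intro continuous_measurable continuous_intros) (use T in auto)
  show "norm (c n t) \<le> (norm (h - q T) + norm (q 0)) * norm (1::real)" if t: "t \<in> {0..T}" for n t
  proof -
   have 1: "\<bar>t / T\<bar> ^ Suc n \<le> 1" "\<bar>1 - t / T\<bar> ^ Suc n \<le> 1"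
    using t T by (auto intro!: power_le_one simp: abs_le_iff simp del: power_Suc)
   have "norm (c n t) \<le> \<bar>t / T\<bar> ^ Suc n * norm (h - q T) + \<bar>1 - t / T\<bar> ^ Suc n * norm (q 0)"
    unfolding c_def by (intro order_trans[OF norm_triangle_ineq4]) (simp add: power_abs abs_mult)
   also have "\<dots> \<le> 1 * norm (h - q T) + 1 * norm (q 0)" by (intro add_mono mult_right_mono 1) auto
   finally show ?thesis by simp
  qed
  have "AE t in leb T. t \<notin> {0, T}"
  proof -
   have "AE t in lebesgue. t \<notin> {0, T}" by (rule AE_not_in) (simp add: negligible_iff_null_sets[symmetric])
   then show ?thesis by (simp add: AE_restrict_space_iff) (auto elim: eventually_mono)
  qed
  then show "AE t in leb T. (\<lambda>n. c n t) \<longlonglongrightarrow> 0"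
  proof (rule AE_mp, intro AE_I2 impI)
   fix t assume t: "t \<in> space (leb T)" "t \<notin> {0, T}"
   have "\<bar>t / T\<bar> < 1" "\<bar>1 - t / T\<bar> < 1" using t T by (auto simp: abs_less_iff)
   then have "(\<lambda>n. c n t) \<longlonglongrightarrow> 0 *\<^sub>R (h - q T) - 0 *\<^sub>R q 0"
    unfolding c_def by (intro tendsto_intros LIMSEQ_Suc[OF LIMSEQ_power_zero]) auto
   then show "(\<lambda>n. c n t) \<longlonglongrightarrow> 0" by simp
  qed
 qed
 then have "\<forall>\<^sub>F n in sequentially. l2n T (c n) < e / 3"
  unfolding L2conv_def using \<open>e > 0\<close> by (intro order_tendstoD) auto
 then obtain n where n: "l2n T (c n) < e / 3" by (auto simp: eventually_sequentially)
 define Y where "Y t = q t + c n t" for t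
 \<comment> \<open>The derivative of \<open>Y\<close>; as \<open>Y 0 = 0\<close>, its primitive
   gives back \<open>Y\<close>.\<close>
 define V where "V t = q' t + ((real (Suc n) * (t / T) ^ n / T) *\<^sub>R (h - q T) + (real (Suc n) * (1 - t / T) ^ n / T) *\<^sub>R q 0)" for t
 have Y0: "Y 0 = 0" using T by (simp add: Y_def c_def)
 have Vc: "continuous_on UNIV V" unfolding V_def by (intro continuous_intros continuous_on_polymonial_function[OF q'(1)]) (use T in auto)
 have "(Y has_vector_derivative V t) (at t)" for t unfolding Y_def[abs_def] V_def c_def by (rule has_vector_derivative_add[OF q'(2)])
   (use T in \<open>auto intro!: derivative_eq_intros simp: has_vector_derivative_def scaleR_add_right mult_ac simp del: power_Suc\<close>)
 from eq_integral_of_derivative[OF has_vector_derivative_at_within[OF this]]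
 have Y: "intg t V = Y t" if "t \<in> {0..T}" for t using that T by (metis Y0 add_0)
 have "l2n T (\<lambda>t. Y t - y t) < e"
 proof -
  have cn: "c n \<in> L2 T" using cL by (simp add: L2conv_def)
  have "l2n T (\<lambda>t. ((q t - g t) + (g t - y t)) + c n t) < e" using L2_triangle[OF L2_add[OF L2_diff[OF qL gL] L2_diff[OF gL y]] cn]
    L2_triangle[OF L2_diff[OF qL gL] L2_diff[OF gL y]] qg g(2) n by linarith
  then show ?thesis by (simp add: Y_def algebra_simps)
 qed
 then have "l2n T (\<lambda>t. intg t V - y t) < e" using l2n_cong[of T "\<lambda>t. intg t V - y t" "\<lambda>t. Y t - y t"] Y by simp
 moreover have "intg T V = h" using Y[of T] T by (simp add: Y_def c_def)
 ultimately show ?thesis using Vc by blast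
qed

lemma L2_sum:
 assumes "\<And>j. j \<in> A \<Longrightarrow> H j \<in> L2 T" "finite A"
 shows "(\<lambda>t. \<Sum>j\<in>A. H j t) \<in> L2 T \<and> l2n T (\<lambda>t. \<Sum>j\<in>A. H j t) \<le> (\<Sum>j\<in>A. l2n T (H j))"
 using assms(2,1)
proof (induction A)
 case empty
 show ?case using L2_const[of 0 T] by (simp add: l2n_def)
next
 case (insert a A)
 then show ?case
  using L2_add[of "H a" T "\<lambda>t. \<Sum>j\<in>A. H j t"] L2_triangle[of "H a" T "\<lambda>t. \<Sum>j\<in>A. H j t"] by force
qed

text \<open>A case of the Riesz-Fischer theorem: monotone convergence for the sums of norms gives
  convergence almost everywhere, and Fatou's lemma carries the estimates of finite tails over to the
  limit. The factor 3/2 is the sum of the geometric series.\<close>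

lemma L2_absolutely_summable:
 fixes H :: "nat \<Rightarrow> real \<Rightarrow> 'a::euclidean_space"
 assumes H: "\<And>j. H j \<in> L2 T" and b: "\<And>j. l2n T (H j) \<le> (1/3) ^ j"
 shows "\<exists>\<phi>\<in>L2 T. \<forall>J. l2n T (\<lambda>t. \<phi> t - (\<Sum>j<J. H j t)) \<le> 3/2 * (1/3) ^ J"
proof -
 let ?M = "leb T"
 note m[measurable] = L2_measurable[OF H]
 have geo: "(\<Sum>j=a..<b. (1/3::real) ^ j) \<le> 3/2 * (1/3) ^ a" for a b
 proof (cases "a \<le> b")
  case True
  then have "(\<Sum>j=a..<b. (1/3::real) ^ j) = 3/2 * (1/3) ^ a - 3/2 * (1/3) ^ b" by (induction b rule: dec_induct) auto
  then show ?thesis by simp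
 qed simp
 have nH: "(\<lambda>t. norm (H j t)) \<in> L2 T" "l2n T (\<lambda>t. norm (H j t)) = l2n T (H j)" for j
  using H[of j] m[of j] by (auto simp: L2_def l2n_def)
 have tail: "(\<lambda>t. \<Sum>j=a..<b. G j t) \<in> L2 T \<and> l2n T (\<lambda>t. \<Sum>j=a..<b. G j t) \<le> 3/2 * (1/3) ^ a"
  if "\<And>j. G j \<in> L2 T" "\<And>j. l2n T (G j) \<le> (1/3) ^ j" for G :: "nat \<Rightarrow> real \<Rightarrow> 'c::euclidean_space" and a b
 proof -
  have "(\<Sum>j=a..<b. l2n T (G j)) \<le> 3/2 * (1/3) ^ a" by (rule order_trans[OF sum_mono geo]) (rule that)
  then show ?thesis using L2_sum[of "{a..<b}" G T] that by auto
 qed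
 have nn: "(\<integral>\<^sup>+t. ennreal ((norm (g t))\<^sup>2) \<partial>?M) \<le> ennreal (c\<^sup>2)"
  if "g \<in> L2 T" "l2n T g \<le> c" for g :: "real \<Rightarrow> 'c::euclidean_space" and c
 proof -
  have "(\<integral>\<^sup>+t. ennreal ((norm (g t))\<^sup>2) \<partial>?M) = ennreal ((l2n T g)\<^sup>2)"
   unfolding l2n_sq by (rule nn_integral_eq_integral) (use that L2_integrable_sq in auto)
  also have "\<dots> \<le> ennreal (c\<^sup>2)" by (intro ennreal_leI power_mono that l2n_nonneg)
  finally show ?thesis .
 qed
 define F where "F J t = (\<Sum>j<J. norm (H j t))" for J t
 have F: "F J \<in> L2 T" "l2n T (F J) \<le> 3/2" for J
  using tail[of "\<lambda>j t. norm (H j t)" 0 J] nH b unfolding F_def by (auto simp: atLeast0LessThan)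
 have F0: "0 \<le> F J t" for J t by (simp add: F_def sum_nonneg)
 have "(\<integral>\<^sup>+t. (SUP J. ennreal ((F J t)\<^sup>2)) \<partial>?M) = (SUP J. \<integral>\<^sup>+t. ennreal ((F J t)\<^sup>2) \<partial>?M)"
 proof (rule nn_integral_monotone_convergence_SUP)
  show "incseq (\<lambda>J t. ennreal ((F J t)\<^sup>2))" unfolding incseq_def le_fun_def
   by (intro allI impI ennreal_leI power_mono F0) (auto simp: F_def intro!: sum_mono2)
  show "(\<lambda>t. ennreal ((F J t)\<^sup>2)) \<in> borel_measurable ?M" for J unfolding F_def by measurable
 qed
 also have "\<dots> \<le> ennreal ((3/2)\<^sup>2)" by (intro SUP_least) (use nn[OF F(1) F(2)] F0 in auto)
 finally have "(\<integral>\<^sup>+t. (SUP J. ennreal ((F J t)\<^sup>2)) \<partial>?M) \<noteq> \<infinity>" by (auto simp: top_unique)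
 then have "AE t in ?M. (SUP J. ennreal ((F J t)\<^sup>2)) \<noteq> \<infinity>" by (intro nn_integral_noteq_infinite) (auto simp: F_def)
 then have conv: "AE t in ?M. summable (\<lambda>j. H j t)"
 proof eventually_elim
  case (elim t)
  then obtain c where c: "0 \<le> c" "(SUP J. ennreal ((F J t)\<^sup>2)) = ennreal c" by (metis ennreal_cases infinity_ennreal_def)
  have "F J t \<le> sqrt c" for J
  proof -
   have "ennreal ((F J t)\<^sup>2) \<le> ennreal c" unfolding c(2)[symmetric] by (rule SUP_upper) simp
   then have "(F J t)\<^sup>2 \<le> c" using c(1) by (simp add: ennreal_le_iff)
   then show ?thesis by (rule real_le_rsqrt)
  qed
  then have "summable (\<lambda>j. norm (H j t))" unfolding F_def by (intro summableI_nonneg_bounded) auto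
  then show ?case by (rule summable_norm_cancel)
 qed
 define \<phi> where "\<phi> t = lim (\<lambda>J. \<Sum>j<J. H j t)" for t
 have \<phi>m[measurable]: "\<phi> \<in> borel_measurable ?M" unfolding \<phi>_def by (intro borel_measurable_lim_metric) measurable
 have \<phi>lim: "AE t in ?M. (\<lambda>J. \<Sum>j<J. H j t) \<longlonglongrightarrow> \<phi> t"
  using conv by eventually_elim (auto simp: \<phi>_def convergent_LIMSEQ_iff[symmetric] summable_iff_convergent)
 have bound: "(\<integral>\<^sup>+t. ennreal ((norm (\<phi> t - (\<Sum>j<J. H j t)))\<^sup>2) \<partial>?M) \<le> ennreal ((3/2 * (1/3) ^ J)\<^sup>2)" for J
 proof -
  let ?u = "\<lambda>M t. ennreal ((norm ((\<Sum>j<M. H j t) - (\<Sum>j<J. H j t)))\<^sup>2)"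
  have "(\<integral>\<^sup>+t. ennreal ((norm (\<phi> t - (\<Sum>j<J. H j t)))\<^sup>2) \<partial>?M) = (\<integral>\<^sup>+t. liminf (\<lambda>M. ?u M t) \<partial>?M)"
  proof (rule nn_integral_cong_AE)
   show "AE t in ?M. ennreal ((norm (\<phi> t - (\<Sum>j<J. H j t)))\<^sup>2) = liminf (\<lambda>M. ?u M t)" using \<phi>lim
   proof eventually_elim
    case (elim t)
    then have "(\<lambda>M. ?u M t) \<longlonglongrightarrow> ennreal ((norm (\<phi> t - (\<Sum>j<J. H j t)))\<^sup>2)"
     by (intro tendsto_ennrealI tendsto_intros)
    then show ?case by (rule lim_imp_Liminf[OF sequentially_bot, symmetric])
   qed
  qed
  also have "\<dots> \<le> liminf (\<lambda>M. \<integral>\<^sup>+t. ?u M t \<partial>?M)" by (rule nn_integral_liminf) measurable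
  also have "\<dots> \<le> ennreal ((3/2 * (1/3) ^ J)\<^sup>2)"
  proof (rule Liminf_le)
   show "\<forall>\<^sub>F M in sequentially. (\<integral>\<^sup>+t. ?u M t \<partial>?M) \<le> ennreal ((3/2 * (1/3) ^ J)\<^sup>2)"
    unfolding eventually_sequentially
   proof (intro exI[of _ J] allI impI)
    fix M assume "J \<le> M"
    then have "(\<Sum>j<M. H j t) - (\<Sum>j<J. H j t) = (\<Sum>j=J..<M. H j t)" for t
     by (metis add_diff_cancel_left' atLeast0LessThan le0 sum.atLeastLessThan_concat)
    then show "(\<integral>\<^sup>+t. ?u M t \<partial>?M) \<le> ennreal ((3/2 * (1/3) ^ J)\<^sup>2)"
     using nn[OF conjunct1[OF tail[OF H b]] conjunct2[OF tail[OF H b]], of J M] by simp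
   qed
  qed simp
  finally show ?thesis .
 qed
 have int: "integrable ?M (\<lambda>t. (norm (\<phi> t - (\<Sum>j<J. H j t)))\<^sup>2)" for J
  by (rule integrableI_nonneg) (use bound[of J] in \<open>auto intro: order_le_less_trans\<close>)
 have l2: "l2n T (\<lambda>t. \<phi> t - (\<Sum>j<J. H j t)) \<le> 3/2 * (1/3) ^ J" for J
 proof -
  have "ennreal ((l2n T (\<lambda>t. \<phi> t - (\<Sum>j<J. H j t)))\<^sup>2) \<le> ennreal ((3/2 * (1/3) ^ J)\<^sup>2)"
   unfolding l2n_sq using bound[of J] nn_integral_eq_integral[OF int[of J]] by simp
  then have "(l2n T (\<lambda>t. \<phi> t - (\<Sum>j<J. H j t)))\<^sup>2 \<le> (3/2 * (1/3) ^ J)\<^sup>2"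
   by (subst (asm) ennreal_le_iff) auto
  then show ?thesis by (rule power2_le_imp_le) simp
 qed
 have "\<phi> \<in> L2 T" using int[of 0] by (simp add: L2_def)
 then show ?thesis using l2 by blast
qed

text \<open>Gliding hump: the signs \<open>s j\<close> are chosen so that pairing with \<open>G (k j)\<close> cannot cancel.\<close>

theorem L2_uniform_boundedness:
 fixes G :: "nat \<Rightarrow> real \<Rightarrow> 'a::euclidean_space"
 assumes G: "\<And>n. G n \<in> L2 T"
  and wk: "\<And>\<phi>. \<phi> \<in> L2 T \<Longrightarrow> bounded (range (\<lambda>n. ip T (G n) \<phi>))"
 shows "\<exists>C. \<forall>n. l2n T (G n) \<le> C"
proof (rule ccontr)
 assume "\<not> ?thesis"
 then have "\<forall>j. \<exists>n. l2n T (G n) > 4 ^ j" by (meson not_le)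
 then obtain k where k: "\<And>j. l2n T (G (k j)) > 4 ^ j" by metis
 define a where "a j = l2n T (G (k j))" for j
 have a: "a j > 4 ^ j" "a j > 0" for j using k[of j] zero_less_power[of "4::real" j] unfolding a_def by linarith+
 \<comment> \<open>A hump of L2 norm 3^-j in the direction of \<open>G (k j)\<close>; its pairing
   with \<open>G (k j)\<close> is 3^-j times \<open>a j\<close>, hence larger than (4/3)^j.\<close>
 define e where "e j t = ((1/3) ^ j / a j) *\<^sub>R G (k j) t" for j t
 have eL: "e j \<in> L2 T" for j unfolding e_def by (rule L2_scale[OF G])
 \<comment> \<open>Recursive because each sign depends on the partial sum already built: it is that
   of the pairing of this sum with \<open>G (k j)\<close>.\<close>
 define S where "S = rec_nat (\<lambda>t. 0 :: 'a) (\<lambda>j f. (\<lambda>t. f t + (if ip T (G (k j)) f \<ge> 0 then 1 else -1) *\<^sub>R e j t))"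
 define s where "s j = (if ip T (G (k j)) (S j) \<ge> 0 then 1 else -1 :: real)" for j
 define H where "H j t = s j *\<^sub>R e j t" for j t
 have S_Suc: "S (Suc j) = (\<lambda>t. S j t + H j t)" for j by (simp add: S_def H_def s_def)
 have S_sum: "S J = (\<lambda>t. \<Sum>j<J. H j t)" for J by (induction J) (simp_all add: S_Suc, simp add: S_def)
 have HL: "H j \<in> L2 T" for j unfolding H_def by (rule L2_scale[OF eL])
 have SL: "S J \<in> L2 T" for J unfolding S_sum using L2_sum[of "{..<J}" H T] HL by simp
 have nH: "l2n T (H j) \<le> (1/3) ^ j" for j
 proof -
  have "l2n T (H j) \<le> \<bar>(1/3) ^ j / a j\<bar> * l2n T (G (k j))" by (rule L2_bounded_image(2)[OF G L2_measurable[OF HL]])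
    (use a(2)[of j] in \<open>auto simp: H_def e_def s_def\<close>)
  also have "\<dots> = (1/3) ^ j" using a(2)[of j] by (simp add: a_def[symmetric])
  finally show ?thesis .
 qed
 obtain \<phi> where \<phi>: "\<phi> \<in> L2 T" and tail: "\<And>J. l2n T (\<lambda>t. \<phi> t - S J t) \<le> 3/2 * (1/3) ^ J"
  using L2_absolutely_summable[OF HL nH] unfolding S_sum by blast
 have ip_add: "ip T u (\<lambda>t. v t + w t) = ip T u v + ip T u w" if "u \<in> L2 T" "v \<in> L2 T" "w \<in> L2 T" for u v w
  unfolding inner_add_right by (intro Bochner_Integration.integral_add L2_inner_integrable that)
 have "\<bar>ip T (G (k j)) \<phi>\<bar> \<ge> (4/3) ^ j / 2" for j
 proof -
  have "ip T (G (k j)) (H j) = s j * ((1/3) ^ j * a j)"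
  proof -
   have "ip T (G (k j)) (H j) = (\<integral>t. (s j * ((1/3) ^ j / a j)) * (norm (G (k j) t))\<^sup>2 \<partial>leb T)"
    unfolding H_def e_def by (simp add: power2_norm_eq_inner mult_ac)
   also have "\<dots> = (s j * ((1/3) ^ j / a j)) * (a j)\<^sup>2" by (simp add: a_def l2n_sq)
   finally show ?thesis using a(2)[of j] by (simp add: power2_eq_square)
  qed
  then have "ip T (G (k j)) (S (Suc j)) = ip T (G (k j)) (S j) + s j * ((1/3) ^ j * a j)" unfolding S_Suc by (simp add: ip_add[OF G SL HL])
  moreover have "0 < (1/3) ^ j * a j" using a(2)[of j] by simp
  ultimately have 1: "\<bar>ip T (G (k j)) (S (Suc j))\<bar> \<ge> (1/3) ^ j * a j" unfolding s_def by (auto split: if_splits)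
  \<comment> \<open>All later humps together contribute at most half of what the j-th one
    contributes.\<close>
  have "\<bar>ip T (G (k j)) (\<lambda>t. \<phi> t - S (Suc j) t)\<bar> \<le> a j * (3/2 * (1/3) ^ Suc j)" unfolding a_def
   by (rule order_trans[OF L2_inner_bound[OF G L2_diff[OF \<phi> SL]] mult_left_mono[OF tail l2n_nonneg]])
  moreover have "ip T (G (k j)) \<phi> = ip T (G (k j)) (S (Suc j)) + ip T (G (k j)) (\<lambda>t. \<phi> t - S (Suc j) t)"
   using ip_add[OF G SL L2_diff[OF \<phi> SL], of "k j" "Suc j" "Suc j"] by simp
  moreover have "a j * (3/2 * (1/3) ^ Suc j) = (1/3) ^ j * a j / 2" by simp
  ultimately have "\<bar>ip T (G (k j)) \<phi>\<bar> \<ge> (1/3) ^ j * a j / 2" using 1 by linarith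
  moreover have "(1/3) ^ j * 4 ^ j \<le> (1/3) ^ j * a j" using a(1)[of j] by (intro mult_left_mono) auto
  ultimately show ?thesis by (simp add: power_divide)
 qed
 moreover obtain B where "\<And>n. \<bar>ip T (G n) \<phi>\<bar> \<le> B" using wk[OF \<phi>] unfolding bounded_iff by auto
 moreover obtain j where "(4/3::real) ^ j > 2 * B" using real_arch_pow[of "4/3" "2 * B"] by auto
 ultimately show False by (metis (no_types) divide_le_eq_numeral1(1) linorder_not_le mult.commute order_trans)
qed

section \<open>Weak derivatives and weak convergence in \<open>W_2\<close>\<close>

lemma indefinite_integral_zero_imp_AE:
 fixes g :: "real \<Rightarrow> 'a::euclidean_space"
 assumes g: "integrable (leb T) g" and zero: "\<And>t. t \<in> {0..T} \<Longrightarrow> integral\<^sup>L (leb t) g = 0"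
 shows "AE t in leb T. g t = 0"
proof -
 define G where "G = (\<lambda>t. if t \<in> {0..T} then g t else 0)"
 have G: "integrable lebesgue G" using g unfolding G_def by (subst Lebesgue_Measure.integrable_restrict_UNIV) simp_all
 have restr: "(LINT t:A|lebesgue. G t) = integral\<^sup>L (lebesgue_on (A \<inter> {0..T})) g" if "A \<in> sets lebesgue" for A
 proof -
  have "(LINT t:A|lebesgue. G t) = (LINT t|lebesgue. (if t \<in> A \<inter> {0..T} then g t else 0))"
   unfolding set_lebesgue_integral_def G_def by (rule Bochner_Integration.integral_cong) (auto simp: indicator_def)
  also have "\<dots> = integral\<^sup>L (lebesgue_on (A \<inter> {0..T})) g"
   by (rule Lebesgue_Measure.integral_restrict_UNIV) (use that in auto)
  finally show ?thesis .
 qed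
 have si: "set_integrable lebesgue A G" if "A \<in> sets lebesgue" for A
  using that G unfolding set_integrable_def by (rule integrable_mult_indicator)
 have tot: "integral\<^sup>L lebesgue G = 0"
  using restr[of UNIV] zero[of T] by (cases "0 \<le> T") (simp_all add: set_lebesgue_integral_def)
 \<comment> \<open>Half-lines are stable under intersection and generate the Borel sets. On them the
   integral vanishes by assumption, since \<open>G\<close> is 0 outside [0,T]; complements use that
   the total integral is 0.\<close>
 have borel: "(LINT t:A|lebesgue. G t) = 0" if "A \<in> sets (borel :: real measure)" for A
 proof -
  have gen: "sets (borel :: real measure) = sigma_sets UNIV (range (\<lambda>a. {..a}))" by (subst borel_eq_atMost) simp
  have leb: "B \<in> sets lebesgue" if "B \<in> sigma_sets UNIV (range (\<lambda>a::real. {..a}))" for B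
   using that unfolding gen[symmetric] by auto
  have stable: "Int_stable (range (\<lambda>a::real. {..a}))" by (auto simp: Int_stable_def image_iff intro: exI[of _ "min _ _"])
  have pow: "range (\<lambda>a::real. {..a}) \<subseteq> Pow UNIV" by simp
  show ?thesis using that unfolding gen
  proof (induction rule: sigma_sets_induct_disjoint[OF stable pow, consumes 1, case_names basic empty compl union])
   case (basic B)
   then obtain a where B: "B = {..a}" by blast
   have "{..a} \<inter> {0..T} = {0..min a T}" by auto
   then have "(LINT t:B|lebesgue. G t) = integral\<^sup>L (leb (min a T)) g" using restr[of "{..a}"] unfolding B by simp
   then show ?case using zero[of "min a T"] by (cases "0 \<le> min a T") auto
  next
   case empty
   then show ?case by (simp add: set_lebesgue_integral_def)
  next
   case (compl B)
   have "(LINT t:UNIV - B|lebesgue. G t) = integral\<^sup>L lebesgue G - (LINT t:B|lebesgue. G t)"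
   proof -
    have "(LINT t:UNIV - B|lebesgue. G t) = (LINT t|lebesgue. G t - indicator B t *\<^sub>R G t)"
     unfolding set_lebesgue_integral_def by (rule Bochner_Integration.integral_cong) (auto simp: indicator_def)
    also have "\<dots> = integral\<^sup>L lebesgue G - (LINT t|lebesgue. indicator B t *\<^sub>R G t)"
     by (rule Bochner_Integration.integral_diff[OF G si[OF leb[OF compl(1)], unfolded set_integrable_def]])
    finally show ?thesis by (simp add: set_lebesgue_integral_def)
   qed
   then show ?case using compl tot by simp
  next
   case (union A)
   have "(LINT t:(\<Union>i. A i)|lebesgue. G t) = (\<Sum>i. LINT t:A i|lebesgue. G t)"
   proof (rule lebesgue_integral_countable_add)
    show "A i \<in> sets lebesgue" for i using union leb by blast
    show "i \<noteq> j \<Longrightarrow> A i \<inter> A j = {}" for i j using union by (auto simp: disjoint_family_on_def)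
    show "set_integrable lebesgue (\<Union>i. A i) G" by (rule si) (use union leb in auto)
   qed
   then show ?case using union by simp
  qed
 qed
 interpret finite_measure "leb T" by (rule finite_measure_lebesgue_on) simp
 show ?thesis
 proof (rule density_zero[OF g])
  fix A :: "real set" assume "A \<in> sets (leb T)"
  then have A0: "A \<in> sets lebesgue" "A \<subseteq> {0..T}" by (auto simp: sets_restrict_space)
  \<comment> \<open>A Lebesgue set differs from a Borel set by a subset of a null set only, which
    transfers the vanishing of the integrals.\<close>
  obtain B Z Z' where A: "A = B \<union> Z" "Z \<subseteq> Z'" "Z' \<in> null_sets lborel" "B \<in> sets lborel"
   by (rule sets_completionE[OF A0(1)])
  have Bl: "B \<in> sets lebesgue" using A(4) by auto
  have "AE t in lborel. t \<notin> Z'" using A(3) by (rule AE_not_in)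
  then have "AE t in lebesgue. t \<notin> Z'" by (rule AE_completion)
  then have "(LINT t:A|lebesgue. G t) = (LINT t:B|lebesgue. G t)" unfolding set_lebesgue_integral_def
   using borel_measurable_integrable[OF si[OF A0(1), unfolded set_integrable_def]]
    borel_measurable_integrable[OF si[OF Bl, unfolded set_integrable_def]] A(1,2)
   by (intro integral_cong_AE) (auto simp: indicator_def elim!: eventually_mono)
  then have "(LINT t:A|lebesgue. G t) = 0" using borel[of B] A(4) by simp
  moreover have "(LINT t:A|leb T. g t) = (LINT t:A|lebesgue. G t)"
  proof -
   have "(LINT t:A|leb T. g t) = (LINT t|lebesgue. (if t \<in> {0..T} then indicator A t *\<^sub>R g t else 0))"
    unfolding set_lebesgue_integral_def by (rule Lebesgue_Measure.integral_restrict_UNIV[symmetric]) simp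
   also have "\<dots> = (LINT t:A|lebesgue. G t)" unfolding set_lebesgue_integral_def G_def by (rule Bochner_Integration.integral_cong) auto
   finally show ?thesis .
  qed
  ultimately show "(LINT t:A|leb T. g t) = 0" by simp
 qed
qed

lemma has_wderiv_AE_unique:
 assumes "has_wderiv T x g" "has_wderiv T x g'" shows "AE t in leb T. g t = g' t"
proof -
 have "AE t in leb T. g t - g' t = 0"
 proof (rule indefinite_integral_zero_imp_AE)
  show "integrable (leb T) (\<lambda>t. g t - g' t)"
   by (intro Bochner_Integration.integrable_diff has_wderivD[OF assms(1)] has_wderivD[OF assms(2)])
  fix t assume t: "t \<in> {0..T}"
  have "x t = x 0 + integral\<^sup>L (leb t) g" "x t = x 0 + integral\<^sup>L (leb t) g'" using assms t unfolding has_wderiv_def by blast+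
  then show "(LINT t|leb t. g t - g' t) = 0"
   by (subst Bochner_Integration.integral_diff[OF has_wderiv_integrable[OF assms(1) t] has_wderiv_integrable[OF assms(2) t]]) simp
 qed
 then show ?thesis by simp
qed

lemma L2_cong_AE:
 assumes u: "u \<in> L2 T" and v: "v \<in> borel_measurable (leb T)" and eq: "AE t in leb T. u t = v t" shows "v \<in> L2 T"
proof -
 have "integrable (leb T) (\<lambda>t. (norm (v t))\<^sup>2)" by (rule integrable_cong_AE_imp[OF L2_integrable_sq[OF u]]) (use v eq in auto)
 then show ?thesis using v by (simp add: L2_def)
qed

lemma W12_wderiv:
 assumes "x \<in> W12 T" shows "has_wderiv T x (wderiv T x)" "wderiv T x \<in> L2 T"
proof -
 obtain g where g: "g \<in> L2 T" "has_wderiv T x g" using assms by (auto simp: W12_def)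
 show h: "has_wderiv T x (wderiv T x)" unfolding wderiv_def by (rule someI[of "has_wderiv T x", OF g(2)])
 show "wderiv T x \<in> L2 T" by (rule L2_cong_AE[OF g(1) _ has_wderiv_AE_unique[OF g(2) h]])
   (rule borel_measurable_integrable[OF has_wderivD[OF h]])
qed

lemma L2_integrable:
 fixes u :: "real \<Rightarrow> 'a::euclidean_space"
 assumes "u \<in> L2 T" shows "integrable (leb T) u"
proof -
 have "integrable (leb T) (\<lambda>t. norm (u t) * norm (1::real))" by (rule L2_norm_mult_integrable[OF assms L2_const])
 then show ?thesis using L2_measurable[OF assms] by (simp add: integrable_norm_iff)
qed

lemma L2_norm_integral_le:
 fixes u :: "real \<Rightarrow> 'a::euclidean_space"
 assumes u: "u \<in> L2 T" and t: "t \<in> {0..T}" shows "intg t (\<lambda>s. norm (u s)) \<le> sqrt T * l2n T u"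
proof -
 have i: "integrable (leb T) (\<lambda>s. norm (u s))" using L2_integrable[OF u] by simp
 have it: "integrable (leb t) (\<lambda>s. norm (u s))" by (rule integrable_subinterval[OF i]) (use t in auto)
 have "intg t (\<lambda>s. norm (u s)) \<le> intg T (\<lambda>s. norm (u s))"
  by (rule integral_subset_le) (use t in \<open>auto intro!: integrable_on_lebesgue_on[OF i] integrable_on_lebesgue_on[OF it]\<close>)
 also have "\<dots> = (LINT s|leb T. norm (u s) * norm (1::real))" using lebesgue_integral_eq_integral[OF i] by simp
 also have "\<dots> \<le> l2n T u * l2n T (\<lambda>s. 1::real)" by (rule L2_cauchy_schwarz[OF u L2_const])
 also have "l2n T (\<lambda>s. 1::real) = sqrt T" using t by (simp add: l2n_def measure_restrict_space)
 finally show ?thesis by (simp add: mult.commute)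
qed

lemma norm_integral_le:
 fixes u :: "real \<Rightarrow> 'a::euclidean_space"
 assumes "integrable (leb T) u" and t: "t \<in> {0..T}" shows "norm (intg t u) \<le> intg t (\<lambda>s. norm (u s))"
proof -
 have it: "integrable (leb t) u" by (rule integrable_subinterval[OF assms(1)]) (use t in auto)
 then have itn: "integrable (leb t) (\<lambda>s. norm (u s))" by simp
 show ?thesis by (rule integral_norm_bound_integral) (auto intro!: integrable_on_lebesgue_on[OF it] integrable_on_lebesgue_on[OF itn])
qed

text \<open>As \<open>x'\<close> is only square integrable, it is approximated by continuous
  functions. For their primitives the rule is classical, and both integrals and the boundary values
  converge.\<close>

lemma integration_by_parts_W12:
 fixes x c :: "real \<Rightarrow> 'a::euclidean_space"
 assumes T: "0 \<le> T" and x: "has_wderiv T x x'" "x' \<in> L2 T"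
  and c: "\<And>t. t \<in> {0..T} \<Longrightarrow> vd T c (c' t) t" and c': "cont_on T c'"
 shows "(\<integral>t. x t \<bullet> c' t + x' t \<bullet> c t \<partial>leb T) = x T \<bullet> c T - x 0 \<bullet> c 0"
proof -
 have cc: "cont_on T c" by (rule has_vector_derivative_continuous_on[OF c])
 note cL = continuous_imp_L2[OF cc] continuous_imp_L2[OF c']
 have xL: "x \<in> L2 T" by (rule continuous_imp_L2[OF has_wderiv_continuous[OF x(1)]])
 have "\<forall>n. \<exists>g. continuous_on UNIV g \<and> l2n T (\<lambda>t. g t - x' t) < 1 / real (Suc n)"
  using L2_dense_continuous[OF x(2)] by simp
 from choice[OF this] obtain g where g: "\<And>n. continuous_on UNIV (g n)"
   "\<And>n. l2n T (\<lambda>t. g n t - x' t) < 1 / real (Suc n)" by blast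
 have gc: "cont_on T (g n)" for n by (rule continuous_on_subset[OF g(1)]) simp
 note gL = continuous_imp_L2[OF gc]
 have lim0: "(\<lambda>n. 1 / real (Suc n)) \<longlonglongrightarrow> 0" using LIMSEQ_inverse_real_of_nat by (simp add: inverse_eq_divide)
 have gconv: "L2conv T g x'" unfolding L2conv_def using gL x(2) g(2)
  by (auto intro!: tendsto_0_abs_le[OF _ lim0] less_imp_le simp: l2n_nonneg)
 define X where "X n t = x 0 + intg t (g n)" for n t
 have dX: "vd T (X n) (g n t) t" if "t \<in> {0..T}" for n t
  unfolding X_def using has_vector_derivative_add[OF has_vector_derivative_const integral_has_vector_derivative[OF gc that]] by simp
 have Xc: "cont_on T (X n)" for n by (rule has_vector_derivative_continuous_on[OF dX])
 have Xx: "norm (X n t - x t) \<le> sqrt T * (1 / real (Suc n))" if t: "t \<in> {0..T}" for n t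
 proof -
  have i: "integrable (leb t) (g n)" "integrable (leb t) x'"
   by (rule integrable_subinterval[OF L2_integrable[OF gL]], use t in auto) (rule has_wderiv_integrable[OF x(1) t])
  have "X n t - x t = intg t (\<lambda>s. g n s - x' s)" unfolding X_def using has_wderiv_eq[OF x(1) t]
   by (simp add: integral_diff[OF integrable_on_lebesgue_on[OF i(1)] integrable_on_lebesgue_on[OF i(2)]])
  also have "norm \<dots> \<le> sqrt T * l2n T (\<lambda>s. g n s - x' s)"
   by (rule order_trans[OF norm_integral_le[OF L2_integrable[OF L2_diff[OF gL x(2)]] t] L2_norm_integral_le[OF L2_diff[OF gL x(2)] t]])
  also have "\<dots> \<le> sqrt T * (1 / real (Suc n))" using T g(2)[of n] by (intro mult_left_mono) auto
  finally show ?thesis .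
 qed
 have lim1: "(\<lambda>n. sqrt T * (1 / real (Suc n))) \<longlonglongrightarrow> 0" using tendsto_mult_right_zero[OF lim0] by simp
 have Xlim: "(\<lambda>n. X n t) \<longlonglongrightarrow> x t" if "t \<in> {0..T}" for t
 proof -
  have "(\<lambda>n. X n t - x t) \<longlonglongrightarrow> 0" by (rule Lim_null_comparison[OF _ lim1]) (use Xx[OF that] in auto)
  then show ?thesis by (simp add: LIM_zero_iff)
 qed
 have Xconv: "L2conv T X x"
 proof -
  have "\<bar>l2n T (\<lambda>t. X n t - x t)\<bar> \<le> sqrt T * (1 / real (Suc n)) * sqrt T" for n
  proof -
   have "l2n T (\<lambda>t. X n t - x t) \<le> \<bar>sqrt T * (1 / real (Suc n))\<bar> * l2n T (\<lambda>t. 1::real)"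
    by (rule L2_bounded_image(2)[OF L2_const L2_measurable[OF L2_diff[OF continuous_imp_L2[OF Xc] xL]]]) (use Xx in simp)
   also have "l2n T (\<lambda>s. 1::real) = sqrt T" using T by (simp add: l2n_def measure_restrict_space)
   finally show ?thesis using T by (simp add: abs_of_nonneg[OF l2n_nonneg])
  qed
  from tendsto_0_abs_le[OF this tendsto_mult_left_zero[OF lim1]]
  show ?thesis unfolding L2conv_def using continuous_imp_L2[OF Xc] xL by blast
 qed
 have "(\<lambda>n. (ip T (X n) c') + ip T (g n) c) \<longlonglongrightarrow> (ip T x c') + ip T x' c"
  by (intro tendsto_add L2conv_weak[OF Xconv cL(2)] L2conv_weak[OF gconv cL(1)])
 moreover have "ip T (X n) c' + ip T (g n) c = X n T \<bullet> c T - X n 0 \<bullet> c 0" for n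
 proof -
  have "vd T (\<lambda>t. X n t \<bullet> c t) (X n t \<bullet> c' t + g n t \<bullet> c t) t" if "t \<in> {0..T}" for t
   by (rule bounded_bilinear.has_vector_derivative[OF bounded_bilinear_inner dX[OF that] c[OF that]])
  from eq_integral_of_derivative[OF this, of T] T
  have "intg T (\<lambda>t. X n t \<bullet> c' t + g n t \<bullet> c t) = X n T \<bullet> c T - X n 0 \<bullet> c 0" by simp
  moreover have "cont_on T (\<lambda>t. X n t \<bullet> c' t + g n t \<bullet> c t)" by (intro continuous_intros Xc gc cc c')
  ultimately have "(\<integral>t. X n t \<bullet> c' t + g n t \<bullet> c t \<partial>leb T) = X n T \<bullet> c T - X n 0 \<bullet> c 0"
   by (simp add: lebesgue_integral_continuous)
  then show ?thesis by (subst (asm) Bochner_Integration.integral_add) (auto intro!: L2_inner_integrable continuous_imp_L2 Xc gc cc c')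
 qed
 moreover have "(\<lambda>n. X n T \<bullet> c T - X n 0 \<bullet> c 0) \<longlonglongrightarrow> x T \<bullet> c T - x 0 \<bullet> c 0"
  by (intro tendsto_intros Xlim) (use T in auto)
 ultimately have "ip T x c' + ip T x' c = x T \<bullet> c T - x 0 \<bullet> c 0" by (simp add: LIMSEQ_unique)
 then show ?thesis by (subst Bochner_Integration.integral_add) (auto intro!: L2_inner_integrable xL x(2) cL)
qed

lemma W12_of_derivative:
 fixes x :: "real \<Rightarrow> 'a::euclidean_space"
 assumes "\<And>t. t \<in> {0..T} \<Longrightarrow> vd T x (g t) t" "cont_on T g" shows "x \<in> W12 T" "AE t in leb T. wderiv T x t = g t"
proof -
 have h: "has_wderiv T x g" by (rule has_wderiv_of_derivative[OF assms])
 then show x: "x \<in> W12 T" unfolding W12_def using continuous_imp_L2[OF assms(2)] by blast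
 show "AE t in leb T. wderiv T x t = g t" by (rule has_wderiv_AE_unique[OF W12_wderiv(1)[OF x] h])
qed

lemma zero_in_W12: "(\<lambda>t. 0 :: 'a::euclidean_space) \<in> W12 T" and wderiv_zero: "AE t in leb T. wderiv T (\<lambda>t. 0 :: 'a::euclidean_space) t = 0"
 using W12_of_derivative[of T "\<lambda>t. 0 :: 'a" "\<lambda>t. 0"] by auto

text \<open>The initial value is represented in \<open>W12\<close> by the solution \<open>cosh (T - t)\<close> of \<open>z'' = z\<close>.\<close>

lemma weakly_conv_W2_components:
 fixes w :: "nat \<Rightarrow> ('n::finite, 'l::finite, 'm::finite) traj"
 assumes T: "0 < T" and wk: "weakly_conv_W2 T w w0" and w: "\<And>k. w k \<in> W_2 T" and w0: "w0 \<in> W_2 T"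
 shows "\<phi> \<in> L2 T \<Longrightarrow> (\<lambda>k. ip T (fst (snd (w k))) \<phi>) \<longlonglongrightarrow> ip T (fst (snd w0)) \<phi>"
  and "\<psi> \<in> L2 T \<Longrightarrow> (\<lambda>k. ip T (snd (snd (w k))) \<psi>) \<longlonglongrightarrow> ip T (snd (snd w0)) \<psi>"
  and "(\<lambda>k. fst (w k) 0) \<longlonglongrightarrow> fst w0 0"
proof -
 have inner_z: "inner_W2 T (x, u, v) (z, \<phi>, \<psi>) = (\<integral>t. x t \<bullet> z t + wderiv T x t \<bullet> z' t + u t \<bullet> \<phi> t + v t \<bullet> \<psi> t \<partial>leb T)"
  if "(x, u, v) \<in> W_2 T" "AE t in leb T. wderiv T z t = z' t" "z \<in> W12 T" "z' \<in> L2 T" "\<phi> \<in> L2 T" "\<psi> \<in> L2 T"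
  for x u v z z' \<phi> \<psi>
 proof -
  have m: "x \<in> borel_measurable (leb T)" "wderiv T x \<in> borel_measurable (leb T)"
   "u \<in> borel_measurable (leb T)" "v \<in> borel_measurable (leb T)"
  proof -
   have x: "x \<in> W12 T" and "u \<in> L2 T" "v \<in> L2 T" using that(1) by (simp_all add: W_2_def)
   then show "u \<in> borel_measurable (leb T)" "v \<in> borel_measurable (leb T)" by (simp_all add: L2_measurable)
   show "x \<in> borel_measurable (leb T)" "wderiv T x \<in> borel_measurable (leb T)"
    by (rule continuous_measurable[OF has_wderiv_continuous[OF W12_wderiv(1)[OF x]]] L2_measurable[OF W12_wderiv(2)[OF x]])+
  qed
  have mz: "z \<in> borel_measurable (leb T)" "wderiv T z \<in> borel_measurable (leb T)"
   by (rule continuous_measurable[OF has_wderiv_continuous[OF W12_wderiv(1)[OF that(3)]]]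
     L2_measurable[OF W12_wderiv(2)[OF that(3)]])+
  show ?thesis unfolding inner_W2.simps
   by (rule integral_cong_AE) (use m mz that(2) L2_measurable[OF that(4)] L2_measurable[OF that(5)] L2_measurable[OF that(6)] in \<open>auto elim!: eventually_mono\<close>)
 qed
 have split: "a = (fst a, fst (snd a), snd (snd a))" for a :: "('n, 'l, 'm) traj" by simp
 have W: "(fst (w k), fst (snd (w k)), snd (snd (w k))) \<in> W_2 T" "(fst w0, fst (snd w0), snd (snd w0)) \<in> W_2 T" for k
  using w[of k] w0 by simp_all
 have conv: "(\<lambda>k. inner_W2 T (fst (w k), fst (snd (w k)), snd (snd (w k))) z) \<longlonglongrightarrow> inner_W2 T (fst w0, fst (snd w0), snd (snd w0)) z"
  if "z \<in> W_2 T" for z using wk that by (simp add: weakly_conv_W2_def)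
 show "(\<lambda>k. ip T (fst (snd (w k))) \<phi>) \<longlonglongrightarrow> ip T (fst (snd w0)) \<phi>"
  if \<phi>: "\<phi> \<in> L2 T"
 proof -
  have z: "((\<lambda>t. 0 :: real^'n), \<phi>, (\<lambda>t. 0 :: real^'m)) \<in> W_2 T"
   unfolding W_2_def using \<phi> by (simp add: zero_in_W12 L2_const)
  show ?thesis using conv[OF z] unfolding inner_z[OF W(1) wderiv_zero zero_in_W12 L2_const \<phi> L2_const]
    inner_z[OF W(2) wderiv_zero zero_in_W12 L2_const \<phi> L2_const] by simp
 qed
 show "(\<lambda>k. ip T (snd (snd (w k))) \<psi>) \<longlonglongrightarrow> ip T (snd (snd w0)) \<psi>"
  if \<psi>: "\<psi> \<in> L2 T"
 proof -
  have z: "((\<lambda>t. 0 :: real^'n), (\<lambda>t. 0 :: real^'l), \<psi>) \<in> W_2 T"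
   unfolding W_2_def using \<psi> by (simp add: zero_in_W12 L2_const)
  show ?thesis using conv[OF z] unfolding inner_z[OF W(1) wderiv_zero zero_in_W12 L2_const L2_const \<psi>]
    inner_z[OF W(2) wderiv_zero zero_in_W12 L2_const L2_const \<psi>] by simp
 qed
 show "(\<lambda>k. fst (w k) 0) \<longlonglongrightarrow> fst w0 0"
 proof (rule vec_tendstoI)
  fix i
  define e :: "real^'n" where "e = axis i 1"
  define z where "z t = cosh (T - t) *\<^sub>R e" for t
  define z' where "z' t = (- sinh (T - t)) *\<^sub>R e" for t
  have dz: "vd T z (z' t) t" for t
   unfolding z_def z'_def by (auto intro!: derivative_eq_intros simp: has_real_derivative_iff_has_vector_derivative[symmetric])
  have dz': "vd T z' (z t) t" for t
   unfolding z_def z'_def by (auto intro!: derivative_eq_intros simp: has_real_derivative_iff_has_vector_derivative[symmetric])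
  have zc: "cont_on T z" "cont_on T z'" by (rule has_vector_derivative_continuous_on[OF dz] has_vector_derivative_continuous_on[OF dz'])+
  note Z = W12_of_derivative[OF dz zc(2)]
  have *: "inner_W2 T (x, u, v) (z, (\<lambda>t. 0), (\<lambda>t. 0)) = sinh T * x 0 $ i" if "(x, u, v) \<in> W_2 T"
   for x and u :: "real \<Rightarrow> real^'l" and v :: "real \<Rightarrow> real^'m"
  proof -
   have x: "x \<in> W12 T" using that by (simp add: W_2_def)
   have "inner_W2 T (x, u, v) (z, (\<lambda>t. 0), (\<lambda>t. 0)) = (\<integral>t. x t \<bullet> z t + wderiv T x t \<bullet> z' t \<partial>leb T)"
    using inner_z[OF that Z(2,1) continuous_imp_L2[OF zc(2)] L2_const L2_const] by (simp del: inner_W2.simps)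
   \<comment> \<open>The term at \<open>T\<close> drops out because sinh 0 = 0, and the term at 0 is
     \<open>sinh T\<close> times the i-th coordinate of \<open>x 0\<close>.\<close>
   also have "\<dots> = x T \<bullet> z' T - x 0 \<bullet> z' 0"
    by (rule integration_by_parts_W12[OF _ W12_wderiv[OF x] dz' zc(1)]) (use T in simp)
   finally show ?thesis by (simp add: z'_def e_def inner_axis)
  qed
  have "(z, (\<lambda>t. 0 :: real^'l), (\<lambda>t. 0 :: real^'m)) \<in> W_2 T" unfolding W_2_def using Z(1) by (simp add: L2_const)
  from conv[OF this] have "(\<lambda>k. sinh T * fst (w k) 0 $ i) \<longlonglongrightarrow> sinh T * fst w0 0 $ i" unfolding *[OF W(1)] *[OF W(2)] .
  then have "(\<lambda>k. (1 / sinh T) * (sinh T * fst (w k) 0 $ i)) \<longlonglongrightarrow> (1 / sinh T) * (sinh T * fst w0 0 $ i)"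
   by (rule tendsto_mult_left)
  then show "(\<lambda>k. fst (w k) 0 $ i) \<longlonglongrightarrow> fst w0 0 $ i" using T by simp
 qed
qed

section \<open>The transformed form as a linear function of the multiplier\<close>

type_synonym ('n, 'l, 'm) ctrl = "(real^'n) \<times> (real \<Rightarrow>\<^sub>C ((real^'l) \<times> (real^'m)))"

context nominal_ocp
begin

text \<open>The integrand of \<open>Omega_P2\<close> with the costate factored out; its derivative,
  which enters through the derivatives of H_vx and S, has been eliminated by the adjoint equation.
  See \<open>integrand_P2_Theta\<close>.\<close>

definition Theta :: "real \<Rightarrow> real^'n \<Rightarrow> real^'l \<Rightarrow> real^'m \<Rightarrow> real^'n" where
 "Theta t \<xi> u y =
  (let D = (\<lambda>a b. dyn2 P (W t) a b); F = Fv P wh t *v y; A = (\<lambda>a. Fx P wh t *v a); B = Bmat P wh t *v y in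
   (1/2) *\<^sub>R D (\<xi>, 0, 0) (\<xi>, 0, 0) + D (\<xi>, 0, 0) (0, u, 0)
   + (D (\<xi>, 0, 0) (F, 0, 0) - Wxv t \<xi> y + A (D (\<xi>, 0, 0) (0, 0, y)) - D (A \<xi>, 0, 0) (0, 0, y))
   + (1/2) *\<^sub>R D (0, u, 0) (0, u, 0)
   + (D (F, 0, 0) (0, u, 0) - D (Fu P wh t *v u, 0, 0) (0, 0, y))
   + (1/2) *\<^sub>R (D (F, 0, 0) (F, 0, 0) - 2 *\<^sub>R D (B, 0, 0) (0, 0, y)
     - (Wxv t F y - A (D (F, 0, 0) (0, 0, y)) + D (Fv' t *v y, 0, 0) (0, 0, y))))"

end

context nominal_costate
begin

lemma S'_inner: "y \<bullet> (S' t *v y) = y \<bullet> (Hvx' t *v (Fv P wh t *v y)) + y \<bullet> (Hvx P wh \<mu> t *v (Fv' t *v y))"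
proof -
 let ?K = "Hvx' t ** Fv P wh t + Hvx P wh \<mu> t ** Fv' t"
 have "y \<bullet> (S' t *v y) = 1/2 * (y \<bullet> (?K *v y) + y \<bullet> (transpose ?K *v y))"
  unfolding S'_def scaleR_matrix_vector_assoc[symmetric] inner_scaleR_right matrix_vector_mult_add_rdistrib[of ?K]
   inner_add_right ..
 also have "y \<bullet> (transpose ?K *v y) = y \<bullet> (?K *v y)" by (simp add: inner_transpose inner_commute)
 finally show ?thesis by (simp add: matrix_vector_mult_add_rdistrib inner_add_right matrix_vector_mul_assoc[symmetric])
qed

lemma Mmat_inner: "t \<in> {0..T} \<Longrightarrow> y \<bullet> (Mmat P wh \<mu> t *v \<xi>)
  = (Fv P wh t *v y) \<bullet> (Hxx P wh \<mu> t *v \<xi>) - y \<bullet> (Hvx' t *v \<xi>) - y \<bullet> (Hvx P wh \<mu> t *v (Fx P wh t *v \<xi>))"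
 by (simp add: Mmat_eq matrix_vector_mult_diff_rdistrib inner_diff_right matrix_vector_mul_assoc[symmetric] inner_transpose)

lemma Emat_inner: "y \<bullet> (Emat P wh \<mu> t *v u)
  = u \<bullet> (Hux P wh \<mu> t *v (Fv P wh t *v y)) - y \<bullet> (Hvx P wh \<mu> t *v (Fu P wh t *v u))"
 by (simp add: Emat_def matrix_vector_mult_diff_rdistrib inner_diff_right matrix_vector_mul_assoc[symmetric] inner_transpose
   inner_commute[of "Hux P wh \<mu> t *v (Fv P wh t *v y)" u])

lemma Rmat_inner: "t \<in> {0..T} \<Longrightarrow> y \<bullet> (Rmat P wh \<mu> t *v y)
  = (Fv P wh t *v y) \<bullet> (Hxx P wh \<mu> t *v (Fv P wh t *v y)) - 2 * (y \<bullet> (Hvx P wh \<mu> t *v (Bmat P wh t *v y))) - y \<bullet> (S' t *v y)"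
 by (simp add: Rmat_eq matrix_vector_mult_diff_rdistrib matrix_vector_mult_add_rdistrib inner_diff_right inner_add_right
   matrix_vector_mul_assoc[symmetric] inner_transpose inner_commute[of "Hvx P wh \<mu> t *v (Bmat P wh t *v y)" y])

lemma integrand_P2_Theta: "t \<in> {0..T} \<Longrightarrow> integrand_P2 t \<xi> u y = p t \<bullet> Theta t \<xi> u y"
 unfolding integrand_P2_def Mmat_inner Emat_inner Rmat_inner S'_inner Hvx'_inner p'_inner
  Hxx_inner Hux_inner Hvx_inner Huu_inner Theta_def Let_def by (simp add: inner_add_right inner_diff_right algebra_simps)

lemma Vmat_inner: "a \<bullet> (Vmat P wh \<mu> t *v b)
  = p t \<bullet> ((1/2) *\<^sub>R (dyn2 P (W t) (Fv P wh t *v b, 0, 0) (0, 0, a) - dyn2 P (W t) (Fv P wh t *v a, 0, 0) (0, 0, b)))"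
proof -
 have "a \<bullet> (Vmat P wh \<mu> t *v b) = 1/2 * (a \<bullet> (Hvx P wh \<mu> t *v (Fv P wh t *v b)) - b \<bullet> (Hvx P wh \<mu> t *v (Fv P wh t *v a)))"
  unfolding Vmat_def scaleR_matrix_vector_assoc[symmetric] inner_scaleR_right matrix_vector_mult_diff_rdistrib
   inner_diff_right inner_transpose by (simp add: matrix_vector_mul_assoc[symmetric] inner_commute[of _ b])
 then show ?thesis by (simp add: Hvx_inner inner_diff_right)
qed

lemma Smat_inner: "a \<bullet> (Smat P wh \<mu> t *v a) = p t \<bullet> dyn2 P (W t) (Fv P wh t *v a, 0, 0) (0, 0, a)"
proof -
 have "a \<bullet> (Smat P wh \<mu> t *v a) = a \<bullet> (Hvx P wh \<mu> t *v (Fv P wh t *v a))"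
  unfolding Smat_def scaleR_matrix_vector_assoc[symmetric] inner_scaleR_right matrix_vector_mult_add_rdistrib
   inner_add_right inner_transpose by (simp add: matrix_vector_mul_assoc[symmetric] inner_commute[of _ a])
 then show ?thesis by (simp add: Hvx_inner)
qed

lemma gfun_eq: "gfun P wh \<mu> \<zeta>0 \<zeta>T h = 1/2 * (\<Sum>k<N. coeff P \<mu> k * D2 (chi P k) qh (\<zeta>0, \<zeta>T + Fv P wh T *v h) (\<zeta>0, \<zeta>T + Fv P wh T *v h))
  + p T \<bullet> (dyn2 P (W T) (\<zeta>T, 0, 0) (0, 0, h) + (1/2) *\<^sub>R dyn2 P (W T) (Fv P wh T *v h, 0, 0) (0, 0, h))"
 unfolding gfun_def Let_def D2ell_eq inner_add_right inner_scaleR_right Smat_inner Hvx_inner ..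

lemma Omega_P2_eq: "Omega_P2 P wh \<mu> (\<xi>, u, y, h) = gfun P wh \<mu> (\<xi> 0) (\<xi> T) h
  + (\<integral>t. integrand_P2 t (\<xi> t) (u t) (y t) \<partial>leb T)" unfolding Omega_P2.simps integrand_P2_def ..

lemma L2_quadratic_integrable:
 fixes A :: "real \<Rightarrow> real^'a::finite^'b::finite"
 assumes "cont_on T A" "u \<in> L2 T" "v \<in> L2 T" shows "integrable (leb T) (\<lambda>t. u t \<bullet> (A t *v v t))"
 by (rule L2_inner_integrable[OF assms(2) matrix_L2[OF assms(1,3)]])

lemma integrand_P2_terms:
 assumes "\<xi> \<in> L2 T" "u \<in> L2 T" "y \<in> L2 T" shows "integrable (leb T) (\<lambda>t. integrand_P2 t (\<xi> t) (u t) (y t))" (is ?int)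
  and "(\<integral>t. integrand_P2 t (\<xi> t) (u t) (y t) \<partial>leb T)
   = 1/2 * form T (Hxx P wh \<mu>) \<xi> \<xi> + form T (Hux P wh \<mu>) u \<xi>
    + form T (Mmat P wh \<mu>) y \<xi> + 1/2 * form T (Huu P wh \<mu>) u u
    + form T (Emat P wh \<mu>) y u + 1/2 * form T (Rmat P wh \<mu>) y y" (is ?eq)
proof -
 note i = L2_quadratic_integrable[OF Hxx_cont assms(1) assms(1)] L2_quadratic_integrable[OF Hux_cont assms(2) assms(1)]
  L2_quadratic_integrable[OF Mmat_cont assms(3) assms(1)] L2_quadratic_integrable[OF Huu_cont assms(2) assms(2)]
  L2_quadratic_integrable[OF Emat_cont assms(3) assms(2)] L2_quadratic_integrable[OF Rmat_cont assms(3) assms(3)]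
 show ?int unfolding integrand_P2_def by (intro Bochner_Integration.integrable_add integrable_mult_right i)
 show ?eq unfolding integrand_P2_def by (simp add: i del: times_divide_eq_left)
qed

lemma Omega_P2_tendsto:
 assumes \<xi>: "L2conv T \<Xi> \<xi>" "(\<lambda>n. \<Xi> n 0) \<longlonglongrightarrow> \<xi> 0" "(\<lambda>n. \<Xi> n T) \<longlonglongrightarrow> \<xi> T"
  and u: "L2conv T U u" and y: "L2conv T Y y" and h: "Hn \<longlonglongrightarrow> h"
 shows "(\<lambda>n. Omega_P2 P wh \<mu> (\<Xi> n, U n, Y n, Hn n)) \<longlonglongrightarrow> Omega_P2 P wh \<mu> (\<xi>, u, y, h)"
proof -
 have mem: "\<And>n. \<Xi> n \<in> L2 T" "\<xi> \<in> L2 T" "\<And>n. U n \<in> L2 T" "u \<in> L2 T" "\<And>n. Y n \<in> L2 T" "y \<in> L2 T"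
  using \<xi>(1) u y unfolding L2conv_def by blast+
 have mv: "(\<lambda>n. A *v f n) \<longlonglongrightarrow> A *v a" if "f \<longlonglongrightarrow> a" for A :: "real^'a::finite^'b::finite" and f a
  by (rule bounded_bilinear.tendsto[OF bounded_bilinear_matrix_vector tendsto_const that])
 have z: "(\<lambda>n. (\<Xi> n 0, \<Xi> n T + Fv P wh T *v Hn n)) \<longlonglongrightarrow> (\<xi> 0, \<xi> T + Fv P wh T *v h)"
  by (intro tendsto_intros \<xi> mv h)
 have "(\<lambda>n. gfun P wh \<mu> (\<Xi> n 0) (\<Xi> n T) (Hn n)) \<longlonglongrightarrow> gfun P wh \<mu> (\<xi> 0) (\<xi> T) h"
  unfolding gfun_eq by (intro tendsto_intros z \<xi> h mv blinfun.tendsto)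
 moreover have "(\<lambda>n. (\<integral>t. integrand_P2 t (\<Xi> n t) (U n t) (Y n t) \<partial>leb T))
   \<longlonglongrightarrow> (\<integral>t. integrand_P2 t (\<xi> t) (u t) (y t) \<partial>leb T)"
  unfolding integrand_P2_terms(2)[OF mem(1,3,5)] integrand_P2_terms(2)[OF mem(2,4,6)]
  by (intro tendsto_add tendsto_mult tendsto_const L2conv_quadratic Hxx_cont Hux_cont Mmat_cont Huu_cont Emat_cont Rmat_cont \<xi> u y)
 ultimately show ?thesis unfolding Omega_P2_eq by (rule tendsto_add)
qed

end

context nominal_ocp
begin

definition uc :: "('n, 'l, 'm) ctrl \<Rightarrow> real \<Rightarrow> real^'l" where "uc g t = fst (apply_bcontfun (snd g) t)"
definition vc :: "('n, 'l, 'm) ctrl \<Rightarrow> real \<Rightarrow> real^'m" where "vc g t = snd (apply_bcontfun (snd g) t)"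
definition yc :: "('n, 'l, 'm) ctrl \<Rightarrow> real \<Rightarrow> real^'m" where "yc g t = intg t (vc g)"
text \<open>The Goh state of an actual control. For such a control the parameter h of a direction is
  \<open>yc g T\<close>, whereas elements of \<open>P_2\<close> may have any h.\<close>

definition xic :: "('n, 'l, 'm) ctrl \<Rightarrow> real \<Rightarrow> real^'n" where "xic g t = xlin g t - Fv P wh t *v yc g t"

lemma uc_cont: "continuous_on S (uc g)" and vc_cont: "continuous_on S (vc g)"
 unfolding uc_def[abs_def] vc_def[abs_def] by (intro continuous_intros continuous_on_apply_bcontfun)+

lemma snd_ctrl: "apply_bcontfun (snd g) t = (uc g t, vc g t)" by (simp add: uc_def vc_def)

lemma yc_deriv: "t \<in> {0..T} \<Longrightarrow> vd T (yc g) (vc g t) t"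
 unfolding yc_def[abs_def] by (rule integral_has_vector_derivative[OF vc_cont])

lemma yc_cont: "cont_on T (yc g)" by (rule has_vector_derivative_continuous_on[OF yc_deriv])

lemma yc_0: "yc g 0 = 0" by (simp add: yc_def)

lemma xic_0: "xic g 0 = fst g" by (simp add: xic_def yc_0 xlin_0)

lemma xlin_eq: "xlin g t = xic g t + Fv P wh t *v yc g t" by (simp add: xic_def)

text \<open>The term F_v v of the linearized equation cancels against F_v times the derivative of y;
  what remains of y is collected in B = F_x F_v - dF_v/dt.\<close>

lemma xic_deriv:
 assumes t: "t \<in> {0..T}" shows "vd T (xic g) (Fx P wh t *v xic g t + Fu P wh t *v uc g t + Bmat P wh t *v yc g t) t"
proof -
 have "vd T (xlin g) (Fx P wh t *v xlin g t + Fu P wh t *v uc g t + Fv P wh t *v vc g t) t"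
  using xlin_deriv[OF t, of g] unfolding snd_ctrl dyn1_split .
 from has_vector_derivative_diff[OF this bounded_bilinear.has_vector_derivative[OF bounded_bilinear_matrix_vector Fv'_deriv[OF t] yc_deriv[OF t, of g]]]
 show ?thesis unfolding xic_def[abs_def] Bmat_eq[OF t]
  by (simp add: matrix_vector_mult_diff_rdistrib matrix_vector_mult_diff_distrib matrix_vector_mul_assoc[symmetric] algebra_simps)
qed

lemma xic_cont: "cont_on T (xic g)" by (rule has_vector_derivative_continuous_on[OF xic_deriv])

lemma lin_ctrl:
 shows "uc (g + h) t = uc g t + uc h t" "uc (r *\<^sub>R g) t = r *\<^sub>R uc g t"
  and "vc (g + h) t = vc g t + vc h t" "vc (r *\<^sub>R g) t = r *\<^sub>R vc g t" by (simp_all add: uc_def vc_def)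

lemma yc_lin:
 shows "t \<in> {0..T} \<Longrightarrow> yc (g + h) t = yc g t + yc h t" "t \<in> {0..T} \<Longrightarrow> yc (r *\<^sub>R g) t = r *\<^sub>R yc g t"
 unfolding yc_def lin_ctrl[abs_def] by (auto intro!: integral_add integrable_continuous_real vc_cont)

lemma xic_lin:
 shows "t \<in> {0..T} \<Longrightarrow> xic (g + h) t = xic g t + xic h t" "t \<in> {0..T} \<Longrightarrow> xic (r *\<^sub>R g) t = r *\<^sub>R xic g t"
 by (simp_all add: xic_def xlin_add xlin_scale yc_lin matrix_vector_right_distrib matrix_vector_mult_scaleR scaleR_diff_right)

text \<open>The costate that belongs to the single end-point function \<open>chi P k\<close>; these
  costates are the building blocks of all others.\<close>

definition pk :: "nat \<Rightarrow> real \<Rightarrow> real^'n" where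
 "pk k = (SOME p. costate p \<and> (\<forall>a. p T \<bullet> a = D1 (chi P k) qh (0, a)))"

lemma pk: "costate (pk k)" "pk k T \<bullet> a = D1 (chi P k) qh (0, a)"
proof -
 define \<pi> where "\<pi> = (\<Sum>b\<in>Basis. D1 (chi P k) qh (0, b) *\<^sub>R b)"
 have \<pi>: "\<pi> \<bullet> a = D1 (chi P k) qh (0, a)" for a unfolding \<pi>_def by (rule linear_representer, rule linearI)
   (simp_all add: blinfun.add_right[symmetric] blinfun.scaleR_right[symmetric] del: real_scaleR_def)
 obtain q where "costate q" "q T = \<pi>" using costate_exists by blast
 then have "\<exists>p. costate p \<and> (\<forall>a. p T \<bullet> a = D1 (chi P k) qh (0, a))" using \<pi> by blast
 from someI_ex[OF this] show "costate (pk k)" "pk k T \<bullet> a = D1 (chi P k) qh (0, a)" unfolding pk_def by blast+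
qed

text \<open>Rebuilds a multiplier from its coefficients. The equality multipliers sit behind the
  first \<open>Suc (dphi P)\<close> entries, so that their j-th one, counted from 1, is entry
  \<open>dphi P + j\<close>.\<close>

definition mu :: "(nat \<Rightarrow> real) \<Rightarrow> 'n mult" where
 "mu \<nu> = (\<nu>, (\<lambda>j. \<nu> (dphi P + j)), (\<lambda>t. \<Sum>k<N. \<nu> k *\<^sub>R pk k t))"

text \<open>A single end-point function with weight 1. As an element of \<open>Lambda\<close> it
  would have to satisfy stationarity as well; here it serves as a basis vector on which linear
  expressions in the multiplier are evaluated.\<close>

definition unit_mult :: "nat \<Rightarrow> 'n mult" where
 "unit_mult k = mu (\<lambda>j. if j = k then 1 else 0)"

abbreviation "Vk k \<equiv> Vmat P wh (unit_mult k)"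
abbreviation "Hvuk k \<equiv> Hvu P wh (unit_mult k)"
abbreviation "Huuk k \<equiv> Huu P wh (unit_mult k)"

lemma coeff_mu: "coeff P (mu \<nu>) k = (if k < N then \<nu> k else 0)" by (auto simp: mu_def)

lemma snd_mu: "snd (snd (mu \<nu>)) t = (\<Sum>k<N. \<nu> k *\<^sub>R pk k t)" by (simp add: mu_def)

lemma snd_unit: "k < N \<Longrightarrow> snd (snd (unit_mult k)) = pk k"
 unfolding unit_mult_def by (rule ext) (simp add: snd_mu if_distrib[of "\<lambda>r. r *\<^sub>R _"] cong: if_cong)

lemma costate_sum: "costate (\<lambda>t. \<Sum>k<n. \<nu> k *\<^sub>R pk k t)" unfolding costate_def
proof
 fix t assume t: "t \<in> {0..T}"
 have "((\<lambda>t. \<Sum>k<n. \<nu> k *\<^sub>R pk k t) has_vector_derivative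
   (\<Sum>k<n. \<nu> k *\<^sub>R (- (\<Sum>b\<in>Basis. (pk k t \<bullet> dyn1 P (W t) (b, 0)) *\<^sub>R b)))) (at t within {0..T})"
  by (intro has_vector_derivative_sum bounded_linear.has_vector_derivative[OF bounded_linear_scaleR_right])
   (use pk(1) t in \<open>auto simp: costate_def\<close>)
 also have "(\<Sum>k<n. \<nu> k *\<^sub>R (- (\<Sum>b\<in>Basis. (pk k t \<bullet> dyn1 P (W t) (b, 0)) *\<^sub>R b)))
   = - (\<Sum>b\<in>Basis. ((\<Sum>k<n. \<nu> k *\<^sub>R pk k t) \<bullet> dyn1 P (W t) (b, 0)) *\<^sub>R b)"
  by (simp add: inner_sum_left scaleR_sum_left scaleR_sum_right sum_negf, subst sum.swap, simp)
 finally show "((\<lambda>t. \<Sum>k<n. \<nu> k *\<^sub>R pk k t) has_vector_derivative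
   - (\<Sum>b\<in>Basis. ((\<Sum>k<n. \<nu> k *\<^sub>R pk k t) \<bullet> dyn1 P (W t) (b, 0)) *\<^sub>R b)) (at t within {0..T})" .
qed

text \<open>Just the two conditions that determine p from the coefficients.\<close>

definition adjoint_mult :: "'n mult \<Rightarrow> bool" where
 "adjoint_mult \<mu> \<longleftrightarrow> costate (snd (snd \<mu>)) \<and> (\<forall>a. snd (snd \<mu>) T \<bullet> a = (\<Sum>k<N. coeff P \<mu> k * D1 (chi P k) qh (0, a)))"

text \<open>The difference of the two sides is a costate with zero terminal value.\<close>

lemma adjoint_mult_sum:
 assumes \<mu>: "adjoint_mult \<mu>" and t: "t \<in> {0..T}" shows "snd (snd \<mu>) t = (\<Sum>k<N. coeff P \<mu> k *\<^sub>R pk k t)"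
proof -
 define q where "q t = snd (snd \<mu>) t - (\<Sum>k<N. coeff P \<mu> k *\<^sub>R pk k t)" for t
 have "costate q" unfolding costate_def
 proof
  fix s assume s: "s \<in> {0..T}"
  have "vd T q ((- (\<Sum>b\<in>Basis. (snd (snd \<mu>) s \<bullet> dyn1 P (W s) (b, 0)) *\<^sub>R b))
    - (- (\<Sum>b\<in>Basis. ((\<Sum>k<N. coeff P \<mu> k *\<^sub>R pk k s) \<bullet> dyn1 P (W s) (b, 0)) *\<^sub>R b))) s"
   unfolding q_def[abs_def]
   by (rule has_vector_derivative_diff) (use \<mu> costate_sum[of "coeff P \<mu>" N] s in \<open>auto simp: adjoint_mult_def costate_def\<close>)
  then show "vd T q (- (\<Sum>b\<in>Basis. (q s \<bullet> dyn1 P (W s) (b, 0)) *\<^sub>R b)) s"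
   by (simp add: q_def inner_diff_left scaleR_diff_left sum_subtractf)
 qed
 moreover have "q T = 0"
 proof -
  have "q T \<bullet> a = 0" for a using \<mu> by (simp add: q_def inner_diff_left inner_sum_left adjoint_mult_def pk(2))
  then show ?thesis using inner_eq_zero_iff by blast
 qed
 ultimately have "q t = 0" by (rule costate_zero_terminal[OF _ _ t])
 then show ?thesis by (simp add: q_def)
qed

lemma adjoint_mu: "adjoint_mult (mu \<nu>)"
proof -
 have "snd (snd (mu \<nu>)) = (\<lambda>t. \<Sum>k<N. \<nu> k *\<^sub>R pk k t)" by (simp add: mu_def)
 then show ?thesis using costate_sum[of \<nu> N] by (simp add: adjoint_mult_def coeff_mu inner_sum_left pk(2))
qed

lemma adjoint_unit: "adjoint_mult (unit_mult k)" unfolding unit_mult_def by (rule adjoint_mu)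

lemma nominal_costateI: "adjoint_mult \<mu> \<Longrightarrow> nominal_costate P xh uh vh \<mu>"
 unfolding adjoint_mult_def by unfold_locales simp

definition OP :: "nat \<Rightarrow> ('n, 'l, 'm) tdir \<Rightarrow> real" where
 "OP k z = Omega_P2 P wh (unit_mult k) z"

lemma coeff_unit: "coeff P (unit_mult k) j = (if j < N \<and> j = k then 1 else 0)" by (simp add: unit_mult_def coeff_mu)

text \<open>Makes \<open>Omega_P2\<close>, for a fixed direction, a linear function of the
  coefficient vector; this is the function that is finally maximized.\<close>

lemma Omega_P2_sum:
 assumes \<mu>: "adjoint_mult \<mu>" and L: "\<xi> \<in> L2 T" "u \<in> L2 T" "y \<in> L2 T"
 shows "Omega_P2 P wh \<mu> (\<xi>, u, y, h) = (\<Sum>k<N. coeff P \<mu> k * OP k (\<xi>, u, y, h))"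
proof -
 interpret nominal_costate P xh uh vh \<mu> by (rule nominal_costateI[OF \<mu>])
 have unit: "nominal_costate P xh uh vh (unit_mult k)" for k by (rule nominal_costateI[OF adjoint_unit])
 let ?I = "\<lambda>k t. nominal_costate.integrand_P2 P xh uh vh (unit_mult k) t (\<xi> t) (u t) (y t)"
 have T': "T \<in> {0..T}" using T by simp
 have int: "integrable (leb T) (?I k)" for k by (rule nominal_costate.integrand_P2_terms(1)[OF unit L])
 have I: "?I k t = pk k t \<bullet> Theta t (\<xi> t) (u t) (y t)" if "t \<in> {0..T}" "k < N" for k t
  using nominal_costate.integrand_P2_Theta[OF unit that(1)] that(2) by (simp add: snd_unit)
 have "(\<integral>t. integrand_P2 t (\<xi> t) (u t) (y t) \<partial>leb T) = (\<integral>t. (\<Sum>k<N. coeff P \<mu> k * ?I k t) \<partial>leb T)"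
 proof (rule Bochner_Integration.integral_cong[OF refl])
  fix t assume "t \<in> space (leb T)"
  then have t: "t \<in> {0..T}" by simp
  show "integrand_P2 t (\<xi> t) (u t) (y t) = (\<Sum>k<N. coeff P \<mu> k * ?I k t)"
   unfolding integrand_P2_Theta[OF t] adjoint_mult_sum[OF \<mu> t] by (simp add: inner_sum_left I[OF t])
 qed
 also have "\<dots> = (\<Sum>k<N. coeff P \<mu> k * (\<integral>t. ?I k t \<partial>leb T))" using int by simp
 finally have 1: "(\<integral>t. integrand_P2 t (\<xi> t) (u t) (y t) \<partial>leb T)
   = (\<Sum>k<N. coeff P \<mu> k * (\<integral>t. ?I k t \<partial>leb T))" .
 have gk: "gfun P wh (unit_mult k) (\<xi> 0) (\<xi> T) h = 1/2 * D2 (chi P k) qh (\<xi> 0, \<xi> T + Fv P wh T *v h) (\<xi> 0, \<xi> T + Fv P wh T *v h)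
  + pk k T \<bullet> (dyn2 P (W T) (\<xi> T, 0, 0) (0, 0, h) + (1/2) *\<^sub>R dyn2 P (W T) (Fv P wh T *v h, 0, 0) (0, 0, h))" if "k < N" for k
  unfolding nominal_costate.gfun_eq[OF unit] snd_unit[OF that] coeff_unit
  using that by (simp add: if_distrib[of "\<lambda>r. r * _"] cong: if_cong)
 have 2: "gfun P wh \<mu> (\<xi> 0) (\<xi> T) h = (\<Sum>k<N. coeff P \<mu> k * gfun P wh (unit_mult k) (\<xi> 0) (\<xi> T) h)"
  unfolding gfun_eq adjoint_mult_sum[OF \<mu> T'] by (simp add: gk inner_sum_left distrib_left sum.distrib sum_distrib_left mult_ac)
 show ?thesis unfolding OP_def Omega_P2_eq nominal_costate.Omega_P2_eq[OF unit] 1 2 by (simp add: distrib_left sum.distrib)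
qed

end

context nominal_costate
begin

text \<open>Integrating the pointwise identity leaves the boundary term at \<open>T\<close> only,
  because \<open>yc g 0 = 0\<close>.\<close>

lemma goh_integrated:
 "1/2 * intg T (\<lambda>t. p t \<bullet> dyn2 P (W t) (xlin g t, snd g t) (xlin g t, snd g t))
  = intg T (\<lambda>t. integrand_P2 t (xic g t) (uc g t) (yc g t))
   + yc g T \<bullet> (Hvx P wh \<mu> T *v xic g T + (1/2) *\<^sub>R (Smat P wh \<mu> T *v yc g T))
   + intg T (\<lambda>t. vc g t \<bullet> (Vmat P wh \<mu> t *v yc g t)) + intg T (\<lambda>t. vc g t \<bullet> (Hvu P wh \<mu> t *v uc g t))"
proof -
 define \<psi>' where "\<psi>' t = vc g t \<bullet> (Hvx P wh \<mu> t *v xic g t) + yc g t \<bullet> (Hvx' t *v xic g t)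
     + yc g t \<bullet> (Hvx P wh \<mu> t *v (Fx P wh t *v xic g t + Fu P wh t *v uc g t + Bmat P wh t *v yc g t))
     + vc g t \<bullet> (Smat P wh \<mu> t *v yc g t) + 1/2 * (yc g t \<bullet> (S' t *v yc g t))" for t
 note c = xic_cont[of g] yc_cont[of g] uc_cont[of "{0..T}" g] vc_cont[of "{0..T}" g]
 have c1: "cont_on T (\<lambda>t. integrand_P2 t (xic g t) (uc g t) (yc g t))" unfolding integrand_P2_def
  by (intro continuous_intros continuous_matrix_vector c Hxx_cont Hux_cont Mmat_cont Huu_cont Emat_cont Rmat_cont)
 have c2: "cont_on T \<psi>'" unfolding \<psi>'_def by (intro continuous_intros continuous_matrix_vector c matrix_continuous_intros)
 have c3: "cont_on T (\<lambda>t. vc g t \<bullet> (Vmat P wh \<mu> t *v yc g t))"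
  and c4: "cont_on T (\<lambda>t. vc g t \<bullet> (Hvu P wh \<mu> t *v uc g t))"
  by (intro continuous_intros continuous_matrix_vector c Vmat_cont Hvu_cont)+
 have "1/2 * intg T (\<lambda>t. p t \<bullet> dyn2 P (W t) (xlin g t, snd g t) (xlin g t, snd g t))
   = intg T (\<lambda>t. 1/2 * (p t \<bullet> dyn2 P (W t) (xlin g t, snd g t) (xlin g t, snd g t)))" by simp
 also have "\<dots> = intg T (\<lambda>t. integrand_P2 t (xic g t) (uc g t) (yc g t) + \<psi>' t
   + vc g t \<bullet> (Vmat P wh \<mu> t *v yc g t) + vc g t \<bullet> (Hvu P wh \<mu> t *v uc g t))"
  by (rule integral_cong) (simp only: xlin_eq snd_ctrl goh_pointwise \<psi>'_def)
 also have "\<dots> = intg T (\<lambda>t. integrand_P2 t (xic g t) (uc g t) (yc g t)) + intg T \<psi>'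
   + intg T (\<lambda>t. vc g t \<bullet> (Vmat P wh \<mu> t *v yc g t)) + intg T (\<lambda>t. vc g t \<bullet> (Hvu P wh \<mu> t *v uc g t))"
  by (simp add: integral_add integrable_continuous_real continuous_on_add c1 c2 c3 c4)
 also have "intg T \<psi>' = yc g T \<bullet> (Hvx P wh \<mu> T *v xic g T + (1/2) *\<^sub>R (Smat P wh \<mu> T *v yc g T))"
  using eq_integral_of_derivative[OF goh_boundary_deriv[OF _ xic_deriv yc_deriv], of T g g] T unfolding \<psi>'_def by (simp add: yc_0)
 finally show ?thesis by simp
qed

text \<open>The boundary term of the transformation is precisely what \<open>gfun\<close> adds to
  the second derivative of \<open>ell\<close> when h is \<open>yc g T\<close>; the terms with V and
  H_vu are left over.\<close>

lemma Omega_P2_ctrl: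
 "1/2 * D2ell P wh \<mu> (fst g, xlin g T) + 1/2 * intg T (\<lambda>t. p t \<bullet> dyn2 P (W t) (xlin g t, snd g t) (xlin g t, snd g t))
  = Omega_P2 P wh \<mu> (xic g, uc g, yc g, yc g T)
   + intg T (\<lambda>t. vc g t \<bullet> (Vmat P wh \<mu> t *v yc g t)) + intg T (\<lambda>t. vc g t \<bullet> (Hvu P wh \<mu> t *v uc g t))"
proof -
 have "cont_on T (\<lambda>t. integrand_P2 t (xic g t) (uc g t) (yc g t))" unfolding integrand_P2_def
  by (intro continuous_intros continuous_matrix_vector xic_cont yc_cont uc_cont Hxx_cont Hux_cont Mmat_cont Huu_cont Emat_cont Rmat_cont)
 then show ?thesis unfolding goh_integrated Omega_P2_eq gfun_def Let_def by (simp add: lebesgue_integral_continuous xic_0 xlin_eq)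
qed

end

lemma l2n_le_sup:
 assumes f: "f \<in> L2 T" and b: "\<And>t. t \<in> {0..T} \<Longrightarrow> norm (f t) \<le> s" and "0 \<le> T" "0 \<le> s"
 shows "l2n T f \<le> sqrt T * s"
proof -
 have "(\<integral>t. (norm (f t))\<^sup>2 \<partial>leb T) \<le> (\<integral>t. s\<^sup>2 \<partial>leb T)"
  by (rule integral_mono[OF L2_integrable_sq[OF f]]) (use b in \<open>auto intro!: power_mono integrable_const finite_measureI
   simp: emeasure_restrict_space\<close>)
 also have "\<dots> = T * s\<^sup>2"
  using \<open>0 \<le> T\<close> by (simp add: lebesgue_integral_continuous[OF continuous_on_const] del: lebesgue_integral_const)
 finally have "l2n T f \<le> sqrt (T * s\<^sup>2)" unfolding l2n_def by (rule real_sqrt_le_mono)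
 then show ?thesis using \<open>0 \<le> s\<close> by (simp add: real_sqrt_mult)
qed

lemma matrix_L2_bound:
 fixes A :: "real \<Rightarrow> real^'a::finite^'b::finite"
 assumes "cont_on T A" shows "\<exists>C\<ge>0. \<forall>u\<in>L2 T. l2n T (\<lambda>t. A t *v u t) \<le> C * l2n T u"
proof -
 obtain C where C: "0 \<le> C" "\<forall>t\<in>{0..T}. \<forall>x. norm (A t *v x) \<le> C * norm x" using matrix_bound[OF assms] by blast
 have "l2n T (\<lambda>t. A t *v u t) \<le> C * l2n T u" if "u \<in> L2 T" for u
  using L2_bounded_image(2)[OF that L2_measurable[OF matrix_L2[OF assms that]], of C] C by simp
 then show ?thesis using C(1) by blast
qed

lemma L2conv_zeroI: "(\<And>n. f n \<in> L2 T) \<Longrightarrow> (\<lambda>n. l2n T (f n)) \<longlonglongrightarrow> 0 \<Longrightarrow> L2conv T f (\<lambda>t. 0)"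
 by (simp add: L2conv_def L2_const)

lemma integral_inner_tendsto_0:
 fixes \<kappa> :: "real \<Rightarrow> 'a::euclidean_space"
 assumes \<kappa>: "cont_on T \<kappa>" and f: "\<And>n. cont_on T (f n)"
  and lim: "(\<lambda>n. intg T (\<lambda>t. norm (f n t))) \<longlonglongrightarrow> 0"
 shows "(\<lambda>n. intg T (\<lambda>t. \<kappa> t \<bullet> f n t)) \<longlonglongrightarrow> 0"
proof -
 obtain C where C: "\<And>t. t \<in> {0..T} \<Longrightarrow> norm (\<kappa> t) \<le> C"
  using compact_imp_bounded[OF compact_continuous_image[OF \<kappa>]] unfolding bounded_iff by force
 have "\<bar>intg T (\<lambda>t. \<kappa> t \<bullet> f n t)\<bar> \<le> C * intg T (\<lambda>t. norm (f n t))" for n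
 proof -
  have "norm (intg T (\<lambda>t. \<kappa> t \<bullet> f n t)) \<le> intg T (\<lambda>t. C * norm (f n t))"
  proof (rule integral_norm_bound_integral)
   fix t assume t: "t \<in> {0..T}"
   show "norm (\<kappa> t \<bullet> f n t) \<le> C * norm (f n t)"
    using order_trans[OF Cauchy_Schwarz_ineq2 mult_right_mono[OF C[OF t] norm_ge_zero]] by simp
  qed (intro integrable_continuous_real continuous_intros \<kappa> f)+
  then show ?thesis by simp
 qed
 from tendsto_0_abs_le[OF this] show ?thesis using tendsto_mult_right_zero[OF lim, of C] by simp
qed

section \<open>Variations of the end-point functions, and a criterion for oscillations\<close>

context nominal_ocp
begin

text \<open>The value 0 from \<open>N\<close> on keeps the second variation symmetric for every
  index, as \<open>quadratic_model\<close> requires.\<close>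

definition D2k :: "nat \<Rightarrow> ((real^'n) \<times> (real^'n)) \<Rightarrow>\<^sub>L ((real^'n) \<times> (real^'n)) \<Rightarrow>\<^sub>L real" where
 "D2k k = (if k < N then D2 (chi P k) qh else 0)"

definition Lk :: "nat \<Rightarrow> ('n, 'l, 'm) ctrl \<Rightarrow> real" where "Lk k = first_variation (D1 (chi P k) qh) (pk k)"
definition Bk :: "nat \<Rightarrow> ('n, 'l, 'm) ctrl \<Rightarrow> ('n, 'l, 'm) ctrl \<Rightarrow> real" where "Bk k = second_variation (D2k k) (pk k)"

lemma pk_cont: "cont_on T (pk k)" by (rule costate_cont[OF pk(1)])

lemma quadratic_model: "quadratic_model Lk Bk"
proof -
 have 1: "bounded_linear (Lk i)" for i unfolding Lk_def by (rule bounded_linear_first_variation[OF pk_cont])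
 have 2: "bounded_bilinear (Bk i)" for i unfolding Bk_def by (rule bounded_bilinear_second_variation[OF pk_cont])
 have 3: "Bk i x y = Bk i y x" for i x y unfolding Bk_def by (rule second_variation_sym) (auto simp: D2k_def D2_sym[OF chi_smooth])
 show ?thesis by (rule quadratic_model.intro[OF 1 2 3])
qed

text \<open>The costate form of \<open>Lk\<close> fits the expansion, this form fits the sign
  conditions in \<open>P_2\<close>; the Lagrange identity connects them.\<close>

lemma Lk_eq: "Lk k g = D1 (chi P k) qh (fst g, xlin g T)"
proof -
 have "pk k T \<bullet> xlin g T = pk k 0 \<bullet> xlin g 0 + intg T (\<lambda>t. pk k t \<bullet> dyn1 P (W t) (0, snd g t))"
  using xlin_deriv[of _ g] by (intro costate_integral pk(1)) (simp add: F1_Pair[symmetric] del: snd_conv)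
 moreover have "D1 (chi P k) qh (fst g, xlin g T) = D1 (chi P k) qh (fst g, 0) + D1 (chi P k) qh (0, xlin g T)"
  by (simp add: blinfun.add_right[symmetric])
 ultimately show ?thesis by (simp add: Lk_def first_variation_def pk(2) xlin_0)
qed

lemma unit_costate: "nominal_costate P xh uh vh (unit_mult k)" by (rule nominal_costateI[OF adjoint_unit])

lemma sum_unit: "k < N \<Longrightarrow> (\<Sum>j<N. coeff P (unit_mult k) j * f j) = f k"
 by (simp add: coeff_unit if_distrib[of "\<lambda>r. r * _"] cong: if_cong)

lemma Bk_ctrl:
 assumes k: "k < N" shows "Bk k g g / 2 = OP k (xic g, uc g, yc g, yc g T)
   + intg T (\<lambda>t. vc g t \<bullet> (Vk k t *v yc g t))
   + intg T (\<lambda>t. vc g t \<bullet> (Hvuk k t *v uc g t))" using nominal_costate.Omega_P2_ctrl[OF unit_costate[of k], of g]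
 by (simp add: OP_def Bk_def second_variation_def D2k_def D2ell_eq sum_unit k snd_unit add_divide_distrib)

text \<open>The control v enters only through its primitive y. Hence the Goh state is small as soon
  as u is small in L1 and y in L2, however large v may be.\<close>

lemma xic_bound: "\<exists>C\<ge>0. \<forall>g. \<forall>t\<in>{0..T}. norm (xic g t) \<le> C * (norm (fst g) + intg T (\<lambda>s. norm (uc g s)) + l2n T (yc g))"
proof -
 obtain C1 where C1: "0 \<le> C1" "\<forall>t\<in>{0..T}. \<forall>x. norm (Fu P wh t *v x) \<le> C1 * norm x" using matrix_bound[OF Fu_cont] by blast
 obtain C2 where C2: "0 \<le> C2" "\<forall>t\<in>{0..T}. \<forall>x. norm (Bmat P wh t *v x) \<le> C2 * norm x" using matrix_bound[OF Bmat_cont] by blast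
 define C where "C = (1 + C1 + C2 * sqrt T) * exp (Kc * T)"
 have "norm (xic g t) \<le> C * (norm (fst g) + intg T (\<lambda>s. norm (uc g s)) + l2n T (yc g))" if t: "t \<in> {0..T}" for g t
 proof -
  let ?U = "intg T (\<lambda>s. norm (uc g s))" and ?Y = "l2n T (yc g)"
  have U0: "0 \<le> ?U" and Y0: "0 \<le> ?Y" by (auto simp: l2n_nonneg intro!: integral_nonneg integrable_continuous_real continuous_intros uc_cont)
  have ny: "intg T (\<lambda>s. norm (yc g s)) \<le> sqrt T * ?Y"
   by (rule L2_norm_integral_le[OF continuous_imp_L2[OF yc_cont]]) (use T in simp)
  have cont: "cont_on T (\<lambda>s. Fu P wh s *v uc g s + Bmat P wh s *v yc g s)"
   by (intro continuous_intros continuous_matrix_vector Fu_cont Bmat_cont uc_cont yc_cont)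
  have "norm (xic g t) \<le> (norm (xic g 0) + intg T (\<lambda>s. norm (Fu P wh s *v uc g s + Bmat P wh s *v yc g s))) * exp (Kc * T)"
   by (rule linear_solution_bound[OF _ cont t]) (use xic_deriv[of _ g] in \<open>simp add: pair_zero Fx_apply add.assoc\<close>)
  also have "intg T (\<lambda>s. norm (Fu P wh s *v uc g s + Bmat P wh s *v yc g s))
    \<le> intg T (\<lambda>s. C1 * norm (uc g s) + C2 * norm (yc g s))"
   by (rule integral_le) (use C1 C2 in \<open>auto intro!: integrable_continuous_real continuous_intros cont uc_cont yc_cont norm_triangle_mono\<close>)
  also have "\<dots> = C1 * ?U + C2 * intg T (\<lambda>s. norm (yc g s))"
   by (subst integral_add) (auto intro!: integrable_continuous_real continuous_intros uc_cont yc_cont)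
  also have "\<dots> \<le> C1 * ?U + C2 * (sqrt T * ?Y)" using mult_left_mono[OF ny C2(1)] by simp
  also have "norm (xic g 0) + (C1 * ?U + C2 * (sqrt T * ?Y)) \<le> (1 + C1 + C2 * sqrt T) * (norm (fst g) + ?U + ?Y)"
  proof -
   have "0 \<le> C1 * norm (fst g)" "0 \<le> C1 * ?Y" "0 \<le> C2 * sqrt T * norm (fst g)" "0 \<le> C2 * sqrt T * ?U"
    using U0 Y0 C1 C2 T by (simp_all add: mult_nonneg_nonneg)
   then show ?thesis using U0 Y0 by (simp add: xic_0 algebra_simps)
  qed
  finally show ?thesis by (simp add: C_def mult_ac)
 qed
 moreover have "0 \<le> C" using C1 C2 T by (simp add: C_def)
 ultimately show ?thesis by blast
qed

text \<open>With \<xi> tending to 0 uniformly and y in L2, every term of the transformed form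
  disappears except the one with H_uu, since u is only bounded in L2. Together with the leftover
  terms in V and H_vu this is the limit assumed in \<open>lim\<close>.\<close>

lemma oscillation_vectorI:
 fixes w :: "nat \<Rightarrow> ('n, 'l, 'm) ctrl"
 assumes w0: "\<And>n. fst (w n) = 0" and u1: "(\<lambda>n. intg T (\<lambda>t. norm (uc (w n) t))) \<longlonglongrightarrow> 0"
  and u2: "\<And>n. l2n T (uc (w n)) \<le> C" and y2: "(\<lambda>n. l2n T (yc (w n))) \<longlonglongrightarrow> 0" and yT: "(\<lambda>n. yc (w n) T) \<longlonglongrightarrow> 0"
  and v: "\<And>\<kappa>. cont_on T \<kappa> \<Longrightarrow> (\<lambda>n. intg T (\<lambda>t. \<kappa> t \<bullet> vc (w n) t)) \<longlonglongrightarrow> 0"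
  and lim: "\<And>k. k < N \<Longrightarrow> (\<lambda>n. 1/2 * intg T (\<lambda>t. uc (w n) t \<bullet> (Huuk k t *v uc (w n) t))
   + intg T (\<lambda>t. vc (w n) t \<bullet> (Vk k t *v yc (w n) t))
   + intg T (\<lambda>t. vc (w n) t \<bullet> (Hvuk k t *v uc (w n) t))) \<longlonglongrightarrow> c k" shows "oscillation_vector N Lk Bk c"
proof -
 obtain Cx where Cx: "0 \<le> Cx" "\<forall>g. \<forall>t\<in>{0..T}. norm (xic g t) \<le> Cx * (norm (fst g) + intg T (\<lambda>s. norm (uc g s)) + l2n T (yc g))"
  using xic_bound by blast
 define s where "s n = Cx * (intg T (\<lambda>s. norm (uc (w n) s)) + l2n T (yc (w n)))" for n
 have s0: "s \<longlonglongrightarrow> 0" using tendsto_mult_right_zero[OF tendsto_add_zero[OF u1 y2], of Cx] by (simp add: s_def[abs_def])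
 have xs: "norm (xic (w n) t) \<le> s n" if "t \<in> {0..T}" for n t using Cx(2)[rule_format, of t "w n"] that w0[of n] by (simp add: s_def)
 have s_nn: "0 \<le> s n" for n using order_trans[OF norm_ge_zero xs[of 0 n]] T by simp
 have T': "T \<in> {0..T}" using T by simp
 have mx: "xic (w n) \<in> L2 T" and mu: "uc (w n) \<in> L2 T" and my: "yc (w n) \<in> L2 T" for n
  by (intro continuous_imp_L2 xic_cont uc_cont yc_cont)+
 have "(\<lambda>n. sqrt T * s n) \<longlonglongrightarrow> 0" by (rule tendsto_mult_right_zero[OF s0])
 moreover have "\<bar>l2n T (xic (w n))\<bar> \<le> sqrt T * s n" for n
  using l2n_le_sup[OF mx, of n "s n"] xs s_nn T by (simp add: l2n_nonneg)
 ultimately have x2: "(\<lambda>n. l2n T (xic (w n))) \<longlonglongrightarrow> 0" by (rule tendsto_0_abs_le[rotated])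
 have Lx: "L2conv T (\<lambda>n. xic (w n)) (\<lambda>t. 0)" and Ly: "L2conv T (\<lambda>n. yc (w n)) (\<lambda>t. 0)"
  by (intro L2conv_zeroI mx my x2 y2)+
 have xT: "(\<lambda>n. xic (w n) T) \<longlonglongrightarrow> 0"
  using tendsto_0_abs_le[of "\<lambda>n. norm (xic (w n) T)" s] xs[OF T'] s0 by (simp add: tendsto_norm_zero_iff)
 have mv: "(\<lambda>n. A *v f n) \<longlonglongrightarrow> 0" if "f \<longlonglongrightarrow> 0" for A :: "real^'a::finite^'b::finite" and f
  using bounded_bilinear.tendsto[OF bounded_bilinear_matrix_vector tendsto_const that, of A] by simp
 have xlT: "(\<lambda>n. xlin (w n) T) \<longlonglongrightarrow> 0" unfolding xlin_eq using tendsto_add[OF xT mv[OF yT]] by simp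
 have xl1: "(\<lambda>n. intg T (\<lambda>t. norm (xlin (w n) t))) \<longlonglongrightarrow> 0"
 proof -
  obtain C2 where C2: "0 \<le> C2" "\<forall>t\<in>{0..T}. \<forall>x. norm (Fv P wh t *v x) \<le> C2 * norm x" using matrix_bound[OF Fv_cont] by blast
  have b: "\<bar>intg T (\<lambda>t. norm (xlin (w n) t))\<bar> \<le> sqrt T * l2n T (xic (w n)) + C2 * (sqrt T * l2n T (yc (w n)))" for n
  proof -
   have "intg T (\<lambda>t. norm (xlin (w n) t)) \<le> intg T (\<lambda>t. norm (xic (w n) t) + C2 * norm (yc (w n) t))"
    by (rule integral_le) (use C2 in \<open>auto intro!: integrable_continuous_real continuous_intros xlin_cont xic_cont yc_cont
     norm_triangle_mono simp: xlin_eq intro: continuous_matrix_vector Fv_cont\<close>)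
   also have "\<dots> = intg T (\<lambda>t. norm (xic (w n) t)) + C2 * intg T (\<lambda>t. norm (yc (w n) t))"
    by (subst integral_add) (auto intro!: integrable_continuous_real continuous_intros xic_cont yc_cont)
   also have "\<dots> \<le> sqrt T * l2n T (xic (w n)) + C2 * (sqrt T * l2n T (yc (w n)))"
    by (intro add_mono mult_left_mono C2 L2_norm_integral_le[OF _ T'] mx my)
   finally show ?thesis using integral_nonneg[OF integrable_continuous_real[OF continuous_on_norm[OF xlin_cont]], of "w n"] by simp
  qed
  have "(\<lambda>n. sqrt T * l2n T (xic (w n)) + C2 * (sqrt T * l2n T (yc (w n)))) \<longlonglongrightarrow> 0"
   by (intro tendsto_add_zero tendsto_mult_right_zero x2 y2)
  from tendsto_0_abs_le[OF b this] show ?thesis .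
 qed
 have "(\<lambda>n. Bk k g (w n)) \<longlonglongrightarrow> 0" if k: "k < N" for k g
 proof -
  define G where "G t = (xlin g t, uc g t, vc g t)" for t
  have G: "cont_on T G" unfolding G_def by (intro continuous_intros xlin_cont uc_cont vc_cont)
  \<comment> \<open>Against a fixed \<open>g\<close> the second variation is linear in the
    oscillation, with continuous kernels for its state, its u and its v; each of the three parts
    tends to 0 for its own reason.\<close>
  define kx where "kx t = (\<Sum>b\<in>Basis. (pk k t \<bullet> dyn2 P (W t) (G t) (b, 0, 0)) *\<^sub>R b)" for t
  define ku where "ku t = (\<Sum>b\<in>Basis. (pk k t \<bullet> dyn2 P (W t) (G t) (0, b, 0)) *\<^sub>R b)" for t
  define kv where "kv t = (\<Sum>b\<in>Basis. (pk k t \<bullet> dyn2 P (W t) (G t) (0, 0, b)) *\<^sub>R b)" for t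
  have kx: "kx t \<bullet> x = pk k t \<bullet> dyn2 P (W t) (G t) (x, 0, 0)" and ku: "ku t \<bullet> u = pk k t \<bullet> dyn2 P (W t) (G t) (0, u, 0)"
   and kv: "kv t \<bullet> v = pk k t \<bullet> dyn2 P (W t) (G t) (0, 0, v)" for t x u v
   unfolding kx_def ku_def kv_def by (rule blinfun_representer; simp add: linear_iff)+
  have kc: "cont_on T kx" "cont_on T ku" "cont_on T kv" unfolding kx_def ku_def kv_def by (intro continuous_intros pk_cont dyn2_cont G)+
  have eq: "pk k t \<bullet> dyn2 P (W t) (G t) (x, u, v) = kx t \<bullet> x + ku t \<bullet> u + kv t \<bullet> v" for t x u v
   unfolding kx ku kv by (simp add: inner_add_right[symmetric] blinfun.add_right[symmetric])
  have "(\<lambda>n. D2k k (fst g, xlin g T) (0, xlin (w n) T) + (intg T (\<lambda>t. kx t \<bullet> xlin (w n) t)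
    + intg T (\<lambda>t. ku t \<bullet> uc (w n) t) + intg T (\<lambda>t. kv t \<bullet> vc (w n) t))) \<longlonglongrightarrow> D2k k (fst g, xlin g T) (0, 0) + (0 + 0 + 0)"
   by (intro tendsto_add blinfun.tendsto tendsto_const tendsto_Pair xlT integral_inner_tendsto_0 kc xlin_cont uc_cont xl1 u1 v)
  moreover have "Bk k g (w n) = D2k k (fst g, xlin g T) (0, xlin (w n) T) + (intg T (\<lambda>t. kx t \<bullet> xlin (w n) t)
    + intg T (\<lambda>t. ku t \<bullet> uc (w n) t) + intg T (\<lambda>t. kv t \<bullet> vc (w n) t))" for n
  proof -
   have "cont_on T (\<lambda>t. kx t \<bullet> xlin (w n) t)" "cont_on T (\<lambda>t. ku t \<bullet> uc (w n) t)"
    "cont_on T (\<lambda>t. kv t \<bullet> vc (w n) t)" by (intro continuous_intros kc xlin_cont uc_cont vc_cont)+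
   then show ?thesis unfolding Bk_def second_variation_def w0 G_def[symmetric] snd_ctrl eq
    by (simp add: integral_add integrable_continuous_real continuous_on_add)
  qed
  ultimately show ?thesis by (simp add: zero_prod_def[symmetric])
 qed
 moreover have "(\<lambda>n. Lk k (w n)) \<longlonglongrightarrow> 0" for k
 proof -
  have "(\<lambda>n. D1 (chi P k) qh (0, xlin (w n) T)) \<longlonglongrightarrow> D1 (chi P k) qh (0, 0)"
   by (intro blinfun.tendsto tendsto_const tendsto_Pair xlT)
  then show ?thesis by (simp add: Lk_eq w0 zero_prod_def[symmetric])
 qed
 moreover have "(\<lambda>n. Bk k (w n) (w n) / 2) \<longlonglongrightarrow> c k" if k: "k < N" for k
 proof -
  interpret u: nominal_costate P xh uh vh "unit_mult k" by (rule unit_costate)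
  \<comment> \<open>The part of the transformed form that has to vanish: everything but the term
    with H_uu.\<close>
  define r where "r n = OP k (xic (w n), uc (w n), yc (w n), yc (w n) T) -
    1/2 * intg T (\<lambda>t. uc (w n) t \<bullet> (Huuk k t *v uc (w n) t))" for n
  have z: "(\<lambda>n. (0 :: real^'n, xic (w n) T + Fv P wh T *v yc (w n) T)) \<longlonglongrightarrow> (0, 0)"
   using tendsto_Pair[OF tendsto_const tendsto_add[OF xT mv[OF yT]]] by simp
  have "(\<lambda>n. gfun P wh (unit_mult k) 0 (xic (w n) T) (yc (w n) T))
    \<longlonglongrightarrow> 1/2 * (\<Sum>j<N. coeff P (unit_mult k) j * D2 (chi P j) qh (0, 0) (0, 0))
     + u.p T \<bullet> (dyn2 P (W T) (0, 0, 0) (0, 0, 0) + (1/2) *\<^sub>R dyn2 P (W T) (0, 0, 0) (0, 0, 0))"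
   unfolding u.gfun_eq by (intro tendsto_intros z xT yT mv blinfun.tendsto)
  then have g0: "(\<lambda>n. gfun P wh (unit_mult k) 0 (xic (w n) T) (yc (w n) T)) \<longlonglongrightarrow> 0"
   by (simp add: zero_prod_def[symmetric])
  have t1: "(\<lambda>n. form T A (uc (w n)) (f n)) \<longlonglongrightarrow> 0"
   if "cont_on T A" "L2conv T f (\<lambda>t. 0)" for f :: "nat \<Rightarrow> real \<Rightarrow> real^'a::finite" and A
   using L2_inner_convergence[where U="\<lambda>n. uc (w n)" and u="\<lambda>t. 0", OF that(1) mu u2 _ that(2)] by simp
  have t2: "(\<lambda>n. form T A (f n) (f' n)) \<longlonglongrightarrow> 0"
   if "cont_on T A" "L2conv T f (\<lambda>t. 0)" "L2conv T f' (\<lambda>t. 0)" for f :: "nat \<Rightarrow> real \<Rightarrow> real^'a::finite" and f' :: "nat \<Rightarrow> real \<Rightarrow> real^'b::finite" and A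
   using L2conv_quadratic[OF that] by simp
  have E: "(\<lambda>n. form T (Emat P wh (unit_mult k)) (yc (w n)) (uc (w n))) \<longlonglongrightarrow> 0"
   using t1[OF bounded_linear.continuous_on[OF u.bounded_linear_transpose u.Emat_cont] Ly] by (simp add: inner_transpose inner_commute)
  have "(\<lambda>n. gfun P wh (unit_mult k) 0 (xic (w n) T) (yc (w n) T) + (1/2 * form T (Hxx P wh (unit_mult k)) (xic (w n)) (xic (w n))
    + form T (Hux P wh (unit_mult k)) (uc (w n)) (xic (w n))
    + form T (Mmat P wh (unit_mult k)) (yc (w n)) (xic (w n))
    + form T (Emat P wh (unit_mult k)) (yc (w n)) (uc (w n))
    + 1/2 * form T (Rmat P wh (unit_mult k)) (yc (w n)) (yc (w n)))) \<longlonglongrightarrow> 0"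
   by (intro tendsto_add_zero tendsto_mult_right_zero g0 E t1 t2 u.Hxx_cont u.Hux_cont u.Mmat_cont u.Rmat_cont Lx Ly)
  moreover have "form T (Huuk k) (uc (w n)) (uc (w n))
   = intg T (\<lambda>t. uc (w n) t \<bullet> (Huuk k t *v uc (w n) t))" for n
   by (intro lebesgue_integral_continuous continuous_intros continuous_matrix_vector u.Huu_cont uc_cont)
  ultimately have "r \<longlonglongrightarrow> 0" unfolding r_def OP_def u.Omega_P2_eq u.integrand_P2_terms(2)[OF mx mu my] xic_0 w0
   by (simp add: algebra_simps)
  from tendsto_add[OF this lim[OF k]] show ?thesis unfolding r_def Bk_ctrl[OF k] by (simp add: algebra_simps)
 qed
 ultimately show ?thesis unfolding oscillation_vector_def by (intro exI[of _ w]) blast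
qed

end

section \<open>Impulses and loops\<close>

lemma l2n_continuous: "cont_on T f \<Longrightarrow> l2n T f = sqrt (intg T (\<lambda>t. (norm (f t))\<^sup>2))"
 unfolding l2n_def by (simp add: lebesgue_integral_continuous continuous_on_power continuous_on_norm)

context
 fixes T t0 s :: real and h :: "real \<Rightarrow> real"
 assumes s: "0 \<le> t0" "0 < s" "t0 + s \<le> T" and h: "continuous_on UNIV h" "\<forall>x. x \<notin> {0..1} \<longrightarrow> h x = 0"
begin

lemma rescaled_bump_continuous: "continuous_on S (\<lambda>t. h ((t - t0) / s) / s)"
 using s by (intro continuous_intros continuous_on_compose2[OF h(1)]) auto

lemma integral_rescaled_bump: "intg T (\<lambda>t. h ((t - t0) / s) / s) = intg 1 h"
proof -
 have "(h has_integral intg 1 h) (cbox 0 1)"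
  using integrable_continuous_real[OF continuous_on_subset[OF h(1)], of 0 1] by (simp add: integrable_integral)
 from has_integral_affinity'[OF this, of "1/s" "- t0/s"] s
 have "((\<lambda>t. h ((t - t0) / s)) has_integral (s * intg 1 h)) {t0..t0+s}"
  by (simp add: algebra_simps diff_divide_distrib add_divide_distrib)
 from has_integral_divide[OF this, of s] s
 have "((\<lambda>t. h ((t - t0) / s) / s) has_integral intg 1 h) {t0..t0+s}" by simp
 then have "((\<lambda>t. h ((t - t0) / s) / s) has_integral intg 1 h) {0..T}"
  by (rule has_integral_on_superset) (use s h(2) in \<open>auto simp: divide_simps\<close>)
 then show ?thesis by (rule integral_unique)
qed

end

text \<open>An approximate identity: the rescaled profile keeps its integral and is supported in
  \<open>[t0, t0 + s n]\<close>, where \<open>f\<close> is close to \<open>f t0\<close>. The profile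
  may change sign.\<close>

lemma concentration:
 fixes f h :: "real \<Rightarrow> real" and s :: "nat \<Rightarrow> real"
 assumes t0: "0 \<le> t0" and s: "\<And>n. 0 < s n" "\<And>n. t0 + s n \<le> T" "s \<longlonglongrightarrow> 0"
  and h: "continuous_on UNIV h" "\<forall>x. x \<notin> {0..1} \<longrightarrow> h x = 0" and f: "cont_on T f"
 shows "(\<lambda>n. intg T (\<lambda>t. f t * (h ((t - t0) / s n) / s n))) \<longlonglongrightarrow> f t0 * intg 1 h"
proof -
 define H where "H = intg 1 (\<lambda>x. \<bar>h x\<bar>)"
 have H: "0 \<le> H" unfolding H_def
  by (intro integral_nonneg integrable_continuous_real continuous_intros continuous_on_subset[OF h(1)]) auto
 have t0T: "t0 \<in> {0..T}" using t0 s(1)[of 0] s(2)[of 0] by simp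
 note hs = rescaled_bump_continuous[OF t0 s(1,2) h]
 have ah: "continuous_on UNIV (\<lambda>x. \<bar>h x\<bar>)" "\<forall>x. x \<notin> {0..1} \<longrightarrow> \<bar>h x\<bar> = 0" using h by (auto intro: continuous_intros)
 show ?thesis
 proof (rule LIMSEQ_I)
  fix r :: real assume r: "0 < r"
  define e where "e = r / (H + 1)"
  have e: "0 < e" "e * H < r" using r H by (auto simp: e_def divide_simps algebra_simps)
  obtain d where d: "0 < d" "\<And>t. t \<in> {0..T} \<Longrightarrow> dist t t0 < d \<Longrightarrow> dist (f t) (f t0) < e"
   using f t0T e(1) unfolding continuous_on_iff by blast
  obtain n0 where n0: "\<And>n. n \<ge> n0 \<Longrightarrow> norm (s n - 0) < d" using LIMSEQ_D[OF s(3) d(1)] by blast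
  have "norm (intg T (\<lambda>t. f t * (h ((t - t0) / s n) / s n)) - f t0 * intg 1 h) < r" if n: "n \<ge> n0" for n
  proof -
   have eq: "intg T (\<lambda>t. f t * (h ((t - t0) / s n) / s n)) - f t0 * intg 1 h
     = intg T (\<lambda>t. (f t - f t0) * (h ((t - t0) / s n) / s n))"
   proof -
    have "f t0 * intg 1 h = intg T (\<lambda>t. f t0 * (h ((t - t0) / s n) / s n))"
     unfolding integral_mult_right using integral_rescaled_bump[OF t0 s(1,2) h, of n] by simp
    moreover have "cont_on T (\<lambda>t. f t * (h ((t - t0) / s n) / s n))"
     "cont_on T (\<lambda>t. f t0 * (h ((t - t0) / s n) / s n))" using continuous_on_mult[OF f hs] continuous_on_mult_left[OF hs] by blast+
    ultimately show ?thesis by (simp only: left_diff_distrib integral_diff[OF integrable_continuous_real integrable_continuous_real])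
   qed
   also have "norm \<dots> \<le> intg T (\<lambda>t. e * (\<bar>h ((t - t0) / s n)\<bar> / s n))"
   proof (rule integral_norm_bound_integral)
    fix t assume t: "t \<in> {0..T}"
    show "norm ((f t - f t0) * (h ((t - t0) / s n) / s n)) \<le> e * (\<bar>h ((t - t0) / s n)\<bar> / s n)"
    proof (cases "(t - t0) / s n \<in> {0..1}")
     case True
     then have "0 \<le> t - t0" "t - t0 \<le> s n" using s(1)[of n] by (auto simp: divide_simps split: if_splits)
     then have "\<bar>f t - f t0\<bar> \<le> e" using d(2)[OF t] n0[OF n] by (auto simp: dist_real_def)
     then show ?thesis using s(1)[of n] by (simp add: abs_mult divide_simps mult_right_mono)
    qed (use h(2) in auto)
   qed (rule integrable_continuous_real,
     (rule continuous_on_mult[OF continuous_on_diff[OF f continuous_on_const] hs]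
      | rule continuous_on_mult_left[OF rescaled_bump_continuous[OF t0 s(1,2) ah]]))+
   also have "\<dots> = e * H" unfolding integral_mult_right H_def integral_rescaled_bump[OF t0 s(1,2) ah, of n] ..
   finally show ?thesis using e(2) by simp
  qed
  then show "\<exists>n0. \<forall>n\<ge>n0. norm (intg T (\<lambda>t. f t * (h ((t - t0) / s n) / s n)) - f t0 * intg 1 h) < r" by blast
 qed
qed

text \<open>A parabola cut off at 0. Its square is continuously differentiable, so that it can be a
  component of y whose derivative is an admissible v.\<close>

definition bump :: "real \<Rightarrow> real" where "bump x = max 0 (x * (1 - x))"

lemma bump: "continuous_on S bump" "x \<notin> {0..1} \<Longrightarrow> bump x = 0" "0 \<le> bump x"
proof -
 show "x \<notin> {0..1} \<Longrightarrow> bump x = 0"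
  unfolding bump_def by (cases "x < 0") (auto simp: mult_nonneg_nonpos mult_nonpos_nonneg)
qed (auto simp: bump_def[abs_def] intro!: continuous_intros)

lemma bump_power_integral_pos: "0 < intg 1 (\<lambda>x. bump x ^ k)"
proof -
 have c: "cont_on 1 (\<lambda>x. bump x ^ k)" by (intro continuous_intros bump)
 have "intg 1 (\<lambda>x. bump x ^ k) \<noteq> 0"
 proof
  assume "intg 1 (\<lambda>x. bump x ^ k) = 0"
  then have "\<forall>x\<in>{0..1}. bump x ^ k = 0" by (subst (asm) integral_eq_0_iff[OF c]) (simp_all add: bump(3))
  then have "bump (1/2) ^ k = 0" by (rule bspec) simp
  then show False by (simp add: bump_def)
 qed
 moreover have "0 \<le> intg 1 (\<lambda>x. bump x ^ k)" by (intro integral_nonneg integrable_continuous_real c) (simp add: bump(3))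
 ultimately show ?thesis by simp
qed

text \<open>The square of the positive part is differentiable even where the positive part has its
  kink.\<close>

lemma DERIV_bump_sq: "((\<lambda>x. bump x ^ 2) has_real_derivative 2 * bump x * (1 - 2 * x)) (at x)"
proof -
 have pos: "((\<lambda>x. (max 0 x)\<^sup>2) has_real_derivative 2 * max 0 x) (at x)" for x :: real unfolding DERIV_def
 proof (rule LIM_zero_cancel, rule Lim_null_comparison[where g="\<lambda>h. \<bar>h\<bar>"])
  have "\<bar>((max 0 (x + h))\<^sup>2 - (max 0 x)\<^sup>2) / h - 2 * max 0 x\<bar> \<le> \<bar>h\<bar>" if "h \<noteq> 0" for h
  proof -
   have "\<bar>(max 0 (x + h))\<^sup>2 - (max 0 x)\<^sup>2 - 2 * max 0 x * h\<bar> \<le> h\<^sup>2"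
   proof (cases "0 \<le> x"; cases "0 \<le> x + h")
    assume "0 \<le> x" "\<not> 0 \<le> x + h"
    then have "0 \<le> x * (- h - x)" "0 \<le> (h + x)\<^sup>2" "x * h \<le> 0" by (auto simp: mult_nonneg_nonpos)
    then have "- (x\<^sup>2) - 2 * x * h \<le> h\<^sup>2" "- (x\<^sup>2) - 2 * x * h \<ge> 0" by (auto simp: power2_eq_square algebra_simps)
    then show ?thesis using \<open>0 \<le> x\<close> \<open>\<not> 0 \<le> x + h\<close> by (simp add: max_def)
   next
    assume "\<not> 0 \<le> x" "0 \<le> x + h"
    then show ?thesis by (auto simp: max_def intro!: power_mono)
   qed (auto simp: max_def power2_eq_square algebra_simps)
   then have "\<bar>((max 0 (x + h))\<^sup>2 - (max 0 x)\<^sup>2 - 2 * max 0 x * h) / h\<bar> \<le> \<bar>h\<bar>"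
    unfolding abs_divide using that by (subst pos_divide_le_eq) (auto simp: power2_eq_square)
   then show ?thesis using that by (simp add: diff_divide_distrib)
  qed
  then show "\<forall>\<^sub>F h in at 0. norm (((max 0 (x + h))\<^sup>2 - (max 0 x)\<^sup>2) / h - 2 * max 0 x) \<le> \<bar>h\<bar>"
   by (auto simp: eventually_at intro!: exI[of _ 1])
  show "((\<lambda>h. \<bar>h\<bar>) \<longlongrightarrow> 0) (at (0::real))" using tendsto_rabs_zero[OF tendsto_ident_at] .
 qed
 have "((\<lambda>x. x * (1 - x)) has_real_derivative (1 - 2 * x)) (at x)" for x :: real by (auto intro!: derivative_eq_intros)
 from DERIV_chain2[OF pos this] show ?thesis by (simp add: bump_def)
qed

context nominal_ocp
begin

definition ctrl_of :: "(real \<Rightarrow> real^'l) \<Rightarrow> (real \<Rightarrow> real^'m) \<Rightarrow> ('n, 'l, 'm) ctrl" where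
 "ctrl_of u v = (0, clamp_ext T (\<lambda>t. (u t, v t)))"

lemma ctrl_of:
 assumes "cont_on T u" "cont_on T v" "t \<in> {0..T}" shows "uc (ctrl_of u v) t = u t" "vc (ctrl_of u v) t = v t"
 using apply_clamp_ext_on[OF _ continuous_on_Pair[OF assms(1,2)] assms(3)] T by (simp_all add: uc_def vc_def ctrl_of_def)

lemma oscillation_vector_controls:
 fixes u :: "nat \<Rightarrow> real \<Rightarrow> real^'l" and v y :: "nat \<Rightarrow> real \<Rightarrow> real^'m"
 assumes u: "\<And>n. cont_on T (u n)" and v: "\<And>n. cont_on T (v n)"
  and y: "\<And>n t. t \<in> {0..T} \<Longrightarrow> vd T (y n) (v n t) t" "\<And>n. y n 0 = 0"
  and u1: "(\<lambda>n. intg T (\<lambda>t. norm (u n t))) \<longlonglongrightarrow> 0"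
  and u2: "\<And>n. l2n T (u n) \<le> C" and y2: "(\<lambda>n. l2n T (y n)) \<longlonglongrightarrow> 0" and yT: "(\<lambda>n. y n T) \<longlonglongrightarrow> 0"
  and v1: "\<And>\<kappa>. cont_on T \<kappa> \<Longrightarrow> (\<lambda>n. intg T (\<lambda>t. \<kappa> t \<bullet> v n t)) \<longlonglongrightarrow> 0"
  and lim: "\<And>k. k < N \<Longrightarrow> (\<lambda>n. 1/2 * intg T (\<lambda>t. u n t \<bullet> (Huuk k t *v u n t))
   + intg T (\<lambda>t. v n t \<bullet> (Vk k t *v y n t))
   + intg T (\<lambda>t. v n t \<bullet> (Hvuk k t *v u n t))) \<longlonglongrightarrow> c k" shows "oscillation_vector N Lk Bk c"
proof -
 define w where "w n = ctrl_of (u n) (v n)" for n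
 have wu: "uc (w n) t = u n t" and wv: "vc (w n) t = v n t" if "t \<in> {0..T}" for n t using ctrl_of[OF u v that] by (simp_all add: w_def)
 have wy: "yc (w n) t = y n t" if t: "t \<in> {0..T}" for n t
 proof -
  have "yc (w n) t = intg t (v n)" unfolding yc_def by (rule integral_cong) (use wv t in auto)
  then show ?thesis using eq_integral_of_derivative[OF y(1) t, of n] y(2) by simp
 qed
 have i1: "intg T (\<lambda>t. norm (uc (w n) t)) = intg T (\<lambda>t. norm (u n t))"
  and i2: "intg T (\<lambda>t. \<kappa> t \<bullet> vc (w n) t) = intg T (\<lambda>t. \<kappa> t \<bullet> v n t)"
  and i3: "intg T (\<lambda>t. uc (w n) t \<bullet> (A t *v uc (w n) t)) = intg T (\<lambda>t. u n t \<bullet> (A t *v u n t))"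
  and i4: "intg T (\<lambda>t. vc (w n) t \<bullet> (B t *v yc (w n) t)) = intg T (\<lambda>t. v n t \<bullet> (B t *v y n t))"
  and i5: "intg T (\<lambda>t. vc (w n) t \<bullet> (D t *v uc (w n) t)) = intg T (\<lambda>t. v n t \<bullet> (D t *v u n t))"
  for n \<kappa> A B D by (rule integral_cong; simp add: wu wv wy)+
 have i6: "l2n T (uc (w n)) = l2n T (u n)" and i7: "l2n T (yc (w n)) = l2n T (y n)" for n by (intro l2n_cong wu wy; simp)+
 have i8: "yc (w n) T = y n T" for n using wy T by simp
 have i9: "fst (w n) = 0" for n by (simp add: w_def ctrl_of_def)
 show ?thesis by (rule oscillation_vectorI[of w C, unfolded i1 i2 i3 i4 i5 i6 i7 i8, OF i9 u1 u2 y2 yT v1 lim])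
qed

lemma shrinking:
 assumes "t0 \<in> {0..<T}" shows "\<exists>s. (\<forall>n. 0 < s n \<and> t0 + s n \<le> T) \<and> s \<longlonglongrightarrow> 0"
proof (intro exI[of _ "\<lambda>n. (T - t0) / real (Suc n)"] conjI allI)
 fix n
 have "(T - t0) / real (Suc n) \<le> (T - t0) / 1" using assms by (intro divide_left_mono) auto
 then show "t0 + (T - t0) / real (Suc n) \<le> T" by simp
 show "0 < (T - t0) / real (Suc n)" using assms by simp
next
 show "(\<lambda>n. (T - t0) / real (Suc n)) \<longlonglongrightarrow> 0" using LIMSEQ_Suc[OF lim_const_over_n] by simp
qed

text \<open>The controls u and v receive the same scalar impulse, multiplied by the vectors
  \<open>c\<close> and \<open>b\<close>. Its primitive tends to 0, which removes the V-term, whereas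
  its square concentrates at \<open>t0\<close> and reads off H_uu and H_vu there.\<close>

lemma impulse_oscillation:
 assumes t0: "t0 \<in> {0..<T}" shows "oscillation_vector N Lk Bk (\<lambda>k. intg 1 (\<lambda>x. bump x ^ 2) *
  (1/2 * (c \<bullet> (Huuk k t0 *v c)) + b \<bullet> (Hvuk k t0 *v c)))"
proof -
 obtain s where s': "\<forall>n. 0 < s n \<and> t0 + s n \<le> T" "s \<longlonglongrightarrow> 0" using shrinking[OF t0] by blast
 then have s: "\<And>n. 0 < s n" "\<And>n. t0 + s n \<le> T" "s \<longlonglongrightarrow> 0" by blast+
 have t0': "0 \<le> t0" "t0 \<in> {0..T}" using t0 by auto
 \<comment> \<open>Height of order 1 / sqrt s on an interval of length s: the integral is of order
   sqrt s, the L2 norm does not depend on n.\<close>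
 define \<phi> where "\<phi> n t = sqrt (s n) * (bump ((t - t0) / s n) / s n)" for n t
 have b1: "continuous_on UNIV bump" "\<forall>x. x \<notin> {0..1} \<longrightarrow> bump x = 0" by (simp_all add: bump)
 have b2: "continuous_on UNIV (\<lambda>x. bump x ^ 2)" "\<forall>x. x \<notin> {0..1} \<longrightarrow> bump x ^ 2 = 0" using bump by (auto intro!: continuous_intros)
 have \<phi>c: "continuous_on S (\<phi> n)" for n S
  unfolding \<phi>_def by (intro continuous_intros rescaled_bump_continuous[OF t0'(1) s(1,2) b1])
 have \<phi>0: "0 \<le> \<phi> n t" for n t using s(1)[of n] bump(3) by (simp add: \<phi>_def)
 have \<phi>1: "intg T (\<phi> n) = sqrt (s n) * intg 1 bump" for n
  unfolding \<phi>_def integral_mult_right integral_rescaled_bump[OF t0'(1) s(1,2) b1, of n] ..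
 have \<phi>1_0: "(\<lambda>n. intg T (\<phi> n)) \<longlonglongrightarrow> 0"
  unfolding \<phi>1 using tendsto_mult_left_zero[OF tendsto_real_sqrt[OF s(3), simplified]] by simp
 have sq: "\<phi> n t * \<phi> n t = bump ((t - t0) / s n) ^ 2 / s n" for n t
  using s(1)[of n] by (simp add: \<phi>_def power2_eq_square divide_simps)
 have conc: "(\<lambda>n. intg T (\<lambda>t. f t * (\<phi> n t * \<phi> n t))) \<longlonglongrightarrow> f t0 * intg 1 (\<lambda>x. bump x ^ 2)"
  if "cont_on T f" for f unfolding sq by (rule concentration[OF t0'(1) s b2 that])
 have nrm: "intg T (\<lambda>t. norm (\<phi> n t *\<^sub>R a)) = intg T (\<phi> n) * norm a" for n and a :: "'x::real_normed_vector"
  using \<phi>0 by simp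
 have l2: "l2n T (\<lambda>t. \<phi> n t *\<^sub>R a) = norm a * sqrt (intg 1 (\<lambda>x. bump x ^ 2))" for n and a :: "'x::euclidean_space"
 proof -
  have "intg T (\<lambda>t. (norm (\<phi> n t *\<^sub>R a))\<^sup>2) = intg T (\<lambda>t. (norm a)\<^sup>2 * (bump ((t - t0) / s n) ^ 2 / s n))"
   unfolding sq[symmetric] by (simp add: power2_eq_square mult_ac)
  also have "\<dots> = (norm a)\<^sup>2 * intg 1 (\<lambda>x. bump x ^ 2)"
   unfolding integral_mult_right integral_rescaled_bump[OF t0'(1) s(1,2) b2, of n] ..
  finally show ?thesis by (subst l2n_continuous) (auto intro!: continuous_intros \<phi>c simp: real_sqrt_mult)
 qed
 define y where "y n t = intg t (\<lambda>t. \<phi> n t *\<^sub>R b)" for n t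
 have yd: "vd T (y n) (\<phi> n t *\<^sub>R b) t" if "t \<in> {0..T}" for n t
  unfolding y_def by (rule integral_has_vector_derivative[OF _ that]) (intro continuous_intros \<phi>c)
 have yb: "norm (y n t) \<le> intg T (\<phi> n) * norm b" if t: "t \<in> {0..T}" for n t
 proof -
  have "norm (y n t) \<le> intg t (\<lambda>t. norm (\<phi> n t *\<^sub>R b))"
   unfolding y_def by (rule norm_integral_le[OF L2_integrable[OF continuous_imp_L2] t]) (intro continuous_intros \<phi>c)
  also have "\<dots> \<le> intg T (\<lambda>t. norm (\<phi> n t *\<^sub>R b))"
   by (rule integral_subset_le) (use t in \<open>auto intro!: integrable_continuous_real continuous_intros \<phi>c\<close>)
  finally show ?thesis unfolding nrm .
 qed
 have y0: "(\<lambda>n. intg T (\<phi> n) * norm b) \<longlonglongrightarrow> 0" by (rule tendsto_mult_left_zero[OF \<phi>1_0])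
 have Y: "y n \<in> L2 T" for n by (rule continuous_imp_L2[OF has_vector_derivative_continuous_on[OF yd]])
 have y2: "(\<lambda>n. l2n T (y n)) \<longlonglongrightarrow> 0"
 proof (rule tendsto_0_abs_le[OF _ tendsto_mult_right_zero[OF y0]])
  show "\<bar>l2n T (y n)\<bar> \<le> sqrt T * (intg T (\<phi> n) * norm b)" for n
   using l2n_le_sup[OF Y yb, of n] T order_trans[OF norm_ge_zero yb[of 0 n]] by (simp add: l2n_nonneg)
 qed
 show ?thesis
 proof (rule oscillation_vector_controls[where u="\<lambda>n t. \<phi> n t *\<^sub>R c" and v="\<lambda>n t. \<phi> n t *\<^sub>R b" and y=y])
  show "(\<lambda>n. y n T) \<longlonglongrightarrow> 0"
   using tendsto_0_abs_le[of "\<lambda>n. norm (y n T)", OF _ y0] yb[of T] T by (simp add: tendsto_norm_zero_iff)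
  show "(\<lambda>n. intg T (\<lambda>t. norm (\<phi> n t *\<^sub>R c))) \<longlonglongrightarrow> 0"
   unfolding nrm by (rule tendsto_mult_left_zero[OF \<phi>1_0])
  show "(\<lambda>n. intg T (\<lambda>t. \<kappa> t \<bullet> \<phi> n t *\<^sub>R b)) \<longlonglongrightarrow> 0" if "cont_on T \<kappa>" for \<kappa>
   by (rule integral_inner_tendsto_0[OF that]) (unfold nrm, intro continuous_intros \<phi>c, rule y0)
  fix k assume "k < N"
  interpret u: nominal_costate P xh uh vh "unit_mult k" by (rule unit_costate)
  have 1: "(\<lambda>n. intg T (\<lambda>t. \<phi> n t *\<^sub>R b \<bullet> (Vk k t *v y n t))) \<longlonglongrightarrow> 0"
  proof -
   have "(\<lambda>n. \<integral>t. \<phi> n t *\<^sub>R b \<bullet> (Vk k t *v y n t) \<partial>leb T) \<longlonglongrightarrow> (\<integral>t. 0 \<bullet> (Vk k t *v 0) \<partial>leb T)"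
    by (rule L2_inner_convergence[OF u.Vmat_cont _ eq_refl[OF l2] _ L2conv_zeroI[OF Y y2]])
     (auto intro!: continuous_imp_L2 continuous_intros \<phi>c)
   moreover have "(\<integral>t. \<phi> n t *\<^sub>R b \<bullet> (Vk k t *v y n t) \<partial>leb T)
    = intg T (\<lambda>t. \<phi> n t *\<^sub>R b \<bullet> (Vk k t *v y n t))" for n
    by (intro lebesgue_integral_continuous continuous_intros \<phi>c continuous_matrix_vector u.Vmat_cont has_vector_derivative_continuous_on[OF yd])
   ultimately show ?thesis by simp
  qed
  have 2: "(\<lambda>n. intg T (\<lambda>t. (c \<bullet> (Huuk k t *v c)) * (\<phi> n t * \<phi> n t))) \<longlonglongrightarrow> (c \<bullet> (Huuk k t0 *v c)) * intg 1 (\<lambda>x. bump x ^ 2)"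
   and 3: "(\<lambda>n. intg T (\<lambda>t. (b \<bullet> (Hvuk k t *v c)) * (\<phi> n t * \<phi> n t))) \<longlonglongrightarrow> (b \<bullet> (Hvuk k t0 *v c)) * intg 1 (\<lambda>x. bump x ^ 2)"
   by (intro conc continuous_intros continuous_matrix_vector u.Huu_cont u.Hvu_cont)+
  show "(\<lambda>n. 1/2 * intg T (\<lambda>t. \<phi> n t *\<^sub>R c \<bullet> (Huuk k t *v \<phi> n t *\<^sub>R c))
   + intg T (\<lambda>t. \<phi> n t *\<^sub>R b \<bullet> (Vk k t *v y n t))
   + intg T (\<lambda>t. \<phi> n t *\<^sub>R b \<bullet> (Hvuk k t *v \<phi> n t *\<^sub>R c)))
   \<longlonglongrightarrow> intg 1 (\<lambda>x. bump x ^ 2) * (1/2 * (c \<bullet> (Huuk k t0 *v c)) + b \<bullet> (Hvuk k t0 *v c))"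
   using tendsto_add[OF tendsto_add[OF tendsto_mult_left[OF 2, of "1/2"] 1] 3] by (simp add: matrix_vector_mult_scaleR algebra_simps)
 qed (use yd y2 in \<open>auto intro!: continuous_intros \<phi>c simp: y_def l2\<close>)
qed

text \<open>Within the short time s the primitive y runs once through a closed curve in the span of
  \<open>a\<close> and \<open>b\<close>. The speed is of order 1 / s, so the integral of v . V y
  tends to a . V b times an area integral of the curve, which does not depend on s, while y tends to
  0 in L2.\<close>

lemma loop_oscillation:
 assumes t0: "t0 \<in> {0..<T}"
 shows "oscillation_vector N Lk Bk (\<lambda>k. - (a \<bullet> (Vk k t0 *v b)) * intg 1 (\<lambda>x. bump x ^ 4))"
proof -
 obtain s where s': "\<forall>n. 0 < s n \<and> t0 + s n \<le> T" "s \<longlonglongrightarrow> 0" using shrinking[OF t0] by blast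
 then have s: "\<And>n. 0 < s n" "\<And>n. t0 + s n \<le> T" "s \<longlonglongrightarrow> 0" by blast+
 have t0': "0 \<le> t0" "t0 \<in> {0..T}" using t0 by auto
 define A where "A x = bump x ^ 2" for x
 define A' where "A' x = bump x * (2 * (1 - 2 * x))" for x
 \<comment> \<open>With B = x A the area density A' B - B' A equals - A^2 = - bump^4, which has one
   sign, so the area cannot cancel.\<close>
 define B where "B x = bump x ^ 2 * x" for x
 define B' where "B' x = bump x ^ 2 + x * A' x" for x
 have A: "(A has_real_derivative A' x) (at x)" and B: "(B has_real_derivative B' x) (at x)" for x
  unfolding A_def B_def B'_def A'_def using DERIV_bump_sq[of x] DERIV_mult[OF DERIV_bump_sq[of x] DERIV_ident]
  by (simp_all add: mult_ac add_ac)
 have cont: "continuous_on S A" "continuous_on S B" "continuous_on S A'" "continuous_on S B'" for S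
  unfolding A_def B_def A'_def B'_def by (intro continuous_intros bump)+
 have zero: "A x = 0" "B x = 0" "A' x = 0" "B' x = 0" if "x \<notin> {0..1}" for x
  using bump(2)[OF that] by (simp_all add: A_def B_def A'_def B'_def)
 have ends: "A 0 = 0" "A 1 = 0" "B 0 = 0" "B 1 = 0" by (simp_all add: A_def B_def bump_def)
 have A'0: "intg 1 A' = 0" and B'0: "intg 1 B' = 0"
  using eq_integral_of_derivative[of 1 A A' 1] eq_integral_of_derivative[of 1 B B' 1] A B ends
  by (auto simp: has_real_derivative_iff_has_vector_derivative intro: has_vector_derivative_at_within)
 define \<tau> where "\<tau> n t = (t - t0) / s n" for n t
 define y where "y n t = A (\<tau> n t) *\<^sub>R a + B (\<tau> n t) *\<^sub>R b" for n t
 define v where "v n t = (A' (\<tau> n t) / s n) *\<^sub>R a + (B' (\<tau> n t) / s n) *\<^sub>R b" for n t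
 have conc: "(\<lambda>n. intg T (\<lambda>t. f t * (h (\<tau> n t) / s n))) \<longlonglongrightarrow> f t0 * intg 1 h"
  if "cont_on T f" "continuous_on UNIV h" "\<forall>x. x \<notin> {0..1} \<longrightarrow> h x = 0" for f h
  unfolding \<tau>_def by (rule concentration[OF t0'(1) s that(2,3,1)])
 have c\<tau>: "continuous_on S (\<lambda>t. h (\<tau> n t))" if "continuous_on UNIV h" for h :: "real \<Rightarrow> real" and n S
  unfolding \<tau>_def using s(1)[of n] by (intro continuous_on_compose2[OF that] continuous_intros) auto
 have yd: "(y n has_vector_derivative v n t) (at t within S)" for n t S
 proof -
  have "(\<tau> n has_real_derivative 1 / s n) (at t within S)" unfolding \<tau>_def using s(1)[of n] by (auto intro!: derivative_eq_intros)
  from DERIV_chain2[OF A this] DERIV_chain2[OF B this] show ?thesis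
   unfolding y_def v_def by (auto intro!: derivative_eq_intros simp: has_real_derivative_iff_has_vector_derivative)
 qed
 have yc: "continuous_on S (y n)" and vcont: "continuous_on S (v n)" for n S
  unfolding y_def v_def using s(1)[of n] by (intro continuous_intros c\<tau> cont; simp)+
 have y2: "(\<lambda>n. l2n T (y n)) \<longlonglongrightarrow> 0"
 proof -
  define q where "q x = (norm (A x *\<^sub>R a + B x *\<^sub>R b))\<^sup>2" for x
  have "intg T (\<lambda>t. (norm (y n t))\<^sup>2) = s n * intg 1 q" for n
  proof -
   have "intg T (\<lambda>t. (norm (y n t))\<^sup>2) = intg T (\<lambda>t. s n * (q ((t - t0) / s n) / s n))"
    using s(1)[of n] by (simp add: y_def q_def \<tau>_def)
   also have "\<dots> = s n * intg 1 q" unfolding integral_mult_right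
    by (subst integral_rescaled_bump[OF t0'(1) s(1,2)]) (auto simp: q_def zero intro!: continuous_intros cont)
   finally show ?thesis .
  qed
  then have "l2n T (y n) = sqrt (s n * intg 1 q)" for n by (simp add: l2n_continuous yc)
  then show ?thesis using tendsto_real_sqrt[OF tendsto_mult_left_zero[OF s(3)], of "intg 1 q"] by simp
 qed
 have yT: "y n T = 0" and y0: "y n 0 = 0" for n
 proof -
  have "A (\<tau> n T) = 0 \<and> B (\<tau> n T) = 0"
   using s(1)[of n] s(2)[of n] zero[of "\<tau> n T"] ends by (cases "\<tau> n T = 1") (auto simp: \<tau>_def divide_simps)
  then show "y n T = 0" by (simp add: y_def)
  have "A (\<tau> n 0) = 0 \<and> B (\<tau> n 0) = 0"
   using s(1)[of n] t0'(1) zero[of "\<tau> n 0"] ends by (cases "\<tau> n 0 = 0") (auto simp: \<tau>_def divide_simps)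
  then show "y n 0 = 0" by (simp add: y_def)
 qed
 show ?thesis
 proof (rule oscillation_vector_controls[where u="\<lambda>n t. 0" and v=v and y=y and C=0])
  show "l2n T (\<lambda>t. 0 :: real^'l) \<le> 0" by (simp add: l2n_def)
  show "(\<lambda>n. intg T (\<lambda>t. \<kappa> t \<bullet> v n t)) \<longlonglongrightarrow> 0" if \<kappa>: "cont_on T \<kappa>" for \<kappa>
  proof -
   have "(\<lambda>n. intg T (\<lambda>t. (\<kappa> t \<bullet> a) * (A' (\<tau> n t) / s n)) + intg T (\<lambda>t. (\<kappa> t \<bullet> b) * (B' (\<tau> n t) / s n)))
    \<longlonglongrightarrow> (\<kappa> t0 \<bullet> a) * intg 1 A' + (\<kappa> t0 \<bullet> b) * intg 1 B'"
    by (intro tendsto_add conc continuous_intros \<kappa> cont allI impI zero)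
   moreover have "intg T (\<lambda>t. \<kappa> t \<bullet> v n t) = intg T (\<lambda>t. (\<kappa> t \<bullet> a) * (A' (\<tau> n t) / s n))
    + intg T (\<lambda>t. (\<kappa> t \<bullet> b) * (B' (\<tau> n t) / s n))" for n
   proof -
    have "cont_on T (\<lambda>t. (\<kappa> t \<bullet> a) * (A' (\<tau> n t) / s n))" "cont_on T (\<lambda>t. (\<kappa> t \<bullet> b) * (B' (\<tau> n t) / s n))"
     using s(1)[of n] by (intro continuous_intros \<kappa> c\<tau> cont; simp)+
    from integral_add[OF this[THEN integrable_continuous_real], symmetric]
    show ?thesis by (simp add: v_def inner_add_right mult.commute)
   qed
   ultimately show ?thesis by (simp add: A'0 B'0)
  qed
  fix k assume "k < N"
  interpret u: nominal_costate P xh uh vh "unit_mult k" by (rule unit_costate)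
  let ?V = "Vk k"
  have anti: "x \<bullet> (?V t *v z) = - (z \<bullet> (?V t *v x))" for x z t
   unfolding u.Vmat_inner by (simp add: inner_diff_right field_simps)
  have V0: "x \<bullet> (?V t *v x) = 0" for x t using anti[of x t x] by simp
  have "v n t \<bullet> (?V t *v y n t) = (a \<bullet> (?V t *v b)) * (- (bump (\<tau> n t) ^ 4) / s n)" for n t
  proof -
   have "v n t \<bullet> (?V t *v y n t) = (a \<bullet> (?V t *v b)) * ((A' (\<tau> n t) * B (\<tau> n t) - B' (\<tau> n t) * A (\<tau> n t)) / s n)"
    unfolding v_def y_def using anti[of b t a]
    by (simp add: matrix_vector_right_distrib matrix_vector_mult_scaleR inner_add_left inner_add_right V0 diff_divide_distrib algebra_simps)
   also have "A' (\<tau> n t) * B (\<tau> n t) - B' (\<tau> n t) * A (\<tau> n t) = - (bump (\<tau> n t) ^ 4)"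
    by (simp add: A_def B_def B'_def algebra_simps power2_eq_square power4_eq_xxxx)
   finally show ?thesis .
  qed
  moreover have "(\<lambda>n. intg T (\<lambda>t. (a \<bullet> (?V t *v b)) * ((\<lambda>x. - (bump x ^ 4)) (\<tau> n t) / s n)))
   \<longlonglongrightarrow> (a \<bullet> (?V t0 *v b)) * intg 1 (\<lambda>x. - (bump x ^ 4))"
   by (rule conc) (auto intro!: continuous_intros continuous_matrix_vector u.Vmat_cont bump simp: bump(2))
  ultimately show "(\<lambda>n. 1/2 * intg T (\<lambda>t. 0 \<bullet> (Huuk k t *v 0))
   + intg T (\<lambda>t. v n t \<bullet> (?V t *v y n t)) + intg T (\<lambda>t. v n t \<bullet> (Hvuk k t *v 0)))
   \<longlonglongrightarrow> - (a \<bullet> (?V t0 *v b)) * intg 1 (\<lambda>x. bump x ^ 4)" by simp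
 qed (auto simp: y0 yT yd vcont y2)
qed

section \<open>Existence of multipliers for continuous directions\<close>

lemma sum_Huu: "(\<Sum>k<N. \<nu> k * (a \<bullet> (Huuk k t *v b))) = a \<bullet> (Huu P wh (mu \<nu>) t *v b)"
 and sum_Hvu: "(\<Sum>k<N. \<nu> k * (c \<bullet> (Hvuk k t *v b))) = c \<bullet> (Hvu P wh (mu \<nu>) t *v b)"
 by (auto simp: Huu_inner Hvu_inner snd_mu snd_unit inner_sum_left intro!: sum.cong)

lemma sum_Vmat: "(\<Sum>k<N. \<nu> k * (a \<bullet> (Vk k t *v b))) = a \<bullet> (Vmat P wh (mu \<nu>) t *v b)"
 unfolding nominal_costate.Vmat_inner[OF unit_costate] nominal_costate.Vmat_inner[OF nominal_costateI[OF adjoint_mu]]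
 by (auto simp: snd_mu snd_unit inner_sum_left sum_divide_distrib intro!: sum.cong)

text \<open>Conditions on coefficients in which weak lower semicontinuity is replaced by its
  pointwise cause, H_uu \<ge> 0 and H_vu = 0.\<close>

definition goh_multiplier :: "(nat \<Rightarrow> real) \<Rightarrow> bool" where
 "goh_multiplier \<nu> \<longleftrightarrow> (\<forall>i<Suc (dphi P). 0 \<le> \<nu> i) \<and> (\<forall>i\<ge>N. \<nu> i = 0) \<and> (\<forall>g. (\<Sum>i<N. \<nu> i * Lk i g) = 0) \<and>
  (\<forall>t\<in>{0..T}. (\<forall>c. 0 \<le> c \<bullet> (Huu P wh (mu \<nu>) t *v c)) \<and> Hvu P wh (mu \<nu>) t = 0 \<and> Vmat P wh (mu \<nu>) t = 0)"

lemma closure_T: "closure {0..<T} = {0..T}" using T by simp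

text \<open>Impulses give an inequality that is affine in the vector \<open>b\<close>, which forces
  H_vu = 0; loops with \<open>a\<close> and with \<open>- a\<close> give opposite inequalities for
  V.\<close>

lemma goh_multiplierI:
 assumes "\<forall>i<Suc (dphi P). 0 \<le> \<nu> i" "\<forall>i\<ge>N. \<nu> i = 0" "\<forall>g. (\<Sum>i<N. \<nu> i * Lk i g) = 0"
  and osc: "\<forall>c. oscillation_vector N Lk Bk c \<longrightarrow> 0 \<le> (\<Sum>i<N. \<nu> i * c i)" shows "goh_multiplier \<nu>"
proof -
 interpret m: nominal_costate P xh uh vh "mu \<nu>" by (rule nominal_costateI[OF adjoint_mu])
 \<comment> \<open>Impulses start at some t0 < T and need room to the right; the value at
   \<open>T\<close> is a limit.\<close>
 have H: "0 \<le> 1/2 * (c \<bullet> (Huu P wh (mu \<nu>) t *v c)) + b \<bullet> (Hvu P wh (mu \<nu>) t *v c)" if t: "t \<in> {0..T}" for t b c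
 proof (rule continuous_ge_on_closure[where S="{0..<T}" and f="\<lambda>t. 1/2 * (c \<bullet> (Huu P wh (mu \<nu>) t *v c)) + b \<bullet> (Hvu P wh (mu \<nu>) t *v c)"])
  fix s assume s: "s \<in> {0..<T}"
  have "0 \<le> (\<Sum>k<N. \<nu> k * (intg 1 (\<lambda>x. bump x ^ 2) *
    (1/2 * (c \<bullet> (Huuk k s *v c)) + b \<bullet> (Hvuk k s *v c))))" using osc impulse_oscillation[OF s] by blast
  also have "\<dots> = intg 1 (\<lambda>x. bump x ^ 2) * (1/2 * (\<Sum>k<N. \<nu> k * (c \<bullet> (Huuk k s *v c)))
    + (\<Sum>k<N. \<nu> k * (b \<bullet> (Hvuk k s *v c))))" by (simp add: sum_distrib_left sum.distrib distrib_left mult_ac)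
  finally show "0 \<le> 1/2 * (c \<bullet> (Huu P wh (mu \<nu>) s *v c)) + b \<bullet> (Hvu P wh (mu \<nu>) s *v c)"
   unfolding sum_Huu sum_Hvu using bump_power_integral_pos[of 2] by (simp add: zero_le_mult_iff)
 qed (use t in \<open>auto simp: closure_T intro!: continuous_intros continuous_matrix_vector m.Huu_cont m.Hvu_cont\<close>)
 have 1: "0 \<le> c \<bullet> (Huu P wh (mu \<nu>) t *v c)" if "t \<in> {0..T}" for t c using H[OF that, of c 0] by simp
 have 2: "Hvu P wh (mu \<nu>) t = 0" if t: "t \<in> {0..T}" for t
 proof (rule matrix_vector_inner_eqI)
  fix b c
  define q where "q = 1/2 * (c \<bullet> (Huu P wh (mu \<nu>) t *v c))"
  define l where "l = b \<bullet> (Hvu P wh (mu \<nu>) t *v c)"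
  have "0 \<le> q + r * l" for r using H[OF t, of c "r *\<^sub>R b"] by (simp add: q_def l_def)
  \<comment> \<open>For nonzero \<open>l\<close> this choice would give q + r l = -1.\<close>
  from this[of "- (q + 1) / l"] have "l = 0" by (cases "l = 0") auto
  then show "b \<bullet> (Hvu P wh (mu \<nu>) t *v c) = b \<bullet> (0 *v c)" by (simp add: l_def)
 qed
 have 3: "Vmat P wh (mu \<nu>) t = 0" if t: "t \<in> {0..T}" for t
 proof (rule continuous_constant_on_closure[where S="{0..<T}" and f="Vmat P wh (mu \<nu>)"])
  fix s assume s: "s \<in> {0..<T}"
  have V: "0 \<le> - (a \<bullet> (Vmat P wh (mu \<nu>) s *v b))" for a b
  proof -
   have "0 \<le> (\<Sum>k<N. \<nu> k * (- (a \<bullet> (Vk k s *v b)) * intg 1 (\<lambda>x. bump x ^ 4)))"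
    using osc loop_oscillation[OF s] by blast
   also have "\<dots> = - (\<Sum>k<N. \<nu> k * (a \<bullet> (Vk k s *v b))) * intg 1 (\<lambda>x. bump x ^ 4)"
    by (simp add: sum_distrib_left sum_distrib_right mult_ac sum_negf)
   finally show ?thesis unfolding sum_Vmat using bump_power_integral_pos[of 4] by (simp add: mult_le_0_iff)
  qed
  have "a \<bullet> (Vmat P wh (mu \<nu>) s *v b) = 0" for a b using V[of a b] V[of "- a" b] by simp
  then show "Vmat P wh (mu \<nu>) s = 0" by (intro matrix_vector_inner_eqI) simp
 qed (use t in \<open>auto simp: closure_T m.Vmat_cont\<close>)
 show ?thesis using assms(1-3) 1 2 3 by (simp add: goh_multiplier_def)
qed

lemma goh_multiplier_Bk:
 assumes "goh_multiplier \<nu>" shows "(\<Sum>k<N. \<nu> k * Bk k g g) / 2 = (\<Sum>k<N. \<nu> k * OP k (xic g, uc g, yc g, yc g T))"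
proof -
 interpret m: nominal_costate P xh uh vh "mu \<nu>" by (rule nominal_costateI[OF adjoint_mu])
 have c: "cont_on T (\<lambda>t. vc g t \<bullet> (Vk k t *v yc g t))"
  "cont_on T (\<lambda>t. vc g t \<bullet> (Hvuk k t *v uc g t))" for k
  by (intro continuous_intros continuous_matrix_vector vc_cont uc_cont yc_cont nominal_costate.Vmat_cont[OF unit_costate]
   nominal_costate.Hvu_cont[OF unit_costate])+
 have "(\<Sum>k<N. \<nu> k * intg T (\<lambda>t. vc g t \<bullet> (Vk k t *v yc g t)))
   = intg T (\<lambda>t. \<Sum>k<N. \<nu> k * (vc g t \<bullet> (Vk k t *v yc g t)))"
  by (subst integral_sum) (auto intro!: integrable_continuous_real continuous_intros c)
 also have "\<dots> = intg T (\<lambda>t. 0)"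
  unfolding sum_Vmat by (rule integral_cong) (use assms in \<open>simp add: goh_multiplier_def\<close>)
 finally have 1: "(\<Sum>k<N. \<nu> k * intg T (\<lambda>t. vc g t \<bullet> (Vk k t *v yc g t))) = 0" by simp
 have "(\<Sum>k<N. \<nu> k * intg T (\<lambda>t. vc g t \<bullet> (Hvuk k t *v uc g t)))
   = intg T (\<lambda>t. \<Sum>k<N. \<nu> k * (vc g t \<bullet> (Hvuk k t *v uc g t)))"
  by (subst integral_sum) (auto intro!: integrable_continuous_real continuous_intros c)
 also have "\<dots> = intg T (\<lambda>t. 0)"
  unfolding sum_Hvu by (rule integral_cong) (use assms in \<open>simp add: goh_multiplier_def\<close>)
 finally have 2: "(\<Sum>k<N. \<nu> k * intg T (\<lambda>t. vc g t \<bullet> (Hvuk k t *v uc g t))) = 0" by simp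
 have "(\<Sum>k<N. \<nu> k * Bk k g g) / 2 = (\<Sum>k<N. \<nu> k * (Bk k g g / 2))" by (simp add: sum_divide_distrib)
 also have "\<dots> = (\<Sum>k<N. \<nu> k * OP k (xic g, uc g, yc g, yc g T))" using 1 2 by (simp add: Bk_ctrl distrib_left sum.distrib)
 finally show ?thesis .
qed

text \<open>All constraints vanish at the nominal end points. A perturbation with negative values
  for cost and inequalities and zero values for equalities is therefore feasible and strictly
  cheaper.\<close>

definition Phi :: "nat \<Rightarrow> ('n, 'l, 'm) ctrl \<Rightarrow> real" where
 "Phi k g = chi P k (qh + (fst g, xnl g T)) - chi P k qh"

lemma Phi_taylor:
 assumes k: "k < N"
 shows "\<exists>C. \<forall>g. norm g \<le> radius \<longrightarrow> \<bar>Phi k g - Lk k g - Bk k g g / 2\<bar> \<le> C * norm g ^ 3"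
proof -
 obtain C0 where C0: "\<forall>x h. norm (chi P k (x + h) - chi P k x - D1 (chi P k) x h - (1/2) *\<^sub>R D2 (chi P k) x h h) \<le> C0 * norm h ^ 3"
  using taylor_second_order[OF chi_smooth[OF k]] by blast
 have b: "\<bar>(chi P k (qh + q) - chi P k qh) - D1 (chi P k) qh q - D2 (chi P k) qh q q / 2\<bar> \<le> C0 * norm q ^ 3" for q
  using C0[rule_format, of qh q] by simp
 show ?thesis
 proof (rule endpoint_expansion[OF pk(1) pk(2) b])
  fix C assume "\<And>g. norm g \<le> radius \<Longrightarrow>
   \<bar>chi P k (qh + (fst g, xnl g T)) - chi P k qh - first_variation (D1 (chi P k) qh) (pk k) g
    - second_variation (D2 (chi P k) qh) (pk k) g g / 2\<bar> \<le> C * norm g ^ 3"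
  then show ?thesis unfolding Phi_def Lk_def Bk_def D2k_def using k by (intro exI[of _ C]) auto
 qed
qed

lemma Phi_cont:
 assumes k: "k < N" shows "continuous_on (cball 0 radius) (\<lambda>g. Phi k g)"
proof -
 have "continuous_on UNIV (\<lambda>q. chi P k (qh + q) - chi P k qh)"
  by (intro continuous_intros continuous_on_compose2[OF continuous_D0[OF chi_smooth[OF k], of UNIV]]) auto
 from endpoint_continuous[OF this] show ?thesis by (simp add: Phi_def)
qed

lemma nominal_facts:
 shows "t \<in> {0..T} \<Longrightarrow> vd T xh (dynw P (W t)) t"
  and "cont_on T xh" "cont_on T uh" "cont_on T vh" "cont_on T (\<lambda>t. dynw P (W t))"
proof -
 show x: "cont_on T xh" and u: "cont_on T uh" and v: "cont_on T vh"
  using continuous_on_fst[OF W_cont] continuous_on_fst[OF continuous_on_snd[OF W_cont]] continuous_on_snd[OF continuous_on_snd[OF W_cont]]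
  by (simp_all add: W_def)
 show d: "cont_on T (\<lambda>t. dynw P (W t))" by (rule continuous_on_compose2[OF cont_dynw[OF data] W_cont]) auto
 have "has_wderiv T xh (\<lambda>t. dynw P (W t))" using nom by (simp add: feasible_def dyn_eq_dynw W_def)
 then show "t \<in> {0..T} \<Longrightarrow> vd T xh (dynw P (W t)) t" by (rule has_wderiv_imp_derivative[OF _ d])
qed

lemma perturbed_trajectory_feasible:
 assumes g: "norm g \<le> radius" and neg: "\<forall>i<N. if i < Suc (dphi P) then Phi i g < 0 else Phi i g = 0"
 shows "((\<lambda>t. xh t + xnl g t), (\<lambda>t. uh t + uc g t), (\<lambda>t. vh t + vc g t)) \<in> feasible P"
proof -
 let ?x = "\<lambda>t. xh t + xnl g t" and ?u = "\<lambda>t. uh t + uc g t" and ?v = "\<lambda>t. vh t + vc g t"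
 have Wg: "W t + (xnl g t, uc g t, vc g t) = (?x t, ?u t, ?v t)" for t by (simp add: W_def)
 have c: "cont_on T ?x" "cont_on T ?u" "cont_on T ?v" by (intro continuous_intros nominal_facts xnl_cont g uc_cont vc_cont)+
 have dc: "cont_on T (\<lambda>t. dynw P (?x t, ?u t, ?v t))"
  by (rule continuous_on_compose2[OF cont_dynw[OF data]]) (auto intro!: continuous_intros c)
 have dx: "vd T ?x (dynw P (?x t, ?u t, ?v t)) t" if t: "t \<in> {0..T}" for t
  using has_vector_derivative_add[OF nominal_facts(1)[OF t] xnl_deriv[OF g t]] unfolding snd_ctrl Wg by simp
 have w: "has_wderiv T ?x (\<lambda>t. dynw P (?x t, ?u t, ?v t))" by (rule has_wderiv_of_derivative[OF dx dc])
 have W_inf: "(?x, ?u, ?v) \<in> W_inf T" using w continuous_imp_Linf[OF dc] continuous_imp_Linf[OF c(2)] continuous_imp_Linf[OF c(3)]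
  by (auto simp: W_inf_def W1inf_def)
 have q: "qh + (fst g, xnl g T) = (?x 0, ?x T)" by (simp add: qh_def xnl_0[OF g])
 have nphi: "\<forall>i\<in>{1..dphi P}. phi P i qh = 0" and neta: "\<forall>j\<in>{1..deta P}. eta P j qh = 0"
  using nom by (auto simp: feasible_def qh_def)
 have "phi P i (?x 0, ?x T) \<le> 0" if i: "i \<in> {1..dphi P}" for i
  using neg[rule_format, of i] i nphi by (simp add: Phi_def q chi_def nchi_def)
 moreover have "eta P j (?x 0, ?x T) = 0" if j: "j \<in> {1..deta P}" for j
  using neg[rule_format, of "dphi P + j"] j neta by (simp add: Phi_def q chi_def nchi_def)
 ultimately show ?thesis using W_inf w by (simp add: feasible_def dyn_eq_dynw)
qed

lemma weak_minimum_infeasible: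
 assumes wm: "weak_minimum P wh"
 shows "\<exists>\<rho>>0. \<rho> \<le> radius \<and> (\<forall>g. norm g \<le> \<rho> \<longrightarrow> \<not> (\<forall>i<N. if i < Suc (dphi P) then Phi i g < 0 else Phi i g = 0))"
proof -
 obtain \<epsilon> where \<epsilon>: "0 < \<epsilon>" "\<forall>w\<in>feasible P. near T \<epsilon> w wh \<longrightarrow> cost P wh \<le> cost P w"
  using wm unfolding weak_minimum_def by blast
 \<comment> \<open>The state deviates by at most gain times \<rho>, hence at most \<epsilon>/2;
   since \<open>gain\<close> is at least 1, the controls are close enough too.\<close>
 define \<rho> where "\<rho> = min radius (\<epsilon> / (2 * gain))"
 have \<rho>: "0 < \<rho>" "\<rho> \<le> radius" "gain * \<rho> < \<epsilon>" "\<rho> < \<epsilon>"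
 proof -
  have "gain * (\<epsilon> / (2 * gain)) = \<epsilon> / 2" using gain_ge_1 by simp
  moreover have "gain * \<rho> \<le> gain * (\<epsilon> / (2 * gain))" using gain_ge_1 by (intro mult_left_mono) (auto simp: \<rho>_def)
  ultimately show 1: "gain * \<rho> < \<epsilon>" using \<epsilon>(1) by simp
  show 2: "0 < \<rho>" using \<epsilon>(1) gain_ge_1 radius by (simp add: \<rho>_def)
  have "1 * \<rho> \<le> gain * \<rho>" using 2 by (intro mult_right_mono gain_ge_1) simp
  then show "\<rho> < \<epsilon>" using 1 by linarith
 qed (simp add: \<rho>_def)
 have False if g: "norm g \<le> \<rho>" and neg: "\<forall>i<N. if i < Suc (dphi P) then Phi i g < 0 else Phi i g = 0" for g
 proof -
  have gr: "norm g \<le> radius" using g \<rho> by simp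
  have ng: "norm (uc g t) \<le> norm g" "norm (vc g t) \<le> norm g" for t
  proof -
   have "norm (apply_bcontfun (snd g) t) \<le> norm g" using norm_bounded[of "snd g" t] norm_snd_le_norm[of g] by linarith
   then show "norm (uc g t) \<le> norm g" "norm (vc g t) \<le> norm g"
    unfolding uc_def vc_def using norm_fst_le_norm norm_snd_le_norm order_trans by blast+
  qed
  have lt: "Linf_norm T f < ereal \<epsilon>" if "cont_on T f" "\<And>t. t \<in> {0..T} \<Longrightarrow> norm (f t) \<le> r" "r < \<epsilon>" for f :: "real \<Rightarrow> real^'a::finite" and r
   using Linf_norm_le[OF that(1,2)] that(3) by (simp add: le_less_trans)
  have "near T \<epsilon> ((\<lambda>t. xh t + xnl g t), (\<lambda>t. uh t + uc g t), (\<lambda>t. vh t + vc g t)) wh"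
  proof -
   have "gain * norm g \<le> gain * \<rho>" using g gain_ge_1 by (intro mult_left_mono) auto
   then have "gain * norm g < \<epsilon>" using \<rho>(3) by linarith
   from lt[OF xnl_cont[OF gr] xnl_bound[OF gr] this] have "Linf_norm T (xnl g) < ereal \<epsilon>" .
   moreover have "Linf_norm T (uc g) < ereal \<epsilon>" "Linf_norm T (vc g) < ereal \<epsilon>"
    using lt[OF uc_cont ng(1)] lt[OF vc_cont ng(2)] g \<rho>(4) by auto
   ultimately show ?thesis by simp
  qed
  then have "cost P wh \<le> cost P ((\<lambda>t. xh t + xnl g t), (\<lambda>t. uh t + uc g t), (\<lambda>t. vh t + vc g t))"
   using \<epsilon>(2) perturbed_trajectory_feasible[OF gr neg] by blast
  moreover have "Phi 0 g < 0" using neg[rule_format, of 0] by (simp add: nchi_def)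
  ultimately show False by (simp add: Phi_def chi_def qh_def xnl_0[OF gr])
 qed
 then show ?thesis using \<rho> by blast
qed

text \<open>The case of directions that are continuous controls. With \<open>Suc (dphi P)\<close>
  sign conditions the cost counts as one more inequality to be made strict.\<close>

lemma goh_multiplier_exists:
 assumes wm: "weak_minimum P wh" and g0: "\<And>i. i < N \<Longrightarrow> if i < Suc (dphi P) then Lk i g0 \<le> 0 else Lk i g0 = 0"
 shows "\<exists>\<nu>. goh_multiplier \<nu> \<and> (\<Sum>i<N. \<bar>\<nu> i\<bar>) = 1 \<and> 0 \<le> (\<Sum>k<N. \<nu> k * OP k (xic g0, uc g0, yc g0, yc g0 T))"
proof -
 interpret q: quadratic_model N Lk Bk by (rule quadratic_model)
 obtain \<rho> where \<rho>: "0 < \<rho>" "\<rho> \<le> radius"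
  "\<forall>g. norm g \<le> \<rho> \<longrightarrow> \<not> (\<forall>i<N. if i < Suc (dphi P) then Phi i g < 0 else Phi i g = 0)"
  using weak_minimum_infeasible[OF wm] by blast
 obtain C where C: "\<And>k. k < N \<Longrightarrow> \<forall>g. norm g \<le> radius \<longrightarrow> \<bar>Phi k g - Lk k g - Bk k g g / 2\<bar> \<le> C k * norm g ^ 3"
  using Phi_taylor by metis
 define M where "M = (\<Sum>k<N. \<bar>C k\<bar>)"
 have CM: "C k \<le> M" if "k < N" for k using member_le_sum[of k "{..<N}" "\<lambda>k. \<bar>C k\<bar>"] that by (simp add: M_def)
 have cont: "continuous_on (cball 0 \<rho>) (Phi i)" if "i < N" for i
  by (rule continuous_on_subset[OF Phi_cont[OF that]]) (use \<rho> in auto)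
 have tay: "\<bar>Phi i g - Lk i g - Bk i g g / 2\<bar> \<le> M * norm g ^ 3" if "i < N" "norm g \<le> \<rho>" for i g
  using C[OF that(1), rule_format, of g] that(2) \<rho>(2) mult_right_mono[OF CM[OF that(1)], of "norm g ^ 3"] by simp
 obtain \<nu> where \<nu>: "\<forall>i<Suc (dphi P). 0 \<le> \<nu> i" "(\<Sum>i<N. \<bar>\<nu> i\<bar>) = 1" "\<forall>i\<ge>N. \<nu> i = 0"
  "\<forall>g. (\<Sum>i<N. \<nu> i * Lk i g) = 0" "\<forall>c. oscillation_vector N Lk Bk c \<longrightarrow> 0 \<le> (\<Sum>i<N. \<nu> i * c i)"
  "0 \<le> (\<Sum>i<N. \<nu> i * Bk i g0 g0)"
  using q.second_order_multiplier[where d="Suc (dphi P)" and ?g0.0=g0 and C=M and \<Phi>=Phi, OF \<rho>(1) cont tay _ g0] \<rho>(3) by blast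
 have G: "goh_multiplier \<nu>" by (rule goh_multiplierI[OF \<nu>(1,3,4,5)])
 then have "0 \<le> (\<Sum>k<N. \<nu> k * OP k (xic g0, uc g0, yc g0, yc g0 T))"
  using \<nu>(6) unfolding goh_multiplier_Bk[OF G, symmetric] by simp
 then show ?thesis using G \<nu>(2) by blast
qed

end

section \<open>Approximation of critical directions\<close>

lemma L2conv_cong:
 assumes "L2conv T U u" "\<And>n t. t \<in> {0..T} \<Longrightarrow> V n t = U n t" "\<And>n. V n \<in> L2 T" shows "L2conv T V u"
proof -
 have "l2n T (\<lambda>t. V n t - u t) = l2n T (\<lambda>t. U n t - u t)" for n by (rule l2n_cong) (simp add: assms(2))
 then show ?thesis using assms(1,3) by (simp add: L2conv_def)
qed

lemma L2convI:
 assumes "\<And>n. U n \<in> L2 T" "u \<in> L2 T" "\<And>n. l2n T (\<lambda>t. U n t - u t) \<le> e n" "e \<longlonglongrightarrow> 0"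
 shows "L2conv T U u"
 unfolding L2conv_def using assms tendsto_0_abs_le[of "\<lambda>n. l2n T (\<lambda>t. U n t - u t)" e] by (auto simp: l2n_nonneg)

lemma L2conv_perturb:
 fixes E :: "nat \<Rightarrow> real \<Rightarrow> 'a::euclidean_space"
 assumes U: "L2conv T U u" and E: "\<And>i. E i \<in> L2 T" and r: "\<And>i. i < N \<Longrightarrow> (\<lambda>n. r n i) \<longlonglongrightarrow> 0"
 shows "L2conv T (\<lambda>n t. U n t - (\<Sum>i<N. r n i *\<^sub>R E i t)) u"
proof -
 have m: "U n \<in> L2 T" "u \<in> L2 T" for n using U by (auto simp: L2conv_def)
 have S: "(\<lambda>t. \<Sum>i<N. (- r n i) *\<^sub>R E i t) \<in> L2 T" "l2n T (\<lambda>t. \<Sum>i<N. (- r n i) *\<^sub>R E i t) \<le> (\<Sum>i<N. \<bar>r n i\<bar> * l2n T (E i))" for n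
 proof -
  have sc: "(\<lambda>t. (- r n i) *\<^sub>R E i t) \<in> L2 T" for i by (rule L2_scale[OF E])
  have "l2n T (\<lambda>t. (- r n i) *\<^sub>R E i t) \<le> \<bar>r n i\<bar> * l2n T (E i)" for i
   using L2_bounded_image(2)[OF E[of i] L2_measurable[OF sc[of i]], of "\<bar>r n i\<bar>"] by simp
  then have "(\<Sum>i<N. l2n T (\<lambda>t. (- r n i) *\<^sub>R E i t)) \<le> (\<Sum>i<N. \<bar>r n i\<bar> * l2n T (E i))" by (intro sum_mono) simp
  then show "(\<lambda>t. \<Sum>i<N. (- r n i) *\<^sub>R E i t) \<in> L2 T" "l2n T (\<lambda>t. \<Sum>i<N. (- r n i) *\<^sub>R E i t) \<le> (\<Sum>i<N. \<bar>r n i\<bar> * l2n T (E i))"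
   using L2_sum[of "{..<N}" "\<lambda>i t. (- r n i) *\<^sub>R E i t", OF sc] by auto
 qed
 have eq: "U n t - (\<Sum>i<N. r n i *\<^sub>R E i t) = U n t + (\<Sum>i<N. (- r n i) *\<^sub>R E i t)" for n t by (simp add: sum_negf)
 have "l2n T (\<lambda>t. (U n t - (\<Sum>i<N. r n i *\<^sub>R E i t)) - u t) \<le> l2n T (\<lambda>t. U n t - u t) + (\<Sum>i<N. \<bar>r n i\<bar> * l2n T (E i))" for n
  using L2_triangle[OF L2_diff[OF m(1)[of n] m(2)] S(1)[of n]] S(2)[of n] by (simp add: algebra_simps sum_negf)
 moreover have "(\<lambda>n. l2n T (\<lambda>t. U n t - u t) + (\<Sum>i<N. \<bar>r n i\<bar> * l2n T (E i))) \<longlonglongrightarrow> 0"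
  using U unfolding L2conv_def by (intro tendsto_add_zero tendsto_null_sum tendsto_mult_left_zero tendsto_rabs_zero r) auto
 ultimately have "(\<lambda>n. l2n T (\<lambda>t. (U n t - (\<Sum>i<N. r n i *\<^sub>R E i t)) - u t)) \<longlonglongrightarrow> 0"
  by (intro tendsto_0_abs_le[where f="\<lambda>n. l2n T (\<lambda>t. (U n t - (\<Sum>i<N. r n i *\<^sub>R E i t)) - u t)"]) (simp add: l2n_nonneg)
 then show ?thesis unfolding L2conv_def using L2_add[OF m(1) S(1)] m(2) by (simp add: eq)
qed

lemma has_wderiv_diff:
 fixes x y :: "real \<Rightarrow> 'a::euclidean_space"
 assumes x: "has_wderiv T x g" and y: "has_wderiv T y h" shows "has_wderiv T (\<lambda>t. x t - y t) (\<lambda>t. g t - h t)"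
proof -
 have "x t - y t = x 0 - y 0 + (\<integral>s. g s - h s \<partial>leb t)" if t: "t \<in> {0..T}" for t
 proof -
  have "x t = x 0 + integral\<^sup>L (leb t) g" "y t = y 0 + integral\<^sup>L (leb t) h" using x y t unfolding has_wderiv_def by blast+
  then show ?thesis using Bochner_Integration.integral_diff[OF has_wderiv_integrable[OF x t] has_wderiv_integrable[OF y t]] by simp
 qed
 with Bochner_Integration.integrable_diff[OF has_wderivD[OF x] has_wderivD[OF y]] show ?thesis unfolding has_wderiv_def by blast
qed

context nominal_ocp
begin

text \<open>Subtracting the primitive of \<open>b\<close> leaves a continuously differentiable
  function whose source involves only that primitive. The estimate thus sees primitives in place of
  \<open>b\<close>, and primitives of weakly convergent sources converge strongly.\<close>

lemma linear_wderiv_bound: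
 fixes b :: "real \<Rightarrow> real^'n"
 assumes \<delta>: "has_wderiv T \<delta> (\<lambda>t. Fx P wh t *v \<delta> t + b t)" and b: "b \<in> L2 T"
 shows "cont_on T (\<lambda>t. intg t b)"
  and "t \<in> {0..T} \<Longrightarrow> norm (\<delta> t - intg t b) \<le> (norm (\<delta> 0) + Kc * intg T (\<lambda>s. norm (intg s b))) * exp (Kc * T)"
proof -
 define I where "I t = intg t b" for t
 have bi: "b integrable_on {0..T}" using L2_integrable[OF b] by (simp add: integrable_on_lebesgue_on)
 show Ic: "cont_on T (\<lambda>t. intg t b)" by (rule indefinite_integral_continuous_1[OF bi])
 have Ic': "cont_on T I" using Ic by (simp add: I_def[abs_def])
 define z where "z t = \<delta> t - I t" for t
 have \<delta>c: "cont_on T \<delta>" by (rule has_wderiv_continuous[OF \<delta>])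
 have Fc: "cont_on T (\<lambda>t. Fx P wh t *v \<delta> t)" by (rule continuous_matrix_vector[OF Fx_cont \<delta>c])
 have z: "z s = \<delta> 0 + intg s (\<lambda>t. Fx P wh t *v \<delta> t)" if s: "s \<in> {0..T}" for s
 proof -
  have "intg s (\<lambda>t. Fx P wh t *v \<delta> t + b t) = intg s (\<lambda>t. Fx P wh t *v \<delta> t) + I s"
   unfolding I_def using s by (intro integral_add integrable_on_subinterval[OF bi]
    integrable_continuous_real continuous_on_subset[OF Fc]) auto
  then show ?thesis using has_wderiv_eq[OF \<delta> s] by (simp add: z_def)
 qed
 have dz: "vd T z (dyn1 P (W s) (z s, 0) + Fx P wh s *v I s) s" if s: "s \<in> {0..T}" for s
 proof -
  have "vd T (\<lambda>s. \<delta> 0 + intg s (\<lambda>t. Fx P wh t *v \<delta> t)) (Fx P wh s *v \<delta> s) s"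
   using has_vector_derivative_add[OF has_vector_derivative_const integral_has_vector_derivative[OF Fc s]] by simp
  from has_vector_derivative_transform[OF s z this]
  have "vd T z (Fx P wh s *v \<delta> s) s" .
  moreover have "Fx P wh s *v \<delta> s = dyn1 P (W s) (z s, 0) + Fx P wh s *v I s"
   by (simp add: pair_zero Fx_apply[symmetric] z_def matrix_vector_right_distrib[symmetric])
  ultimately show ?thesis by simp
 qed
 have cI: "cont_on T (\<lambda>s. Fx P wh s *v I s)" by (rule continuous_matrix_vector[OF Fx_cont Ic'])
 assume t: "t \<in> {0..T}"
 have "norm (z t) \<le> (norm (z 0) + intg T (\<lambda>s. norm (Fx P wh s *v I s))) * exp (Kc * T)"
  by (rule linear_solution_bound[OF dz cI t])
 also have "\<dots> \<le> (norm (\<delta> 0) + intg T (\<lambda>s. Kc * norm (I s))) * exp (Kc * T)"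
 proof (intro mult_right_mono add_mono integral_le)
  show "norm (z 0) \<le> norm (\<delta> 0)" by (simp add: z_def I_def)
  show "norm (Fx P wh s *v I s) \<le> Kc * norm (I s)" if "s \<in> {0..T}" for s
   using F1_bound[OF that, of "(I s, 0, 0)"] by (simp add: Fx_apply norm_Pair)
 qed (auto intro!: integrable_continuous_real continuous_intros cI Ic')
 finally show "norm (\<delta> t - intg t b) \<le> (norm (\<delta> 0) + Kc * intg T (\<lambda>s. norm (intg s b))) * exp (Kc * T)"
  by (simp add: z_def I_def)
qed

text \<open>The independence of y and h in \<open>P_2\<close> is met by primitives that are close to
  y in L2 but take exactly the value h at \<open>T\<close>.\<close>

lemma control_approximation:
 assumes u: "u \<in> L2 T" and y: "y \<in> L2 T"
  and \<xi>: "has_wderiv T \<xi> (\<lambda>t. Fx P wh t *v \<xi> t + Fu P wh t *v u t + Bmat P wh t *v y t)"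
 shows "\<exists>g. L2conv T (\<lambda>n. uc (g n)) u \<and> L2conv T (\<lambda>n. yc (g n)) y \<and> L2conv T (\<lambda>n. xic (g n)) \<xi> \<and>
  (\<lambda>n. yc (g n) T) \<longlonglongrightarrow> h \<and> (\<lambda>n. xic (g n) 0) \<longlonglongrightarrow> \<xi> 0 \<and> (\<lambda>n. xic (g n) T) \<longlonglongrightarrow> \<xi> T"
proof -
 define \<epsilon> where "\<epsilon> n = 1 / real (Suc n)" for n
 have \<epsilon>: "0 < \<epsilon> n" "\<epsilon> \<longlonglongrightarrow> 0" for n
  using LIMSEQ_Suc[OF lim_const_over_n[of "1::real"]] by (simp_all add: \<epsilon>_def[abs_def])
 have "\<forall>n. \<exists>g. continuous_on UNIV g \<and> l2n T (\<lambda>t. g t - u t) < \<epsilon> n"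
  using L2_dense_continuous[OF u \<epsilon>(1)] by blast
 from choice[OF this] obtain U where U: "\<And>n. continuous_on UNIV (U n)" "\<And>n. l2n T (\<lambda>t. U n t - u t) < \<epsilon> n" by blast
 have "\<forall>n. \<exists>V. continuous_on UNIV V \<and> intg T V = h \<and> l2n T (\<lambda>t. intg t V - y t) < \<epsilon> n"
  using L2_dense_boundary_values[OF y T \<epsilon>(1)] by blast
 from choice[OF this] obtain V where V: "\<And>n. continuous_on UNIV (V n)" "\<And>n. intg T (V n) = h"
  "\<And>n. l2n T (\<lambda>t. intg t (V n) - y t) < \<epsilon> n" by blast
 define g :: "nat \<Rightarrow> ('n, 'l, 'm) ctrl" where "g n = (\<xi> 0, snd (ctrl_of (U n) (V n)))" for n
 have c: "cont_on T (U n)" "cont_on T (V n)" for n by (rule continuous_on_subset[OF U(1)] continuous_on_subset[OF V(1)]; simp)+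
 have gu: "uc (g n) t = U n t" and gv: "vc (g n) t = V n t" if "t \<in> {0..T}" for n t
  using ctrl_of[OF c that] by (simp_all add: g_def uc_def vc_def)
 have gy: "yc (g n) t = intg t (V n)" if t: "t \<in> {0..T}" for n t unfolding yc_def by (rule integral_cong) (use gv t in auto)
 have mem: "uc (g n) \<in> L2 T" "yc (g n) \<in> L2 T" "xic (g n) \<in> L2 T" for n by (intro continuous_imp_L2 uc_cont yc_cont xic_cont)+
 have du: "l2n T (\<lambda>t. uc (g n) t - u t) \<le> \<epsilon> n" for n
  using U(2)[of n] l2n_cong[of T "\<lambda>t. uc (g n) t - u t" "\<lambda>t. U n t - u t"] gu by simp
 have dy: "l2n T (\<lambda>t. yc (g n) t - y t) \<le> \<epsilon> n" for n
  using V(3)[of n] l2n_cong[of T "\<lambda>t. yc (g n) t - y t" "\<lambda>t. intg t (V n) - y t"] gy by simp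
 obtain C1 where C1: "0 \<le> C1" "\<forall>u\<in>L2 T. l2n T (\<lambda>t. Fu P wh t *v u t) \<le> C1 * l2n T u" using matrix_L2_bound[OF Fu_cont] by blast
 obtain C2 where C2: "0 \<le> C2" "\<forall>u\<in>L2 T. l2n T (\<lambda>t. Bmat P wh t *v u t) \<le> C2 * l2n T u" using matrix_L2_bound[OF Bmat_cont] by blast
 define r where "r n = sqrt T * ((C1 + C2) * \<epsilon> n)" for n
 define s where "s n = r n + (Kc * (T * r n)) * exp (Kc * T)" for n
 have r0: "0 \<le> r n" "0 \<le> s n" for n using C1 C2 T K \<epsilon>(1)[of n] by (simp_all add: r_def s_def)
 have s0: "s \<longlonglongrightarrow> 0"
  unfolding s_def r_def by (intro tendsto_add_zero tendsto_mult_right_zero tendsto_mult_left_zero \<epsilon>(2))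
 have \<delta>: "norm (xic (g n) t - \<xi> t) \<le> s n" if t: "t \<in> {0..T}" for n t
 proof -
  define b where "b t = Fu P wh t *v (uc (g n) t - u t) + Bmat P wh t *v (yc (g n) t - y t)" for t
  have uL: "(\<lambda>t. uc (g n) t - u t) \<in> L2 T" and yL: "(\<lambda>t. yc (g n) t - y t) \<in> L2 T" by (intro L2_diff mem u y)+
  note m1 = matrix_L2[OF Fu_cont uL] and m2 = matrix_L2[OF Bmat_cont yL]
  have b: "b \<in> L2 T" unfolding b_def by (intro L2_add m1 m2)
  have "C1 * l2n T (\<lambda>t. uc (g n) t - u t) + C2 * l2n T (\<lambda>t. yc (g n) t - y t) \<le> (C1 + C2) * \<epsilon> n"
   unfolding distrib_right by (intro add_mono mult_left_mono du dy C1 C2)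
  then have "l2n T b \<le> (C1 + C2) * \<epsilon> n"
   using L2_triangle[OF m1 m2] bspec[OF C1(2) uL] bspec[OF C2(2) yL] unfolding b_def by linarith
  then have rn: "sqrt T * l2n T b \<le> r n" using T by (simp add: r_def)
  have I: "norm (intg t b) \<le> r n" if "t \<in> {0..T}" for t
   using norm_integral_le[OF L2_integrable[OF b] that] L2_norm_integral_le[OF b that] rn by linarith
  have w: "has_wderiv T (\<lambda>t. xic (g n) t - \<xi> t) (\<lambda>t. Fx P wh t *v (xic (g n) t - \<xi> t) + b t)"
  proof -
   have x: "has_wderiv T (xic (g n)) (\<lambda>t. Fx P wh t *v xic (g n) t + Fu P wh t *v uc (g n) t + Bmat P wh t *v yc (g n) t)"
    by (rule has_wderiv_of_derivative[OF xic_deriv])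
     (auto intro!: continuous_intros continuous_matrix_vector Fx_cont Fu_cont Bmat_cont xic_cont uc_cont yc_cont)
   have eq: "Fx P wh t *v (xic (g n) t - \<xi> t) + b t = (Fx P wh t *v xic (g n) t + Fu P wh t *v uc (g n) t + Bmat P wh t *v yc (g n) t)
    - (Fx P wh t *v \<xi> t + Fu P wh t *v u t + Bmat P wh t *v y t)" for t by (simp add: b_def matrix_vector_mult_diff_distrib)
   show ?thesis unfolding eq by (rule has_wderiv_diff[OF x \<xi>])
  qed
  have "intg T (\<lambda>s. norm (intg s b)) \<le> intg T (\<lambda>s. r n)"
   by (rule integral_le) (use I linear_wderiv_bound(1)[OF w b] in \<open>auto intro!: integrable_continuous_real continuous_intros\<close>)
  then have "Kc * intg T (\<lambda>s. norm (intg s b)) \<le> Kc * (T * r n)" using T K by (intro mult_left_mono) auto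
  from mult_right_mono[OF this, of "exp (Kc * T)"] have "(norm (xic (g n) 0 - \<xi> 0) + Kc * intg T (\<lambda>s. norm (intg s b))) * exp (Kc * T) \<le> (Kc * (T * r n)) * exp (Kc * T)"
   by (simp add: xic_0 g_def)
  then have "norm (xic (g n) t - \<xi> t - intg t b) \<le> (Kc * (T * r n)) * exp (Kc * T)"
   by (rule order_trans[OF linear_wderiv_bound(2)[OF w b t]])
  then show ?thesis using I[OF t] norm_triangle_sub[of "xic (g n) t - \<xi> t" "intg t b"] by (simp add: s_def)
 qed
 have \<xi>L: "\<xi> \<in> L2 T" by (rule continuous_imp_L2[OF has_wderiv_continuous[OF \<xi>]])
 have "L2conv T (\<lambda>n. uc (g n)) u" "L2conv T (\<lambda>n. yc (g n)) y" "L2conv T (\<lambda>n. xic (g n)) \<xi>"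
 proof -
  show "L2conv T (\<lambda>n. uc (g n)) u" by (rule L2convI[OF mem(1) u du \<epsilon>(2)])
  show "L2conv T (\<lambda>n. yc (g n)) y" by (rule L2convI[OF mem(2) y dy \<epsilon>(2)])
  have "l2n T (\<lambda>t. xic (g n) t - \<xi> t) \<le> sqrt T * s n" for n
   by (rule l2n_le_sup[OF L2_diff[OF mem(3) \<xi>L] \<delta>]) (use T r0 in auto)
  from L2convI[OF mem(3) \<xi>L this tendsto_mult_right_zero[OF s0]] show "L2conv T (\<lambda>n. xic (g n)) \<xi>" .
 qed
 moreover have "(\<lambda>n. xic (g n) t) \<longlonglongrightarrow> \<xi> t" if "t \<in> {0..T}" for t
  using tendsto_0_abs_le[of "\<lambda>n. norm (xic (g n) t - \<xi> t)" s] \<delta>[OF that] s0 by (simp add: tendsto_norm_zero_iff LIM_zero_iff)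
 moreover have "(\<lambda>n. yc (g n) T) \<longlonglongrightarrow> h" using gy[of T] V(2) T by simp
 ultimately show ?thesis using T by (intro exI[of _ g]) auto
qed

text \<open>Every condition is an equation or a nonstrict inequality that is linear in the
  coefficients.\<close>

lemma goh_multiplier_limit:
 assumes g: "\<And>n. goh_multiplier (X n)" and l: "\<And>i. (\<lambda>n. X n i) \<longlonglongrightarrow> l i" shows "goh_multiplier l"
proof -
 have lim: "(\<lambda>n. \<Sum>k<N. X n k * f k) \<longlonglongrightarrow> (\<Sum>k<N. l k * f k)" for f
  by (intro tendsto_sum tendsto_mult l tendsto_const)
 have le: "0 \<le> (\<Sum>k<N. l k * f k)" if "\<And>n. 0 \<le> (\<Sum>k<N. X n k * f k)" for f
  by (rule LIMSEQ_le_const[OF lim]) (use that in auto)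
 have eq: "(\<Sum>k<N. l k * f k) = 0" if "\<And>n. (\<Sum>k<N. X n k * f k) = 0" for f by (rule LIMSEQ_unique[OF lim]) (simp add: that)
 have "0 \<le> l i" if "i < Suc (dphi P)" for i by (rule LIMSEQ_le_const[OF l]) (use g that in \<open>auto simp: goh_multiplier_def\<close>)
 moreover have "l i = 0" if "N \<le> i" for i by (rule LIMSEQ_unique[OF l]) (use g that in \<open>simp add: goh_multiplier_def\<close>)
 moreover have "(\<Sum>i<N. l i * Lk i h) = 0" for h by (rule eq) (use g in \<open>unfold goh_multiplier_def, blast\<close>)
 moreover have "0 \<le> c \<bullet> (Huu P wh (mu l) t *v c)" if "t \<in> {0..T}" for t c
  unfolding sum_Huu[symmetric] by (rule le, unfold sum_Huu) (use g that in \<open>simp add: goh_multiplier_def\<close>)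
 moreover have "Hvu P wh (mu l) t = 0" if "t \<in> {0..T}" for t
 proof (rule matrix_vector_inner_eqI)
  fix b c
  have "b \<bullet> (Hvu P wh (mu l) t *v c) = 0"
   unfolding sum_Hvu[symmetric] by (rule eq, unfold sum_Hvu) (use g that in \<open>simp add: goh_multiplier_def\<close>)
  then show "b \<bullet> (Hvu P wh (mu l) t *v c) = b \<bullet> (0 *v c)" by simp
 qed
 moreover have "Vmat P wh (mu l) t = 0" if "t \<in> {0..T}" for t
 proof (rule matrix_vector_inner_eqI)
  fix b c
  have "b \<bullet> (Vmat P wh (mu l) t *v c) = 0"
   unfolding sum_Vmat[symmetric] by (rule eq, unfold sum_Vmat) (use g that in \<open>simp add: goh_multiplier_def\<close>)
  then show "b \<bullet> (Vmat P wh (mu l) t *v c) = b \<bullet> (0 *v c)" by simp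
 qed
 ultimately show ?thesis by (simp add: goh_multiplier_def)
qed

lemma OP_tendsto:
 assumes "L2conv T \<Xi> \<xi>" "(\<lambda>n. \<Xi> n 0) \<longlonglongrightarrow> \<xi> 0" "(\<lambda>n. \<Xi> n T) \<longlonglongrightarrow> \<xi> T" "L2conv T U u" "L2conv T Y y" "Hn \<longlonglongrightarrow> h"
 shows "(\<lambda>n. OP k (\<Xi> n, U n, Y n, Hn n)) \<longlonglongrightarrow> OP k (\<xi>, u, y, h)"
 unfolding OP_def by (rule nominal_costate.Omega_P2_tendsto[OF unit_costate assms])

text \<open>Critical directions need exact signs of the first variations, and approximate ones could
  violate them slightly. The defects tend to 0 and are removed along the fixed vectors
  \<open>e i\<close> with vanishing coefficients.\<close>

lemma control_approximation_exact:
 assumes u: "u \<in> L2 T" and y: "y \<in> L2 T"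
  and \<xi>: "has_wderiv T \<xi> (\<lambda>t. Fx P wh t *v \<xi> t + Fu P wh t *v u t + Bmat P wh t *v y t)"
 shows "\<exists>g. L2conv T (\<lambda>n. uc (g n)) u \<and> L2conv T (\<lambda>n. yc (g n)) y \<and> L2conv T (\<lambda>n. xic (g n)) \<xi> \<and>
  (\<lambda>n. yc (g n) T) \<longlonglongrightarrow> h \<and> (\<lambda>n. xic (g n) 0) \<longlonglongrightarrow> \<xi> 0 \<and> (\<lambda>n. xic (g n) T) \<longlonglongrightarrow> \<xi> T \<and>
  (\<forall>n. \<forall>k<N. Lk k (g n) = D1 (chi P k) qh (\<xi> 0, \<xi> T + Fv P wh T *v h))"
proof -
 obtain g where g: "L2conv T (\<lambda>n. uc (g n)) u" "L2conv T (\<lambda>n. yc (g n)) y" "L2conv T (\<lambda>n. xic (g n)) \<xi>"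
  "(\<lambda>n. yc (g n) T) \<longlonglongrightarrow> h" "(\<lambda>n. xic (g n) 0) \<longlonglongrightarrow> \<xi> 0" "(\<lambda>n. xic (g n) T) \<longlonglongrightarrow> \<xi> T"
  using control_approximation[OF u y \<xi>, of h] by blast
 interpret q: quadratic_model N Lk Bk by (rule quadratic_model)
 have linL: "linear (Lk k)" for k by (rule bounded_linear.linear[OF q.L])
 obtain e where e: "\<And>g k. k < N \<Longrightarrow> Lk k (g - (\<Sum>i<N. Lk i g *\<^sub>R e i)) = 0"
  using linear_functionals_projection[of Lk N] linL by blast
 define l where "l k = D1 (chi P k) qh (\<xi> 0, \<xi> T + Fv P wh T *v h)" for k
 have Ll: "(\<lambda>n. Lk k (g n)) \<longlonglongrightarrow> l k" for k unfolding Lk_eq l_def xlin_eq xic_0[symmetric]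
  by (intro tendsto_intros blinfun.tendsto g bounded_bilinear.tendsto[OF bounded_bilinear_matrix_vector])
 define r where "r n i = Lk i (g n) - l i" for n i
 have r: "(\<lambda>n. r n i) \<longlonglongrightarrow> 0" for i unfolding r_def using Ll[of i] by (simp add: LIM_zero)
 define g' where "g' n = g n - (\<Sum>i<N. r n i *\<^sub>R e i)" for n
 have lin_sub: "F (g' n) = F (g n) - (\<Sum>i<N. r n i *\<^sub>R F (e i))" if "linear F" for F :: "_ \<Rightarrow> 'a::real_vector" and n
  unfolding g'_def by (simp add: linear_diff[OF that] linear_sum[OF that] linear_scale[OF that])
 \<comment> \<open>By the property of \<open>e\<close>, the value on the corrected control is the
   same for all n, and it converges to \<open>l k\<close>; so it equals \<open>l k\<close>
   throughout.\<close>
 have exact: "Lk k (g' n) = l k" if k: "k < N" for k n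
 proof -
  have const: "Lk k (g' n) = (\<Sum>i<N. l i * Lk k (e i))" for n
  proof -
   have "Lk k (g n) = (\<Sum>i<N. Lk i (g n) * Lk k (e i))"
    using e[OF k, of "g n"] by (simp add: linear_diff[OF linL] linear_sum[OF linL] linear_scale[OF linL])
   then show ?thesis by (simp add: lin_sub[OF linL] r_def left_diff_distrib sum_subtractf)
  qed
  have "(\<lambda>n. Lk k (g n) - (\<Sum>i<N. r n i *\<^sub>R Lk k (e i))) \<longlonglongrightarrow> l k - (\<Sum>i<N. 0 *\<^sub>R Lk k (e i))"
   by (intro tendsto_intros Ll r)
  then have "(\<lambda>n. Lk k (g' n)) \<longlonglongrightarrow> l k" by (simp add: lin_sub[OF linL])
  then show ?thesis using const LIMSEQ_unique[OF tendsto_const] by force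
 qed
 have lin: "linear (\<lambda>g. uc g t)" "t \<in> {0..T} \<Longrightarrow> linear (\<lambda>g. yc g t)" "t \<in> {0..T} \<Longrightarrow> linear (\<lambda>g. xic g t)" for t
  by (rule linearI; simp add: lin_ctrl yc_lin xic_lin)+
 have mem: "uc f \<in> L2 T" "yc f \<in> L2 T" "xic f \<in> L2 T" for f by (intro continuous_imp_L2 uc_cont yc_cont xic_cont)+
 have "L2conv T (\<lambda>n. uc (g' n)) u"
  by (rule L2conv_cong[OF L2conv_perturb[OF g(1) mem(1)[of "e _"] r]]) (simp_all add: lin_sub[OF lin(1)] mem)
 moreover have "L2conv T (\<lambda>n. yc (g' n)) y"
  by (rule L2conv_cong[OF L2conv_perturb[OF g(2) mem(2)[of "e _"] r]]) (simp_all add: lin_sub[OF lin(2)] mem)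
 moreover have "L2conv T (\<lambda>n. xic (g' n)) \<xi>"
  by (rule L2conv_cong[OF L2conv_perturb[OF g(3) mem(3)[of "e _"] r]]) (simp_all add: lin_sub[OF lin(3)] mem)
 moreover have "(\<lambda>n. F (g' n)) \<longlonglongrightarrow> z" if "linear F" "(\<lambda>n. F (g n)) \<longlonglongrightarrow> z" for F :: "_ \<Rightarrow> 'a::real_normed_vector" and z
 proof -
  have "(\<lambda>n. F (g n) - (\<Sum>i<N. r n i *\<^sub>R F (e i))) \<longlonglongrightarrow> z - (\<Sum>i<N. 0 *\<^sub>R F (e i))" by (intro tendsto_intros that r)
  then show ?thesis by (simp add: lin_sub[OF that(1)])
 qed
 note this[OF lin(2) g(4)] this[OF lin(3) g(5)] this[OF lin(3) g(6)]
 ultimately show ?thesis using exact T unfolding l_def by (intro exI[of _ g']) auto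
qed

text \<open>Each approximating control has its own multiplier. Normalization by the sum of absolute
  values allows a convergent subsequence and keeps the limit from being 0.\<close>

lemma goh_multiplier_at:
 assumes wm: "weak_minimum P wh" and z: "(\<xi>, u, y, h) \<in> P_2 P wh"
 shows "\<exists>\<nu>. goh_multiplier \<nu> \<and> (\<Sum>i<N. \<bar>\<nu> i\<bar>) = 1 \<and> 0 \<le> (\<Sum>k<N. \<nu> k * OP k (\<xi>, u, y, h))"
proof -
 have u: "u \<in> L2 T" and y: "y \<in> L2 T"
  and \<xi>: "has_wderiv T \<xi> (\<lambda>t. Fx P wh t *v \<xi> t + Fu P wh t *v u t + Bmat P wh t *v y t)"
  and eta0: "\<forall>j\<in>{1..deta P}. frechet_derivative (eta P j) (at qh) (\<xi> 0, \<xi> T + Fv P wh T *v h) = 0"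
  and phi0: "\<forall>i\<in>{0..dphi P}. frechet_derivative (phi P i) (at qh) (\<xi> 0, \<xi> T + Fv P wh T *v h) \<le> 0"
  using z by (simp_all add: P_2_def Let_def qh_def)
 obtain g where g: "L2conv T (\<lambda>n. uc (g n)) u" "L2conv T (\<lambda>n. yc (g n)) y" "L2conv T (\<lambda>n. xic (g n)) \<xi>"
  "(\<lambda>n. yc (g n) T) \<longlonglongrightarrow> h" "(\<lambda>n. xic (g n) 0) \<longlonglongrightarrow> \<xi> 0" "(\<lambda>n. xic (g n) T) \<longlonglongrightarrow> \<xi> T"
  "\<forall>n. \<forall>k<N. Lk k (g n) = D1 (chi P k) qh (\<xi> 0, \<xi> T + Fv P wh T *v h)"
  using control_approximation_exact[OF u y \<xi>, of h] by blast
 have sgn: "if i < Suc (dphi P) then Lk i (g n) \<le> 0 else Lk i (g n) = 0" if i: "i < N" for i n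
 proof (cases "i < Suc (dphi P)")
  case True
  then show ?thesis using g(7)[rule_format, OF i, of n] phi0[rule_format, of i] frechet_chi[OF i, of qh] by (simp add: chi_def)
 next
  case False
  then have "i - dphi P \<in> {1..deta P}" using i by (auto simp: nchi_def)
  then show ?thesis
   using False g(7)[rule_format, OF i, of n] eta0[rule_format, of "i - dphi P"] frechet_chi[OF i, of qh] by (simp add: chi_def)
 qed
 have "\<forall>n. \<exists>\<nu>. goh_multiplier \<nu> \<and> (\<Sum>i<N. \<bar>\<nu> i\<bar>) = 1 \<and> 0 \<le> (\<Sum>k<N. \<nu> k * OP k (xic (g n), uc (g n), yc (g n), yc (g n) T))"
  using goh_multiplier_exists[OF wm sgn] by blast
 from choice[OF this] obtain X where X: "\<And>n. goh_multiplier (X n)" "\<And>n. (\<Sum>i<N. \<bar>X n i\<bar>) = 1"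
  "\<And>n. 0 \<le> (\<Sum>k<N. X n k * OP k (xic (g n), uc (g n), yc (g n), yc (g n) T))" by blast
 have "X n \<in> {\<nu>. (\<forall>i<Suc (dphi P). 0 \<le> \<nu> i) \<and> (\<Sum>i<N. \<bar>\<nu> i\<bar>) = 1 \<and> (\<forall>i\<ge>N. \<nu> i = 0)}" for n
  using X(1)[of n] X(2)[of n] unfolding goh_multiplier_def by blast
 from compact_convergent_subsequence[OF compact_multiplier_sphere this]
 obtain l \<sigma> where l': "l \<in> {\<nu>. (\<forall>i<Suc (dphi P). 0 \<le> \<nu> i) \<and> (\<Sum>i<N. \<bar>\<nu> i\<bar>) = 1 \<and> (\<forall>i\<ge>N. \<nu> i = 0)}"
  and \<sigma>: "strict_mono (\<sigma> :: nat \<Rightarrow> nat)" and lim: "(X \<circ> \<sigma>) \<longlonglongrightarrow> l" .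
 have l: "(\<Sum>i<N. \<bar>l i\<bar>) = 1" using l' by simp
 have li: "(\<lambda>n. X (\<sigma> n) i) \<longlonglongrightarrow> l i" for i using lim by (simp add: tendsto_fun_iff)
 have "goh_multiplier l" by (rule goh_multiplier_limit[OF X(1) li])
 moreover have "0 \<le> (\<Sum>k<N. l k * OP k (\<xi>, u, y, h))"
 proof (rule LIMSEQ_le_const)
  have "(\<lambda>n. OP k (xic (g n), uc (g n), yc (g n), yc (g n) T)) \<longlonglongrightarrow> OP k (\<xi>, u, y, h)" for k
   by (intro OP_tendsto g)
  from LIMSEQ_subseq_LIMSEQ[OF this \<sigma>]
  show "(\<lambda>n. \<Sum>k<N. X (\<sigma> n) k * OP k (xic (g (\<sigma> n)), uc (g (\<sigma> n)), yc (g (\<sigma> n)), yc (g (\<sigma> n)) T)) \<longlonglongrightarrow> (\<Sum>k<N. l k * OP k (\<xi>, u, y, h))"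
   by (intro tendsto_sum tendsto_mult li) (simp add: o_def)
 qed (use X(3) in auto)
 ultimately show ?thesis using l by blast
qed

end

section \<open>Weak lower semicontinuity\<close>

lemma le_liminf_ereal_iff:
 fixes f :: "nat \<Rightarrow> real"
 shows "ereal a \<le> liminf (\<lambda>k. ereal (f k)) \<longleftrightarrow> (\<forall>e>0. \<forall>\<^sub>F k in sequentially. a - e < f k)"
proof
 assume "ereal a \<le> liminf (\<lambda>k. ereal (f k))"
 then show "\<forall>e>0. \<forall>\<^sub>F k in sequentially. a - e < f k"
  unfolding le_Liminf_iff by (auto dest: spec[of _ "ereal (a - _)"])
next
 assume *: "\<forall>e>0. \<forall>\<^sub>F k in sequentially. a - e < f k"
 show "ereal a \<le> liminf (\<lambda>k. ereal (f k))" unfolding le_Liminf_iff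
 proof (intro allI impI)
  fix y assume y: "y < ereal a"
  then obtain b where b: "y < ereal b" "b < a" by (metis ereal_dense2 ereal_less_eq(3) less_ereal.simps(1))
  with *[rule_format, of "a - b"] have "\<forall>\<^sub>F k in sequentially. b < f k" by simp
  then show "\<forall>\<^sub>F k in sequentially. y < ereal (f k)" by eventually_elim (use b in \<open>auto intro: less_trans\<close>)
 qed
qed

lemma L2_weak_bounded:
 fixes U :: "nat \<Rightarrow> real \<Rightarrow> 'a::euclidean_space"
 assumes U: "\<And>k. U k \<in> L2 T"
  and wk: "\<And>\<phi>. \<phi> \<in> L2 T \<Longrightarrow> (\<lambda>k. ip T (U k) \<phi>) \<longlonglongrightarrow> ip T u \<phi>"
 shows "\<exists>C\<ge>0. \<forall>k. l2n T (U k) \<le> C"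
proof -
 obtain C where C: "\<forall>k. l2n T (U k) \<le> C" using L2_uniform_boundedness[OF U convergent_imp_bounded[OF wk]] by blast
 then have "0 \<le> C" using l2n_nonneg order_trans by blast
 then show ?thesis using C by blast
qed

lemma L2_weak_quadratic:
 fixes A :: "real \<Rightarrow> real^'a::finite^'b::finite"
 assumes A: "cont_on T A" and U: "\<And>k. U k \<in> L2 T" and V: "L2conv T V v"
  and wk: "\<And>\<phi>. \<phi> \<in> L2 T \<Longrightarrow> (\<lambda>k. ip T (U k) \<phi>) \<longlonglongrightarrow> ip T u \<phi>"
 shows "(\<lambda>k. form T A (U k) (V k)) \<longlonglongrightarrow> form T A u v"
proof -
 obtain C where C: "\<And>k. l2n T (U k) \<le> C" using L2_weak_bounded[OF U wk] by blast
 have "v \<in> L2 T" using V by (simp add: L2conv_def)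
 from L2_inner_convergence[OF A U C wk[OF matrix_L2[OF A this]] V] show ?thesis .
qed

lemma L2_form_bounded:
 fixes A :: "real \<Rightarrow> real^'a::finite^'b::finite"
 assumes A: "cont_on T A" and U: "\<And>k. U k \<in> L2 T" "\<And>k. l2n T (U k) \<le> C" and V: "\<And>k. V k \<in> L2 T" "\<And>k. l2n T (V k) \<le> D"
 shows "\<exists>M. \<forall>k::nat. \<bar>form T A (U k) (V k)\<bar> \<le> M"
proof -
 obtain K where K: "0 \<le> K" "\<forall>u\<in>L2 T. l2n T (\<lambda>t. A t *v u t) \<le> K * l2n T u" using matrix_L2_bound[OF A] by blast
 have "\<bar>form T A (U k) (V k)\<bar> \<le> C * (K * D)" for k
 proof -
  have m: "(\<lambda>t. A t *v V k t) \<in> L2 T" by (rule matrix_L2[OF A V(1)])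
  have "l2n T (\<lambda>t. A t *v V k t) \<le> K * l2n T (V k)" using K(2) V(1) by blast
  also have "\<dots> \<le> K * D" using K(1) V(2) by (simp add: mult_left_mono)
  finally have "l2n T (U k) * l2n T (\<lambda>t. A t *v V k t) \<le> C * (K * D)"
   using U(2)[of k] l2n_nonneg order_trans[OF l2n_nonneg U(2)] by (intro mult_mono) auto
  then show ?thesis using L2_inner_bound[OF U(1)[of k] m] by simp
 qed
 then show ?thesis by blast
qed

context nominal_ocp
begin

context
 fixes w :: "nat \<Rightarrow> ('n, 'l, 'm) traj" and x0 u0 v0
 assumes H: "\<And>k. w k \<in> H_2 P wh" and H0: "(x0, u0, v0) \<in> H_2 P wh" and wk: "weakly_conv_W2 T w (x0, u0, v0)"
begin

lemma H2_members: "fst (snd (w k)) \<in> L2 T" "snd (snd (w k)) \<in> L2 T" "fst (w k) \<in> L2 T" "u0 \<in> L2 T" "v0 \<in> L2 T" "x0 \<in> L2 T"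
  "has_wderiv T (fst (w k)) (\<lambda>t. Fx P wh t *v fst (w k) t + Fu P wh t *v fst (snd (w k)) t + Fv P wh t *v snd (snd (w k)) t)"
  "has_wderiv T x0 (\<lambda>t. Fx P wh t *v x0 t + Fu P wh t *v u0 t + Fv P wh t *v v0 t)"
 and W2_members: "w k \<in> W_2 T" "(x0, u0, v0) \<in> W_2 T"
proof -
 show 1: "has_wderiv T (fst (w k)) (\<lambda>t. Fx P wh t *v fst (w k) t + Fu P wh t *v fst (snd (w k)) t + Fv P wh t *v snd (snd (w k)) t)"
  "has_wderiv T x0 (\<lambda>t. Fx P wh t *v x0 t + Fu P wh t *v u0 t + Fv P wh t *v v0 t)"
  and 2: "fst (snd (w k)) \<in> L2 T" "snd (snd (w k)) \<in> L2 T" "u0 \<in> L2 T" "v0 \<in> L2 T" "(x0, u0, v0) \<in> W_2 T"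
  using H[of k] H0 by (auto simp: H_2_def W_2_def split_beta)
 show "w k \<in> W_2 T" using H[of k] by (auto simp: H_2_def)
 show "fst (w k) \<in> L2 T" "x0 \<in> L2 T" by (intro continuous_imp_L2 has_wderiv_continuous[OF 1(1)] has_wderiv_continuous[OF 1(2)])+
qed

lemma H2_weak:
 shows "\<phi> \<in> L2 T \<Longrightarrow> (\<lambda>k. ip T (fst (snd (w k))) \<phi>) \<longlonglongrightarrow> ip T u0 \<phi>"
  and "\<psi> \<in> L2 T \<Longrightarrow> (\<lambda>k. ip T (snd (snd (w k))) \<psi>) \<longlonglongrightarrow> ip T v0 \<psi>"
  and "(\<lambda>k. fst (w k) 0) \<longlonglongrightarrow> x0 0" using weakly_conv_W2_components[OF T wk W2_members] by simp_all

text \<open>Integration is a compact operation: primitives of weakly convergent controls are bounded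
  and converge pointwise, hence strongly in L2, and the state equation passes this on to the
  states.\<close>

lemma H2_state_convergence: "L2conv T (\<lambda>k. fst (w k)) x0" "(\<lambda>k. fst (w k) T) \<longlonglongrightarrow> x0 T"
proof -
 define \<delta> where "\<delta> k t = fst (w k) t - x0 t" for k t
 define du where "du k t = fst (snd (w k)) t - u0 t" for k t
 define dv where "dv k t = snd (snd (w k)) t - v0 t" for k t
 have mem: "du k \<in> L2 T" "dv k \<in> L2 T" for k unfolding du_def dv_def by (intro L2_diff H2_members)+
 have wu: "(\<lambda>k. ip T (du k) \<phi>) \<longlonglongrightarrow> 0" if "\<phi> \<in> L2 T" for \<phi>
  using LIM_zero[OF H2_weak(1)[OF that]] L2_inner_integrable[OF H2_members(1) that] L2_inner_integrable[OF H2_members(4) that]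
  by (simp add: du_def inner_diff_left)
 have wv: "(\<lambda>k. ip T (dv k) \<phi>) \<longlonglongrightarrow> 0" if "\<phi> \<in> L2 T" for \<phi>
  using LIM_zero[OF H2_weak(2)[OF that]] L2_inner_integrable[OF H2_members(2) that] L2_inner_integrable[OF H2_members(5) that]
  by (simp add: dv_def inner_diff_left)
 obtain Cu where Cu: "0 \<le> Cu" "\<And>k. l2n T (du k) \<le> Cu"
  using L2_weak_bounded[where U=du and u="\<lambda>t. 0", OF mem(1)] wu by (simp, blast)
 obtain Cv where Cv: "0 \<le> Cv" "\<And>k. l2n T (dv k) \<le> Cv"
  using L2_weak_bounded[where U=dv and u="\<lambda>t. 0", OF mem(2)] wv by (simp, blast)
 define b where "b k t = Fu P wh t *v du k t + Fv P wh t *v dv k t" for k t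
 define I where "I k t = intg t (b k)" for k t
 note m1 = matrix_L2[OF Fu_cont mem(1)] and m2 = matrix_L2[OF Fv_cont mem(2)]
 have b: "b k \<in> L2 T" for k unfolding b_def by (intro L2_add m1 m2)
 have \<delta>: "has_wderiv T (\<delta> k) (\<lambda>t. Fx P wh t *v \<delta> k t + b k t)" for k
 proof -
  have "Fx P wh t *v \<delta> k t + b k t = (Fx P wh t *v fst (w k) t + Fu P wh t *v fst (snd (w k)) t + Fv P wh t *v snd (snd (w k)) t)
    - (Fx P wh t *v x0 t + Fu P wh t *v u0 t + Fv P wh t *v v0 t)" for t
   by (simp add: b_def \<delta>_def du_def dv_def matrix_vector_mult_diff_distrib)
  then show ?thesis using has_wderiv_diff[OF H2_members(7) H2_members(8)] by (simp add: \<delta>_def[abs_def])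
 qed
 obtain C1 where C1: "0 \<le> C1" "\<forall>u\<in>L2 T. l2n T (\<lambda>t. Fu P wh t *v u t) \<le> C1 * l2n T u" using matrix_L2_bound[OF Fu_cont] by blast
 obtain C2 where C2: "0 \<le> C2" "\<forall>u\<in>L2 T. l2n T (\<lambda>t. Fv P wh t *v u t) \<le> C2 * l2n T u" using matrix_L2_bound[OF Fv_cont] by blast
 define M where "M = sqrt T * (C1 * Cu + C2 * Cv)"
 have I_bound: "norm (I k t) \<le> M" if t: "t \<in> {0..T}" for k t
 proof -
  have "C1 * l2n T (du k) + C2 * l2n T (dv k) \<le> C1 * Cu + C2 * Cv" by (intro add_mono mult_left_mono Cu Cv C1 C2)
  then have "l2n T (b k) \<le> C1 * Cu + C2 * Cv"
   using L2_triangle[OF m1[of k] m2[of k]] bspec[OF C1(2) mem(1)[of k]] bspec[OF C2(2) mem(2)[of k]] unfolding b_def by linarith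
  then have "sqrt T * l2n T (b k) \<le> M" using T by (simp add: M_def)
  then show ?thesis unfolding I_def
   by (rule order_trans[OF order_trans[OF norm_integral_le[OF L2_integrable[OF b] t] L2_norm_integral_le[OF b t]]])
 qed
 have I0: "(\<lambda>k. I k t) \<longlonglongrightarrow> 0" if t: "t \<in> {0..T}" for t
 proof -
  have "(\<lambda>k. I k t \<bullet> a) \<longlonglongrightarrow> 0 \<bullet> a" if a: "a \<in> Basis" for a
  proof -
   \<comment> \<open>A coordinate of the primitive at time \<open>t\<close> is the pairing with this
     truncated basis vector; moving F_u and F_v to the other side by transposition leaves weakly
     convergent controls against fixed functions.\<close>
   define \<phi> where "\<phi> s = indicator {0..t} s *\<^sub>R a" for s
   have \<phi>: "\<phi> \<in> L2 T"
   proof (rule L2_bounded_image(1)[OF L2_const[of a T], where C=1])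
    show "\<phi> \<in> borel_measurable (leb T)" unfolding \<phi>_def by (intro measurable_restrict_space1 measurable_completion) measurable
   qed (auto simp: \<phi>_def indicator_def)
   let ?u = "\<lambda>s. transpose (Fu P wh s) *v \<phi> s" and ?v = "\<lambda>s. transpose (Fv P wh s) *v \<phi> s"
   have mu: "?u \<in> L2 T" and mv: "?v \<in> L2 T"
    by (intro matrix_L2[OF bounded_linear.continuous_on[OF nominal_costate.bounded_linear_transpose[OF unit_costate]]] Fu_cont Fv_cont \<phi>)+
   have "I k t \<bullet> a = ip T (du k) ?u + ip T (dv k) ?v" for k
   proof -
    have bt: "b k integrable_on {0..t}"
     by (rule integrable_on_subinterval[OF integrable_on_lebesgue_on[OF L2_integrable[OF b[of k]]]]) (use t in auto)
    have "I k t \<bullet> a = intg t (\<lambda>s. b k s \<bullet> a)" unfolding I_def using integral_component_eq[OF bt] by simp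
    also have "\<dots> = intg T (\<lambda>s. if s \<in> {0..t} then b k s \<bullet> a else 0)"
     using t by (subst integral_restrict_Int) (auto intro!: arg_cong2[where f=integral])
    also have "\<dots> = intg T (\<lambda>s. b k s \<bullet> \<phi> s)" by (rule integral_cong) (auto simp: \<phi>_def indicator_def)
    also have "\<dots> = ip T (b k) \<phi>" by (rule lebesgue_integral_eq_integral[symmetric, OF L2_inner_integrable[OF b \<phi>]]) simp
    also have "\<dots> = (\<integral>s. du k s \<bullet> ?u s + dv k s \<bullet> ?v s \<partial>leb T)"
     unfolding b_def inner_add_left inner_transpose ..
    also have "\<dots> = ip T (du k) ?u + ip T (dv k) ?v"
     by (rule Bochner_Integration.integral_add[OF L2_inner_integrable[OF mem(1) mu] L2_inner_integrable[OF mem(2) mv]])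
    finally show ?thesis .
   qed
   then show ?thesis using tendsto_add_zero[OF wu[OF mu] wv[OF mv]] by simp
  qed
  then show ?thesis by (subst tendsto_componentwise_iff) auto
 qed
 have Ic: "cont_on T (I k)" for k using linear_wderiv_bound(1)[OF \<delta> b, of k] by (simp add: I_def[abs_def])
 have IL: "I k \<in> L2 T" for k by (rule continuous_imp_L2[OF Ic])
 have "L2conv T I (\<lambda>t. 0)"
 proof (rule L2conv_dominated[OF L2_measurable[OF IL] L2_const])
  show "norm (I k t) \<le> M * norm (1 :: real)" if "t \<in> {0..T}" for k t using I_bound[OF that] by simp
  show "AE t in leb T. (\<lambda>k. I k t) \<longlonglongrightarrow> 0" by (rule AE_I2) (simp add: I0)
 qed (rule L2_const)
 then have I2: "(\<lambda>k. l2n T (I k)) \<longlonglongrightarrow> 0" by (simp add: L2conv_def)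
 define s where "s k = (norm (\<delta> k 0) + Kc * (sqrt T * l2n T (I k))) * exp (Kc * T)" for k
 have "(\<lambda>k. \<delta> k 0) \<longlonglongrightarrow> 0" unfolding \<delta>_def by (rule LIM_zero[OF H2_weak(3)])
 then have s0: "s \<longlonglongrightarrow> 0" unfolding s_def
  by (intro tendsto_mult_left_zero tendsto_add_zero tendsto_mult_right_zero I2) (simp add: tendsto_norm_zero)
 have zs: "norm (\<delta> k t - I k t) \<le> s k" if t: "t \<in> {0..T}" for k t
 proof -
  have "norm (\<delta> k t - I k t) \<le> (norm (\<delta> k 0) + Kc * intg T (\<lambda>s. norm (I k s))) * exp (Kc * T)"
   using linear_wderiv_bound(2)[OF \<delta> b t] by (simp add: I_def)
  also have "\<dots> \<le> s k" unfolding s_def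
   by (intro mult_right_mono add_left_mono mult_left_mono L2_norm_integral_le[OF IL] K) (use T in auto)
  finally show ?thesis .
 qed
 have s_nn: "0 \<le> s k" for k using order_trans[OF norm_ge_zero zs[of 0 k]] T by simp
 have \<delta>L: "\<delta> k \<in> L2 T" for k unfolding \<delta>_def by (intro L2_diff H2_members)
 show "L2conv T (\<lambda>k. fst (w k)) x0"
 proof (rule L2convI)
  show "l2n T (\<lambda>t. fst (w k) t - x0 t) \<le> sqrt T * s k + l2n T (I k)" for k
  proof -
   have "l2n T (\<lambda>t. (\<delta> k t - I k t) + I k t) \<le> l2n T (\<lambda>t. \<delta> k t - I k t) + l2n T (I k)"
    by (intro L2_triangle L2_diff \<delta>L IL)
   also have "l2n T (\<lambda>t. \<delta> k t - I k t) \<le> sqrt T * s k"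
    by (rule l2n_le_sup[OF L2_diff[OF \<delta>L IL] zs]) (use T s_nn in auto)
   finally show ?thesis by (simp add: \<delta>_def)
  qed
  show "(\<lambda>k. sqrt T * s k + l2n T (I k)) \<longlonglongrightarrow> 0" by (intro tendsto_add_zero tendsto_mult_right_zero s0 I2)
 qed (rule H2_members)+
 have "(\<lambda>k. \<delta> k T - I k T) \<longlonglongrightarrow> 0"
  using tendsto_0_abs_le[of "\<lambda>k. norm (\<delta> k T - I k T)" s] zs[of T] s0 T by (simp add: tendsto_norm_zero_iff)
 from tendsto_add[OF this I0[of T]] T have "(\<lambda>k. \<delta> k T) \<longlonglongrightarrow> 0" by simp
 then show "(\<lambda>k. fst (w k) T) \<longlonglongrightarrow> x0 T" by (simp add: \<delta>_def LIM_zero_iff)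
qed

end

end

context nominal_costate
begin

lemma Omega_terms:
 assumes "x \<in> L2 T" "u \<in> L2 T" "v \<in> L2 T"
 shows "integrable (leb T) (\<lambda>t. 1/2 * (p t \<bullet> dyn2 P (W t) (x t, u t, v t) (x t, u t, v t)))" (is ?int)
  and "Omega P wh \<mu> (x, u, v) = 1/2 * D2ell P wh \<mu> (x 0, x T)
   + 1/2 * form T (Hxx P wh \<mu>) x x + form T (Hux P wh \<mu>) u x
    + form T (Hvx P wh \<mu>) v x + 1/2 * form T (Huu P wh \<mu>) u u
    + form T (Hvu P wh \<mu>) v u" (is ?eq)
proof -
 note i = L2_quadratic_integrable[OF Hxx_cont assms(1) assms(1)] L2_quadratic_integrable[OF Hux_cont assms(2) assms(1)]
  L2_quadratic_integrable[OF Hvx_cont assms(3) assms(1)] L2_quadratic_integrable[OF Huu_cont assms(2) assms(2)]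
  L2_quadratic_integrable[OF Hvu_cont assms(3) assms(2)]
 show ?int unfolding Omega_integrand[symmetric] by (intro Bochner_Integration.integrable_add integrable_mult_right i)
 show ?eq unfolding Omega.simps by (simp add: i del: times_divide_eq_left)
qed

end

context nominal_ocp
begin

definition OM :: "nat \<Rightarrow> ('n, 'l, 'm) traj \<Rightarrow> real" where
 "OM k w = Omega P wh (unit_mult k) w"

text \<open>Like the form itself, weak lower semicontinuity depends on a multiplier only through its
  coefficients, so it can be studied under sums, multiples and limits of these.\<close>

definition weak_lsc_coeff :: "(nat \<Rightarrow> real) \<Rightarrow> bool" where
 "weak_lsc_coeff \<nu> \<longleftrightarrow> weakly_lsc_on T (H_2 P wh) (\<lambda>w. \<Sum>k<N. \<nu> k * OM k w)"

lemma H_2_L2: "(x, u, v) \<in> H_2 P wh \<Longrightarrow> x \<in> L2 T \<and> u \<in> L2 T \<and> v \<in> L2 T"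
 by (auto simp: H_2_def W_2_def intro!: continuous_imp_L2 intro: has_wderiv_continuous)

lemma Omega_sum:
 assumes \<mu>: "adjoint_mult \<mu>" and w: "w \<in> H_2 P wh" shows "Omega P wh \<mu> w = (\<Sum>k<N. coeff P \<mu> k * OM k w)"
proof -
 obtain x u v where wv: "w = (x, u, v)" by (cases w)
 then have L: "x \<in> L2 T" "u \<in> L2 T" "v \<in> L2 T" using H_2_L2 w by blast+
 let ?I = "\<lambda>k t. 1/2 * (snd (snd (unit_mult k)) t \<bullet> dyn2 P (W t) (x t, u t, v t) (x t, u t, v t))"
 have int: "integrable (leb T) (?I k)" for k by (rule nominal_costate.Omega_terms(1)[OF unit_costate L])
 have "(\<integral>t. 1/2 * (snd (snd \<mu>) t \<bullet> dyn2 P (W t) (x t, u t, v t) (x t, u t, v t)) \<partial>leb T)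
   = (\<integral>t. (\<Sum>k<N. coeff P \<mu> k * ?I k t) \<partial>leb T)"
 proof (rule Bochner_Integration.integral_cong[OF refl])
  fix t assume "t \<in> space (leb T)"
  then have t: "t \<in> {0..T}" by simp
  show "1/2 * (snd (snd \<mu>) t \<bullet> dyn2 P (W t) (x t, u t, v t) (x t, u t, v t)) = (\<Sum>k<N. coeff P \<mu> k * ?I k t)"
   unfolding adjoint_mult_sum[OF \<mu> t] by (simp add: inner_sum_left sum_divide_distrib snd_unit)
 qed
 also have "\<dots> = (\<Sum>k<N. coeff P \<mu> k * (\<integral>t. ?I k t \<partial>leb T))"
  using int by (simp del: times_divide_eq_left times_divide_eq_right)
 finally show ?thesis unfolding wv OM_def Omega_eq D2ell_eq by (simp add: sum_unit distrib_left sum.distrib sum_distrib_left mult_ac)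
qed

lemma weak_lsc_coeff_iff:
 assumes "adjoint_mult \<mu>" shows "weakly_lsc_on T (H_2 P wh) (Omega P wh \<mu>) \<longleftrightarrow> weak_lsc_coeff (coeff P \<mu>)"
 unfolding weak_lsc_coeff_def weakly_lsc_on_def using Omega_sum[OF assms] by (auto cong: conj_cong)

text \<open>States converge strongly, so terms that contain the state converge. The term with H_vu
  is absent, and the one with H_uu is a nonnegative quadratic form in weakly convergent
  controls.\<close>

lemma goh_multiplier_lsc:
 assumes g: "goh_multiplier \<nu>" shows "weak_lsc_coeff \<nu>"
proof -
 interpret m: nominal_costate P xh uh vh "mu \<nu>" by (rule nominal_costateI[OF adjoint_mu])
 have "weakly_lsc_on T (H_2 P wh) (Omega P wh (mu \<nu>))" unfolding weakly_lsc_on_def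
 proof (intro allI impI, elim conjE)
  fix w w0 assume H: "\<forall>k. w k \<in> H_2 P wh" and H0: "w0 \<in> H_2 P wh" and wk: "weakly_conv_W2 T w w0"
  obtain x0 u0 v0 where w0: "w0 = (x0, u0, v0)" by (cases w0)
  let ?X = "\<lambda>k. fst (w k)" and ?U = "\<lambda>k. fst (snd (w k))" and ?V = "\<lambda>k. snd (snd (w k))"
  note c = H[rule_format] H0[unfolded w0] wk[unfolded w0]
  note mem = H2_members[OF c] and weak = H2_weak[OF c] and conv = H2_state_convergence[OF c]
  let ?Q = "Huu P wh (mu \<nu>)"
  note i = m.L2_quadratic_integrable[OF m.Huu_cont mem(1) mem(1)] m.L2_quadratic_integrable[OF m.Huu_cont mem(1) mem(4)]
   m.L2_quadratic_integrable[OF m.Huu_cont mem(4) mem(1)] m.L2_quadratic_integrable[OF m.Huu_cont mem(4) mem(4)]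
  have Hvu0: "form T (Hvu P wh (mu \<nu>)) f h = 0" for f h
  proof -
   have "form T (Hvu P wh (mu \<nu>)) f h = (\<integral>t. 0 \<partial>leb T)"
    using g by (intro Bochner_Integration.integral_cong) (auto simp: goh_multiplier_def)
   then show ?thesis by simp
  qed
  define A where "A x u v = 1/2 * D2ell P wh (mu \<nu>) (x 0, x T)
   + 1/2 * form T (Hxx P wh (mu \<nu>)) x x + form T (Hux P wh (mu \<nu>)) u x
    + form T (Hvx P wh (mu \<nu>)) v x" for x u v
  define Q where "Q u v = form T ?Q u v" for u v
  have \<Omega>: "Omega P wh (mu \<nu>) (w k) = A (?X k) (?U k) (?V k) + 1/2 * Q (?U k) (?U k)" for k
   using m.Omega_terms(2)[OF mem(3)[of k] mem(1)[of k] mem(2)[of k]] by (simp add: A_def Q_def Hvu0)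
  have \<Omega>0: "Omega P wh (mu \<nu>) w0 = A x0 u0 v0 + 1/2 * Q u0 u0"
   using m.Omega_terms(2)[OF mem(6,4,5)] by (simp add: A_def Q_def Hvu0 w0)
  have "(\<lambda>k. D2ell P wh (mu \<nu>) (?X k 0, ?X k T)) \<longlonglongrightarrow> D2ell P wh (mu \<nu>) (x0 0, x0 T)"
   unfolding D2ell_eq by (intro tendsto_intros blinfun.tendsto weak(3) conv(2))
  then have AA: "(\<lambda>k. A (?X k) (?U k) (?V k)) \<longlonglongrightarrow> A x0 u0 v0" unfolding A_def
   by (intro tendsto_add tendsto_mult tendsto_const L2conv_quadratic[OF m.Hxx_cont conv(1) conv(1)]
    L2_weak_quadratic[OF m.Hux_cont mem(1) conv(1) weak(1)] L2_weak_quadratic[OF m.Hvx_cont mem(2) conv(1) weak(2)])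
  have Q1: "(\<lambda>k. Q (?U k) u0) \<longlonglongrightarrow> Q u0 u0"
   unfolding Q_def by (rule weak(1)[OF matrix_L2[OF m.Huu_cont mem(4)]])
  have Q2: "(\<lambda>k. Q u0 (?U k)) \<longlonglongrightarrow> Q u0 u0"
  proof -
   have flip: "u0 t \<bullet> (?Q t *v f t) = f t \<bullet> (transpose (?Q t) *v u0 t)" for f t by (simp add: inner_transpose inner_commute)
   show ?thesis unfolding Q_def flip
    by (rule weak(1)[OF matrix_L2[OF bounded_linear.continuous_on[OF m.bounded_linear_transpose m.Huu_cont] mem(4)]])
  qed
  \<comment> \<open>Nonnegativity on the difference bounds the quadratic term below by expressions
    linear in the varying control, and these converge.\<close>
  have Qpos: "Q (?U k) u0 + Q u0 (?U k) - Q u0 u0 \<le> Q (?U k) (?U k)" for k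
  proof -
   have "0 \<le> (\<integral>t. (?U k t - u0 t) \<bullet> (?Q t *v (?U k t - u0 t)) \<partial>leb T)"
    by (rule integral_nonneg_AE) (use g in \<open>auto simp: goh_multiplier_def intro!: AE_I2\<close>)
   also have "\<dots> = Q (?U k) (?U k) - Q (?U k) u0 - (Q u0 (?U k) - Q u0 u0)"
    unfolding Q_def by (simp add: matrix_vector_mult_diff_distrib inner_diff_left inner_diff_right i)
   finally show ?thesis by simp
  qed
  define R where "R k = A (?X k) (?U k) (?V k) + 1/2 * (Q (?U k) u0 + Q u0 (?U k) - Q u0 u0)" for k
  have "R \<longlonglongrightarrow> A x0 u0 v0 + 1/2 * (Q u0 u0 + Q u0 u0 - Q u0 u0)" unfolding R_def by (intro tendsto_intros AA Q1 Q2)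
  then have "(\<lambda>k. ereal (R k)) \<longlonglongrightarrow> ereal (Omega P wh (mu \<nu>) w0)" by (simp add: \<Omega>0)
  from lim_imp_Liminf[OF trivial_limit_sequentially this]
  have "ereal (Omega P wh (mu \<nu>) w0) = liminf (\<lambda>k. ereal (R k))" by (rule sym)
  also have "\<dots> \<le> liminf (\<lambda>k. ereal (Omega P wh (mu \<nu>) (w k)))"
  proof (intro Liminf_mono always_eventually allI)
   show "ereal (R k) \<le> ereal (Omega P wh (mu \<nu>) (w k))" for k using Qpos[of k] by (simp add: R_def \<Omega>)
  qed
  finally show "ereal (Omega P wh (mu \<nu>) w0) \<le> liminf (\<lambda>k. ereal (Omega P wh (mu \<nu>) (w k)))" .
 qed
 then have "weak_lsc_coeff (coeff P (mu \<nu>))" using weak_lsc_coeff_iff[OF adjoint_mu] by blast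
 moreover have "coeff P (mu \<nu>) = \<nu>" using g by (auto simp: coeff_mu goh_multiplier_def)
 ultimately show ?thesis by simp
qed

text \<open>Weakly convergent sequences have bounded controls and strongly convergent states. The
  uniform bound on the basis forms is what lets \<open>weak_lsc_coeff_limit\<close> compare forms
  with nearby coefficients along the whole sequence.\<close>

lemma OM_bounded:
 assumes H: "\<And>k. w k \<in> H_2 P wh" and H0: "w0 \<in> H_2 P wh" and wk: "weakly_conv_W2 T w w0"
 shows "\<exists>M. \<forall>j. \<bar>OM i (w j)\<bar> \<le> M"
proof -
 interpret m: nominal_costate P xh uh vh "unit_mult i" by (rule unit_costate)
 obtain x0 u0 v0 where w0: "w0 = (x0, u0, v0)" by (cases w0)
 let ?X = "\<lambda>k. fst (w k)" and ?U = "\<lambda>k. fst (snd (w k))" and ?V = "\<lambda>k. snd (snd (w k))"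
 note c = H H0[unfolded w0] wk[unfolded w0]
 note mem = H2_members[OF c] and weak = H2_weak[OF c] and conv = H2_state_convergence[OF c]
 obtain Cx where Cx: "\<And>k. l2n T (?X k) \<le> Cx" using L2conv_bounded[OF conv(1)] by blast
 obtain Cu where Cu: "\<And>k. l2n T (?U k) \<le> Cu" using L2_weak_bounded[OF mem(1) weak(1)] by blast
 obtain Cv where Cv: "\<And>k. l2n T (?V k) \<le> Cv" using L2_weak_bounded[OF mem(2) weak(2)] by blast
 have "(\<lambda>k. D2ell P wh (unit_mult i) (?X k 0, ?X k T)) \<longlonglongrightarrow> D2ell P wh (unit_mult i) (x0 0, x0 T)"
  unfolding D2ell_eq by (intro tendsto_intros blinfun.tendsto weak(3) conv(2))
 from convergent_imp_bounded[OF this] obtain M0 where "\<forall>y\<in>range (\<lambda>k. D2ell P wh (unit_mult i) (?X k 0, ?X k T)). norm y \<le> M0"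
  unfolding bounded_iff ..
 then have M0: "\<bar>D2ell P wh (unit_mult i) (?X k 0, ?X k T)\<bar> \<le> M0" for k by simp
 obtain M1 where M1: "\<forall>k. \<bar>form T (Hxx P wh (unit_mult i)) (?X k) (?X k)\<bar> \<le> M1"
  using L2_form_bounded[where U="?X" and V="?X", OF m.Hxx_cont mem(3) Cx mem(3) Cx] by blast
 obtain M2 where M2: "\<forall>k. \<bar>form T (Hux P wh (unit_mult i)) (?U k) (?X k)\<bar> \<le> M2"
  using L2_form_bounded[where U="?U" and V="?X", OF m.Hux_cont mem(1) Cu mem(3) Cx] by blast
 obtain M3 where M3: "\<forall>k. \<bar>form T (Hvx P wh (unit_mult i)) (?V k) (?X k)\<bar> \<le> M3"
  using L2_form_bounded[where U="?V" and V="?X", OF m.Hvx_cont mem(2) Cv mem(3) Cx] by blast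
 obtain M4 where M4: "\<forall>k. \<bar>form T (Huu P wh (unit_mult i)) (?U k) (?U k)\<bar> \<le> M4"
  using L2_form_bounded[where U="?U" and V="?U", OF m.Huu_cont mem(1) Cu mem(1) Cu] by blast
 obtain M5 where M5: "\<forall>k. \<bar>form T (Hvu P wh (unit_mult i)) (?V k) (?U k)\<bar> \<le> M5"
  using L2_form_bounded[where U="?V" and V="?U", OF m.Hvu_cont mem(2) Cv mem(1) Cu] by blast
 have tri: "\<bar>1/2 * a0 + 1/2 * a1 + a2 + a3 + 1/2 * a4 + a5\<bar> \<le> M0 + M1 + M2 + M3 + M4 + M5"
  if "\<bar>a0\<bar> \<le> M0" "\<bar>a1\<bar> \<le> M1" "\<bar>a2\<bar> \<le> M2" "\<bar>a3\<bar> \<le> M3" "\<bar>a4\<bar> \<le> M4" "\<bar>a5\<bar> \<le> M5" for a0 a1 a2 a3 a4 a5 :: real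
  using that by linarith
 have "\<bar>OM i (w j)\<bar> \<le> M0 + M1 + M2 + M3 + M4 + M5" for j
  using tri[OF M0 M1[rule_format] M2[rule_format] M3[rule_format] M4[rule_format] M5[rule_format], of j j j j j j]
   m.Omega_terms(2)[OF mem(3)[of j] mem(1)[of j] mem(2)[of j]] by (simp add: OM_def)
 then show ?thesis by blast
qed

lemma weak_lsc_coeffD:
 assumes "weak_lsc_coeff \<nu>" "\<And>k. w k \<in> H_2 P wh" "w0 \<in> H_2 P wh" "weakly_conv_W2 T w w0" "0 < e"
 shows "\<forall>\<^sub>F j in sequentially. (\<Sum>k<N. \<nu> k * OM k w0) - e < (\<Sum>k<N. \<nu> k * OM k (w j))"
 using assms unfolding weak_lsc_coeff_def weakly_lsc_on_def le_liminf_ereal_iff by blast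

lemma weak_lsc_coeffI:
 assumes "\<And>w w0 e. (\<And>k. w k \<in> H_2 P wh) \<Longrightarrow> w0 \<in> H_2 P wh \<Longrightarrow> weakly_conv_W2 T w w0 \<Longrightarrow> 0 < e \<Longrightarrow>
  \<forall>\<^sub>F j in sequentially. (\<Sum>k<N. \<nu> k * OM k w0) - e < (\<Sum>k<N. \<nu> k * OM k (w j))"
 shows "weak_lsc_coeff \<nu>" using assms unfolding weak_lsc_coeff_def weakly_lsc_on_def le_liminf_ereal_iff by blast

lemma weak_lsc_coeff_add:
 assumes "weak_lsc_coeff \<nu>" "weak_lsc_coeff \<nu>'" shows "weak_lsc_coeff (\<lambda>k. \<nu> k + \<nu>' k)"
proof (rule weak_lsc_coeffI)
 fix w w0 and e :: real assume H: "\<And>k. w k \<in> H_2 P wh" "w0 \<in> H_2 P wh" "weakly_conv_W2 T w w0" and e: "0 < e"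
 from e have "0 < e/2" by simp
 from weak_lsc_coeffD[OF assms(1) H this] weak_lsc_coeffD[OF assms(2) H this]
 show "\<forall>\<^sub>F j in sequentially. (\<Sum>k<N. (\<nu> k + \<nu>' k) * OM k w0) - e < (\<Sum>k<N. (\<nu> k + \<nu>' k) * OM k (w j))"
  by eventually_elim (simp add: distrib_right sum.distrib)
qed

lemma weak_lsc_coeff_scale:
 assumes "weak_lsc_coeff \<nu>" "0 \<le> r" shows "weak_lsc_coeff (\<lambda>k. r * \<nu> k)"
proof (cases "r = 0")
 case True
 then show ?thesis by (intro weak_lsc_coeffI) simp
next
 case False
 show ?thesis
 proof (rule weak_lsc_coeffI)
  fix w w0 and e :: real assume H: "\<And>k. w k \<in> H_2 P wh" "w0 \<in> H_2 P wh" "weakly_conv_W2 T w w0" and e: "0 < e"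
  have r: "0 < r" "0 < e/r" using False assms(2) e by auto
  from weak_lsc_coeffD[OF assms(1) H r(2)]
  show "\<forall>\<^sub>F j in sequentially. (\<Sum>k<N. r * \<nu> k * OM k w0) - e < (\<Sum>k<N. r * \<nu> k * OM k (w j))"
  proof eventually_elim
   case (elim j)
   from mult_strict_left_mono[OF elim r(1)] r(1) show ?case by (simp add: sum_distrib_left right_diff_distrib mult.assoc)
  qed
 qed
qed

lemma weak_lsc_coeff_limit:
 assumes X: "\<And>n. weak_lsc_coeff (X n)" and l: "\<And>i. (\<lambda>n. X n i) \<longlonglongrightarrow> l i" shows "weak_lsc_coeff l"
proof (rule weak_lsc_coeffI)
 fix w w0 and e :: real assume H: "\<And>k. w k \<in> H_2 P wh" "w0 \<in> H_2 P wh" "weakly_conv_W2 T w w0" and e: "0 < e"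
 obtain M where M: "\<And>i j. \<bar>OM i (w j)\<bar> \<le> M i" using OM_bounded[OF H] by metis
 have "(\<lambda>n. \<Sum>k<N. \<bar>X n k - l k\<bar> * (M k + \<bar>OM k w0\<bar>)) \<longlonglongrightarrow> 0"
  by (intro tendsto_null_sum tendsto_mult_left_zero tendsto_rabs_zero LIM_zero l)
 from order_tendstoD(2)[OF this, of "e/2"] e obtain n where n: "(\<Sum>k<N. \<bar>X n k - l k\<bar> * (M k + \<bar>OM k w0\<bar>)) < e/2"
  by (auto simp: eventually_sequentially)
 have d: "(\<Sum>k<N. X n k * OM k (w j)) - (\<Sum>k<N. X n k * OM k w0) \<le> (\<Sum>k<N. l k * OM k (w j)) - (\<Sum>k<N. l k * OM k w0) + e/2" for j
 proof -
  have "(\<Sum>k<N. X n k * OM k (w j)) - (\<Sum>k<N. X n k * OM k w0) - ((\<Sum>k<N. l k * OM k (w j)) - (\<Sum>k<N. l k * OM k w0))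
    = (\<Sum>k<N. (X n k - l k) * (OM k (w j) - OM k w0))" by (simp add: algebra_simps sum_subtractf sum.distrib)
  also have "\<dots> \<le> (\<Sum>k<N. \<bar>X n k - l k\<bar> * (M k + \<bar>OM k w0\<bar>))"
  proof (rule sum_mono)
   fix k
   have "(X n k - l k) * (OM k (w j) - OM k w0) \<le> \<bar>X n k - l k\<bar> * \<bar>OM k (w j) - OM k w0\<bar>"
    by (metis abs_ge_self abs_mult)
   also have "\<dots> \<le> \<bar>X n k - l k\<bar> * (M k + \<bar>OM k w0\<bar>)" using M[of k j] by (intro mult_left_mono) auto
   finally show "(X n k - l k) * (OM k (w j) - OM k w0) \<le> \<bar>X n k - l k\<bar> * (M k + \<bar>OM k w0\<bar>)" .
  qed
  finally show ?thesis using n by simp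
 qed
 from e have "0 < e/2" by simp
 from weak_lsc_coeffD[OF X[of n] H this]
 show "\<forall>\<^sub>F j in sequentially. (\<Sum>k<N. l k * OM k w0) - e < (\<Sum>k<N. l k * OM k (w j))"
 proof eventually_elim
  case (elim j)
  then show ?case using d[of j] by simp
 qed
qed

section \<open>Coefficient vectors of multipliers and the convex hull\<close>

lemma sum_Lk:
 assumes \<mu>: "adjoint_mult \<mu>"
 shows "(\<Sum>k<N. coeff P \<mu> k * Lk k g) = (\<Sum>k<N. coeff P \<mu> k * D1 (chi P k) qh (fst g, 0)) + snd (snd \<mu>) 0 \<bullet> fst g
  + intg T (\<lambda>t. snd (snd \<mu>) t \<bullet> dyn1 P (W t) (0, uc g t, vc g t))"
proof -
 have c: "cont_on T (\<lambda>t. pk k t \<bullet> dyn1 P (W t) (0, uc g t, vc g t))" for k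
  by (intro continuous_intros pk_cont dyn1_cont uc_cont vc_cont)
 have "intg T (\<lambda>t. snd (snd \<mu>) t \<bullet> dyn1 P (W t) (0, uc g t, vc g t))
   = intg T (\<lambda>t. \<Sum>k<N. coeff P \<mu> k * (pk k t \<bullet> dyn1 P (W t) (0, uc g t, vc g t)))"
  by (rule integral_cong) (simp add: adjoint_mult_sum[OF \<mu>] inner_sum_left)
 also have "\<dots> = (\<Sum>k<N. coeff P \<mu> k * intg T (\<lambda>t. pk k t \<bullet> dyn1 P (W t) (0, uc g t, vc g t)))"
  by (subst integral_sum) (auto intro!: integrable_continuous_real continuous_on_mult_left c)
 finally show ?thesis using adjoint_mult_sum[OF \<mu>, of 0] T
  by (simp add: Lk_def first_variation_def snd_ctrl distrib_left sum.distrib inner_sum_left)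
qed

lemma Hx_eq: "Hx P wh \<mu> t = (\<Sum>b\<in>Basis. (snd (snd \<mu>) t \<bullet> dyn1 P (W t) (b, 0)) *\<^sub>R b)"
proof (rule vector_eq_ldot[THEN iffD1], rule allI)
 fix k show "k \<bullet> Hx P wh \<mu> t = k \<bullet> (\<Sum>b\<in>Basis. (snd (snd \<mu>) t \<bullet> dyn1 P (W t) (b, 0)) *\<^sub>R b)"
  unfolding Hx_inner using adjoint_inner[of "snd (snd \<mu>) t" t k] by (simp add: inner_commute pair_zero)
qed

lemma Huv_cont:
 assumes "cont_on T (snd (snd \<mu>))" shows "cont_on T (Hu P wh \<mu>)" "cont_on T (Hv P wh \<mu>)" "cont_on T (Hx P wh \<mu>)"
 by (subst continuous_on_componentwise, intro ballI, subst inner_commute, unfold Hu_inner Hv_inner Hx_inner,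
  intro continuous_intros assms dyn1_cont)+

definition multiplier_norm :: "(nat \<Rightarrow> real) \<Rightarrow> real" where
 "multiplier_norm \<nu> = L2_set \<nu> {0..dphi P} + L2_set (\<lambda>j. \<nu> (dphi P + j)) {1..deta P}"

text \<open>Without the normalization the coefficient vectors of \<open>Lambda_sharp\<close> form a
  convex cone, which then also contains those of the convex hull.\<close>

definition multiplier_cone :: "(nat \<Rightarrow> real) set" where
 "multiplier_cone = {\<nu>. (\<forall>i<Suc (dphi P). 0 \<le> \<nu> i) \<and> (\<forall>i\<ge>N. \<nu> i = 0) \<and> (\<forall>g. (\<Sum>i<N. \<nu> i * Lk i g) = 0) \<and> weak_lsc_coeff \<nu>}"

text \<open>The adjoint equation and the condition at \<open>T\<close> hold by construction of
  \<open>mu\<close>; the condition at 0 and stationarity are extracted from the vanishing first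
  variation by suitable perturbations.\<close>

lemma mu_Lambda_sharp:
 assumes \<nu>: "\<nu> \<in> multiplier_cone" and n1: "multiplier_norm \<nu> = 1" shows "mu \<nu> \<in> Lambda_sharp P wh"
proof -
 interpret m: nominal_costate P xh uh vh "mu \<nu>" by (rule nominal_costateI[OF adjoint_mu])
 have cf: "coeff P (mu \<nu>) = \<nu>" using \<nu> by (auto simp: coeff_mu multiplier_cone_def)
 have L0: "(\<Sum>k<N. \<nu> k * D1 (chi P k) qh (fst g, 0)) + m.p 0 \<bullet> fst g
  + intg T (\<lambda>t. m.p t \<bullet> dyn1 P (W t) (0, uc g t, vc g t)) = 0" for g
 proof -
  have "(\<Sum>k<N. \<nu> k * Lk k g) = 0" using \<nu> unfolding multiplier_cone_def by blast
  then show ?thesis using sum_Lk[OF adjoint_mu[of \<nu>], of g] unfolding cf by simp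
 qed
 note Hc = Huv_cont[OF m.p_cont]
 have w: "has_wderiv T m.p (\<lambda>t. - Hx P wh (mu \<nu>) t)"
 proof (rule has_wderiv_of_derivative)
  show "vd T (m.p) (- Hx P wh (mu \<nu>) t) t" if "t \<in> {0..T}" for t using m.p_deriv[OF that] by (simp add: m.p'_def Hx_eq)
 qed (intro continuous_intros Hc)
 have W: "m.p \<in> W1inf T" using w continuous_imp_Linf[OF continuous_on_minus[OF Hc(3)]] by (auto simp: W1inf_def)
 \<comment> \<open>Perturbing the initial value with zero controls isolates the condition at
   0.\<close>
 have p0: "m.p 0 = - grad (\<lambda>q. ell P (mu \<nu>) (q, xh T)) (xh 0)"
 proof (rule vector_eq_ldot[THEN iffD1], rule allI)
  fix a
  have "uc (a, 0) t = 0" "vc (a, 0) t = 0" for t by (simp_all add: uc_def vc_def)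
  then have "(\<Sum>k<N. \<nu> k * D1 (chi P k) qh (a, 0)) + m.p 0 \<bullet> a = 0"
   using L0[of "(a, 0)"] by (simp add: zero_prod_def[symmetric])
  then show "a \<bullet> m.p 0 = a \<bullet> - grad (\<lambda>q. ell P (mu \<nu>) (q, xh T)) (xh 0)"
   unfolding inner_minus_right grad_ell(1) cf by (simp add: inner_commute)
 qed
 have pT: "m.p T = grad (\<lambda>q. ell P (mu \<nu>) (xh 0, q)) (xh T)"
 proof (rule vector_eq_ldot[THEN iffD1], rule allI)
  fix a show "a \<bullet> m.p T = a \<bullet> grad (\<lambda>q. ell P (mu \<nu>) (xh 0, q)) (xh T)"
   unfolding grad_ell(2) using adjoint_mu[of \<nu>] by (simp add: adjoint_mult_def inner_commute)
 qed
 have H0: "Hu P wh (mu \<nu>) t = 0 \<and> Hv P wh (mu \<nu>) t = 0" if t: "t \<in> {0..T}" for t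
 proof -
  \<comment> \<open>The functions H_u and H_v themselves serve as control perturbations; the first
    variation is then the integral of this sum of squares.\<close>
  define q where "q t = Hu P wh (mu \<nu>) t \<bullet> Hu P wh (mu \<nu>) t + Hv P wh (mu \<nu>) t \<bullet> Hv P wh (mu \<nu>) t" for t
  have qc: "cont_on T q" unfolding q_def by (intro continuous_intros Hc)
  have "intg T q = intg T (\<lambda>t. m.p t \<bullet> dyn1 P (W t) (0, uc (ctrl_of (Hu P wh (mu \<nu>)) (Hv P wh (mu \<nu>))) t, vc (ctrl_of (Hu P wh (mu \<nu>)) (Hv P wh (mu \<nu>))) t))"
  proof (rule integral_cong)
   fix t assume t: "t \<in> {0..T}"
   show "q t = m.p t \<bullet> dyn1 P (W t) (0, uc (ctrl_of (Hu P wh (mu \<nu>)) (Hv P wh (mu \<nu>))) t, vc (ctrl_of (Hu P wh (mu \<nu>)) (Hv P wh (mu \<nu>))) t)"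
    unfolding ctrl_of[OF Hc(1,2) t] q_def Hu_inner Hv_inner by (simp add: inner_add_right[symmetric] blinfun.add_right[symmetric])
  qed
  also have "\<dots> = 0"
   using L0[of "ctrl_of (Hu P wh (mu \<nu>)) (Hv P wh (mu \<nu>))"] by (simp add: ctrl_of_def zero_prod_def[symmetric])
  finally have "\<forall>t\<in>{0..T}. q t = 0" by (subst (asm) integral_eq_0_iff[OF qc T]) (auto simp: q_def)
  then have "q t = 0" using t by blast
  moreover have "0 \<le> Hu P wh (mu \<nu>) t \<bullet> Hu P wh (mu \<nu>) t" "0 \<le> Hv P wh (mu \<nu>) t \<bullet> Hv P wh (mu \<nu>) t" by simp_all
  ultimately have "Hu P wh (mu \<nu>) t \<bullet> Hu P wh (mu \<nu>) t = 0" "Hv P wh (mu \<nu>) t \<bullet> Hv P wh (mu \<nu>) t = 0"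
   unfolding q_def by linarith+
  then show ?thesis by simp
 qed
 have "is_multiplier P wh (\<nu>, (\<lambda>j. \<nu> (dphi P + j)), m.p)" unfolding is_multiplier.simps Let_def mu_def[symmetric]
 proof -
  have eq: "(\<nu>, (\<lambda>j. \<nu> (dphi P + j)), m.p) = mu \<nu>" by (simp add: mu_def)
  show "L2_set \<nu> {0..dphi P} + L2_set (\<lambda>j. \<nu> (dphi P + j)) {1..deta P} = 1 \<and> (\<forall>i\<in>{0..dphi P}. 0 \<le> \<nu> i) \<and> m.p \<in> W1inf T \<and>
   has_wderiv T m.p (\<lambda>t. - Hx P wh (\<nu>, (\<lambda>j. \<nu> (dphi P + j)), m.p) t) \<and>
   m.p 0 = - grad (\<lambda>q. ell P (\<nu>, (\<lambda>j. \<nu> (dphi P + j)), m.p) (q, xh T)) (xh 0) \<and>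
   m.p T = grad (\<lambda>q. ell P (\<nu>, (\<lambda>j. \<nu> (dphi P + j)), m.p) (xh 0, q)) (xh T) \<and>
   (AE t in leb T. Hu P wh (\<nu>, (\<lambda>j. \<nu> (dphi P + j)), m.p) t = 0) \<and>
   (AE t in leb T. Hv P wh (\<nu>, (\<lambda>j. \<nu> (dphi P + j)), m.p) t = 0)"
   unfolding eq using n1 \<nu> W w p0 pT H0 by (auto simp: multiplier_norm_def multiplier_cone_def intro!: AE_I2)
 qed
 then have "mu \<nu> \<in> Lambda P wh" by (simp add: Lambda_def mu_def)
 moreover have "weakly_lsc_on T (H_2 P wh) (Omega P wh (mu \<nu>))"
  unfolding weak_lsc_coeff_iff[OF adjoint_mu] cf using \<nu> by (simp add: multiplier_cone_def)
 ultimately show ?thesis by (simp add: Lambda_sharp_def)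
qed

text \<open>The converse passage to coefficients. Stationarity almost everywhere is enough for the
  first variation to vanish, since it enters under an integral.\<close>

lemma Lambda_sharp_coeff:
 assumes \<mu>: "\<mu> \<in> Lambda_sharp P wh"
 shows "adjoint_mult \<mu>" "coeff P \<mu> \<in> multiplier_cone" "multiplier_norm (coeff P \<mu>) = 1"
proof -
 obtain \<alpha> \<beta> p where eq: "\<mu> = (\<alpha>, \<beta>, p)" by (cases \<mu>)
 have "is_multiplier P wh (\<alpha>, \<beta>, p)" using \<mu> by (simp add: Lambda_sharp_def Lambda_def eq)
 then have m: "L2_set \<alpha> {0..dphi P} + L2_set \<beta> {1..deta P} = 1" "\<forall>i\<in>{0..dphi P}. 0 \<le> \<alpha> i"
  "has_wderiv T p (\<lambda>t. - Hx P wh \<mu> t)" "p 0 = - grad (\<lambda>q. ell P \<mu> (q, xh T)) (xh 0)"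
  "p T = grad (\<lambda>q. ell P \<mu> (xh 0, q)) (xh T)" "AE t in leb T. Hu P wh \<mu> t = 0" "AE t in leb T. Hv P wh \<mu> t = 0"
  unfolding is_multiplier.simps Let_def eq by blast+
 have pe: "snd (snd \<mu>) = p" by (simp add: eq)
 have pc: "cont_on T (snd (snd \<mu>))" unfolding pe by (rule has_wderiv_continuous[OF m(3)])
 note Hc = Huv_cont[OF pc]
 have cs: "costate (snd (snd \<mu>))" unfolding costate_def Hx_eq[symmetric] unfolding pe
  by (intro ballI has_wderiv_imp_derivative[OF m(3)] continuous_on_minus Hc)
 show adj: "adjoint_mult \<mu>" unfolding adjoint_mult_def
 proof (intro conjI allI cs)
  fix a show "snd (snd \<mu>) T \<bullet> a = (\<Sum>k<N. coeff P \<mu> k * D1 (chi P k) qh (0, a))"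
   using grad_ell(2)[of a \<mu>] m(5) by (simp add: pe inner_commute)
 qed
 have "(\<Sum>i<N. coeff P \<mu> i * Lk i g) = 0" for g
 proof -
  have e: "snd (snd \<mu>) t \<bullet> dyn1 P (W t) (0, uc g t, vc g t) = uc g t \<bullet> Hu P wh \<mu> t + vc g t \<bullet> Hv P wh \<mu> t" for t
   unfolding Hu_inner Hv_inner by (simp add: inner_add_right[symmetric] blinfun.add_right[symmetric])
  have "intg T (\<lambda>t. uc g t \<bullet> Hu P wh \<mu> t + vc g t \<bullet> Hv P wh \<mu> t)
    = (\<integral>t. uc g t \<bullet> Hu P wh \<mu> t + vc g t \<bullet> Hv P wh \<mu> t \<partial>leb T)"
   by (rule lebesgue_integral_continuous[symmetric]) (intro continuous_intros uc_cont vc_cont Hc)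
  also have "\<dots> = 0" by (rule integral_eq_zero_AE) (use m(6,7) in \<open>eventually_elim, simp\<close>)
  finally show ?thesis unfolding sum_Lk[OF adj] e using grad_ell(1)[of "fst g" \<mu>] m(4) by (simp add: pe inner_commute)
 qed
 moreover have "weak_lsc_coeff (coeff P \<mu>)" using \<mu> weak_lsc_coeff_iff[OF adj] by (simp add: Lambda_sharp_def)
 moreover have "0 \<le> coeff P \<mu> i" if "i < Suc (dphi P)" for i using m(2) that by (simp add: eq nchi_def)
 moreover have "coeff P \<mu> i = 0" if "N \<le> i" for i using that by (simp add: eq)
 ultimately show "coeff P \<mu> \<in> multiplier_cone" by (simp add: multiplier_cone_def)
 have "L2_set (coeff P \<mu>) {0..dphi P} = L2_set \<alpha> {0..dphi P}"
  "L2_set (\<lambda>j. coeff P \<mu> (dphi P + j)) {1..deta P} = L2_set \<beta> {1..deta P}"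
  by (auto simp: L2_set_def eq nchi_def intro!: sum.cong arg_cong[where f=sqrt])
 then show "multiplier_norm (coeff P \<mu>) = 1" using m(1) by (simp add: multiplier_norm_def)
qed

lemma multiplier_cone_scale: "\<nu> \<in> multiplier_cone \<Longrightarrow> 0 \<le> r \<Longrightarrow> (\<lambda>k. r * \<nu> k) \<in> multiplier_cone"
 by (auto simp: multiplier_cone_def weak_lsc_coeff_scale mult.assoc sum_distrib_left[symmetric])

lemma multiplier_cone_add: "\<nu> \<in> multiplier_cone \<Longrightarrow> \<nu>' \<in> multiplier_cone \<Longrightarrow> (\<lambda>k. \<nu> k + \<nu>' k) \<in> multiplier_cone"
 by (auto simp: multiplier_cone_def weak_lsc_coeff_add distrib_right sum.distrib)

lemma multiplier_norm_scale: "0 \<le> r \<Longrightarrow> multiplier_norm (\<lambda>k. r * \<nu> k) = r * multiplier_norm \<nu>"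
 by (simp add: multiplier_norm_def L2_set_right_distrib distrib_left)

lemma multiplier_norm_add: "multiplier_norm (\<lambda>k. \<nu> k + \<nu>' k) \<le> multiplier_norm \<nu> + multiplier_norm \<nu>'"
 using L2_set_triangle_ineq[of \<nu> \<nu>' "{0..dphi P}"]
  L2_set_triangle_ineq[of "\<lambda>j. \<nu> (dphi P + j)" "\<lambda>j. \<nu>' (dphi P + j)" "{1..deta P}"]
 by (simp add: multiplier_norm_def)

lemma multiplier_norm_nonneg: "0 \<le> multiplier_norm \<nu>" by (simp add: multiplier_norm_def L2_set_nonneg)

lemma coord_le_multiplier_norm:
 assumes k: "k < N" shows "\<bar>\<nu> k\<bar> \<le> multiplier_norm \<nu>"
proof (cases "k \<le> dphi P")
 case True
 then have "\<bar>\<nu> k\<bar> \<le> L2_set (\<lambda>i. \<bar>\<nu> i\<bar>) {0..dphi P}" by (intro member_le_L2_set) auto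
 also have "\<dots> = L2_set \<nu> {0..dphi P}" by (simp add: L2_set_def)
 finally show ?thesis using L2_set_nonneg[of "\<lambda>j. \<nu> (dphi P + j)" "{1..deta P}"] unfolding multiplier_norm_def by linarith
next
 case False
 then have "\<bar>\<nu> (dphi P + (k - dphi P))\<bar> \<le> L2_set (\<lambda>j. \<bar>\<nu> (dphi P + j)\<bar>) {1..deta P}"
  using k by (intro member_le_L2_set[where f="\<lambda>j. \<bar>\<nu> (dphi P + j)\<bar>"]) (auto simp: nchi_def)
 also have "\<dots> = L2_set (\<lambda>j. \<nu> (dphi P + j)) {1..deta P}" by (simp add: L2_set_def)
 finally have "\<bar>\<nu> k\<bar> \<le> L2_set (\<lambda>j. \<nu> (dphi P + j)) {1..deta P}" using False by simp
 then show ?thesis using L2_set_nonneg[of \<nu> "{0..dphi P}"] unfolding multiplier_norm_def by linarith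
qed

text \<open>Linearity of V in the costate turns the condition V = 0 into equations on coefficients,
  which survive multiples and limits.\<close>

definition vmat_zero :: "(nat \<Rightarrow> real) \<Rightarrow> bool" where
 "vmat_zero \<nu> \<longleftrightarrow> (\<forall>t\<in>{0..T}. \<forall>a b. (\<Sum>k<N. \<nu> k * (a \<bullet> (Vk k t *v b))) = 0)"

lemma vmat_zero_iff:
 assumes \<mu>: "adjoint_mult \<mu>" shows "(\<forall>t\<in>{0..T}. Vmat P wh \<mu> t = 0) \<longleftrightarrow> vmat_zero (coeff P \<mu>)"
proof -
 have "a \<bullet> (Vmat P wh \<mu> t *v b) = (\<Sum>k<N. coeff P \<mu> k * (a \<bullet> (Vk k t *v b)))" if "t \<in> {0..T}" for a b t
  unfolding nominal_costate.Vmat_inner[OF nominal_costateI[OF \<mu>]] nominal_costate.Vmat_inner[OF unit_costate]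
  by (auto simp: adjoint_mult_sum[OF \<mu> that] snd_unit inner_sum_left sum_divide_distrib intro!: sum.cong)
 moreover have "Vmat P wh \<mu> t = 0 \<longleftrightarrow> (\<forall>a b. a \<bullet> (Vmat P wh \<mu> t *v b) = 0)" for t
  using matrix_vector_inner_eqI[of "Vmat P wh \<mu> t" 0] by auto
 ultimately show ?thesis by (simp add: vmat_zero_def)
qed

text \<open>Each coordinate is bounded by the norm, which gives a compact box. For closedness the
  essential point is the stability of weak lower semicontinuity under limits of
  coefficients.\<close>

lemma compact_normalized:
 "compact {\<nu> \<in> multiplier_cone. multiplier_norm \<nu> = 1 \<and> vmat_zero \<nu>}" (is "compact ?S")
proof -
 define C :: "(nat \<Rightarrow> real) set" where "C = PiE UNIV (\<lambda>i. if i < N then {-1..1} else {0})"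
 have C: "compact C" unfolding C_def by (rule compact_PiE_UNIV) simp
 have sub: "?S \<subseteq> C"
 proof
  fix \<nu> assume \<nu>: "\<nu> \<in> ?S"
  have "\<nu> i \<in> (if i < N then {-1..1} else {0})" for i
  proof (cases "i < N")
   case True
   then show ?thesis using coord_le_multiplier_norm[OF True, of \<nu>] \<nu> by auto
  qed (use \<nu> in \<open>simp add: multiplier_cone_def\<close>)
  then show "\<nu> \<in> C" by (simp add: C_def PiE_iff)
 qed
 have cl: "closed ?S" unfolding closed_sequential_limits
 proof (intro allI impI, elim conjE)
  fix X l assume X: "\<forall>n. X n \<in> ?S" and "X \<longlonglongrightarrow> l"
  then have li: "(\<lambda>n. X n i) \<longlonglongrightarrow> l i" for i by (simp add: tendsto_fun_iff)
  have eq: "(\<Sum>k<N. l k * f k) = 0" if "\<And>n. (\<Sum>k<N. X n k * f k) = 0" for f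
  proof -
   have "(\<lambda>n. \<Sum>k<N. X n k * f k) \<longlonglongrightarrow> (\<Sum>k<N. l k * f k)" by (intro tendsto_sum tendsto_mult li tendsto_const)
   then show ?thesis by (rule LIMSEQ_unique) (simp add: that)
  qed
  have "0 \<le> l i" if "i < Suc (dphi P)" for i
   by (rule LIMSEQ_le_const[OF li]) (use X that in \<open>auto simp: multiplier_cone_def\<close>)
  moreover have "l i = 0" if "N \<le> i" for i by (rule LIMSEQ_unique[OF li]) (use X that in \<open>simp add: multiplier_cone_def\<close>)
  moreover have "(\<Sum>i<N. l i * Lk i h) = 0" for h by (rule eq) (use X in \<open>unfold multiplier_cone_def, blast\<close>)
  moreover have "weak_lsc_coeff l" by (rule weak_lsc_coeff_limit[OF _ li]) (use X in \<open>simp add: multiplier_cone_def\<close>)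
  moreover have "vmat_zero l" unfolding vmat_zero_def by (intro ballI allI eq) (use X in \<open>simp add: vmat_zero_def\<close>)
  moreover have "multiplier_norm l = 1"
  proof (rule LIMSEQ_unique)
   show "(\<lambda>n. multiplier_norm (X n)) \<longlonglongrightarrow> multiplier_norm l"
    unfolding multiplier_norm_def L2_set_def by (intro tendsto_intros li)
  qed (use X in simp)
  ultimately show "l \<in> ?S" by (simp add: multiplier_cone_def)
 qed
 from compact_Int_closed[OF C cl] show ?thesis by (simp only: Int_absorb1[OF sub])
qed

lemma costate_lin:
 assumes "costate p" "costate q" shows "costate (\<lambda>t. a *\<^sub>R p t + b *\<^sub>R q t)" unfolding costate_def
proof
 fix t assume t: "t \<in> {0..T}"
 have "((\<lambda>t. a *\<^sub>R p t + b *\<^sub>R q t) has_vector_derivative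
   a *\<^sub>R (- (\<Sum>b\<in>Basis. (p t \<bullet> dyn1 P (W t) (b, 0)) *\<^sub>R b)) + b *\<^sub>R (- (\<Sum>b\<in>Basis. (q t \<bullet> dyn1 P (W t) (b, 0)) *\<^sub>R b))) (at t within {0..T})"
  using assms t unfolding costate_def
  by (intro has_vector_derivative_add bounded_linear.has_vector_derivative[OF bounded_linear_scaleR_right]) blast+
 then show "((\<lambda>t. a *\<^sub>R p t + b *\<^sub>R q t) has_vector_derivative
   - (\<Sum>ba\<in>Basis. ((a *\<^sub>R p t + b *\<^sub>R q t) \<bullet> dyn1 P (W t) (ba, 0)) *\<^sub>R ba)) (at t within {0..T})"
  by (simp add: inner_add_left scaleR_add_left sum.distrib scaleR_sum_right)
qed

lemma coeff_lin: "coeff P (a *\<^sub>R \<mu> + b *\<^sub>R \<mu>') k = a * coeff P \<mu> k + b * coeff P \<mu>' k"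
 by (cases \<mu>; cases \<mu>') (simp add: plus_fun_def scaleR_fun_def)

text \<open>The norm is convex but not additive: parts of the equality multipliers can cancel in a
  combination, so the hull satisfies a bound by 1 in place of the normalization.\<close>

lemma hull_coeff:
 assumes "\<mu> \<in> convex hull Lambda_sharp P wh"
 shows "adjoint_mult \<mu> \<and> coeff P \<mu> \<in> multiplier_cone \<and> multiplier_norm (coeff P \<mu>) \<le> 1"
proof -
 define C where "C = {\<mu>. adjoint_mult \<mu> \<and> coeff P \<mu> \<in> multiplier_cone \<and> multiplier_norm (coeff P \<mu>) \<le> 1}"
 have "convex C"
 proof (rule convexI)
  fix \<mu> \<mu>' and a b :: real assume m: "\<mu> \<in> C" "\<mu>' \<in> C" and ab: "0 \<le> a" "0 \<le> b" "a + b = 1"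
  let ?\<mu> = "a *\<^sub>R \<mu> + b *\<^sub>R \<mu>'"
  have cf: "coeff P ?\<mu> = (\<lambda>k. a * coeff P \<mu> k + b * coeff P \<mu>' k)" by (rule ext) (rule coeff_lin)
  have sn: "snd (snd ?\<mu>) = (\<lambda>t. a *\<^sub>R snd (snd \<mu>) t + b *\<^sub>R snd (snd \<mu>') t)"
   by (simp add: plus_fun_def scaleR_fun_def)
  have "adjoint_mult ?\<mu>" unfolding adjoint_mult_def sn coeff_lin using m
   by (auto simp: C_def adjoint_mult_def inner_add_left distrib_right sum.distrib sum_distrib_left mult.assoc intro!: costate_lin)
  moreover have "coeff P ?\<mu> \<in> multiplier_cone"
   unfolding cf using m ab by (intro multiplier_cone_add multiplier_cone_scale) (auto simp: C_def)
  moreover have "multiplier_norm (coeff P ?\<mu>) \<le> 1"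
  proof -
   have "multiplier_norm (coeff P ?\<mu>) \<le> a * multiplier_norm (coeff P \<mu>) + b * multiplier_norm (coeff P \<mu>')"
    unfolding cf using multiplier_norm_add[of "\<lambda>k. a * coeff P \<mu> k" "\<lambda>k. b * coeff P \<mu>' k"] by (simp add: multiplier_norm_scale ab)
   also have "\<dots> \<le> a * 1 + b * 1" using m ab by (intro add_mono mult_left_mono) (auto simp: C_def)
   finally show ?thesis using ab by simp
  qed
  ultimately show "?\<mu> \<in> C" by (simp add: C_def)
 qed
 moreover have "Lambda_sharp P wh \<subseteq> C" using Lambda_sharp_coeff by (auto simp: C_def)
 ultimately have "convex hull Lambda_sharp P wh \<subseteq> C" by (rule hull_minimal[rotated])
 then show ?thesis using assms by (auto simp: C_def)
qed

text \<open>For a fixed direction the value is a linear function \<open>F\<close> of the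
  coefficients, continuous on the compact set of normalized ones, where it attains a maximum that is
  at least the nonnegative value at a normalized \<open>\<nu>0\<close>. Elements of the hull are
  reduced to this set by homogeneity.\<close>

theorem maximal_multiplier:
 assumes wm: "weak_minimum P wh" and z: "z \<in> P_2 P wh"
 shows "\<exists>\<mu>. is_arg_max (\<lambda>\<mu>. Omega_P2 P wh \<mu> z) (\<lambda>\<mu>. \<mu> \<in> Gset P wh (convex hull Lambda_sharp P wh)) \<mu> \<and> 0 \<le> Omega_P2 P wh \<mu> z"
proof -
 obtain \<xi> u y h where zz: "z = (\<xi>, u, y, h)" by (cases z)
 have L: "\<xi> \<in> L2 T" "u \<in> L2 T" "y \<in> L2 T"
  using z unfolding zz by (auto simp: P_2_def Let_def intro!: continuous_imp_L2 intro: has_wderiv_continuous)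
 define F where "F \<nu> = (\<Sum>k<N. \<nu> k * OP k z)" for \<nu>
 have value_eq: "Omega_P2 P wh \<mu> z = F (coeff P \<mu>)" if "adjoint_mult \<mu>" for \<mu>
  unfolding F_def zz by (rule Omega_P2_sum[OF that L])
 define S where "S = {\<nu> \<in> multiplier_cone. multiplier_norm \<nu> = 1 \<and> vmat_zero \<nu>}"
 have normalize: "(\<lambda>k. (1 / multiplier_norm \<nu>) * \<nu> k) \<in> S" and F_normalize: "F \<nu> = multiplier_norm \<nu> * F (\<lambda>k. (1 / multiplier_norm \<nu>) * \<nu> k)"
  if "\<nu> \<in> multiplier_cone" "vmat_zero \<nu>" "multiplier_norm \<nu> \<noteq> 0" for \<nu>
 proof -
  let ?r = "1 / multiplier_norm \<nu>"
  have r: "0 \<le> ?r" using multiplier_norm_nonneg by simp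
  have "vmat_zero (\<lambda>k. ?r * \<nu> k)" using that(2) by (simp add: vmat_zero_def sum_divide_distrib[symmetric])
  then show "(\<lambda>k. ?r * \<nu> k) \<in> S"
   using multiplier_cone_scale[OF that(1) r] multiplier_norm_scale[OF r, of \<nu>] that(3) by (simp add: S_def)
  show "F \<nu> = multiplier_norm \<nu> * F (\<lambda>k. ?r * \<nu> k)" unfolding F_def using that(3) by (simp add: sum_distrib_left)
 qed
 obtain \<nu>0 where \<nu>0: "goh_multiplier \<nu>0" "(\<Sum>i<N. \<bar>\<nu>0 i\<bar>) = 1" "0 \<le> F \<nu>0"
  using goh_multiplier_at[OF wm z[unfolded zz]] unfolding F_def zz by blast
 have c0: "\<nu>0 \<in> multiplier_cone"
  using \<nu>0(1) goh_multiplier_lsc[OF \<nu>0(1)] unfolding multiplier_cone_def goh_multiplier_def by blast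
 have v0: "vmat_zero \<nu>0" using \<nu>0(1) by (simp add: vmat_zero_def sum_Vmat goh_multiplier_def)
 have n0: "multiplier_norm \<nu>0 \<noteq> 0"
 proof
  assume "multiplier_norm \<nu>0 = 0"
  then have "\<bar>\<nu>0 i\<bar> = 0" if "i < N" for i using coord_le_multiplier_norm[OF that, of \<nu>0] by simp
  then show False using \<nu>0(2) by simp
 qed
 have F0: "0 \<le> F (\<lambda>k. (1 / multiplier_norm \<nu>0) * \<nu>0 k)"
  using F_normalize[OF c0 v0 n0] \<nu>0(3) n0 multiplier_norm_nonneg[of \<nu>0] by (simp add: zero_le_mult_iff)
 have "continuous_on S F" unfolding F_def by (intro continuous_intros continuous_on_subset[OF continuous_on_product_coordinates]) auto
 moreover have "compact S" unfolding S_def by (rule compact_normalized)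
 moreover have "S \<noteq> {}" using normalize[OF c0 v0 n0] by blast
 ultimately obtain \<nu> where \<nu>: "\<nu> \<in> S" "\<forall>\<nu>'\<in>S. F \<nu>' \<le> F \<nu>" using continuous_attains_sup by metis
 have pos: "0 \<le> F \<nu>" using F0 \<nu>(2) normalize[OF c0 v0 n0] order_trans by blast
 have cf: "coeff P (mu \<nu>) = \<nu>" using \<nu>(1) by (auto simp: coeff_mu S_def multiplier_cone_def)
 have "mu \<nu> \<in> Lambda_sharp P wh" using \<nu>(1) by (intro mu_Lambda_sharp) (auto simp: S_def)
 then have G: "mu \<nu> \<in> Gset P wh (convex hull Lambda_sharp P wh)"
  using vmat_zero_iff[OF adjoint_mu, of \<nu>] \<nu>(1) hull_subset[of "Lambda_sharp P wh" convex] unfolding Gset_def cf S_def by blast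
 have max: "Omega_P2 P wh \<mu> z \<le> F \<nu>" if \<mu>: "\<mu> \<in> Gset P wh (convex hull Lambda_sharp P wh)" for \<mu>
 proof -
  have "\<mu> \<in> convex hull Lambda_sharp P wh" and V: "\<forall>t\<in>{0..T}. Vmat P wh \<mu> t = 0" using \<mu> by (auto simp: Gset_def)
  from hull_coeff[OF this(1)] have adj: "adjoint_mult \<mu>" and c: "coeff P \<mu> \<in> multiplier_cone" and n: "multiplier_norm (coeff P \<mu>) \<le> 1"
   by blast+
  have v: "vmat_zero (coeff P \<mu>)" using V vmat_zero_iff[OF adj] by blast
  have "F (coeff P \<mu>) \<le> F \<nu>"
  proof (cases "multiplier_norm (coeff P \<mu>) = 0")
   case True
   then have "coeff P \<mu> k = 0" if "k < N" for k using coord_le_multiplier_norm[OF that, of "coeff P \<mu>"] by simp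
   then show ?thesis using pos by (simp add: F_def)
  next
   case False
   have "F (coeff P \<mu>) \<le> multiplier_norm (coeff P \<mu>) * F \<nu>"
    unfolding F_normalize[OF c v False] using \<nu>(2) normalize[OF c v False] multiplier_norm_nonneg by (intro mult_left_mono) auto
   \<comment> \<open>The norm of a hull element may be replaced by 1 because the maximum is
     nonnegative.\<close>
   also have "\<dots> \<le> 1 * F \<nu>" by (rule mult_right_mono[OF n pos])
   finally show ?thesis by simp
  qed
  then show ?thesis by (simp add: value_eq[OF adj])
 qed
 have "Omega_P2 P wh (mu \<nu>) z = F \<nu>" by (simp add: value_eq[OF adjoint_mu] cf)
 then show ?thesis using G max pos by (intro exI[of _ "mu \<nu>"]) (auto simp: is_arg_max_def not_less)
qed

end

theorem theorem5p4:
  fixes P :: "('n::finite, 'l::finite, 'm::finite) ocp"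
    and wh :: "('n, 'l, 'm) traj"
  assumes "ocp_data P"
    and "nominal P wh"
    and "weak_minimum P wh"
  shows "\<forall>z \<in> P_2 P wh.
           \<exists>\<mu>. is_arg_max (\<lambda>\<mu>. Omega_P2 P wh \<mu> z)
                  (\<lambda>\<mu>. \<mu> \<in> Gset P wh (convex hull Lambda_sharp P wh)) \<mu> \<and>
               Omega_P2 P wh \<mu> z \<ge> 0"
proof -
 obtain xh uh vh where wh: "wh = (xh, uh, vh)" by (cases wh)
 interpret nominal_ocp P xh uh vh by unfold_locales (use assms wh in auto)
 show ?thesis using maximal_multiplier assms(3) unfolding wh by blast
qed

end
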